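(* Let $1<m<\infty$. Let $(u_{{\rm L},n})_n$ be a sequence of radial solutions of the linear wave equation $(\partial_t^2-\Delta)u_{\rm L}=0$ on $\mathbb{R}\times\mathbb{R}^3$ such that $(\vec u_{{\rm L},n}(0))_n$ is bounded in $\mathcal{L}^m$; write $(u_{0,n},u_{1,n})=\vec u_{{\rm L},n}(0)$. Then there exist a subsequence of $(u_{{\rm L},n})_n$ (still denoted by $(u_{{\rm L},n})_n$) and, for all $j\geq1$, a solution $U^j_{\rm L}$ of the linear wave equation with initial data $(U^j_0,U^j_1)\in\mathcal{L}^m$ and sequences $(\lambda_{j,n})_n\in(0,\infty)^{\mathbb{N}}$, $(t_{j,n})_n\in\mathbb{R}^{\mathbb{N}}$ such that the following properties hold. - Pseudo-orthogonality: for all $j,k\geq1$, $$j\neq k\Longrightarrow\lim_{n\to\infty}\frac{\lambda_{j,n}}{\lambda_{k,n}}+\frac{\lambda_{k,n}}{\lambda_{j,n}}+\frac{|t_{j,n}-t_{k,n}|}{\lambda_{j,n}}=+\infty.$$ - Weak convergence: for all $j\geq1$, $$\Big(\lambda_{j,n}^{\frac1m}u_{{\rm L},n}(t_{j,n},\lambda_{j,n}\cdot),\ \lambda_{j,n}^{\frac1m+1}\partial_tu_{{\rm L},n}(t_{j,n},\lambda_{j,n}\cdot)\Big)\rightharpoonup(U^j_0,U^j_1)\quad\text{as }n\to\infty,\text{ weakly in }\mathcal{L}^m.$$ - Bessel-type inequality: for all $J\geq1$, $$\lim_{n\to\infty}E_m(u_{0,n},u_{1,n})-\sum_{j=1}^JE_m\big(\vec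 U^j_{\rm L}(0)\big)\geq0.$$ - Vanishing in the dispersive norm: $$\lim_{J\to\infty}\lim_{n\to\infty}\|w_n^J\|_{S(\mathbb{R})}=0,$$ where $$w_n^J(t,x)=u_{{\rm L},n}(t,x)-\sum_{j=1}^JU^j_{{\rm L},n}(t,x),\qquad U^j_{{\rm L},n}(t,x)=\frac{1}{\lambda_{j,n}^{1/m}}U^j_{\rm L}\Big(\frac{t-t_{j,n}}{\lambda_{j,n}},\frac{x}{\lambda_{j,n}}\Big).$$
   Context: All functions are radial in $x\in\mathbb{R}^3$, $r=|x|$, and $\vec u=(u,\partial_tu)$. The space $\mathcal{L}^m$ is the closure of the pairs of radial, smooth, compactly supported functions on $\mathbb{R}^3$ for the norm $$\|(u_0,u_1)\|_{\mathcal{L}^m}=\Big(\int_0^{+\infty}\big(|r\partial_ru_0|^m+|ru_1|^m\big)\,dr\Big)^{1/m}.$$ The modified energy is $$E_m(v_0,v_1)=\int_0^{+\infty}\big(|\partial_r(rv_0)+rv_1|^m+|\partial_r(rv_0)-rv_1|^m\big)\,dr.$$ Also $$\|f\|_{S(\mathbb{R})}=\Big(\int_{\mathbb{R}}\Big(\int_0^{+\infty}|f(t,r)|^{(2m+1)m}\,r^m\,dr\Big)^{1/m}dt\Big)^{\frac{1}{2m+1}}.$$ The solution of the linear wave equation with radial data $(v_0,v_1)\in\mathcal{L}^m$ is $v(t,r)=\frac1r\big(F(t+r)-F(t-r)\big)$, with $F(\sigma)=\frac12\sigma v_0(|\sigma|)+\frac12\int_0^{|\sigma|}\rho\,v_1(\rho)\,d\rho$.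 *)

theory Defs
  imports "HOL-Analysis.Analysis"
begin

text \<open>
  A radial function on three-dimensional space is represented by its profile \<open>r \<mapsto> u r\<close>; only the
  values at \<open>r > 0\<close> are ever used. Functions of time and space are written \<open>u t r\<close>.
\<close>

type_synonym radial_pair = "(real \<Rightarrow> real) \<times> (real \<Rightarrow> real)"

subsection \<open>The space \<open>\<L>\<^sup>m\<close>\<close>

primrec Ck :: "nat \<Rightarrow> ('a::euclidean_space \<Rightarrow> real) \<Rightarrow> bool" where
  "Ck 0 f \<longleftrightarrow> continuous_on UNIV f"
| "Ck (Suc k) f \<longleftrightarrow> (\<forall>x. f differentiable (at x)) \<and>
     (\<forall>i\<in>Basis. Ck k (\<lambda>x. frechet_derivative f (at x) i))"

definition radial_test :: "(real \<Rightarrow> real) \<Rightarrow> bool" where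
  "radial_test p \<longleftrightarrow> (\<exists>f :: real^3 \<Rightarrow> real.
     (\<forall>k. Ck k f) \<and> compact (closure {x. f x \<noteq> 0}) \<and> (\<forall>x. f x = p (norm x)))"

text \<open>
  Local absolute continuity on \<open>(0,\<infinity>)\<close>, in integral form. By Lebesgue's differentiation theorem
  such a function is differentiable almost everywhere and \<^term>\<open>deriv u\<close> is almost everywhere its
  distributional derivative; this is why \<^const>\<open>deriv\<close> can be used under the integrals below.
\<close>

definition loc_abs_cont :: "(real \<Rightarrow> real) \<Rightarrow> bool" where
  "loc_abs_cont u \<longleftrightarrow> (\<exists>g. \<forall>a b. 0 < a \<and> a \<le> b \<longrightarrow>
     set_integrable lebesgue {a..b} g \<and> u b - u a = (LINT r:{a..b}|lebesgue. g r))"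

definition Lm_norm :: "real \<Rightarrow> radial_pair \<Rightarrow> real" where
  "Lm_norm m = (\<lambda>(u0, u1).
     (LINT r:{0<..}|lebesgue. \<bar>r * deriv u0 r\<bar> powr m + \<bar>r * u1 r\<bar> powr m) powr (1 / m))"

text \<open>
  The pairs for which the norm makes sense and is finite. Constants have zero norm as first
  components; the condition that the first component vanishes at infinity removes them, so that
  pairs at distance zero agree almost everywhere. It loses nothing: for \<open>1 < m\<close> a sequence of test
  functions that is Cauchy in the norm converges uniformly on each \<open>[a,\<infinity>)\<close>, \<open>a > 0\<close>.
\<close>

definition Lm_finite :: "real \<Rightarrow> radial_pair set" where
  "Lm_finite m = {(u0, u1). loc_abs_cont u0 \<and> (u0 \<longlongrightarrow> 0) at_top \<and>
     u1 \<in> borel_measurable (lebesgue_on {0<..}) \<and>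
     set_integrable lebesgue {0<..} (\<lambda>r. \<bar>r * deriv u0 r\<bar> powr m + \<bar>r * u1 r\<bar> powr m)}"

definition Lm_space :: "real \<Rightarrow> radial_pair set" where
  "Lm_space m = {(u0, u1) \<in> Lm_finite m. \<forall>e>0. \<exists>p q. radial_test p \<and> radial_test q \<and>
     Lm_norm m (\<lambda>r. u0 r - p r, \<lambda>r. u1 r - q r) < e}"

text \<open>
  A bounded linear functional gives the same value to pairs at distance zero, so it is immaterial
  that elements of the space are functions and not classes of functions.
\<close>

definition Lm_dual :: "real \<Rightarrow> (radial_pair \<Rightarrow> real) set" where
  "Lm_dual m = {l.
     (\<forall>u0 u1 v0 v1. (u0, u1) \<in> Lm_space m \<and> (v0, v1) \<in> Lm_space m \<longrightarrow>
        l (\<lambda>r. u0 r + v0 r, \<lambda>r. u1 r + v1 r) = l (u0, u1) + l (v0, v1)) \<and>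
     (\<forall>c u0 u1. (u0, u1) \<in> Lm_space m \<longrightarrow>
        l (\<lambda>r. c * u0 r, \<lambda>r. c * u1 r) = c * l (u0, u1)) \<and>
     (\<exists>C. \<forall>v\<in>Lm_space m. \<bar>l v\<bar> \<le> C * Lm_norm m v)}"

definition Lm_weakly_tendsto :: "real \<Rightarrow> (nat \<Rightarrow> radial_pair) \<Rightarrow> radial_pair \<Rightarrow> bool" where
  "Lm_weakly_tendsto m v w \<longleftrightarrow> (\<forall>n. v n \<in> Lm_space m) \<and> w \<in> Lm_space m \<and>
     (\<forall>l\<in>Lm_dual m. (\<lambda>n. l (v n)) \<longlonglongrightarrow> l w)"

subsection \<open>Modified energy\<close>

text \<open>For \<open>1 < m\<close> the integrand is integrable on the whole of \<^term>\<open>Lm_space m\<close>, by Hardy's inequality.\<close>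

definition energy :: "real \<Rightarrow> radial_pair \<Rightarrow> real" where
  "energy m = (\<lambda>(v0, v1). LINT r:{0<..}|lebesgue.
     \<bar>deriv (\<lambda>s. s * v0 s) r + r * v1 r\<bar> powr m + \<bar>deriv (\<lambda>s. s * v0 s) r - r * v1 r\<bar> powr m)"

subsection \<open>Radial solutions of the linear wave equation\<close>

definition wave_F :: "radial_pair \<Rightarrow> real \<Rightarrow> real" where
  "wave_F = (\<lambda>(v0, v1) \<sigma>.
     1/2 * \<sigma> * v0 \<bar>\<sigma>\<bar> + 1/2 * (LINT \<rho>:{0..\<bar>\<sigma>\<bar>}|lebesgue. \<rho> * v1 \<rho>))"

definition linear_wave :: "real \<Rightarrow> radial_pair \<Rightarrow> (real \<Rightarrow> real \<Rightarrow> real) \<Rightarrow> bool" where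
  "linear_wave m v u \<longleftrightarrow> v \<in> Lm_space m \<and>
     (\<forall>t. \<forall>r>0. u t r = 1 / r * (wave_F v (t + r) - wave_F v (t - r)))"

text \<open>
  For a solution \<open>u\<close> and each \<open>t\<close>, this classical derivative exists for almost every \<open>r > 0\<close>, because
  \<^term>\<open>wave_F v\<close> is locally absolutely continuous.
\<close>

definition time_deriv :: "(real \<Rightarrow> real \<Rightarrow> real) \<Rightarrow> real \<Rightarrow> real \<Rightarrow> real" where
  "time_deriv u t r = deriv (\<lambda>s. u s r) t"

subsection \<open>The dispersive norm\<close>

text \<open>Power of an extended nonnegative real, for exponents \<open>a > 0\<close>.\<close>

definition ennreal_rpow :: "ennreal \<Rightarrow> real \<Rightarrow> ennreal" where
  "ennreal_rpow x a = (if x = top then top else ennreal (enn2real x powr a))"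

definition S_norm :: "real \<Rightarrow> (real \<Rightarrow> real \<Rightarrow> real) \<Rightarrow> ennreal" where
  "S_norm m f = ennreal_rpow
     (\<integral>\<^sup>+ t. ennreal_rpow
        (\<integral>\<^sup>+ r. ennreal (\<bar>f t r\<bar> powr ((2 * m + 1) * m) * r powr m) * indicator {0<..} r \<partial>lebesgue)
        (1 / m) \<partial>lebesgue)
     (1 / (2 * m + 1))"

end

theory Submission
  imports Defs
begin

text \<open>
  A radial wave is \<open>u(t,r) = \<integral>\<^bsub>t-r\<^esub>\<^bsup>t+r\<^esup> f / r\<close> with \<open>f = F'\<close> in \<open>L\<^sup>m(\<real>)\<close>. Hardy's inequality and its dual make
  the correspondence between \<open>f\<close> and the data an isomorphism, the modified energy is exactly
  \<open>2\<^sup>m \<parallel>f\<parallel>\<^sup>m\<close>, and moving in time is a translation of \<open>f\<close>. Hence everything reduces to a profile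
  decomposition of bounded sequences of \<open>L\<^sup>m(\<real>)\<close> modulo translations and dilations.

  There, a refined Strichartz estimate, from the maximal inequality, bounds the dispersive norm by a
  power of \<open>sup \<bar>r\<^sup>1\<^sup>/\<^sup>m\<^sup>-\<^sup>1 \<integral>\<^bsub>t-r\<^esub>\<^bsup>t+r\<^esup> f\<bar>\<close>, times the norm. The frames are chosen greedily so that this average stays
  almost as large as possible along the sequence. The Bessel inequality, obtained by
  localising to disjoint sets and weak lower semicontinuity, forces the norms of the profiles to be summable,
  hence the averages of the remainder to be small. The greedy choice is made along an ultrafilter,
  so that all limits exist, and a single subsequence is extracted at the end.
\<close>

section \<open>\<open>L\<^sup>m\<close> on the line\<close>

text \<open>For \<open>m\<close> \<noteq> 2 the norm has no Pythagorean expansion around a weak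
  limit, so energy cannot be peeled off profile by profile. What survives is additivity of the
  \<open>m\<close>-th power over disjoint sets, hence the cores of the frames. It serves twice: from
  below for the Bessel inequality, and from above to bound a sum of \<open>J\<close> separated
  bubbles independently of \<open>J\<close>. Without the second bound the estimate of the remainder
  would degenerate as \<open>J\<close> grows.

  The averages are pairings of the rescaled functions with the indicator of \<open>{-1..1}\<close>.
  The limit height of a chosen frame is therefore controlled by the norm of the profile found there;
  this closes the greedy argument.

  The ultrafilter supplies a dichotomy: two sequences of frames are orthogonal or stay at bounded
  distance. A frame in which the remainder is large is thus near at most one chosen frame.

  Weak convergence is tested only on integrals over intervals; Mazur's lemma, from uniform
  convexity, extends it to every bounded functional.\<close>

definition Lp :: "real \<Rightarrow> (real \<Rightarrow> real) set" where
  "Lp m = {f. f \<in> borel_measurable borel \<and> integrable lborel (\<lambda>x. \<bar>f x\<bar> powr m)}"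

definition Lp_pow :: "real \<Rightarrow> (real \<Rightarrow> real) \<Rightarrow> real" where
  "Lp_pow m f = (\<integral>x. \<bar>f x\<bar> powr m \<partial>lborel)"

lemma Lp_measurable: "f \<in> Lp m \<Longrightarrow> f \<in> borel_measurable borel"
  and Lp_integrable: "f \<in> Lp m \<Longrightarrow> integrable lborel (\<lambda>x. \<bar>f x\<bar> powr m)"
  by (auto simp: Lp_def)

lemma Lp_pow_nonneg [simp]: "0 \<le> Lp_pow m f"
  unfolding Lp_pow_def by simp

lemma powr_abs_add_le:
  fixes a b m :: real
  assumes "0 \<le> m"
  shows "\<bar>a + b\<bar> powr m \<le> 2 powr m * (\<bar>a\<bar> powr m + \<bar>b\<bar> powr m)"
proof -
  have "\<bar>a + b\<bar> powr m \<le> (2 * max \<bar>a\<bar> \<bar>b\<bar>) powr m"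
    using assms by (intro powr_mono2) auto
  also have "\<dots> = 2 powr m * (max \<bar>a\<bar> \<bar>b\<bar>) powr m"
    by (simp add: powr_mult)
  also have "\<dots> \<le> 2 powr m * (\<bar>a\<bar> powr m + \<bar>b\<bar> powr m)"
    by (intro mult_left_mono) (auto simp: max_def)
  finally show ?thesis .
qed

lemma powr_abs_sum_le:
  fixes f :: "'i \<Rightarrow> real"
  assumes "0 \<le> m" "finite I"
  shows "\<bar>\<Sum>i\<in>I. f i\<bar> powr m \<le> real (card I) powr m * (\<Sum>i\<in>I. \<bar>f i\<bar> powr m)"
proof (cases "I = {}")
  case False
  define M where "M = Max ((\<lambda>i. \<bar>f i\<bar>) ` I)"
  have "M \<in> (\<lambda>i. \<bar>f i\<bar>) ` I" unfolding M_def using assms False by (intro Max_in) auto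
  then obtain k where k: "k \<in> I" "M = \<bar>f k\<bar>" by auto
  have le: "\<bar>f i\<bar> \<le> M" if "i \<in> I" for i unfolding M_def using assms that by (intro Max_ge) auto
  have "\<bar>\<Sum>i\<in>I. f i\<bar> \<le> (\<Sum>i\<in>I. \<bar>f i\<bar>)" by (rule sum_abs)
  also have "\<dots> \<le> real (card I) * M" using sum_bounded_above[of I "\<lambda>i. \<bar>f i\<bar>" M] le by auto
  finally have "\<bar>\<Sum>i\<in>I. f i\<bar> powr m \<le> (real (card I) * M) powr m"
    using assms by (intro powr_mono2) auto
  also have "\<dots> = real (card I) powr m * \<bar>f k\<bar> powr m" using k by (simp add: powr_mult)
  also have "\<dots> \<le> real (card I) powr m * (\<Sum>i\<in>I. \<bar>f i\<bar> powr m)"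
    using assms k by (intro mult_left_mono member_le_sum) auto
  finally show ?thesis .
qed (use assms in auto)

lemma
  assumes "0 \<le> m" "f \<in> Lp m" "g \<in> Lp m"
  shows Lp_add: "(\<lambda>x. f x + g x) \<in> Lp m"
    and Lp_pow_add_le: "Lp_pow m (\<lambda>x. f x + g x) \<le> 2 powr m * (Lp_pow m f + Lp_pow m g)"
proof -
  note [measurable] = Lp_measurable[OF assms(2)] Lp_measurable[OF assms(3)]
  note [simp] = Lp_integrable[OF assms(2)] Lp_integrable[OF assms(3)]
  have *: "integrable lborel (\<lambda>x. 2 powr m * (\<bar>f x\<bar> powr m + \<bar>g x\<bar> powr m))" by simp
  show 1: "(\<lambda>x. f x + g x) \<in> Lp m"
    unfolding Lp_def using powr_abs_add_le[OF assms(1)]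
    by (auto intro!: Bochner_Integration.integrable_bound[OF *] AE_I2)
  have "Lp_pow m (\<lambda>x. f x + g x) \<le> (\<integral>x. 2 powr m * (\<bar>f x\<bar> powr m + \<bar>g x\<bar> powr m) \<partial>lborel)"
    unfolding Lp_pow_def by (rule integral_mono[OF Lp_integrable[OF 1] *]) (rule powr_abs_add_le[OF assms(1)])
  then show "Lp_pow m (\<lambda>x. f x + g x) \<le> 2 powr m * (Lp_pow m f + Lp_pow m g)"
    by (simp add: Lp_pow_def)
qed

lemma
  assumes "f \<in> Lp m"
  shows Lp_cmult: "(\<lambda>x. c * f x) \<in> Lp m"
    and Lp_pow_cmult: "Lp_pow m (\<lambda>x. c * f x) = \<bar>c\<bar> powr m * Lp_pow m f"
  using assms by (auto simp: Lp_def Lp_pow_def abs_mult powr_mult)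

lemma Lp_zero [simp]: "(\<lambda>x. 0) \<in> Lp m"
  and Lp_pow_zero [simp]: "Lp_pow m (\<lambda>x. 0) = 0"
  by (auto simp: Lp_def Lp_pow_def)

lemma
  assumes "0 \<le> m" "f \<in> Lp m" "g \<in> Lp m"
  shows Lp_diff: "(\<lambda>x. f x - g x) \<in> Lp m"
    and Lp_pow_diff_le: "Lp_pow m (\<lambda>x. f x - g x) \<le> 2 powr m * (Lp_pow m f + Lp_pow m g)"
  using Lp_add[OF assms(1,2) Lp_cmult[OF assms(3), of "-1"]]
    Lp_pow_add_le[OF assms(1,2) Lp_cmult[OF assms(3), of "-1"]] Lp_pow_cmult[OF assms(3), of "-1"]
  by auto

lemma
  assumes "0 \<le> m" "finite I" "\<And>i. i \<in> I \<Longrightarrow> f i \<in> Lp m"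
  shows Lp_sum: "(\<lambda>x. \<Sum>i\<in>I. f i x) \<in> Lp m"
    and Lp_pow_sum_le: "Lp_pow m (\<lambda>x. \<Sum>i\<in>I. f i x) \<le> real (card I) powr m * (\<Sum>i\<in>I. Lp_pow m (f i))"
proof -
  show 1: "(\<lambda>x. \<Sum>i\<in>I. f i x) \<in> Lp m" using assms(2,3)
    by (induction I rule: finite_induct) (auto intro: Lp_add[OF assms(1)])
  have *: "integrable lborel (\<lambda>x. real (card I) powr m * (\<Sum>i\<in>I. \<bar>f i x\<bar> powr m))"
    using assms Lp_integrable by simp
  have "Lp_pow m (\<lambda>x. \<Sum>i\<in>I. f i x) \<le> (\<integral>x. real (card I) powr m * (\<Sum>i\<in>I. \<bar>f i x\<bar> powr m) \<partial>lborel)"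
    unfolding Lp_pow_def
    by (rule integral_mono[OF Lp_integrable[OF 1] *]) (rule powr_abs_sum_le[OF assms(1,2)])
  also have "\<dots> = real (card I) powr m * (\<Sum>i\<in>I. Lp_pow m (f i))"
    unfolding Lp_pow_def using assms(3) Lp_integrable by (subst integral_mult_right_zero) (simp add: Bochner_Integration.integral_sum)
  finally show "Lp_pow m (\<lambda>x. \<Sum>i\<in>I. f i x) \<le> real (card I) powr m * (\<Sum>i\<in>I. Lp_pow m (f i))" .
qed

lemma Lp_bound:
  assumes "0 \<le> m" "f \<in> Lp m" "g \<in> borel_measurable borel" "\<And>x. \<bar>g x\<bar> \<le> \<bar>f x\<bar>"
  shows "g \<in> Lp m" "Lp_pow m g \<le> Lp_pow m f"
proof -
  note [measurable] = assms(3)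
  have le: "\<bar>g x\<bar> powr m \<le> \<bar>f x\<bar> powr m" for x using assms(1,4) by (intro powr_mono2) auto
  show 1: "g \<in> Lp m" unfolding Lp_def
    using le by (auto intro!: Bochner_Integration.integrable_bound[OF Lp_integrable[OF assms(2)]] AE_I2)
  show "Lp_pow m g \<le> Lp_pow m f" unfolding Lp_pow_def
    by (rule integral_mono[OF Lp_integrable[OF 1] Lp_integrable[OF assms(2)] le])
qed

lemma Lp_indicator:
  assumes "0 \<le> m" "f \<in> Lp m" "A \<in> sets borel"
  shows "(\<lambda>x. indicator A x * f x) \<in> Lp m" "Lp_pow m (\<lambda>x. indicator A x * f x) \<le> Lp_pow m f"
  using Lp_bound[OF assms(1,2), of "\<lambda>x. indicator A x * f x"] Lp_measurable[OF assms(2)] assms(3)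
  by (auto simp: indicator_def)

lemma Lp_pow_AE:
  assumes "AE x in lborel. f x = g x" "f \<in> borel_measurable borel" "g \<in> borel_measurable borel"
  shows "Lp_pow m f = Lp_pow m g"
  unfolding Lp_pow_def using assms by (intro integral_cong_AE) auto

section \<open>Hoelder's inequality on sets of finite measure\<close>

lemma le_add_powr:
  fixes x c m :: real
  assumes "1 \<le> m" "0 \<le> x" "0 < c"
  shows "x \<le> c + c powr (1 - m) * x powr m"
proof (cases "x \<le> c")
  case False
  then have "x = x powr (1 - m) * x powr m" using assms by (simp flip: powr_add)
  also have "\<dots> \<le> c powr (1 - m) * x powr m"
    using False assms by (intro mult_right_mono powr_mono2') auto
  finally show ?thesis using assms by simp
qed (use assms in \<open>simp add: add_increasing2\<close>)

text \<open>The choice \<open>c = (b / a) powr (1/m)\<close> makes both terms equal; if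
  \<open>b\<close> or \<open>a\<close> vanishes, \<open>c\<close> is sent to 0 or to infinity. With
  \<open>le_add_powr\<close> integrated in \<open>x\<close>, this is Hoelder's inequality up to a
  factor 2, without the conjugate exponent.\<close>

lemma optimize_powr:
  fixes m a b I :: real
  assumes m: "1 < m" and a: "0 \<le> a" and b: "0 \<le> b"
    and I: "\<And>c. 0 < c \<Longrightarrow> I \<le> c * a + c powr (1 - m) * b"
  shows "I \<le> 2 * (a powr (1 - 1/m) * b powr (1/m))"
proof (cases "a = 0 \<or> b = 0")
  case False
  then have ab: "0 < a" "0 < b" using a b by auto
  have "I \<le> (b / a) powr (1/m) * a + ((b / a) powr (1/m)) powr (1 - m) * b"
    using ab by (intro I) auto
  also have "(b / a) powr (1/m) * a = a powr (1 - 1/m) * b powr (1/m)"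
    using ab by (simp add: powr_divide powr_diff)
  also have "((b / a) powr (1/m)) powr (1 - m) * b = a powr (1 - 1/m) * b powr (1/m)"
  proof -
    have "1/m * (1 - m) = 1/m - 1" using m by (simp add: field_simps)
    then have "((b / a) powr (1/m)) powr (1 - m) = (b / a) powr (1/m - 1)" by (simp add: powr_powr)
    also have "\<dots> * b = a powr (1 - 1/m) * b powr (1/m)"
      using ab by (simp add: powr_divide powr_diff)
    finally show ?thesis .
  qed
  finally show ?thesis by (simp add: mult.commute)
next
  case True
  show ?thesis
  proof (cases "b = 0")
    case b0: True
    have "I \<le> 0"
    proof (rule field_le_epsilon)
      fix e :: real assume e: "e > 0"
      have "I \<le> e / (a + 1) * a + (e / (a + 1)) powr (1 - m) * b" using e a by (intro I) auto
      also have "\<dots> \<le> e" using a e b0 by (simp add: field_simps)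
      finally show "I \<le> 0 + e" by simp
    qed
    then show ?thesis using b0 by simp
  next
    case False
    then have b0: "a = 0" "b > 0" using True b by auto
    have "I \<le> 0"
    proof (rule field_le_epsilon)
      fix e :: real assume e: "e > 0"
      have "I \<le> (e / b) powr (1 / (1 - m)) * a + ((e / b) powr (1 / (1 - m))) powr (1 - m) * b"
        using e b0 by (intro I) auto
      also have "\<dots> = e" using b0 e m by (simp add: powr_powr)
      finally show "I \<le> 0 + e" by simp
    qed
    then show ?thesis using b0 by simp
  qed
qed

text \<open>Integrating \<open>le_add_powr\<close> over \<open>A\<close> and optimising in
  \<open>c\<close> bounds the integral of \<open>\<bar>f\<bar>\<close>; the finite measure of
  \<open>A\<close> pays for the constant term \<open>c\<close>.\<close>

lemma
  assumes m: "1 < m" and f: "f \<in> Lp m" and A: "A \<in> sets borel" "emeasure lborel A < \<infinity>"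
  shows Lp_set_integrable: "set_integrable lborel A f"
    and Lp_set_integral_abs_le:
      "(LINT x:A|lborel. \<bar>f x\<bar>) \<le> 2 * (measure lborel A powr (1 - 1/m) * Lp_pow m f powr (1/m))"
proof -
  note [measurable] = Lp_measurable[OF f] A(1)
  have iA: "integrable lborel (indicator A :: real \<Rightarrow> real)" using A by simp
  have le: "indicator A x * \<bar>f x\<bar> \<le> c * indicator A x + c powr (1 - m) * \<bar>f x\<bar> powr m" if "0 < c" for c x
    using le_add_powr[of m "\<bar>f x\<bar>" c] that m by (auto simp: indicator_def)
  have int: "integrable lborel (\<lambda>x. c * indicator A x + c powr (1 - m) * \<bar>f x\<bar> powr m)" for c
    using iA Lp_integrable[OF f] by simp
  show s: "set_integrable lborel A f"
    unfolding set_integrable_def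
    by (rule Bochner_Integration.integrable_bound[OF int[of 1]]) (use le[of 1] in \<open>auto simp: abs_mult\<close>)
  have sa: "integrable lborel (\<lambda>x. indicator A x * \<bar>f x\<bar>)"
    using set_integrable_abs[OF s] by (simp add: set_integrable_def)
  show "(LINT x:A|lborel. \<bar>f x\<bar>) \<le> 2 * (measure lborel A powr (1 - 1/m) * Lp_pow m f powr (1/m))"
  proof (rule optimize_powr[OF m])
    fix c :: real assume c: "0 < c"
    have "(LINT x:A|lborel. \<bar>f x\<bar>) \<le> (\<integral>x. c * indicator A x + c powr (1 - m) * \<bar>f x\<bar> powr m \<partial>lborel)"
      unfolding set_lebesgue_integral_def real_scaleR_def
      by (rule integral_mono[OF sa int le[OF c]])
    also have "\<dots> = c * measure lborel A + c powr (1 - m) * Lp_pow m f"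
      using iA Lp_integrable[OF f] by (simp add: Lp_pow_def)
    finally show "(LINT x:A|lborel. \<bar>f x\<bar>) \<le> c * measure lborel A + c powr (1 - m) * Lp_pow m f" .
  qed auto
qed

lemma Lp_set_integral_le:
  assumes m: "1 < m" and f: "f \<in> Lp m" and A: "A \<in> sets borel" "emeasure lborel A < \<infinity>"
  shows "\<bar>LINT x:A|lborel. f x\<bar> \<le> 2 * (measure lborel A powr (1 - 1/m) * Lp_pow m f powr (1/m))"
proof -
  have "\<bar>LINT x:A|lborel. f x\<bar> \<le> (LINT x:A|lborel. \<bar>f x\<bar>)"
    using set_integral_norm_bound[OF Lp_set_integrable[OF assms]] by simp
  then show ?thesis using Lp_set_integral_abs_le[OF assms] by simp
qed

lemma Lp_Icc_integrable: "1 < m \<Longrightarrow> f \<in> Lp m \<Longrightarrow> set_integrable lborel {a..b::real} f"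
  by (rule Lp_set_integrable) (auto simp: emeasure_lborel_Icc_eq)

lemma Lp_Icc_le:
  assumes "1 < m" "f \<in> Lp m" "a \<le> b"
  shows "\<bar>LINT x:{a..b}|lborel. f x\<bar> \<le> 2 * ((b - a) powr (1 - 1/m) * Lp_pow m f powr (1/m))"
  using Lp_set_integral_le[OF assms(1,2), of "{a..b}"] assms(3) by (simp add: emeasure_lborel_Icc_eq)

lemma set_integral_Icc_combine:
  fixes f :: "real \<Rightarrow> real"
  assumes "\<And>a b. set_integrable lborel {a..b} f" "a \<le> b" "b \<le> c"
  shows "(LINT x:{a..c}|lborel. f x) = (LINT x:{a..b}|lborel. f x) + (LINT x:{b..c}|lborel. f x)"
proof -
  have "(LINT x:{a..c}|lborel. f x) = (LINT x:{a..b} \<union> {b<..c}|lborel. f x)"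
    using assms(2,3) by (simp add: ivl_disj_un)
  also have "\<dots> = (LINT x:{a..b}|lborel. f x) + (LINT x:{b<..c}|lborel. f x)"
    by (intro set_integral_Un set_integrable_subset[OF assms(1)[of a c]]) (use assms(2,3) in auto)
  also have "(LINT x:{b<..c}|lborel. f x) = (LINT x:{b..c}|lborel. f x)"
    unfolding set_lebesgue_integral_def
  proof (rule integral_cong_AE)
    have "AE x in lborel. x \<noteq> b" by (rule AE_lborel_singleton)
    then show "AE x in lborel. indicat_real {b<..c} x *\<^sub>R f x = indicat_real {b..c} x *\<^sub>R f x"
      by eventually_elim (auto simp: indicator_def)
    show "(\<lambda>x. indicat_real {b..c} x *\<^sub>R f x) \<in> borel_measurable lborel"
      using assms(1)[of b c] by (auto simp: set_integrable_def)
    have "set_integrable lborel {b<..c} f" by (rule set_integrable_subset[OF assms(1)[of b c]]) auto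
    then show "(\<lambda>x. indicat_real {b<..c} x *\<^sub>R f x) \<in> borel_measurable lborel"
      by (auto simp: set_integrable_def)
  qed
  finally show ?thesis .
qed

text \<open>Moving a wave to time \<open>t\<close> and zooming by \<open>l\<close>, seen on its
  profile (see \<open>wave_repr_rescale\<close>). The factor \<open>l powr (1/m)\<close> makes it an
  isometry of \<open>Lp m\<close>.\<close>

definition rescale :: "real \<Rightarrow> real \<Rightarrow> real \<Rightarrow> (real \<Rightarrow> real) \<Rightarrow> real \<Rightarrow> real" where
  "rescale m l t f = (\<lambda>x. l powr (1/m) * f (t + l * x))"

lemma
  assumes m: "1 < m" and f: "f \<in> Lp m" and l: "0 < l"
  shows rescale_Lp: "rescale m l t f \<in> Lp m"
    and Lp_pow_rescale: "Lp_pow m (rescale m l t f) = Lp_pow m f"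
proof -
  note [measurable] = Lp_measurable[OF f]
  have *: "\<bar>rescale m l t f x\<bar> powr m = l * \<bar>f (t + l * x)\<bar> powr m" for x
    using l m by (simp add: rescale_def abs_mult powr_mult powr_powr)
  show "rescale m l t f \<in> Lp m"
    using l lborel_integrable_real_affine[OF Lp_integrable[OF f], of l t]
    by (auto simp: Lp_def *) (simp add: rescale_def)
  show "Lp_pow m (rescale m l t f) = Lp_pow m f"
    unfolding Lp_pow_def * using l lborel_integral_real_affine[of l "\<lambda>x. \<bar>f x\<bar> powr m" t] by simp
qed

lemma rescale_Icc:
  assumes l: "0 < l"
  shows "(LINT x:{a..b}|lborel. rescale m l t f x)
    = l powr (1/m - 1) * (LINT x:{t + l * a..t + l * b}|lborel. f x)"
proof -
  have ind: "indicator {t + l * a..t + l * b} (t + l * x) = (indicator {a..b} x :: real)" for x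
    using l by (simp add: indicator_def)
  have "(LINT x:{t + l * a..t + l * b}|lborel. f x) = l * (LINT x:{a..b}|lborel. f (t + l * x))"
    unfolding set_lebesgue_integral_def
    using l by (subst lborel_integral_real_affine[where c = l and t = t]) (auto simp: ind)
  then show ?thesis using l by (simp add: rescale_def powr_diff)
qed

section \<open>The maximal function\<close>

text \<open>Superlevel set of the centred maximal function. Here and in \<open>hl_max\<close>
  integrals are divided by the radius and not by the length of the interval, so a constant
  \<open>l\<close> has maximal function \<open>2 * l\<close>.\<close>

definition hl_set :: "(real \<Rightarrow> real) \<Rightarrow> real \<Rightarrow> real set" where
  "hl_set h lam = {t. \<exists>r>0. lam * r < (LINT x:{t-r..t+r}|lborel. \<bar>h x\<bar>)}"

lemma set_integral_mono_nonneg_set: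
  fixes f :: "real \<Rightarrow> real"
  assumes "set_integrable lborel B f" "A \<subseteq> B" "A \<in> sets borel" "\<And>x. x \<in> B \<Longrightarrow> 0 \<le> f x"
  shows "(LINT x:A|lborel. f x) \<le> (LINT x:B|lborel. f x)"
  unfolding set_lebesgue_integral_def
proof (rule integral_mono)
  show "integrable lborel (\<lambda>x. indicat_real A x *\<^sub>R f x)"
    using set_integrable_subset[OF assms(1) _ assms(2)] assms(3) by (simp add: set_integrable_def)
  show "integrable lborel (\<lambda>x. indicat_real B x *\<^sub>R f x)"
    using assms(1) by (simp add: set_integrable_def)
qed (use assms(2,4) in \<open>auto simp: indicator_def\<close>)

text \<open>The inequality at radius \<open>r\<close> is strict, so it survives at nearby centres
  for the radius \<open>r + d\<close>, whose interval contains the old one; \<open>d\<close> spends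
  at most half of the gap.\<close>

lemma open_hl_set:
  assumes "\<And>a b. set_integrable lborel {a..b} h"
  shows "open (hl_set h lam)"
proof (rule openI)
  fix t assume "t \<in> hl_set h lam"
  then obtain r where r: "0 < r" "lam * r < (LINT x:{t-r..t+r}|lborel. \<bar>h x\<bar>)"
    by (auto simp: hl_set_def)
  define I where "I = (LINT x:{t-r..t+r}|lborel. \<bar>h x\<bar>)"
  define d where "d = (I - lam * r) / (\<bar>lam\<bar> + 1) / 2"
  have d: "0 < d" using r by (simp add: d_def I_def)
  have "lam * d \<le> (\<bar>lam\<bar> + 1) * d" using d by (intro mult_right_mono) auto
  also have "(\<bar>lam\<bar> + 1) * d = (I - lam * r) / 2"
    using abs_ge_zero[of lam] unfolding d_def by (simp add: field_simps add_nonneg_eq_0_iff)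
  also have "\<dots> < I - lam * r" using r by (simp add: I_def)
  finally have ld: "lam * (r + d) < I" by (simp add: algebra_simps)
  have "s \<in> hl_set h lam" if "s \<in> ball t d" for s
  proof -
    have "I \<le> (LINT x:{s-(r+d)..s+(r+d)}|lborel. \<bar>h x\<bar>)"
      unfolding I_def using that assms
      by (intro set_integral_mono_nonneg_set set_integrable_abs) (auto simp: dist_real_def)
    then show ?thesis using ld d r(1) by (auto simp: hl_set_def intro!: exI[of _ "r + d"])
  qed
  then show "\<exists>e>0. ball t e \<subseteq> hl_set h lam" using d by auto
qed

lemma ennreal_set_integral:
  fixes f :: "real \<Rightarrow> real"
  assumes "set_integrable lborel A f" "\<And>x. x \<in> A \<Longrightarrow> 0 \<le> f x"
  shows "(\<integral>\<^sup>+x. ennreal (f x) * indicator A x \<partial>lborel) = ennreal (LINT x:A|lborel. f x)"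
proof -
  have "(\<integral>\<^sup>+x. ennreal (f x) * indicator A x \<partial>lborel) = (\<integral>\<^sup>+x. ennreal (indicator A x *\<^sub>R f x) \<partial>lborel)"
    by (intro nn_integral_cong) (auto simp: indicator_def)
  also have "\<dots> = ennreal (LINT x:A|lborel. f x)"
    unfolding set_lebesgue_integral_def using assms
    by (intro nn_integral_eq_integral) (auto simp: set_integrable_def indicator_def)
  finally show ?thesis .
qed

lemma integrable_imp_set_integrable:
  fixes f :: "real \<Rightarrow> real"
  shows "integrable lborel f \<Longrightarrow> A \<in> sets borel \<Longrightarrow> set_integrable lborel A f"
  unfolding set_integrable_def by (rule integrable_mult_indicator) auto

text \<open>Vitali's covering argument: the intervals of \<open>C\<close> are disjoint and their
  fivefold dilates cover. As \<open>lam * snd i < I i\<close>, a dilate of length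
  \<open>10 * snd i\<close> costs at most \<open>10 / lam\<close> times the mass of
  \<open>\<bar>h\<bar>\<close> on the original interval.\<close>

lemma hl_set_weak_type:
  assumes h: "integrable lborel h" and lam: "0 < lam"
  shows "emeasure lborel (hl_set h lam) \<le> ennreal (10 / lam * (\<integral>x. \<bar>h x\<bar> \<partial>lborel))"
proof -
  have seth: "set_integrable lborel A (\<lambda>x. \<bar>h x\<bar>)" if "A \<in> sets borel" for A
    using integrable_abs[OF h] that by (rule integrable_imp_set_integrable)
  have [measurable]: "h \<in> borel_measurable borel" using h by auto
  define N where "N = (\<integral>x. \<bar>h x\<bar> \<partial>lborel)"
  define I where "I i = (LINT x:{fst i - snd i..fst i + snd i}|lborel. \<bar>h x\<bar>)" for i :: "real \<times> real"
  define K where "K = {i. 0 < snd i \<and> lam * snd i < I i}"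
  have IN: "I i \<le> N" for i
  proof -
    have "I i \<le> (LINT x:UNIV|lborel. \<bar>h x\<bar>)" unfolding I_def
      by (intro set_integral_mono_nonneg_set seth) auto
    then show ?thesis by (simp add: N_def set_lebesgue_integral_def)
  qed
  have KB: "0 < snd i \<and> snd i \<le> N / lam" if "i \<in> K" for i
    using that IN[of i] lam by (auto simp: K_def field_simps)
  have cov: "hl_set h lam \<subseteq> (\<Union>i\<in>K. cball (fst i) (snd i))"
  proof
    fix t assume "t \<in> hl_set h lam"
    then obtain r where "0 < r" "(t, r) \<in> K" by (auto simp: hl_set_def K_def I_def)
    then show "t \<in> (\<Union>i\<in>K. cball (fst i) (snd i))" by (intro UN_I[of "(t, r)"]) auto
  qed
  obtain C where C: "countable C" "C \<subseteq> K"
     "pairwise (\<lambda>i j. disjnt (cball (fst i) (snd i)) (cball (fst j) (snd j))) C"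
     "hl_set h lam \<subseteq> (\<Union>i\<in>C. cball (fst i) (5 * snd i))"
    by (rule Vitali_covering_lemma_cballs[OF cov KB])
  \<comment> \<open>The countable family is indexed by all of \<open>nat\<close>, with empty sets as
    padding, so that countable additivity applies to the measure \<open>\<nu>\<close> of density
    \<open>\<bar>h\<bar>\<close>.\<close>
  define e where "e = to_nat_on C"
  define A where "A n = (if n \<in> e ` C then cball (fst (from_nat_into C n)) (5 * snd (from_nat_into C n)) else {})" for n
  define D where "D n = (if n \<in> e ` C then cball (fst (from_nat_into C n)) (snd (from_nat_into C n)) else {})" for n
  have inv: "from_nat_into C (e i) = i" if "i \<in> C" for i
    using C(1) that by (simp add: e_def)
  define \<nu> where "\<nu> = density lborel (\<lambda>x. ennreal \<bar>h x\<bar>)"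
  have [simp]: "sets \<nu> = sets borel" by (simp add: \<nu>_def)
  have le: "emeasure lborel (A n) \<le> ennreal (10 / lam) * emeasure \<nu> (D n)" for n
  proof (cases "n \<in> e ` C")
    case True
    then obtain i where i: "i \<in> C" "n = e i" by auto
    then have iK: "i \<in> K" using C by auto
    have "emeasure \<nu> (D n) = (\<integral>\<^sup>+x. ennreal \<bar>h x\<bar> * indicator {fst i - snd i..fst i + snd i} x \<partial>lborel)"
      using True i inv by (simp add: \<nu>_def D_def emeasure_density cball_eq_atLeastAtMost)
    also have "\<dots> = ennreal (I i)" unfolding I_def by (rule ennreal_set_integral[OF seth]) auto
    finally have D: "emeasure \<nu> (D n) = ennreal (I i)" .
    have "emeasure lborel (A n) = ennreal (10 * snd i)"
      using True i inv KB[OF iK] by (simp add: A_def cball_eq_atLeastAtMost emeasure_lborel_Icc_eq)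
    also have "\<dots> \<le> ennreal (10 / lam * I i)"
      using iK lam by (intro ennreal_leI) (auto simp: K_def field_simps)
    also have "\<dots> = ennreal (10 / lam) * ennreal (I i)"
      using lam by (intro ennreal_mult) (auto simp: I_def set_lebesgue_integral_def)
    finally show ?thesis by (simp add: D)
  qed (simp add: A_def)
  have "hl_set h lam \<subseteq> (\<Union>n. A n)"
    using C(4) inv unfolding A_def by (auto split: if_splits)
  moreover have "A n \<in> sets borel" for n by (simp add: A_def)
  ultimately have "emeasure lborel (hl_set h lam) \<le> emeasure lborel (\<Union>n. A n)"
    by (intro emeasure_mono) auto
  also have "\<dots> \<le> (\<Sum>n. emeasure lborel (A n))"
    by (intro emeasure_subadditive_countably) (auto simp: A_def)
  also have "\<dots> \<le> (\<Sum>n. ennreal (10 / lam) * emeasure \<nu> (D n))" by (intro suminf_le le) auto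
  also have "\<dots> = ennreal (10 / lam) * (\<Sum>n. emeasure \<nu> (D n))" by simp
  also have "(\<Sum>n. emeasure \<nu> (D n)) = emeasure \<nu> (\<Union>n. D n)"
  proof (rule suminf_emeasure)
    show "disjoint_family D" unfolding disjoint_family_on_def
    proof (intro ballI impI)
      fix a b :: nat assume "a \<noteq> b"
      show "D a \<inter> D b = {}"
      proof (cases "a \<in> e ` C \<and> b \<in> e ` C")
        case True
        then obtain i j where ij: "i \<in> C" "j \<in> C" "a = e i" "b = e j" by auto
        then have "i \<noteq> j" using \<open>a \<noteq> b\<close> by auto
        then have "disjnt (cball (fst i) (snd i)) (cball (fst j) (snd j))"
          using C(3) ij by (auto simp: pairwise_def)
        then show ?thesis using ij inv by (auto simp: D_def disjnt_def)
      qed (auto simp: D_def)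
    qed
  qed (auto simp: D_def)
  also have "emeasure \<nu> (\<Union>n. D n) \<le> emeasure \<nu> (space \<nu>)" by (rule emeasure_space)
  also have "emeasure \<nu> (space \<nu>) = ennreal N"
    using nn_integral_eq_integral[OF integrable_abs[OF h]] by (simp add: \<nu>_def emeasure_density N_def)
  also have "ennreal (10 / lam) * ennreal N = ennreal (10 / lam * N)"
    using lam by (intro ennreal_mult[symmetric]) (auto simp: N_def)
  finally show ?thesis by (simp add: N_def mult_left_mono)
qed

section \<open>From the weak type bound to the maximal inequality\<close>

definition hl_max :: "(real \<Rightarrow> real) \<Rightarrow> real \<Rightarrow> ennreal" where
  "hl_max f t = (SUP r\<in>{0<..}. ennreal ((LINT x:{t-r..t+r}|lborel. \<bar>f x\<bar>) / r))"

lemma less_hl_max_iff: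
  assumes "0 \<le> l"
  shows "ennreal l < hl_max f t \<longleftrightarrow> t \<in> hl_set f l"
proof -
  have "ennreal l < hl_max f t \<longleftrightarrow> (\<exists>r>0. l < (LINT x:{t-r..t+r}|lborel. \<bar>f x\<bar>) / r)"
    using assms by (auto simp: hl_max_def less_SUP_iff ennreal_less_iff)
  also have "\<dots> \<longleftrightarrow> t \<in> hl_set f l"
    unfolding hl_set_def by (auto simp: field_simps)
  finally show ?thesis .
qed

lemma borel_measurable_hl_max:
  assumes "\<And>a b. set_integrable lborel {a..b} f"
  shows "hl_max f \<in> borel_measurable borel"
proof (rule borel_measurableI_greater)
  fix y :: ennreal
  show "{x \<in> space borel. y < hl_max f x} \<in> sets borel"
  proof (cases y)
    case (real l)
    then have "{x \<in> space borel. y < hl_max f x} = hl_set f l" by (auto simp: less_hl_max_iff)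
    then show ?thesis using open_hl_set[OF assms] by auto
  qed auto
qed

lemma nn_integral_powr_layer:
  fixes p y :: real
  assumes "0 < p" "0 \<le> y"
  shows "(\<integral>\<^sup>+l. ennreal (indicator {0<..<y} l * (p * l powr (p - 1))) \<partial>lborel) = ennreal (y powr p)"
proof -
  have "((\<lambda>l. p * l powr (p - 1)) has_integral p * (y powr (p - 1 + 1) / (p - 1 + 1))) {0..y}"
    using assms by (intro has_integral_mult_right has_integral_powr_from_0) auto
  then have *: "((\<lambda>l. indicator {0..y} l * (p * l powr (p - 1))) has_integral y powr p) UNIV"
    using assms by (subst (asm) has_integral_restrict_UNIV[symmetric])
      (simp add: indicator_def of_bool_def if_distrib if_distribR cong: if_cong)
  have "(\<integral>\<^sup>+l. ennreal (indicator {0<..<y} l * (p * l powr (p - 1))) \<partial>lborel)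
      = (\<integral>\<^sup>+l. ennreal (indicator {0..y} l * (p * l powr (p - 1))) \<partial>lborel)"
  proof (rule nn_integral_cong_AE)
    have "AE x in lborel. x \<noteq> 0" "AE x in lborel. x \<noteq> y" by (rule AE_lborel_singleton)+
    then show "AE l in lborel. ennreal (indicator {0<..<y} l * (p * l powr (p - 1)))
        = ennreal (indicator {0..y} l * (p * l powr (p - 1)))"
      by eventually_elim (auto simp: indicator_def)
  qed
  also have "\<dots> = ennreal (y powr p)"
    by (rule nn_integral_has_integral_lborel[OF _ _ *]) (use assms in auto)
  finally show ?thesis .
qed

text \<open>Layer-cake formula for an extended value. At \<open>top\<close> the bound holds with
  every finite \<open>y\<close> on the left, which forces the integral to be infinite.\<close>

lemma ennreal_rpow_layer_le:
  assumes m: "0 < m"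
  shows "ennreal_rpow x m
    \<le> (\<integral>\<^sup>+l. ennreal (indicator {0<..} l * (m * l powr (m - 1))) * indicator {l. ennreal l < x} l \<partial>lborel)"
    (is "_ \<le> ?R")
proof -
  have *: "ennreal (y powr m) \<le> ?R" if "0 \<le> y" "ennreal y \<le> x" for y
  proof -
    have "ennreal (y powr m) = (\<integral>\<^sup>+l. ennreal (indicator {0<..<y} l * (m * l powr (m - 1))) \<partial>lborel)"
      using nn_integral_powr_layer[OF m that(1)] by simp
    also have "\<dots> \<le> ?R"
    proof (rule nn_integral_mono)
      fix l :: real
      have "ennreal l < x" if "0 < l" "l < y"
        using that \<open>ennreal y \<le> x\<close> by (metis ennreal_lessI order_less_le_trans order.strict_trans)
      then show "ennreal (indicator {0<..<y} l * (m * l powr (m - 1)))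
        \<le> ennreal (indicator {0<..} l * (m * l powr (m - 1))) * indicator {l. ennreal l < x} l"
        using m by (auto simp: indicator_def)
    qed
    finally show ?thesis .
  qed
  show ?thesis
  proof (cases x)
    case (real y)
    then show ?thesis using *[of y] by (simp add: ennreal_rpow_def)
  next
    case top
    have "?R = top"
    proof (rule ccontr)
      assume "?R \<noteq> top"
      then obtain z where z: "0 \<le> z" "?R = ennreal z" by (cases ?R) auto
      then have "ennreal (((z + 1) powr (1/m)) powr m) \<le> ennreal z"
        using *[of "(z + 1) powr (1/m)"] top by simp
      then show False using z m by (simp add: powr_powr)
    qed
    then show ?thesis by simp
  qed
qed

text \<open>On an interval of length \<open>2 * r\<close> the values of \<open>\<bar>f\<bar>\<close>
  up to \<open>l\<close> contribute at most \<open>2 * l * r\<close>, so at least half of an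
  integral above \<open>4 * l * r\<close> is due to the tail where \<open>\<bar>f\<bar>\<close>
  exceeds \<open>l\<close>. The tail is integrable although \<open>f\<close> need not be.\<close>

lemma
  assumes m: "1 < m" and f: "f \<in> Lp m" and l: "0 < l"
  shows Lp_tail_integrable: "integrable lborel (\<lambda>x. indicator {x. l < \<bar>f x\<bar>} x * f x)"
    and hl_set_tail: "hl_set f (4 * l) \<subseteq> hl_set (\<lambda>x. indicator {x. l < \<bar>f x\<bar>} x * f x) (2 * l)"
proof -
  let ?h = "\<lambda>x. indicator {x. l < \<bar>f x\<bar>} x * f x"
  have [measurable]: "f \<in> borel_measurable borel" using f by (rule Lp_measurable)
  have "\<bar>?h x\<bar> \<le> l powr (1 - m) * \<bar>f x\<bar> powr m" for x
  proof (cases "l < \<bar>f x\<bar>")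
    case True
    have "\<bar>f x\<bar> = \<bar>f x\<bar> powr (1 - m) * \<bar>f x\<bar> powr m" using True l by (simp flip: powr_add)
    also have "\<dots> \<le> l powr (1 - m) * \<bar>f x\<bar> powr m"
      using True l m by (intro mult_right_mono powr_mono2') auto
    finally show ?thesis using True by simp
  qed (auto simp: indicator_def)
  then show int: "integrable lborel ?h"
    by (intro Bochner_Integration.integrable_bound[OF integrable_mult_right[OF Lp_integrable[OF f], of "l powr (1 - m)"]])
      (auto simp: abs_mult)
  show "hl_set f (4 * l) \<subseteq> hl_set ?h (2 * l)"
  proof
    fix t assume "t \<in> hl_set f (4 * l)"
    then obtain r where r: "0 < r" "4 * l * r < (LINT x:{t-r..t+r}|lborel. \<bar>f x\<bar>)"
      by (auto simp: hl_set_def)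
    have sh: "set_integrable lborel {t-r..t+r} (\<lambda>x. \<bar>?h x\<bar>)"
      using integrable_abs[OF int] unfolding set_integrable_def by (intro integrable_mult_indicator) auto
    have sl: "set_integrable lborel {t-r..t+r} (\<lambda>x. l)" by (simp add: set_integrable_def emeasure_lborel_Icc_eq)
    have "(LINT x:{t-r..t+r}|lborel. \<bar>f x\<bar>) \<le> (LINT x:{t-r..t+r}|lborel. \<bar>?h x\<bar> + l)"
      using l by (intro set_integral_mono set_integrable_abs Lp_Icc_integrable[OF m f] set_integral_add sh sl)
        (auto simp: indicator_def)
    also have "\<dots> = (LINT x:{t-r..t+r}|lborel. \<bar>?h x\<bar>) + 2 * l * r"
      using r(1) by (subst set_integral_add[OF sh sl]) (simp add: set_lebesgue_integral_def)
    finally have "2 * l * r < (LINT x:{t-r..t+r}|lborel. \<bar>?h x\<bar>)" using r by simp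
    then show "t \<in> hl_set ?h (2 * l)" using r(1) by (auto simp: hl_set_def)
  qed
qed

text \<open>Marcinkiewicz interpolation: at each height \<open>l\<close> the weak type bound is
  applied only to the part of \<open>f\<close> above \<open>l/4\<close>, then the integrals in
  \<open>l\<close> and \<open>x\<close> are exchanged. The power \<open>m - 2\<close> of
  \<open>l\<close> is integrable at 0 because \<open>1 < m\<close>, whence the factor
  \<open>1 / (m - 1)\<close>; the upper limit \<open>4 * \<bar>f x\<bar>\<close> gives
  \<open>4 powr (m - 1)\<close>.\<close>

theorem hl_max_strong_type:
  assumes m: "1 < m" and f: "f \<in> Lp m"
  shows "(\<integral>\<^sup>+t. ennreal_rpow (hl_max f t) m \<partial>lborel)
    \<le> ennreal (20 * m / (m - 1) * 4 powr (m - 1) * Lp_pow m f)"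
proof -
  note [measurable] = Lp_measurable[OF f] borel_measurable_hl_max[OF Lp_Icc_integrable[OF m f]]
  let ?c = "\<lambda>l. indicator {0<..} l * (m * l powr (m - 1))"
  have "(\<integral>\<^sup>+t. ennreal_rpow (hl_max f t) m \<partial>lborel)
     \<le> (\<integral>\<^sup>+t. \<integral>\<^sup>+l. ennreal (?c l) * indicator {l. ennreal l < hl_max f t} l \<partial>lborel \<partial>lborel)"
    using m by (intro nn_integral_mono ennreal_rpow_layer_le) auto
  also have "\<dots> = (\<integral>\<^sup>+l. \<integral>\<^sup>+t. ennreal (?c l) * indicator {l. ennreal l < hl_max f t} l \<partial>lborel \<partial>lborel)"
    by (rule lborel_pair.Fubini'[symmetric]) (simp add: indicator_def, measurable)
  also have "\<dots> \<le> (\<integral>\<^sup>+l. \<integral>\<^sup>+x. ennreal (20 * m / (m - 1) * \<bar>f x\<bar>) *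
      ennreal (indicator {0<..<4 * \<bar>f x\<bar>} l * ((m - 1) * l powr (m - 1 - 1))) \<partial>lborel \<partial>lborel)"
  proof (rule nn_integral_mono)
    fix l :: real
    show "(\<integral>\<^sup>+t. ennreal (?c l) * indicator {l. ennreal l < hl_max f t} l \<partial>lborel)
      \<le> (\<integral>\<^sup>+x. ennreal (20 * m / (m - 1) * \<bar>f x\<bar>) *
        ennreal (indicator {0<..<4 * \<bar>f x\<bar>} l * ((m - 1) * l powr (m - 1 - 1))) \<partial>lborel)"
    proof (cases "0 < l")
      case l: True
      let ?h = "\<lambda>x. indicator {x. l/4 < \<bar>f x\<bar>} x * f x"
      have int: "integrable lborel ?h" using Lp_tail_integrable[OF m f, of "l/4"] l by simp
      have "(\<integral>\<^sup>+t. ennreal (?c l) * indicator {l. ennreal l < hl_max f t} l \<partial>lborel)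
          = (\<integral>\<^sup>+t. ennreal (?c l) * indicator (hl_set f l) t \<partial>lborel)"
        using l by (intro nn_integral_cong) (auto simp: indicator_def less_hl_max_iff)
      also have "\<dots> = ennreal (?c l) * emeasure lborel (hl_set f l)"
        using open_hl_set[OF Lp_Icc_integrable[OF m f]] by (simp add: nn_integral_cmult_indicator)
      also have "\<dots> \<le> ennreal (?c l) * ennreal (10 / (l/2) * (\<integral>x. \<bar>?h x\<bar> \<partial>lborel))"
      proof (rule mult_left_mono)
        have "open (hl_set ?h (l/2))" by (intro open_hl_set integrable_imp_set_integrable[OF int]) auto
        then have "emeasure lborel (hl_set f l) \<le> emeasure lborel (hl_set ?h (l/2))"
          using hl_set_tail[OF m f, of "l/4"] l by (intro emeasure_mono) auto
        also have "\<dots> \<le> ennreal (10 / (l/2) * (\<integral>x. \<bar>?h x\<bar> \<partial>lborel))"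
          using l by (intro hl_set_weak_type int) auto
        finally show "emeasure lborel (hl_set f l) \<le> ennreal (10 / (l/2) * (\<integral>x. \<bar>?h x\<bar> \<partial>lborel))" .
      qed simp
      also have "\<dots> = ennreal (?c l * (20 / l)) * ennreal (\<integral>x. \<bar>?h x\<bar> \<partial>lborel)"
        using l m by (subst (1 2) ennreal_mult[symmetric]) (auto simp: mult_ac)
      also have "ennreal (\<integral>x. \<bar>?h x\<bar> \<partial>lborel) = (\<integral>\<^sup>+x. ennreal \<bar>?h x\<bar> \<partial>lborel)"
        using nn_integral_eq_integral[OF integrable_abs[OF int]] by simp
      also have "ennreal (?c l * (20 / l)) * \<dots> = (\<integral>\<^sup>+x. ennreal (?c l * (20 / l)) * ennreal \<bar>?h x\<bar> \<partial>lborel)"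
        by (intro nn_integral_cmult[symmetric]) measurable
      also have "\<dots> = (\<integral>\<^sup>+x. ennreal (20 * m / (m - 1) * \<bar>f x\<bar>) *
        ennreal (indicator {0<..<4 * \<bar>f x\<bar>} l * ((m - 1) * l powr (m - 1 - 1))) \<partial>lborel)"
      proof (rule nn_integral_cong)
        fix x
        have "?c l * (20 / l) * \<bar>?h x\<bar> = 20 * m / (m - 1) * \<bar>f x\<bar> *
            (indicator {0<..<4 * \<bar>f x\<bar>} l * ((m - 1) * l powr (m - 1 - 1)))"
          using l m powr_diff[of l "m - 1" 1] by (auto simp: indicator_def)
        then show "ennreal (?c l * (20 / l)) * ennreal \<bar>?h x\<bar> = ennreal (20 * m / (m - 1) * \<bar>f x\<bar>) *
            ennreal (indicator {0<..<4 * \<bar>f x\<bar>} l * ((m - 1) * l powr (m - 1 - 1)))"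
          using l m by (subst (1 2) ennreal_mult[symmetric]) auto
      qed
      finally show ?thesis .
    qed simp
  qed
  also have "\<dots> = (\<integral>\<^sup>+x. \<integral>\<^sup>+l. ennreal (20 * m / (m - 1) * \<bar>f x\<bar>) *
      ennreal (indicator {0<..<4 * \<bar>f x\<bar>} l * ((m - 1) * l powr (m - 1 - 1))) \<partial>lborel \<partial>lborel)"
    by (rule lborel_pair.Fubini') (simp add: indicator_def, measurable)
  also have "\<dots> = (\<integral>\<^sup>+x. ennreal (20 * m / (m - 1) * 4 powr (m - 1) * \<bar>f x\<bar> powr m) \<partial>lborel)"
  proof (rule nn_integral_cong)
    fix x
    have "\<bar>f x\<bar> * \<bar>f x\<bar> powr (m - 1) = \<bar>f x\<bar> powr m"
      by (cases "f x = 0") (simp_all add: powr_diff)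
    then have eq: "20 * m / (m - 1) * \<bar>f x\<bar> * (4 * \<bar>f x\<bar>) powr (m - 1)
        = 20 * m / (m - 1) * 4 powr (m - 1) * \<bar>f x\<bar> powr m" by (simp add: powr_mult)
    have "(\<integral>\<^sup>+l. ennreal (20 * m / (m - 1) * \<bar>f x\<bar>) *
      ennreal (indicator {0<..<4 * \<bar>f x\<bar>} l * ((m - 1) * l powr (m - 1 - 1))) \<partial>lborel)
      = ennreal (20 * m / (m - 1) * \<bar>f x\<bar>) * ennreal ((4 * \<bar>f x\<bar>) powr (m - 1))"
      using m nn_integral_powr_layer[of "m - 1" "4 * \<bar>f x\<bar>"]
      by (subst nn_integral_cmult) auto
    also have "\<dots> = ennreal (20 * m / (m - 1) * \<bar>f x\<bar> * (4 * \<bar>f x\<bar>) powr (m - 1))"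
      using m by (intro ennreal_mult[symmetric]) auto
    finally show "(\<integral>\<^sup>+l. ennreal (20 * m / (m - 1) * \<bar>f x\<bar>) *
      ennreal (indicator {0<..<4 * \<bar>f x\<bar>} l * ((m - 1) * l powr (m - 1 - 1))) \<partial>lborel)
      = ennreal (20 * m / (m - 1) * 4 powr (m - 1) * \<bar>f x\<bar> powr m)" unfolding eq .
  qed
  also have "\<dots> = ennreal (20 * m / (m - 1) * 4 powr (m - 1) * Lp_pow m f)"
    unfolding Lp_pow_def using m Lp_integrable[OF f]
    by (subst nn_integral_eq_integral) auto
  finally show ?thesis .
qed

section \<open>Lebesgue points and derivatives of primitives\<close>

lemma L1_approx_continuous:
  fixes f :: "real \<Rightarrow> real"
  assumes "integrable lborel f" "0 < e"
  shows "\<exists>g. continuous_on UNIV g \<and> integrable lborel g \<and> (\<integral>x. \<bar>f x - g x\<bar> \<partial>lborel) < e"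
  using assms
proof (induction f arbitrary: e rule: integrable_induct)
  case (base A c)
  then have A: "A \<in> sets borel" "emeasure lborel A < \<infinity>" by auto
  define d where "d = e / (2 * (\<bar>c\<bar> + 1))"
  have d: "0 < d" using base by (simp add: d_def)
  have AL: "A \<in> sets lebesgue" using A by auto
  \<comment> \<open>Regularity of the measure squeezes \<open>A\<close> between a closed
    \<open>K\<close> and an open \<open>U\<close> with \<open>U - K\<close> of measure below
    \<open>2 * d\<close>; a Urysohn function for this pair differs from the indicator only on
    \<open>U - K\<close>.\<close>
  obtain U where U: "open U" "A \<subseteq> U" "U - A \<in> lmeasurable" "emeasure lebesgue (U - A) < ennreal d"
    using sets_lebesgue_outer_open[OF AL d] by blast
  obtain K where K: "closed K" "K \<subseteq> A" "A - K \<in> lmeasurable" "emeasure lebesgue (A - K) < ennreal d"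
    using sets_lebesgue_inner_closed[OF AL d] by blast
  have UK: "U - K \<in> sets borel" using U K by auto
  have "emeasure lborel (U - K) = emeasure lebesgue (U - K)" using UK by simp
  also have "\<dots> \<le> emeasure lebesgue ((U - A) \<union> (A - K))" using U K A by (intro emeasure_mono) auto
  also have "\<dots> \<le> emeasure lebesgue (U - A) + emeasure lebesgue (A - K)"
    using U K by (intro emeasure_subadditive) auto
  also have "\<dots> < ennreal d + ennreal d" using U K by (intro add_strict_mono) auto
  also have "\<dots> = ennreal (2 * d)" using d by (subst ennreal_plus[symmetric]) auto
  finally have em: "emeasure lborel (U - K) < ennreal (2 * d)" .
  then have fin: "emeasure lborel (U - K) < \<infinity>" by (metis ennreal_less_top infinity_ennreal_def order.strict_trans)
  have me: "measure lborel (U - K) < 2 * d"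
    using em fin d by (subst (asm) emeasure_eq_ennreal_measure) (auto simp: ennreal_less_iff)
  obtain \<psi> :: "real \<Rightarrow> real" where \<psi>: "continuous_on UNIV \<psi>" "\<And>x. \<psi> x \<in> closed_segment 1 0"
    "\<And>x. x \<in> K \<Longrightarrow> \<psi> x = 1" "\<And>x. x \<in> - U \<Longrightarrow> \<psi> x = 0"
    using Urysohn[of K "- U" 1 0] U K by (metis (no_types, lifting) ComplD closed_Compl disjoint_iff subsetD)
  have \<psi>01: "0 \<le> \<psi> x" "\<psi> x \<le> 1" for x using \<psi>(2)[of x] by (auto simp: closed_segment_eq_real_ivl)
  have [measurable]: "\<psi> \<in> borel_measurable borel" using \<psi>(1) by (rule borel_measurable_continuous_onI)
  have le: "\<bar>indicator A x - \<psi> x\<bar> \<le> indicator (U - K) x" for x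
    using \<psi>(3,4)[of x] \<psi>01[of x] U(2) K(2) by (auto simp: indicator_def)
  have iUK: "integrable lborel (indicator (U - K) :: real \<Rightarrow> real)" using UK fin by simp
  have iA: "integrable lborel (indicator A :: real \<Rightarrow> real)" using A by simp
  have i\<psi>: "integrable lborel (\<lambda>x. indicator A x - \<psi> x)"
    by (rule Bochner_Integration.integrable_bound[OF iUK]) (use A le in auto)
  from Bochner_Integration.integrable_diff[OF iA this] have "integrable lborel \<psi>" by simp
  then have 1: "integrable lborel (\<lambda>x. c * \<psi> x)" by simp
  have "(\<integral>x. \<bar>indicator A x *\<^sub>R c - c * \<psi> x\<bar> \<partial>lborel) = \<bar>c\<bar> * (\<integral>x. \<bar>indicator A x - \<psi> x\<bar> \<partial>lborel)"
    by (subst integral_mult_right_zero[symmetric]) (auto simp: abs_mult[symmetric] algebra_simps)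
  also have "\<dots> \<le> \<bar>c\<bar> * (\<integral>x. indicator (U - K) x \<partial>lborel)"
    by (intro mult_left_mono integral_mono integrable_abs i\<psi> iUK le) auto
  also have "\<dots> \<le> \<bar>c\<bar> * (2 * d)" using me by (intro mult_left_mono) auto
  also have "\<dots> < e" using base by (simp add: d_def field_simps)
  finally show ?case using 1 \<psi>(1) by (intro exI[of _ "\<lambda>x. c * \<psi> x"]) (auto intro!: continuous_intros)
next
  case (add f g)
  obtain f' where f': "continuous_on UNIV f'" "integrable lborel f'" "(\<integral>x. \<bar>f x - f' x\<bar> \<partial>lborel) < e/2"
    using add.IH(1)[of "e/2"] add.prems by auto
  obtain g' where g': "continuous_on UNIV g'" "integrable lborel g'" "(\<integral>x. \<bar>g x - g' x\<bar> \<partial>lborel) < e/2"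
    using add.IH(2)[of "e/2"] add.prems by auto
  have "(\<integral>x. \<bar>f x + g x - (f' x + g' x)\<bar> \<partial>lborel) \<le> (\<integral>x. \<bar>f x - f' x\<bar> + \<bar>g x - g' x\<bar> \<partial>lborel)"
    using add f' g' by (intro integral_mono) auto
  also have "\<dots> = (\<integral>x. \<bar>f x - f' x\<bar> \<partial>lborel) + (\<integral>x. \<bar>g x - g' x\<bar> \<partial>lborel)"
    using add f' g' by (intro Bochner_Integration.integral_add) auto
  also have "\<dots> < e" using f' g' by simp
  finally show ?case using f' g'
    by (intro exI[of _ "\<lambda>x. f' x + g' x"]) (auto intro!: continuous_intros)
next
  case (lim f s)
  have "(\<lambda>i. \<integral>x. \<bar>f x - s i x\<bar> \<partial>lborel) \<longlonglongrightarrow> integral\<^sup>L lborel (\<lambda>x::real. 0)"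
  proof (rule integral_dominated_convergence[where w = "\<lambda>x. 3 * \<bar>f x\<bar>"])
    show "AE x in lborel. (\<lambda>i. \<bar>f x - s i x\<bar>) \<longlonglongrightarrow> 0"
    proof (rule AE_I2)
      fix x
      have "(\<lambda>i. \<bar>f x - s i x\<bar>) \<longlonglongrightarrow> \<bar>f x - f x\<bar>"
        by (intro tendsto_intros lim.hyps(2)) auto
      then show "(\<lambda>i. \<bar>f x - s i x\<bar>) \<longlonglongrightarrow> 0" by simp
    qed
    show "AE x in lborel. norm \<bar>f x - s i x\<bar> \<le> 3 * \<bar>f x\<bar>" for i
    proof (rule AE_I2)
      fix x
      show "norm \<bar>f x - s i x\<bar> \<le> 3 * \<bar>f x\<bar>" using lim.hyps(3)[of x i] by auto
    qed
  qed (use lim in auto)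
  then have "(\<lambda>i. \<integral>x. \<bar>f x - s i x\<bar> \<partial>lborel) \<longlonglongrightarrow> 0" by simp
  then have "eventually (\<lambda>i. (\<integral>x. \<bar>f x - s i x\<bar> \<partial>lborel) < e/2) sequentially"
    using lim.prems by (intro order_tendstoD) auto
  then obtain i where i: "(\<integral>x. \<bar>f x - s i x\<bar> \<partial>lborel) < e/2" by (auto simp: eventually_sequentially)
  obtain g where g: "continuous_on UNIV g" "integrable lborel g" "(\<integral>x. \<bar>s i x - g x\<bar> \<partial>lborel) < e/2"
    using lim.IH[of "e/2" i] lim.prems by auto
  have "(\<integral>x. \<bar>f x - g x\<bar> \<partial>lborel) \<le> (\<integral>x. \<bar>f x - s i x\<bar> + \<bar>s i x - g x\<bar> \<partial>lborel)"
    using lim g by (intro integral_mono) auto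
  also have "\<dots> = (\<integral>x. \<bar>f x - s i x\<bar> \<partial>lborel) + (\<integral>x. \<bar>s i x - g x\<bar> \<partial>lborel)"
    using lim g by (intro Bochner_Integration.integral_add) auto
  also have "\<dots> < e" using i g by simp
  finally show ?case using g by auto
qed

text \<open>\<open>B\<close> itself may fail to be measurable; the intersection of measurable covers
  of measure at most \<open>1 / real (Suc n)\<close> is a null set containing it.\<close>

lemma AE_not_mem_if_emeasure_small:
  assumes "\<And>e::real. 0 < e \<Longrightarrow> \<exists>N\<in>sets M. B \<subseteq> N \<and> emeasure M N \<le> ennreal e" "B \<subseteq> space M"
  shows "AE x in M. x \<notin> B"
proof -
  have "\<forall>n. \<exists>N\<in>sets M. B \<subseteq> N \<and> emeasure M N \<le> ennreal (1 / real (Suc n))"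
    using assms(1) by simp
  then obtain N where N: "\<And>n. N n \<in> sets M" "\<And>n. B \<subseteq> N n" "\<And>n. emeasure M (N n) \<le> ennreal (1 / real (Suc n))"
    by metis
  have le: "emeasure M (\<Inter>n. N n) \<le> ennreal (1 / real (Suc n))" for n
    using N(1) by (intro order_trans[OF emeasure_mono N(3)[of n]]) auto
  have "emeasure M (\<Inter>n. N n) \<le> 0"
  proof (rule LIMSEQ_le_const)
    show "(\<lambda>n. ennreal (1 / real (Suc n))) \<longlonglongrightarrow> 0"
      using tendsto_ennrealI[OF LIMSEQ_inverse_real_of_nat] by (simp add: inverse_eq_divide)
  qed (use le in auto)
  then have "(\<Inter>n. N n) \<in> null_sets M" using N(1) by auto
  moreover have "{x \<in> space M. \<not> x \<notin> B} \<subseteq> (\<Inter>n. N n)" using N(2) by auto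
  ultimately show ?thesis by (rule AE_I')
qed

text \<open>\<open>f\<close> is split into a continuous \<open>g\<close>, for which every point is
  good, and a remainder \<open>h\<close> with small integral. At a bad point either the maximal
  function of \<open>h\<close> or \<open>\<bar>h x\<bar>\<close> is large; both sets are small, by
  the weak type bound and by Chebyshev's inequality.\<close>

theorem lebesgue_point_AE:
  fixes f :: "real \<Rightarrow> real"
  assumes f: "integrable lborel f"
  shows "AE x in lborel. \<forall>e>0. \<exists>d>0. \<forall>r. 0 < r \<and> r < d \<longrightarrow> (LINT y:{x-r..x+r}|lborel. \<bar>f y - f x\<bar>) \<le> e * r"
proof -
  define bad where "bad e = {x. \<forall>d>0. \<exists>r. 0 < r \<and> r < d \<and> e * r < (LINT y:{x-r..x+r}|lborel. \<bar>f y - f x\<bar>)}" for e :: real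
  have const: "set_integrable lborel {a..b} (\<lambda>y. c)" for a b c :: real
    by (simp add: set_integrable_def emeasure_lborel_Icc_eq)
  have null: "AE x in lborel. x \<notin> bad e" if e: "0 < e" for e
  proof (rule AE_not_mem_if_emeasure_small)
    fix \<eta> :: real assume \<eta>: "0 < \<eta>"
    \<comment> \<open>The two exceptional sets have measure at most \<open>20 / e * q\<close> and
      \<open>8 / e * q\<close>; their sum \<open>28 / e * q\<close> is below
      \<open>\<eta>\<close>.\<close>
    define q where "q = \<eta> * e / 40"
    have q: "0 < q" using \<eta> e by (simp add: q_def)
    obtain g where g: "continuous_on UNIV g" "integrable lborel g" "(\<integral>x. \<bar>f x - g x\<bar> \<partial>lborel) < q"
      using L1_approx_continuous[OF f q] by blast
    define h where "h = (\<lambda>x. f x - g x)"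
    have h: "integrable lborel h" using f g by (simp add: h_def)
    have [measurable]: "h \<in> borel_measurable borel" using h by auto
    note hI = integrable_imp_set_integrable[OF h]
    note gI = integrable_imp_set_integrable[OF g(2)]
    define S where "S = {x. e/8 < \<bar>h x\<bar>}"
    have S[measurable]: "S \<in> sets borel" unfolding S_def by measurable
    have hl: "hl_set h (e/2) \<in> sets borel" by (rule borel_open, rule open_hl_set, rule hI) simp
    have mS: "emeasure lborel S \<le> ennreal (8 / e * q)"
    proof -
      have "emeasure lborel S = (\<integral>\<^sup>+x. indicator S x \<partial>lborel)" by simp
      also have "\<dots> \<le> (\<integral>\<^sup>+x. ennreal (8 / e * \<bar>h x\<bar>) \<partial>lborel)"
      proof (rule nn_integral_mono)
        fix x show "indicator S x \<le> ennreal (8 / e * \<bar>h x\<bar>)"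
          using e by (auto simp: S_def indicator_def field_simps simp flip: ennreal_1 intro!: ennreal_leI)
      qed
      also have "\<dots> = ennreal (8 / e * (\<integral>x. \<bar>h x\<bar> \<partial>lborel))"
        using e h by (subst nn_integral_eq_integral) auto
      also have "\<dots> \<le> ennreal (8 / e * q)"
        using g(3) e by (intro ennreal_leI mult_left_mono) (auto simp: h_def)
      finally show ?thesis .
    qed
    have mh: "emeasure lborel (hl_set h (e/2)) \<le> ennreal (20 / e * q)"
    proof -
      have "emeasure lborel (hl_set h (e/2)) \<le> ennreal (10 / (e/2) * (\<integral>x. \<bar>h x\<bar> \<partial>lborel))"
        using e by (intro hl_set_weak_type h) auto
      also have "\<dots> \<le> ennreal (20 / e * q)"
        using g(3) e by (intro ennreal_leI) (auto simp: h_def field_simps)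
      finally show ?thesis .
    qed
    have "emeasure lborel (hl_set h (e/2) \<union> S) \<le> emeasure lborel (hl_set h (e/2)) + emeasure lborel S"
      using hl S by (intro emeasure_subadditive) auto
    also have "\<dots> \<le> ennreal (20 / e * q) + ennreal (8 / e * q)" by (intro add_mono mh mS)
    also have "\<dots> = ennreal (28 / e * q)" using e q by (subst ennreal_plus[symmetric]) (auto simp: field_simps)
    also have "\<dots> \<le> ennreal \<eta>" using e \<eta> by (intro ennreal_leI) (simp add: q_def)
    finally have em: "emeasure lborel (hl_set h (e/2) \<union> S) \<le> ennreal \<eta>" .
    have "bad e \<subseteq> hl_set h (e/2) \<union> S"
    proof
      fix x assume x: "x \<in> bad e"
      show "x \<in> hl_set h (e/2) \<union> S"
      proof (rule ccontr)
        assume n: "x \<notin> hl_set h (e/2) \<union> S"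
        then have hx: "\<bar>h x\<bar> \<le> e/8" by (auto simp: S_def)
        have "isCont g x" using g(1) by (simp add: continuous_on_eq_continuous_at)
        then obtain d where d: "0 < d" "\<And>y. \<bar>y - x\<bar> < d \<Longrightarrow> \<bar>g y - g x\<bar> < e/8"
          using e unfolding continuous_at_eps_delta by (metis dist_real_def divide_pos_pos zero_less_numeral)
        obtain r where r: "0 < r" "r < d" "e * r < (LINT y:{x-r..x+r}|lborel. \<bar>f y - f x\<bar>)"
          using x d(1) unfolding bad_def by blast
        have "(LINT y:{x-r..x+r}|lborel. \<bar>f y - f x\<bar>) \<le> (LINT y:{x-r..x+r}|lborel. \<bar>h y\<bar> + e/4)"
        proof (rule set_integral_mono)
          show "set_integrable lborel {x-r..x+r} (\<lambda>y. \<bar>f y - f x\<bar>)"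
            using integrable_imp_set_integrable[OF f] const by (intro set_integrable_abs set_integral_diff) auto
          show "set_integrable lborel {x-r..x+r} (\<lambda>y. \<bar>h y\<bar> + e/4)"
            using hI const by (intro set_integral_add set_integrable_abs) auto
          fix y assume "y \<in> {x-r..x+r}"
          then have "\<bar>g y - g x\<bar> < e/8" using r by (intro d) auto
          then show "\<bar>f y - f x\<bar> \<le> \<bar>h y\<bar> + e/4" using hx unfolding h_def by linarith
        qed
        also have "\<dots> = (LINT y:{x-r..x+r}|lborel. \<bar>h y\<bar>) + e/4 * (2 * r)"
          using r(1) hI const by (subst set_integral_add) (auto simp: set_integrable_abs set_lebesgue_integral_def)
        also have "(LINT y:{x-r..x+r}|lborel. \<bar>h y\<bar>) \<le> e/2 * r"
          using n r(1) unfolding hl_set_def by (auto simp: not_less dest!: spec[of _ r])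
        finally show False using r by simp
      qed
    qed
    then show "\<exists>N\<in>sets lborel. bad e \<subseteq> N \<and> emeasure lborel N \<le> ennreal \<eta>"
      using em hl S by (intro bexI[of _ "hl_set h (e/2) \<union> S"]) auto
  qed auto
  have "AE x in lborel. \<forall>n. x \<notin> bad (1 / real (Suc n))"
    using null by (subst AE_all_countable) auto
  then show ?thesis
  proof eventually_elim
    case (elim x)
    show ?case
    proof (intro allI impI)
      fix e :: real assume "0 < e"
      then obtain n where n: "1 / real (Suc n) < e" using nat_approx_posE by blast
      obtain d where d: "0 < d" "\<And>r. 0 < r \<Longrightarrow> r < d \<Longrightarrow> (LINT y:{x-r..x+r}|lborel. \<bar>f y - f x\<bar>) \<le> 1 / real (Suc n) * r"
        using elim[rule_format, of n] unfolding bad_def mem_Collect_eq not_all not_imp not_ex de_Morgan_conj not_less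
        by (meson not_le)
      have "(LINT y:{x-r..x+r}|lborel. \<bar>f y - f x\<bar>) \<le> e * r" if "0 < r" "r < d" for r
        using d(2)[OF that] n that mult_right_mono[of "1 / real (Suc n)" e r] by simp
      then show "\<exists>d>0. \<forall>r. 0 < r \<and> r < d \<longrightarrow> (LINT y:{x-r..x+r}|lborel. \<bar>f y - f x\<bar>) \<le> e * r"
        using d(1) by blast
    qed
  qed
qed

text \<open>At a Lebesgue point the error of the linear approximation is an integral of
  \<open>g s - g x\<close> over part of the symmetric interval, hence small compared with its
  radius.\<close>

lemma AE_has_derivative_primitive_local:
  fixes F f :: "real \<Rightarrow> real"
  assumes f: "set_integrable lborel {a..b} f"
    and F: "\<And>x y. a \<le> x \<Longrightarrow> x \<le> y \<Longrightarrow> y \<le> b \<Longrightarrow> F y - F x = (LINT s:{x..y}|lborel. f s)"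
  shows "AE x in lborel. x \<in> {a<..<b} \<longrightarrow> (F has_real_derivative f x) (at x)"
proof -
  define g where "g = (\<lambda>x. indicator {a..b} x * f x)"
  have g: "integrable lborel g" using f by (simp add: g_def set_integrable_def)
  have const: "set_integrable lborel {u..v} (\<lambda>y. c)" for u v c :: real
    by (simp add: set_integrable_def emeasure_lborel_Icc_eq)
  note gI = integrable_imp_set_integrable[OF g]
  show ?thesis using lebesgue_point_AE[OF g]
  proof eventually_elim
    case (elim x)
    show ?case
    proof
      assume x: "x \<in> {a<..<b}"
      have gx: "g x = f x" using x by (simp add: g_def)
      have key: "\<bar>F v - F u - g x * (v - u)\<bar> \<le> (LINT y:{x-r..x+r}|lborel. \<bar>g y - g x\<bar>)"
        if "a \<le> u" "u \<le> v" "v \<le> b" "x - r \<le> u" "v \<le> x + r" for u v r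
      proof -
        have "F v - F u = (LINT s:{u..v}|lborel. g s)"
          using that F[of u v] by (auto simp: g_def intro!: set_lebesgue_integral_cong)
        then have "F v - F u - g x * (v - u) = (LINT s:{u..v}|lborel. g s - g x)"
          using gI const that by (subst set_integral_diff) (auto simp: set_lebesgue_integral_def)
        also have "\<bar>\<dots>\<bar> \<le> (LINT s:{u..v}|lborel. \<bar>g s - g x\<bar>)"
          using set_integral_norm_bound[of lborel "{u..v}" "\<lambda>s. g s - g x"] gI const by (auto intro: set_integral_diff)
        also have "\<dots> \<le> (LINT y:{x-r..x+r}|lborel. \<bar>g y - g x\<bar>)"
          using that gI const by (intro set_integral_mono_nonneg_set set_integrable_abs set_integral_diff) auto
        finally show ?thesis .
      qed
      show "(F has_real_derivative f x) (at x)"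
        unfolding has_field_derivative_def has_derivative_at2 LIM_eq
      proof (intro conjI allI impI)
        fix e :: real assume e: "0 < e"
        have "0 < e/2" using e by simp
        then obtain d where d: "0 < d" "\<And>r. 0 < r \<Longrightarrow> r < d \<Longrightarrow> (LINT y:{x-r..x+r}|lborel. \<bar>g y - g x\<bar>) \<le> e/2 * r"
          using elim by blast
        define D where "D = min d (min (x - a) (b - x))"
        have D: "0 < D" using d x by (simp add: D_def)
        have "norm ((1 / norm (y - x)) *\<^sub>R (F y - (F x + f x * (y - x))) - 0) < e"
          if y: "y \<noteq> x" "norm (y - x) < D" for y
        proof -
          define r where "r = \<bar>y - x\<bar>"
          have r: "0 < r" "r < d" using y by (auto simp: r_def D_def)
          have "\<bar>F y - (F x + f x * (y - x))\<bar> \<le> (LINT y:{x-r..x+r}|lborel. \<bar>g y - g x\<bar>)"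
          proof (cases "x \<le> y")
            case True
            then show ?thesis using key[of x y r] y by (auto simp: r_def D_def gx algebra_simps)
          next
            case False
            then show ?thesis using key[of y x r] y
              by (auto simp: r_def D_def gx algebra_simps abs_minus_commute)
          qed
          also have "\<dots> \<le> e/2 * r" by (rule d(2)[OF r])
          also have "\<dots> < e * r" using e r by simp
          finally show ?thesis using r by (simp add: r_def[symmetric] abs_mult field_simps)
        qed
        then show "\<exists>s>0. \<forall>y. y \<noteq> x \<and> norm (y - x) < s \<longrightarrow>
          norm ((1 / norm (y - x)) *\<^sub>R (F y - (F x + f x * (y - x))) - 0) < e"
          using D by blast
      qed (rule bounded_linear_mult_right)
    qed
  qed
qed

lemma AE_has_derivative_primitive:
  fixes F f :: "real \<Rightarrow> real"
  assumes f: "\<And>a b. set_integrable lborel {a..b} f"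
    and F: "\<And>x y. x \<le> y \<Longrightarrow> F y - F x = (LINT s:{x..y}|lborel. f s)"
  shows "AE x in lborel. (F has_real_derivative f x) (at x)"
proof -
  have "AE x in lborel. \<forall>n. x \<in> {- real n<..<real n} \<longrightarrow> (F has_real_derivative f x) (at x)"
    by (subst AE_all_countable) (intro allI AE_has_derivative_primitive_local f F)
  then show ?thesis
  proof eventually_elim
    case (elim x)
    obtain n where "\<bar>x\<bar> < real n" using reals_Archimedean2 by blast
    then show ?case using elim[rule_format, of n] by (simp add: abs_less_iff)
  qed
qed

text \<open>\<open>f\<close> may fail to be integrable at the origin; the half-line is exhausted by
  intervals bounded away from it.\<close>

lemma AE_has_derivative_primitive_pos:
  fixes F f :: "real \<Rightarrow> real"
  assumes f: "\<And>a b. 0 < a \<Longrightarrow> set_integrable lborel {a..b} f"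
    and F: "\<And>x y. 0 < x \<Longrightarrow> x \<le> y \<Longrightarrow> F y - F x = (LINT s:{x..y}|lborel. f s)"
  shows "AE x in lborel. 0 < x \<longrightarrow> (F has_real_derivative f x) (at x)"
proof -
  have "AE x in lborel. \<forall>n. x \<in> {1 / real (Suc n)<..<real n} \<longrightarrow> (F has_real_derivative f x) (at x)"
  proof (subst AE_all_countable, intro allI AE_has_derivative_primitive_local f F)
    fix n x assume "1 / real (Suc n) \<le> x"
    then show "0 < x" by (meson less_le_trans of_nat_0_less_iff zero_less_Suc zero_less_divide_1_iff)
  qed auto
  then show ?thesis
  proof eventually_elim
    case (elim x)
    show ?case
    proof
      assume x: "0 < x"
      obtain n where n: "max x (1/x) < real n" using reals_Archimedean2 by blast
      then have "1 / real (Suc n) < x" using x by (simp add: field_simps)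
      then show "(F has_real_derivative f x) (at x)" using elim[rule_format, of n] n by auto
    qed
  qed
qed

section \<open>A refined Strichartz estimate\<close>

lemma ennreal_rpow_mono: "x \<le> y \<Longrightarrow> 0 \<le> a \<Longrightarrow> ennreal_rpow x a \<le> ennreal_rpow y a"
proof -
  assume xy: "x \<le> y" and a: "0 \<le> a"
  show ?thesis
  proof (cases "y = top")
    case False
    then have "x \<noteq> top" using xy by (auto simp: top_unique)
    moreover have "enn2real x \<le> enn2real y" using xy False by (intro enn2real_mono) (auto simp: top.not_eq_extremum)
    ultimately show ?thesis using False a by (auto simp: ennreal_rpow_def intro!: ennreal_leI powr_mono2)
  qed (simp add: ennreal_rpow_def)
qed

lemma ennreal_rpow_ennreal [simp]: "0 \<le> x \<Longrightarrow> ennreal_rpow (ennreal x) a = ennreal (x powr a)"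
  by (simp add: ennreal_rpow_def)

lemma measurable_ennreal_rpow [measurable]: "(\<lambda>x. ennreal_rpow x a) \<in> borel_measurable borel"
  unfolding ennreal_rpow_def by measurable

lemma S_norm_cong:
  assumes "\<And>t r. 0 < r \<Longrightarrow> f t r = g t r"
  shows "S_norm m f = S_norm m g"
proof -
  have "ennreal (\<bar>f t r\<bar> powr ((2 * m + 1) * m) * r powr m) * indicator {0<..} r
      = ennreal (\<bar>g t r\<bar> powr ((2 * m + 1) * m) * r powr m) * indicator {0<..} r" for t r
    using assms by (auto simp: indicator_def)
  then show ?thesis unfolding S_norm_def by presburger
qed

lemma ennreal_LINT_div_le_hl_max:
  assumes "\<And>a b. set_integrable lborel {a..b} f" "0 < r"
  shows "ennreal \<bar>(LINT x:{t-r..t+r}|lborel. f x) / r\<bar> \<le> hl_max f t"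
proof -
  have "\<bar>LINT x:{t-r..t+r}|lborel. f x\<bar> \<le> (LINT x:{t-r..t+r}|lborel. \<bar>f x\<bar>)"
    using set_integral_norm_bound[OF assms(1)] by simp
  then have "ennreal \<bar>(LINT x:{t-r..t+r}|lborel. f x) / r\<bar> \<le> ennreal ((LINT x:{t-r..t+r}|lborel. \<bar>f x\<bar>) / r)"
    using assms(2) by (intro ennreal_leI) (simp add: divide_right_mono)
  also have "\<dots> \<le> hl_max f t" unfolding hl_max_def using assms(2) by (intro SUP_upper) auto
  finally show ?thesis .
qed

lemma nn_integral_has_integral_on:
  fixes g :: "real \<Rightarrow> real"
  assumes "g \<in> borel_measurable borel" "S \<in> sets borel" "\<And>x. 0 \<le> g x" "(g has_integral I) S"
  shows "(\<integral>\<^sup>+x. ennreal (g x) * indicator S x \<partial>lborel) = ennreal I"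
proof -
  have "((\<lambda>x. indicator S x * g x) has_integral I) UNIV"
    using assms(4) by (subst (asm) has_integral_restrict_UNIV[symmetric])
      (simp add: indicator_def of_bool_def if_distrib if_distribR cong: if_cong)
  then have "(\<integral>\<^sup>+x. ennreal (indicator S x * g x) \<partial>lborel) = ennreal I"
    using assms by (intro nn_integral_has_integral_lborel) auto
  moreover have "ennreal (indicator S x * g x) = ennreal (g x) * indicator S x" for x
    by (auto simp: indicator_def)
  ultimately show ?thesis by simp
qed

text \<open>The value \<open>r = (A / M)\<^sup>m\<close> balances the two bounds \<open>M\<close> and \<open>A r\<^sup>-\<^sup>1\<^sup>/\<^sup>m\<close> on \<open>w\<close>.\<close>

lemma nn_integral_weighted_le:
  fixes m A M :: real
  assumes m: "1 < m" and A: "0 < A" and M: "0 < M"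
    and w: "\<And>r. 0 < r \<Longrightarrow> \<bar>w r\<bar> \<le> M" "\<And>r. 0 < r \<Longrightarrow> \<bar>w r\<bar> \<le> A * r powr (- 1/m)"
  shows "(\<integral>\<^sup>+ r. ennreal (\<bar>w r\<bar> powr ((2 * m + 1) * m) * r powr m) * indicator {0<..} r \<partial>lebesgue)
    \<le> ennreal (2 * (M powr (m * m) * A powr (m * m + m)))"
proof -
  define q where "q = (2 * m + 1) * m"
  define R where "R = (A / M) powr m"
  have R: "0 < R" using A M by (simp add: R_def)
  have q: "0 < q" using m by (simp add: q_def)
  define X where "X = M powr (m * m) * A powr (m * m + m)"
  \<comment> \<open>Below \<open>R\<close> the integrand is at most
    \<open>M powr q * x powr m\<close>, beyond it \<open>A powr q * x powr (- m - 1)\<close>. By the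
    choice of \<open>R\<close> both integrals are multiples of the same \<open>X\<close>, with
    factors \<open>1 / (m + 1)\<close> and \<open>1 / m\<close>.\<close>
  have 1: "(\<integral>\<^sup>+x. ennreal (M powr q * x powr m) * indicator {0..R} x \<partial>lborel) = ennreal (M powr q * (R powr (m + 1) / (m + 1)))"
    using m R by (intro nn_integral_has_integral_on has_integral_mult_right has_integral_powr_from_0) auto
  have 2: "(\<integral>\<^sup>+x. ennreal (A powr q * x powr (- m - 1)) * indicator {R..} x \<partial>lborel)
      = ennreal (A powr q * (- (R powr (- m - 1 + 1)) / (- m - 1 + 1)))"
    using m R by (intro nn_integral_has_integral_on has_integral_mult_right has_integral_powr_to_inf) auto
  have e1: "q + m * - (m + 1) = m * m" "m * m + m = m * (m + 1)" "q - m * m = m * m + m"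
    by (auto simp: q_def algebra_simps)
  have "R powr (m + 1) = A powr (m * m + m) * M powr (m * - (m + 1))"
    using A M by (simp add: R_def powr_powr powr_divide e1(2) powr_minus_divide del: minus_add_distrib)
  then have "M powr q * R powr (m + 1) = A powr (m * m + m) * M powr (q + m * - (m + 1))"
    by (simp add: powr_add)
  then have X1: "M powr q * R powr (m + 1) = X" by (simp only: e1 X_def mult.commute)
  have "R powr (- m - 1 + 1) = M powr (m * m) * A powr (- (m * m))"
    using A M by (simp add: R_def powr_powr powr_divide powr_minus field_simps)
  then have "A powr q * R powr (- m - 1 + 1) = M powr (m * m) * A powr (q + - (m * m))"
    by (simp only: powr_add mult.left_commute)
  also have "q + - (m * m) = m * m + m" using e1(3) by simp
  finally have X2: "A powr q * R powr (- m - 1 + 1) = X" by (simp add: X_def)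
  have "(\<integral>\<^sup>+ r. ennreal (\<bar>w r\<bar> powr q * r powr m) * indicator {0<..} r \<partial>lebesgue)
    \<le> (\<integral>\<^sup>+ x. ennreal (M powr q * x powr m) * indicator {0..R} x + ennreal (A powr q * x powr (- m - 1)) * indicator {R..} x \<partial>lebesgue)"
  proof (rule nn_integral_mono)
    fix r :: real
    show "ennreal (\<bar>w r\<bar> powr q * r powr m) * indicator {0<..} r
      \<le> ennreal (M powr q * r powr m) * indicator {0..R} r + ennreal (A powr q * r powr (- m - 1)) * indicator {R..} r"
    proof (cases "0 < r")
      case r: True
      show ?thesis
      proof (cases "r \<le> R")
        case True
        have "\<bar>w r\<bar> powr q \<le> M powr q" using w(1)[OF r] q by (intro powr_mono2) auto
        then have "ennreal (\<bar>w r\<bar> powr q * r powr m) \<le> ennreal (M powr q * r powr m)"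
          by (intro ennreal_leI mult_right_mono) auto
        then show ?thesis using r True by (simp add: indicator_def add_increasing2)
      next
        case False
        have "\<bar>w r\<bar> powr q \<le> (A * r powr (- 1/m)) powr q" using w(2)[OF r] q by (intro powr_mono2) auto
        also have "\<dots> = A powr q * r powr (- (2 * m + 1))"
          using A r m by (simp add: powr_mult powr_powr q_def)
        finally have "\<bar>w r\<bar> powr q * r powr m \<le> A powr q * (r powr (- (2 * m + 1)) * r powr m)"
          by (simp add: mult_right_mono mult.assoc[symmetric])
        also have "r powr (- (2 * m + 1)) * r powr m = r powr (- m - 1)"
          by (simp flip: powr_add)
        finally have "ennreal (\<bar>w r\<bar> powr q * r powr m) \<le> ennreal (A powr q * r powr (- m - 1))"
          by (rule ennreal_leI)
        then show ?thesis using r False by (simp add: indicator_def)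
      qed
    qed simp
  qed
  also have "\<dots> = (\<integral>\<^sup>+ x. ennreal (M powr q * x powr m) * indicator {0..R} x + ennreal (A powr q * x powr (- m - 1)) * indicator {R..} x \<partial>lborel)"
    by (intro nn_integral_completion)
  also have "\<dots> = ennreal (M powr q * (R powr (m + 1) / (m + 1))) + ennreal (A powr q * (- (R powr (- m - 1 + 1)) / (- m - 1 + 1)))"
    using 1 2 by (subst nn_integral_add) auto
  also have "\<dots> = ennreal (X / (m + 1)) + ennreal (X / m)"
    using X1 X2 by simp
  also have "\<dots> = ennreal (X / (m + 1) + X / m)"
    using m by (intro ennreal_plus[symmetric]) (auto simp: X_def)
  also have "\<dots> \<le> ennreal (2 * X)"
  proof (rule ennreal_leI)
    have "X / (m + 1) \<le> X / 1" "X / m \<le> X / 1" using m by (intro divide_left_mono; simp add: X_def)+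
    then show "X / (m + 1) + X / m \<le> 2 * X" by simp
  qed
  finally show ?thesis by (simp add: q_def X_def)
qed

text \<open>The averages \<open>\<integral>\<^bsub>t-r\<^esub>\<^bsup>t+r\<^esup> f / r\<close> are bounded both by the maximal function and by \<open>A r\<^sup>-\<^sup>1\<^sup>/\<^sup>m\<close>.\<close>

theorem refined_Strichartz:
  fixes m A :: real
  assumes m: "1 < m" and f: "f \<in> Lp m" and A: "0 < A"
    and bd: "\<And>t r. 0 < r \<Longrightarrow> \<bar>LINT x:{t-r..t+r}|lborel. f x\<bar> \<le> A * r powr (1 - 1/m)"
  shows "S_norm m (\<lambda>t r. 1 / r * (LINT x:{t-r..t+r}|lborel. f x))
    \<le> ennreal ((2 powr (1/m) * (20 * m / (m - 1) * 4 powr (m - 1)) * A powr (m + 1) * Lp_pow m f) powr (1 / (2 * m + 1)))"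
proof -
  note fI = Lp_Icc_integrable[OF m f]
  note [measurable] = borel_measurable_hl_max[OF fI]
  define w where "w t r = 1 / r * (LINT x:{t-r..t+r}|lborel. f x)" for t r
  have w2: "\<bar>w t r\<bar> \<le> A * r powr (- 1/m)" if r: "0 < r" for t r
  proof -
    have "\<bar>w t r\<bar> \<le> 1 / r * (A * r powr (1 - 1/m))"
      using r bd[OF r, of t] by (simp add: w_def abs_mult divide_right_mono)
    also have "\<dots> = A * r powr (- 1/m)" using r by (simp add: powr_diff powr_minus field_simps)
    finally show ?thesis .
  qed
  have w1: "ennreal \<bar>w t r\<bar> \<le> hl_max f t" if "0 < r" for t r
    using ennreal_LINT_div_le_hl_max[OF fI that, of t] by (simp add: w_def)
  let ?in = "\<lambda>t. \<integral>\<^sup>+ r. ennreal (\<bar>w t r\<bar> powr ((2 * m + 1) * m) * r powr m) * indicator {0<..} r \<partial>lebesgue"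
  \<comment> \<open>The root \<open>1/m\<close> of
    \<open>M powr (m * m) * A powr (m * m + m)\<close> is \<open>M powr m * A powr (m + 1)\<close>:
    exactly the power of the maximal function whose time integral \<open>hl_max_strong_type\<close>
    controls.\<close>
  have inner: "ennreal_rpow (?in t) (1/m) \<le> ennreal (2 powr (1/m) * A powr (m + 1)) * ennreal_rpow (hl_max f t) m" for t
  proof (cases "hl_max f t")
    case top
    then show ?thesis using A m by (simp add: ennreal_rpow_def ennreal_mult_eq_top_iff)
  next
    case (real M)
    have M1: "\<bar>w t r\<bar> \<le> M" if "0 < r" for r using w1[OF that, of t] real by simp
    show ?thesis
    proof (cases "M = 0")
      case True
      have "?in t = integral\<^sup>N lebesgue (\<lambda>r::real. 0)"
      proof (rule nn_integral_cong)
        fix r :: real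
        show "ennreal (\<bar>w t r\<bar> powr ((2 * m + 1) * m) * r powr m) * indicator {0<..} r = 0"
          using M1[of r] True by (cases "0 < r") auto
      qed
      then show ?thesis by (simp add: ennreal_rpow_def)
    next
      case False
      then have M: "0 < M" using real by simp
      have "ennreal_rpow (?in t) (1/m) \<le> ennreal_rpow (ennreal (2 * (M powr (m * m) * A powr (m * m + m)))) (1/m)"
        using m by (intro ennreal_rpow_mono nn_integral_weighted_le A M M1 w2) auto
      also have "\<dots> = ennreal ((2 * (M powr (m * m) * A powr (m * m + m))) powr (1/m))" by simp
      also have "(2 * (M powr (m * m) * A powr (m * m + m))) powr (1/m) = 2 powr (1/m) * A powr (m + 1) * M powr m"
      proof -
        have "(m * m + m) / m = m + 1" using m by (simp add: add_divide_distrib)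
        then show ?thesis using m A M by (simp add: powr_mult powr_powr)
      qed
      also have "ennreal (2 powr (1/m) * A powr (m + 1) * M powr m)
          = ennreal (2 powr (1/m) * A powr (m + 1)) * ennreal_rpow (hl_max f t) m"
        using real by (simp add: ennreal_mult)
      finally show ?thesis .
    qed
  qed
  have "(\<integral>\<^sup>+ t. ennreal_rpow (?in t) (1/m) \<partial>lebesgue)
     \<le> (\<integral>\<^sup>+ t. ennreal (2 powr (1/m) * A powr (m + 1)) * ennreal_rpow (hl_max f t) m \<partial>lebesgue)"
    by (intro nn_integral_mono inner)
  also have "\<dots> = (\<integral>\<^sup>+ t. ennreal (2 powr (1/m) * A powr (m + 1)) * ennreal_rpow (hl_max f t) m \<partial>lborel)"
    by (intro nn_integral_completion)
  also have "\<dots> = ennreal (2 powr (1/m) * A powr (m + 1)) * (\<integral>\<^sup>+ t. ennreal_rpow (hl_max f t) m \<partial>lborel)"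
    by (intro nn_integral_cmult) measurable
  also have "\<dots> \<le> ennreal (2 powr (1/m) * A powr (m + 1)) * ennreal (20 * m / (m - 1) * 4 powr (m - 1) * Lp_pow m f)"
    by (intro mult_left_mono hl_max_strong_type[OF m f]) auto
  also have "\<dots> = ennreal (2 powr (1/m) * (20 * m / (m - 1) * 4 powr (m - 1)) * A powr (m + 1) * Lp_pow m f)"
    using m by (subst ennreal_mult[symmetric]) (auto simp: mult_ac)
  finally have *: "(\<integral>\<^sup>+ t. ennreal_rpow (?in t) (1/m) \<partial>lebesgue) \<le> \<dots>" .
  have "S_norm m w \<le> ennreal_rpow (ennreal (2 powr (1/m) * (20 * m / (m - 1) * 4 powr (m - 1)) * A powr (m + 1) * Lp_pow m f)) (1 / (2 * m + 1))"
    unfolding S_norm_def using m by (intro ennreal_rpow_mono *) auto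
  also have "\<dots> = ennreal ((2 powr (1/m) * (20 * m / (m - 1) * 4 powr (m - 1)) * A powr (m + 1) * Lp_pow m f) powr (1 / (2 * m + 1)))"
    using m by (intro ennreal_rpow_ennreal) auto
  finally show ?thesis by (simp add: w_def[abs_def])
qed

section \<open>Uniform convexity and weak convergence\<close>

text \<open>The mean value theorem on the two halves yields slopes
  \<open>m * z1 powr (m - 1)\<close> and \<open>m * z2 powr (m - 1)\<close> with
  \<open>z1 < z2\<close>.\<close>

lemma powr_midpoint_strict:
  fixes x y m :: real
  assumes m: "1 < m" and xy: "0 \<le> x" "x < y"
  shows "((x + y) / 2) powr m < (x powr m + y powr m) / 2"
proof -
  define c where "c = (x + y) / 2"
  have c: "x < c" "c < y" using xy by (auto simp: c_def)
  have MV: "\<exists>z. u < z \<and> z < v \<and> v powr m - u powr m = (v - u) * (m * z powr (m - 1))" if "0 \<le> u" "u < v" for u v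
  proof -
    have "\<exists>l z. u < z \<and> z < v \<and> ((\<lambda>x. x powr m) has_real_derivative l) (at z) \<and> v powr m - u powr m = (v - u) * l"
    proof (rule MVT[OF that(2)])
      show "continuous_on {u..v} (\<lambda>x. x powr m)" using that m by (intro continuous_on_powr' continuous_intros) auto
      fix z assume "u < z" "z < v"
      then show "(\<lambda>x. x powr m) differentiable (at z)"
        using that has_real_derivative_powr[of z m] real_differentiable_def by (metis dual_order.strict_trans2)
    qed
    then obtain l z where z: "u < z" "z < v" "((\<lambda>x. x powr m) has_real_derivative l) (at z)" "v powr m - u powr m = (v - u) * l"
      by blast
    have "l = m * z powr (m - 1)"
      using DERIV_unique[OF z(3) has_real_derivative_powr[of z m]] z that by auto
    then show ?thesis using z by blast
  qed
  obtain z1 where z1: "x < z1" "z1 < c" "c powr m - x powr m = (c - x) * (m * z1 powr (m - 1))" using MV[of x c] xy c by auto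
  obtain z2 where z2: "c < z2" "z2 < y" "y powr m - c powr m = (y - c) * (m * z2 powr (m - 1))" using MV[of c y] xy c by auto
  have "z1 powr (m - 1) < z2 powr (m - 1)" using z1 z2 xy m by (intro powr_less_mono2) auto
  moreover have eq: "c - x = y - c" by (simp add: c_def field_simps)
  ultimately have "c powr m - x powr m < y powr m - c powr m"
    unfolding z1(3) z2(3) eq using m c by (intro mult_strict_left_mono) auto
  then show ?thesis unfolding c_def[symmetric] by simp
qed

text \<open>Strictness has two sources: strict convexity when the absolute values differ,
  cancellation when \<open>a = - b\<close>.\<close>

lemma powr_abs_midpoint_strict:
  fixes a b m :: real
  assumes m: "1 < m" and ab: "a \<noteq> b"
  shows "\<bar>(a + b) / 2\<bar> powr m < (\<bar>a\<bar> powr m + \<bar>b\<bar> powr m) / 2"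
proof -
  have le: "\<bar>(a + b) / 2\<bar> powr m \<le> ((\<bar>a\<bar> + \<bar>b\<bar>) / 2) powr m" using m by (intro powr_mono2) auto
  consider "\<bar>a\<bar> < \<bar>b\<bar>" | "\<bar>b\<bar> < \<bar>a\<bar>" | "a = - b" "b \<noteq> 0" using ab by linarith
  then show ?thesis
  proof cases
    case 1
    then show ?thesis using le powr_midpoint_strict[OF m, of "\<bar>a\<bar>" "\<bar>b\<bar>"] by simp
  next
    case 2
    then show ?thesis using le powr_midpoint_strict[OF m, of "\<bar>b\<bar>" "\<bar>a\<bar>"] by (simp add: add.commute)
  next
    case 3
    then show ?thesis by simp
  qed
qed

lemma powr_abs_midpoint:
  fixes a b m :: real
  assumes m: "1 < m"
  shows "\<bar>(a + b) / 2\<bar> powr m \<le> (\<bar>a\<bar> powr m + \<bar>b\<bar> powr m) / 2"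
  using powr_abs_midpoint_strict[OF m, of a b] by (cases "a = b") auto

text \<open>Scalar form of the uniform convexity of \<open>L\<^sup>m\<close>, obtained from strict convexity by compactness and homogeneity.\<close>

lemma uniform_convexity_powr:
  fixes m e :: real
  assumes m: "1 < m" and e: "0 < e"
  shows "\<exists>C>0. \<forall>a b. \<bar>a - b\<bar> powr m \<le> e * (\<bar>a\<bar> powr m + \<bar>b\<bar> powr m)
     + C * ((\<bar>a\<bar> powr m + \<bar>b\<bar> powr m) / 2 - \<bar>(a + b) / 2\<bar> powr m)"
proof -
  define D where "D = (\<lambda>p::real \<times> real. (\<bar>fst p\<bar> powr m + \<bar>snd p\<bar> powr m) / 2 - \<bar>(fst p + snd p) / 2\<bar> powr m)"
  \<comment> \<open>Pairs on the unit sphere whose difference has \<open>m\<close>-th power at least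
    \<open>e\<close>. \<open>K\<close> is compact and the convexity defect \<open>D\<close> is
    positive on it, so \<open>D\<close> has a lower bound \<open>d\<close>; then
    \<open>C = 2 powr m / d\<close> absorbs the trivial bound \<open>2 powr m\<close> of the
    left-hand side.\<close>
  define K where "K = {p::real \<times> real. \<bar>fst p\<bar> powr m + \<bar>snd p\<bar> powr m = 1 \<and> e \<le> \<bar>fst p - snd p\<bar> powr m}"
  have cD: "continuous_on UNIV D" unfolding D_def using m by (intro continuous_on_powr' continuous_intros) auto
  have c1: "continuous_on UNIV (\<lambda>p::real\<times>real. \<bar>fst p\<bar> powr m + \<bar>snd p\<bar> powr m)"
    and c2: "continuous_on UNIV (\<lambda>p::real\<times>real. \<bar>fst p - snd p\<bar> powr m)"
    using m by (intro continuous_on_powr' continuous_intros; simp)+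
  have le1: "x \<le> 1" if "\<bar>x\<bar> powr m + y = 1" "0 \<le> y" for x y :: real
  proof (rule ccontr)
    assume "\<not> x \<le> 1"
    then have "1 powr m < \<bar>x\<bar> powr m" using m by (intro powr_less_mono2) auto
    then show False using that by simp
  qed
  have le1': "\<bar>x\<bar> \<le> 1" if "\<bar>x\<bar> powr m + y = 1" "0 \<le> y" for x y :: real
    using le1[of x y] le1[of "-x" y] that by auto
  have "K \<subseteq> cbox (-1, -1) (1, 1)"
  proof
    fix p assume p: "p \<in> K"
    have "\<bar>fst p\<bar> \<le> 1" "\<bar>snd p\<bar> \<le> 1"
      using p le1'[of "fst p" "\<bar>snd p\<bar> powr m"] le1'[of "snd p" "\<bar>fst p\<bar> powr m"] by (auto simp: K_def add.commute)
    then show "p \<in> cbox (-1, -1) (1, 1)" by (cases p) auto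
  qed
  then have bK: "bounded K" using bounded_cbox bounded_subset by blast
  have "closed {p::real\<times>real. \<bar>fst p\<bar> powr m + \<bar>snd p\<bar> powr m = 1}"
    by (rule closed_Collect_eq[OF c1 continuous_on_const])
  moreover have "closed {p::real\<times>real. e \<le> \<bar>fst p - snd p\<bar> powr m}"
    by (rule closed_Collect_le[OF continuous_on_const c2])
  ultimately have "closed K" unfolding K_def Collect_conj_eq by (rule closed_Int)
  then have K: "compact K" using bK by (simp add: compact_eq_bounded_closed)
  have Dpos: "0 < D p" if "p \<in> K" for p
  proof -
    have "fst p \<noteq> snd p" using that e m by (auto simp: K_def)
    then show ?thesis using powr_abs_midpoint_strict[OF m] by (simp add: D_def)
  qed
  obtain d where d: "0 < d" "\<And>p. p \<in> K \<Longrightarrow> d \<le> D p"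
  proof (cases "K = {}")
    case False
    obtain p where p: "p \<in> K" "\<And>q. q \<in> K \<Longrightarrow> D p \<le> D q"
      using continuous_attains_inf[OF K False continuous_on_subset[OF cD subset_UNIV]] by blast
    then show ?thesis using that[of "D p"] Dpos by auto
  qed (use that[of 1] in auto)
  define C where "C = 2 powr m / d"
  have C: "0 < C" using d by (simp add: C_def)
  have unit: "\<bar>a - b\<bar> powr m \<le> e + C * D (a, b)" if ab: "\<bar>a\<bar> powr m + \<bar>b\<bar> powr m = 1" for a b
  proof (cases "(a, b) \<in> K")
    case True
    have "\<bar>a - b\<bar> powr m \<le> 2 powr m" using powr_abs_add_le[of m a "-b"] m ab by simp
    also have "\<dots> \<le> C * D (a, b)" using d(2)[OF True] d(1) by (simp add: C_def field_simps)
    finally show ?thesis using e by simp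
  next
    case False
    then have "\<bar>a - b\<bar> powr m < e" using ab by (auto simp: K_def)
    moreover have "0 \<le> D (a, b)" using powr_abs_midpoint[OF m] by (simp add: D_def)
    ultimately show ?thesis using C by (smt (verit) mult_nonneg_nonneg)
  qed
  have "\<bar>a - b\<bar> powr m \<le> e * (\<bar>a\<bar> powr m + \<bar>b\<bar> powr m) + C * D (a, b)" for a b
  proof (cases "\<bar>a\<bar> powr m + \<bar>b\<bar> powr m = 0")
    case True
    then have "a = 0" "b = 0" by (auto simp: add_nonneg_eq_0_iff)
    then show ?thesis by (simp add: D_def)
  next
    case False
    define S where "S = \<bar>a\<bar> powr m + \<bar>b\<bar> powr m"
    have S: "0 < S" using False by (simp add: S_def order_less_le)
    define s where "s = S powr (1/m)"
    have s: "0 < s" "s powr m = S" using S m by (auto simp: s_def powr_powr)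
    have h: "\<bar>x / s\<bar> powr m = \<bar>x\<bar> powr m / S" for x using s by (simp add: abs_divide powr_divide)
    have "\<bar>a / s - b / s\<bar> powr m \<le> e + C * D (a / s, b / s)"
      by (rule unit) (unfold h add_divide_distrib[symmetric] S_def[symmetric], use S in simp)
    moreover have "\<bar>a / s - b / s\<bar> powr m = \<bar>a - b\<bar> powr m / S" using h[of "a - b"] by (simp add: diff_divide_distrib)
    moreover have "D (a / s, b / s) = D (a, b) / S"
      using h[of a] h[of b] h[of "(a + b) / 2"] by (simp add: D_def diff_divide_distrib add_divide_distrib divide_divide_eq_left mult.commute)
    ultimately have "\<bar>a - b\<bar> powr m / S \<le> (e * S + C * D (a, b)) / S" using S by (simp add: add_divide_distrib)
    then show ?thesis using S by (simp add: S_def divide_le_cancel)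
  qed
  then show ?thesis using C by (auto simp: D_def)
qed

text \<open>Young's inequality gives \<open>\<bar>z i\<bar> * s powr (m - 1) \<le> \<bar>z i\<bar>
  powr m / m + s powr m * (1 - 1/m)\<close> with \<open>s\<close> the weighted mean of the absolute
  values. Averaged over \<open>i\<close>, the left-hand side becomes \<open>s powr m\<close>, and
  the last term is absorbed.\<close>

lemma powr_Jensen:
  fixes c z :: "'i \<Rightarrow> real"
  assumes m: "1 < m" and c: "\<And>i. i \<in> I \<Longrightarrow> 0 \<le> c i" "(\<Sum>i\<in>I. c i) = 1" and I: "finite I"
  shows "\<bar>\<Sum>i\<in>I. c i * z i\<bar> powr m \<le> (\<Sum>i\<in>I. c i * \<bar>z i\<bar> powr m)"
proof -
  define s where "s = (\<Sum>i\<in>I. c i * \<bar>z i\<bar>)"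
  have s: "0 \<le> s" unfolding s_def using c by (intro sum_nonneg) auto
  have Y: "\<bar>z i\<bar> * s powr (m - 1) \<le> \<bar>z i\<bar> powr m / m + s powr m * (1 - 1/m)" for i
  proof -
    have "\<bar>z i\<bar> * s powr (m - 1) \<le> \<bar>z i\<bar> powr m / m + (s powr (m - 1)) powr (m / (m - 1)) / (m / (m - 1))"
      using m by (intro Youngs_inequality) (auto simp: field_simps)
    also have "(s powr (m - 1)) powr (m / (m - 1)) / (m / (m - 1)) = s powr m * (1 - 1/m)"
    proof -
      have "(m - 1) * (m / (m - 1)) = m" using m by simp
      then have "(s powr (m - 1)) powr (m / (m - 1)) = s powr m" by (simp only: powr_powr)
      then show ?thesis using m by (simp add: field_simps)
    qed
    finally show ?thesis .
  qed
  have "s powr m = s * s powr (m - 1)" using s by (cases "s = 0") (auto simp: powr_diff)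
  also have "\<dots> = (\<Sum>i\<in>I. c i * (\<bar>z i\<bar> * s powr (m - 1)))"
    by (subst s_def) (simp add: sum_distrib_right mult.assoc)
  also have "\<dots> \<le> (\<Sum>i\<in>I. c i * (\<bar>z i\<bar> powr m / m + s powr m * (1 - 1/m)))"
    using c Y by (intro sum_mono mult_left_mono) auto
  also have "\<dots> = (\<Sum>i\<in>I. c i * \<bar>z i\<bar> powr m) / m + (\<Sum>i\<in>I. c i) * (s powr m * (1 - 1/m))"
    unfolding sum_distrib_right sum_divide_distrib sum.distrib[symmetric] by (simp add: algebra_simps)
  finally have "s powr m / m \<le> (\<Sum>i\<in>I. c i * \<bar>z i\<bar> powr m) / m" by (simp add: c algebra_simps)
  then have 1: "s powr m \<le> (\<Sum>i\<in>I. c i * \<bar>z i\<bar> powr m)" using m by (simp add: divide_le_cancel)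
  have "\<bar>\<Sum>i\<in>I. c i * z i\<bar> \<le> s"
    unfolding s_def using c by (intro order_trans[OF sum_abs] sum_mono) (auto simp: abs_mult)
  then have "\<bar>\<Sum>i\<in>I. c i * z i\<bar> powr m \<le> s powr m" using m by (intro powr_mono2) auto
  then show ?thesis using 1 by simp
qed

text \<open>Convexity at the points \<open>x / (1 - t)\<close> and \<open>y / t\<close> with weights
  \<open>1 - t\<close> and \<open>t\<close>. Unlike in \<open>powr_abs_add_le\<close>, the factor of
  \<open>\<bar>x\<bar> powr m\<close> tends to 1 as \<open>t\<close> tends to 0, so bounds pass to
  strong limits without loss.\<close>

lemma powr_abs_add_le_weighted:
  fixes x y t m :: real
  assumes m: "1 < m" and t: "0 < t" "t < 1"
  shows "\<bar>x + y\<bar> powr m \<le> (1 - t) powr (1 - m) * \<bar>x\<bar> powr m + t powr (1 - m) * \<bar>y\<bar> powr m"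
proof -
  have "\<bar>\<Sum>i\<in>UNIV. (if i then t else 1 - t) * (if i then y / t else x / (1 - t))\<bar> powr m
    \<le> (\<Sum>i\<in>UNIV. (if i then t else 1 - t) * \<bar>if i then y / t else x / (1 - t)\<bar> powr m)"
    using t by (intro powr_Jensen m) (auto simp: UNIV_bool)
  then have "\<bar>x + y\<bar> powr m \<le> (1 - t) * \<bar>x / (1 - t)\<bar> powr m + t * \<bar>y / t\<bar> powr m"
    using t by (simp add: UNIV_bool add.commute)
  also have "\<dots> = (1 - t) powr (1 - m) * \<bar>x\<bar> powr m + t powr (1 - m) * \<bar>y\<bar> powr m"
    using t by (simp add: powr_divide powr_diff)
  finally show ?thesis .
qed

lemma Lp_pow_le_weighted:
  assumes m: "1 < m" and t: "0 < t" "t < 1" and f: "f \<in> Lp m" and g: "g \<in> Lp m"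
  shows "Lp_pow m g \<le> (1 - t) powr (1 - m) * Lp_pow m f + t powr (1 - m) * Lp_pow m (\<lambda>x. f x - g x)"
proof -
  have d: "(\<lambda>x. f x - g x) \<in> Lp m" using m f g by (intro Lp_diff) auto
  have "Lp_pow m g \<le> (\<integral>x. (1 - t) powr (1 - m) * \<bar>f x\<bar> powr m + t powr (1 - m) * \<bar>f x - g x\<bar> powr m \<partial>lborel)"
    unfolding Lp_pow_def
  proof (rule integral_mono)
    fix x show "\<bar>g x\<bar> powr m \<le> (1 - t) powr (1 - m) * \<bar>f x\<bar> powr m + t powr (1 - m) * \<bar>f x - g x\<bar> powr m"
      using powr_abs_add_le_weighted[OF m t, of "f x" "g x - f x"] by (simp add: abs_minus_commute)
  qed (use Lp_integrable[OF f] Lp_integrable[OF g] Lp_integrable[OF d] in auto)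
  also have "\<dots> = (1 - t) powr (1 - m) * Lp_pow m f + t powr (1 - m) * Lp_pow m (\<lambda>x. f x - g x)"
    unfolding Lp_pow_def using Lp_integrable[OF f] Lp_integrable[OF d] by simp
  finally show ?thesis .
qed

text \<open>At fixed \<open>t\<close> the limit in \<open>k\<close> removes the error term of
  \<open>Lp_pow_le_weighted\<close>; then \<open>t\<close> tends to 0 and the factor of
  \<open>B\<close> to 1.\<close>

lemma Lp_pow_limit_le:
  assumes m: "1 < m" and a: "\<And>k. a k \<in> Lp m" and g: "g \<in> Lp m"
    and lim: "(\<lambda>k. Lp_pow m (\<lambda>x. a k x - g x)) \<longlonglongrightarrow> 0" and B: "\<And>k. Lp_pow m (a k) \<le> B"
  shows "Lp_pow m g \<le> B"
proof -
  have B0: "0 \<le> B" using order_trans[OF Lp_pow_nonneg B] .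
  have 1: "Lp_pow m g \<le> (1 - t) powr (1 - m) * B" if t: "0 < t" "t < 1" for t
  proof (rule LIMSEQ_le_const)
    show "(\<lambda>k. (1 - t) powr (1 - m) * B + t powr (1 - m) * Lp_pow m (\<lambda>x. a k x - g x)) \<longlonglongrightarrow> (1 - t) powr (1 - m) * B"
      using tendsto_add[OF tendsto_const tendsto_mult_left[OF lim]] by simp
    have "Lp_pow m g \<le> (1 - t) powr (1 - m) * B + t powr (1 - m) * Lp_pow m (\<lambda>x. a k x - g x)" for k
      using Lp_pow_le_weighted[OF m t a g, of k] mult_left_mono[OF B, of "(1 - t) powr (1 - m)" k] by simp
    then show "\<exists>N. \<forall>n\<ge>N. Lp_pow m g \<le> (1 - t) powr (1 - m) * B + t powr (1 - m) * Lp_pow m (\<lambda>x. a n x - g x)"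
      by blast
  qed
  show ?thesis
  proof (rule tendsto_lowerbound)
    have "((\<lambda>t. (1 - t) powr (1 - m) * B) \<longlongrightarrow> (1 - 0) powr (1 - m) * B) (at_right 0)"
      by (intro tendsto_intros) auto
    then show "((\<lambda>t. (1 - t) powr (1 - m) * B) \<longlongrightarrow> B) (at_right 0)" by simp
    show "\<forall>\<^sub>F t in at_right 0. Lp_pow m g \<le> (1 - t) powr (1 - m) * B"
      by (rule eventually_at_rightI[of 0 1]) (use 1 in auto)
  qed simp
qed

text \<open>Riesz-Fischer: a subsequence with rapidly decreasing increments converges almost
  everywhere, and Fatou's lemma along it bounds the distance of the whole sequence to the
  limit.\<close>

lemma Lp_complete:
  assumes m: "1 < m" and a: "\<And>k. a k \<in> Lp m"
    and Cauchy: "\<And>e. 0 < e \<Longrightarrow> \<exists>K. \<forall>k\<ge>K. \<forall>l\<ge>K. Lp_pow m (\<lambda>x. a k x - a l x) \<le> e"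
  shows "\<exists>g\<in>Lp m. (\<lambda>k. Lp_pow m (\<lambda>x. a k x - g x)) \<longlonglongrightarrow> 0"
proof -
  note [measurable] = Lp_measurable[OF a]
  have half: "(1/2::real) ^ i = 2 powr (- real i)" for i
    by (simp add: powr_minus_divide powr_realpow power_one_over)
  have d: "(\<lambda>x. a k x - a l x) \<in> Lp m" for k l using m a by (intro Lp_diff) auto
  have "\<forall>i. \<exists>K. \<forall>k\<ge>K. \<forall>l\<ge>K. Lp_pow m (\<lambda>x. a k x - a l x) \<le> 2 powr (- (real i * m))"
    using Cauchy by simp
  then obtain K where K: "\<And>i k l. K i \<le> k \<Longrightarrow> K i \<le> l \<Longrightarrow> Lp_pow m (\<lambda>x. a k x - a l x) \<le> 2 powr (- (real i * m))"
    by metis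
  \<comment> \<open>Summing the thresholds makes \<open>s\<close> monotone and at least
    \<open>K i\<close>; the added \<open>i\<close> makes it unbounded.\<close>
  define s where "s i = (\<Sum>j\<le>i. K j) + i" for i
  have sK: "K i \<le> s i" for i unfolding s_def by (intro trans_le_add1 member_le_sum) auto
  have sS: "s i \<le> s (Suc i)" for i by (simp add: s_def)
  have si: "i \<le> s i" for i by (simp add: s_def)
  define b where "b i x = a (s (Suc i)) x - a (s i) x" for i x
  have [measurable]: "b i \<in> borel_measurable borel" for i unfolding b_def by measurable
  have bL: "b i \<in> Lp m" for i using d by (simp add: b_def[abs_def])
  have pb: "Lp_pow m (b i) \<le> 2 powr (- (real i * m))" for i
    unfolding b_def using sK[of i] sS[of i] by (intro K) auto
  \<comment> \<open>The weight comes from \<open>le_add_powr\<close> with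
    \<open>c = (1/2) ^ i\<close>: it gives \<open>\<bar>b i x\<bar> \<le> (1/2) ^ i + w i x\<close>,
    while the integral of \<open>w i\<close> is at most \<open>(1/2) ^ i\<close>.\<close>
  define w where "w i x = 2 powr (real i * (m - 1)) * \<bar>b i x\<bar> powr m" for i x
  have "(\<integral>\<^sup>+x. (\<Sum>i. ennreal (w i x)) \<partial>lborel) = (\<Sum>i. \<integral>\<^sup>+x. ennreal (w i x) \<partial>lborel)"
    unfolding w_def by (intro nn_integral_suminf) measurable
  also have "\<dots> \<le> (\<Sum>i. ennreal ((1/2) ^ i))"
  proof (rule suminf_le)
    fix i
    have "(\<integral>\<^sup>+x. ennreal (w i x) \<partial>lborel) = ennreal (2 powr (real i * (m - 1)) * Lp_pow m (b i))"
      unfolding w_def Lp_pow_def using Lp_integrable[OF bL] by (subst nn_integral_eq_integral) auto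
    also have "\<dots> \<le> ennreal (2 powr (real i * (m - 1)) * 2 powr (- (real i * m)))"
      by (intro ennreal_leI mult_left_mono pb) auto
    also have "2 powr (real i * (m - 1)) * 2 powr (- (real i * m)) = (1/2) ^ i"
    proof -
      have "real i * (m - 1) + - (real i * m) = - real i" by (simp add: algebra_simps)
      then have "2 powr (real i * (m - 1)) * 2 powr (- (real i * m)) = 2 powr (- real i)"
        by (simp only: powr_add[symmetric])
      then show ?thesis by (simp only: half)
    qed
    finally show "(\<integral>\<^sup>+x. ennreal (w i x) \<partial>lborel) \<le> ennreal ((1/2) ^ i)" .
  qed auto
  also have "\<dots> < \<infinity>"
    by (subst suminf_ennreal2) (auto intro: summable_geometric)
  finally have "AE x in lborel. (\<Sum>i. ennreal (w i x)) \<noteq> \<infinity>"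
    by (intro nn_integral_PInf_AE) (auto simp: w_def)
  then have AEc: "AE x in lborel. convergent (\<lambda>i. a (s i) x)"
  proof eventually_elim
    case (elim x)
    have sw: "summable (\<lambda>i. w i x)"
      using elim by (intro summable_suminf_not_top) (auto simp: w_def)
    have sg: "summable (\<lambda>i. (1/2::real) ^ i + w i x)" by (intro summable_add sw summable_geometric) simp
    have "summable (\<lambda>i. b i x)"
    proof (rule summable_comparison_test'[OF sg])
      fix i
      have "\<bar>b i x\<bar> \<le> (1/2) ^ i + ((1/2) ^ i) powr (1 - m) * \<bar>b i x\<bar> powr m"
        using m by (intro le_add_powr) auto
      also have "((1/2::real) ^ i) powr (1 - m) = 2 powr (real i * (m - 1))"
      proof -
        have "- real i * (1 - m) = real i * (m - 1)" by (simp add: algebra_simps)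
        then show ?thesis by (simp only: half powr_powr)
      qed
      finally show "norm (b i x) \<le> (1/2) ^ i + w i x" by (simp add: w_def)
    qed
    then have "(\<lambda>n. \<Sum>i<n. b i x) \<longlonglongrightarrow> (\<Sum>i. b i x)" by (rule summable_LIMSEQ)
    moreover have "(\<lambda>n. \<Sum>i<n. b i x) = (\<lambda>n. a (s n) x - a (s 0) x)"
      unfolding b_def by (rule ext) (rule sum_lessThan_telescope)
    ultimately have "(\<lambda>n. a (s n) x - a (s 0) x) \<longlonglongrightarrow> (\<Sum>i. b i x)" by (simp only:)
    from tendsto_add[OF this tendsto_const[of "a (s 0) x"]]
    have "(\<lambda>n. a (s n) x) \<longlonglongrightarrow> (\<Sum>i. b i x) + a (s 0) x" by simp
    then show ?case unfolding convergent_def by blast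
  qed
  define g where "g x = lim (\<lambda>i. a (s i) x)" for x
  have [measurable]: "g \<in> borel_measurable borel" unfolding g_def by measurable
  have bound: "(\<integral>\<^sup>+x. ennreal (\<bar>a k x - g x\<bar> powr m) \<partial>lborel) \<le> ennreal e"
    if KK: "\<forall>k\<ge>K. \<forall>l\<ge>K. Lp_pow m (\<lambda>x. a k x - a l x) \<le> e" and k: "K \<le> k" for e K k
  proof -
    have "(\<integral>\<^sup>+x. ennreal (\<bar>a k x - g x\<bar> powr m) \<partial>lborel)
        = (\<integral>\<^sup>+x. liminf (\<lambda>i. ennreal (\<bar>a k x - a (s i) x\<bar> powr m)) \<partial>lborel)"
    proof (rule nn_integral_cong_AE)
      show "AE x in lborel. ennreal (\<bar>a k x - g x\<bar> powr m) = liminf (\<lambda>i. ennreal (\<bar>a k x - a (s i) x\<bar> powr m))"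
        using AEc
      proof eventually_elim
        case (elim x)
        then have l: "(\<lambda>i. a (s i) x) \<longlonglongrightarrow> g x" unfolding g_def by (rule convergent_LIMSEQ_iff[THEN iffD1])
        have "(\<lambda>i. ennreal (\<bar>a k x - a (s i) x\<bar> powr m)) \<longlonglongrightarrow> ennreal (\<bar>a k x - g x\<bar> powr m)"
          using m l by (intro tendsto_ennrealI tendsto_powr' tendsto_intros) auto
        then show ?case by (intro lim_imp_Liminf[symmetric]) auto
      qed
    qed
    also have "\<dots> \<le> liminf (\<lambda>i. \<integral>\<^sup>+x. ennreal (\<bar>a k x - a (s i) x\<bar> powr m) \<partial>lborel)"
      by (rule nn_integral_liminf) measurable
    also have "\<dots> \<le> ennreal e"
    proof -
      have "(\<integral>\<^sup>+x. ennreal (\<bar>a k x - a (s i) x\<bar> powr m) \<partial>lborel) \<le> ennreal e" if "K \<le> i" for i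
      proof -
        have "(\<integral>\<^sup>+x. ennreal (\<bar>a k x - a (s i) x\<bar> powr m) \<partial>lborel) = ennreal (Lp_pow m (\<lambda>x. a k x - a (s i) x))"
          unfolding Lp_pow_def using Lp_integrable[OF d] by (subst nn_integral_eq_integral) auto
        also have "\<dots> \<le> ennreal e" using KK k that si[of i] by (intro ennreal_leI) auto
        finally show ?thesis .
      qed
      then show ?thesis
        by (intro Liminf_le) (auto simp: eventually_sequentially)
    qed
    finally show ?thesis .
  qed
  have dL: "(\<lambda>x. a k x - g x) \<in> Lp m \<and> Lp_pow m (\<lambda>x. a k x - g x) \<le> e"
    if KK: "\<forall>k\<ge>K. \<forall>l\<ge>K. Lp_pow m (\<lambda>x. a k x - a l x) \<le> e" and k: "K \<le> k" and e: "0 < e" for e K k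
  proof -
    have "integrable lborel (\<lambda>x. \<bar>a k x - g x\<bar> powr m)"
      using bound[OF KK k] by (intro integrableI_bounded) (auto intro: le_less_trans)
    then have L: "(\<lambda>x. a k x - g x) \<in> Lp m" unfolding Lp_def by simp
    have "ennreal (Lp_pow m (\<lambda>x. a k x - g x)) \<le> ennreal e"
      using bound[OF KK k] Lp_integrable[OF L] unfolding Lp_pow_def by (subst nn_integral_eq_integral[symmetric]) auto
    then show ?thesis using L e by (simp add: ennreal_le_iff)
  qed
  obtain K1 where K1: "\<forall>k\<ge>K1. \<forall>l\<ge>K1. Lp_pow m (\<lambda>x. a k x - a l x) \<le> 1" using Cauchy[of 1] by auto
  have "(\<lambda>x. a K1 x - (a K1 x - g x)) \<in> Lp m"
    using Lp_diff[OF _ a[of K1], of "\<lambda>x. a K1 x - g x"] dL[OF K1, of K1] m by simp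
  then have gL: "g \<in> Lp m" by simp
  have "(\<lambda>k. Lp_pow m (\<lambda>x. a k x - g x)) \<longlonglongrightarrow> 0"
  proof (rule LIMSEQ_I)
    fix e :: real assume e: "0 < e"
    then obtain K where K: "\<forall>k\<ge>K. \<forall>l\<ge>K. Lp_pow m (\<lambda>x. a k x - a l x) \<le> e/2" using Cauchy[of "e/2"] by auto
    have "norm (Lp_pow m (\<lambda>x. a k x - g x) - 0) < e" if "K \<le> k" for k
      using dL[OF K that] e by simp
    then show "\<exists>no. \<forall>n\<ge>no. norm (Lp_pow m (\<lambda>x. a n x - g x) - 0) < e" by blast
  qed
  then show ?thesis using gL by blast
qed

section \<open>Mazur's lemma\<close>

definition convex_weights :: "nat \<Rightarrow> nat \<Rightarrow> (nat \<Rightarrow> real) \<Rightarrow> bool" where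
  "convex_weights k N c \<longleftrightarrow> (\<forall>n. 0 \<le> c n) \<and> (\<forall>n. n < k \<or> N \<le> n \<longrightarrow> c n = 0) \<and> (\<Sum>n<N. c n) = 1"

lemma convex_weights_sum_extend:
  fixes y :: "nat \<Rightarrow> real"
  assumes "convex_weights k N c" "N \<le> N'"
  shows "(\<Sum>n<N'. c n * y n) = (\<Sum>n<N. c n * y n)"
  using assms by (intro sum.mono_neutral_right) (auto simp: convex_weights_def)

lemma convex_weights_mono: "convex_weights k N c \<Longrightarrow> k' \<le> k \<Longrightarrow> convex_weights k' N c"
  by (auto simp: convex_weights_def)

lemma convex_weights_single: "convex_weights k (Suc k) (\<lambda>n. if n = k then 1 else 0)"
  by (auto simp: convex_weights_def)

lemma convex_weights_midpoint:
  assumes c: "convex_weights k N c" and d: "convex_weights k M d"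
  shows "convex_weights k (max N M) (\<lambda>n. (c n + d n) / 2)"
    and "(\<Sum>n<max N M. (c n + d n) / 2 * y n) = ((\<Sum>n<N. c n * y n) + (\<Sum>n<M. d n * y n)) / 2"
proof -
  show eq: "(\<Sum>n<max N M. (c n + d n) / 2 * y n) = ((\<Sum>n<N. c n * y n) + (\<Sum>n<M. d n * y n)) / 2" for y
    unfolding convex_weights_sum_extend[OF c, of "max N M", symmetric, simplified]
      convex_weights_sum_extend[OF d, of "max N M", symmetric, simplified]
    by (simp add: sum.distrib[symmetric] sum_divide_distrib algebra_simps)
  show "convex_weights k (max N M) (\<lambda>n. (c n + d n) / 2)"
    using c d eq[of "\<lambda>n. 1"] by (auto simp: convex_weights_def)
qed

text \<open>The \<open>k\<close>-th weights charge only indices from \<open>k\<close> on, so the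
  averages see later and later parts of \<open>y\<close>.\<close>

lemma convex_weights_tendsto:
  fixes y :: "nat \<Rightarrow> real"
  assumes c: "\<And>k. convex_weights k (N k) (c k)" and y: "y \<longlonglongrightarrow> L"
  shows "(\<lambda>k. \<Sum>n<N k. c k n * y n) \<longlonglongrightarrow> L"
proof (rule LIMSEQ_I)
  fix e :: real assume "0 < e"
  then obtain K where K: "\<And>n. K \<le> n \<Longrightarrow> \<bar>y n - L\<bar> < e/2"
    using LIMSEQ_D[OF y, of "e/2"] by auto
  have "norm ((\<Sum>n<N k. c k n * y n) - L) < e" if "K \<le> k" for k
  proof -
    have s: "(\<Sum>n<N k. c k n) = 1" and z: "\<And>n. n < k \<Longrightarrow> c k n = 0" and p: "\<And>n. 0 \<le> c k n"
      using c[of k] by (auto simp: convex_weights_def)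
    have "(\<Sum>n<N k. c k n * y n) - L = (\<Sum>n<N k. c k n * (y n - L))"
      using s by (simp add: right_diff_distrib sum_subtractf flip: sum_distrib_right)
    also have "\<bar>\<dots>\<bar> \<le> (\<Sum>n<N k. c k n * (e/2))"
    proof (rule order_trans[OF sum_abs], rule sum_mono)
      fix n
      show "\<bar>c k n * (y n - L)\<bar> \<le> c k n * (e/2)"
      proof (cases "n < k")
        case False
        then have "\<bar>y n - L\<bar> \<le> e/2" using K[of n] that by simp
        then show ?thesis using mult_left_mono[of "\<bar>y n - L\<bar>" "e/2" "c k n"] p[of n] by (simp add: abs_mult)
      qed (simp add: z)
    qed
    also have "\<dots> = e/2" by (simp only: sum_distrib_right[symmetric] s mult_1)
    finally show ?thesis using \<open>0 < e\<close> by simp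
  qed
  then show "\<exists>no. \<forall>k\<ge>no. norm ((\<Sum>n<N k. c k n * y n) - L) < e" by blast
qed

lemma
  assumes m: "1 < m" and f: "\<And>n. f n \<in> Lp m" and c: "convex_weights k N c"
  shows Lp_convex: "(\<lambda>x. \<Sum>n<N. c n * f n x) \<in> Lp m"
    and Lp_pow_convex_le: "(\<And>n. k \<le> n \<Longrightarrow> Lp_pow m (f n) \<le> B) \<Longrightarrow> Lp_pow m (\<lambda>x. \<Sum>n<N. c n * f n x) \<le> B"
proof -
  show L: "(\<lambda>x. \<Sum>n<N. c n * f n x) \<in> Lp m" using m f by (intro Lp_sum Lp_cmult) auto
  assume B: "\<And>n. k \<le> n \<Longrightarrow> Lp_pow m (f n) \<le> B"
  have s: "(\<Sum>n<N. c n) = 1" and z: "\<And>n. n < k \<Longrightarrow> c n = 0" and p: "\<And>n. 0 \<le> c n"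
    using c by (auto simp: convex_weights_def)
  have "Lp_pow m (\<lambda>x. \<Sum>n<N. c n * f n x) \<le> (\<integral>x. (\<Sum>n<N. c n * \<bar>f n x\<bar> powr m) \<partial>lborel)"
    unfolding Lp_pow_def
  proof (rule integral_mono[OF Lp_integrable[OF L]])
    show "integrable lborel (\<lambda>x. \<Sum>n<N. c n * \<bar>f n x\<bar> powr m)"
      using Lp_integrable[OF f] by simp
    show "\<bar>\<Sum>n<N. c n * f n x\<bar> powr m \<le> (\<Sum>n<N. c n * \<bar>f n x\<bar> powr m)" for x
      using p s by (intro powr_Jensen m) auto
  qed
  also have "\<dots> = (\<Sum>n<N. c n * Lp_pow m (f n))"
    unfolding Lp_pow_def using Lp_integrable[OF f] by simp
  also have "\<dots> \<le> (\<Sum>n<N. c n * B)"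
  proof (rule sum_mono)
    fix n show "c n * Lp_pow m (f n) \<le> c n * B"
      using z[of n] B[of n] p[of n] by (cases "n < k") (auto intro: mult_left_mono)
  qed
  also have "\<dots> = B" using s by (simp flip: sum_distrib_right)
  finally show "Lp_pow m (\<lambda>x. \<Sum>n<N. c n * f n x) \<le> B" .
qed

text \<open>Mazur's lemma in \<open>L\<^sup>m\<close>: convex combinations of the tails with almost minimal norm form a
  Cauchy sequence by uniform convexity.\<close>

theorem convex_combinations_converge:
  assumes m: "1 < m" and f: "\<And>n. f n \<in> Lp m" and B: "\<And>n. Lp_pow m (f n) \<le> B"
  obtains N c g where "\<And>k. convex_weights k (N k) (c k)" "g \<in> Lp m"
    "(\<lambda>k. Lp_pow m (\<lambda>x. (\<Sum>n<N k. c k n * f n x) - g x)) \<longlonglongrightarrow> 0"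
proof -
  \<comment> \<open>Values attainable by combinations of the tail from \<open>k\<close> on. These
    sets shrink with \<open>k\<close>, so their infima \<open>d\<close> increase and, being at most
    \<open>B\<close>, converge.\<close>
  define V where "V k = {Lp_pow m (\<lambda>x. \<Sum>n<N. c n * f n x) |N c. convex_weights k N c}" for k
  define d where "d k = Inf (V k)" for k
  have ne: "V k \<noteq> {}" for k unfolding V_def using convex_weights_single by blast
  have bdd: "bdd_below (V k)" for k unfolding V_def by (intro bdd_belowI[of _ 0]) auto
  have dB: "d k \<le> B" for k
  proof -
    have "Lp_pow m (\<lambda>x. \<Sum>n<Suc k. (if n = k then 1 else 0) * f n x) \<in> V k"
      unfolding V_def by (intro CollectI exI[of _ "Suc k"] exI[of _ "\<lambda>n. if n = k then 1 else 0"] conjI refl convex_weights_single)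
    then have "d k \<le> Lp_pow m (\<lambda>x. \<Sum>n<Suc k. (if n = k then 1 else 0) * f n x)"
      unfolding d_def by (intro cInf_lower bdd)
    also have "\<dots> \<le> B" by (rule Lp_pow_convex_le[OF m f convex_weights_single B])
    finally show ?thesis .
  qed
  have "incseq d"
  proof (rule incseq_SucI)
    fix k show "d k \<le> d (Suc k)" unfolding d_def
      by (rule cInf_superset_mono[OF ne bdd]) (unfold V_def, blast intro: convex_weights_mono[OF _ le_SucI[OF order_refl]])
  qed
  then obtain D where D: "d \<longlonglongrightarrow> D" using incseq_convergent[of d B] dB by blast
  have "\<exists>N c. convex_weights k N c \<and> Lp_pow m (\<lambda>x. \<Sum>n<N. c n * f n x) < d k + 1 / real (Suc k)" for k
  proof -
    have "d k < d k + 1 / real (Suc k)" by simp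
    then obtain v where "v \<in> V k" "v < d k + 1 / real (Suc k)"
      unfolding d_def by (subst (asm) cInf_less_iff[OF ne bdd]) auto
    then show ?thesis by (auto simp: V_def)
  qed
  then obtain N c where c: "\<And>k. convex_weights k (N k) (c k)"
    and small: "\<And>k. Lp_pow m (\<lambda>x. \<Sum>n<N k. c k n * f n x) < d k + 1 / real (Suc k)" by metis
  define a where "a k x = (\<Sum>n<N k. c k n * f n x)" for k x
  have a: "a k \<in> Lp m" for k unfolding a_def[abs_def] by (rule Lp_convex[OF m f c])
  have aB: "Lp_pow m (a k) \<le> B" for k unfolding a_def[abs_def] by (rule Lp_pow_convex_le[OF m f c B])
  have B0: "0 \<le> B" using order_trans[OF Lp_pow_nonneg B] .
  \<comment> \<open>The midpoint of combinations of two tails is a combination of the longer tail,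
    so its \<open>m\<close>-th power is still at least \<open>d k\<close>; uniform convexity then
    leaves no room for \<open>a k\<close> and \<open>a l\<close> to differ.\<close>
  have mid: "d k \<le> Lp_pow m (\<lambda>x. (a k x + a l x) / 2)" if "k \<le> l" for k l
  proof -
    note cl = convex_weights_mono[OF c that]
    have "(\<lambda>x. (a k x + a l x) / 2) = (\<lambda>x. \<Sum>n<max (N k) (N l). (c k n + c l n) / 2 * f n x)"
      unfolding a_def by (rule ext) (rule convex_weights_midpoint(2)[OF c cl, symmetric])
    then have "Lp_pow m (\<lambda>x. (a k x + a l x) / 2) \<in> V k"
      unfolding V_def by (intro CollectI exI[of _ "max (N k) (N l)"] exI[of _ "\<lambda>n. (c k n + c l n) / 2"]
        conjI convex_weights_midpoint(1)[OF c cl]) simp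
    then show ?thesis unfolding d_def by (intro cInf_lower bdd)
  qed
  have "\<exists>K. \<forall>k\<ge>K. \<forall>l\<ge>K. Lp_pow m (\<lambda>x. a k x - a l x) \<le> e" if e: "0 < e" for e
  proof -
    \<comment> \<open>Both contributions are kept within \<open>e / 2\<close>:
      \<open>\<eta> * (B + B)\<close> from the coarse term and \<open>C * (2 * q)\<close> from the
      convexity defect.\<close>
    define \<eta> where "\<eta> = e / (4 * B + 4)"
    have \<eta>: "0 < \<eta>" using e B0 by (simp add: \<eta>_def)
    obtain C where C: "0 < C" "\<And>a b. \<bar>a - b\<bar> powr m \<le> \<eta> * (\<bar>a\<bar> powr m + \<bar>b\<bar> powr m)
       + C * ((\<bar>a\<bar> powr m + \<bar>b\<bar> powr m) / 2 - \<bar>(a + b) / 2\<bar> powr m)"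
      using uniform_convexity_powr[OF m \<eta>] by blast
    define q where "q = e / (4 * C)"
    have q: "0 < q" using e C by (simp add: q_def)
    obtain K1 where K1: "\<And>k. K1 \<le> k \<Longrightarrow> \<bar>d k - D\<bar> < q/2" using LIMSEQ_D[OF D, of "q/2"] q by auto
    obtain K2 where K2: "1 / real (Suc K2) < q" using nat_approx_posE[OF q] by blast
    have ord: "Lp_pow m (\<lambda>x. a k x - a l x) \<le> e" if k: "max K1 K2 \<le> k" "k \<le> l" for k l
    proof -
      have dl: "(\<lambda>x. a k x - a l x) \<in> Lp m" using m a by (intro Lp_diff) auto
      have ml: "(\<lambda>x. (a k x + a l x) / 2) \<in> Lp m" using Lp_cmult[OF Lp_add[OF _ a[of k] a[of l]], of "1/2"] m by simp
      note ints = Lp_integrable[OF dl] Lp_integrable[OF ml] Lp_integrable[OF a]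
      have "Lp_pow m (\<lambda>x. a k x - a l x) \<le> (\<integral>x. \<eta> * (\<bar>a k x\<bar> powr m + \<bar>a l x\<bar> powr m)
         + C * ((\<bar>a k x\<bar> powr m + \<bar>a l x\<bar> powr m) / 2 - \<bar>(a k x + a l x) / 2\<bar> powr m) \<partial>lborel)"
        unfolding Lp_pow_def by (rule integral_mono[OF ints(1) _ C(2)]) (use ints in auto)
      also have "\<dots> = \<eta> * (Lp_pow m (a k) + Lp_pow m (a l))
         + C * ((Lp_pow m (a k) + Lp_pow m (a l)) / 2 - Lp_pow m (\<lambda>x. (a k x + a l x) / 2))"
        unfolding Lp_pow_def using ints by simp
      also have "\<dots> \<le> \<eta> * (B + B) + C * (2 * q)"
      proof (intro add_mono mult_left_mono)
        have "1 / real (Suc k) \<le> 1 / real (Suc K2)" "1 / real (Suc l) \<le> 1 / real (Suc K2)"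
          using k by (intro divide_left_mono; simp)+
        then have "1 / real (Suc k) < q" "1 / real (Suc l) < q" using K2 by linarith+
        then have "Lp_pow m (a k) < d k + q" "Lp_pow m (a l) < d l + q"
          using small[of k] small[of l] unfolding a_def[abs_def] by (meson add_strict_left_mono order.strict_trans)+
        moreover have "d k < D + q/2" "D - q/2 < d k" "d l < D + q/2"
        proof -
          have "\<bar>d k - D\<bar> < q/2" "\<bar>d l - D\<bar> < q/2" by (rule K1, use k in simp)+
          then show "d k < D + q/2" "D - q/2 < d k" "d l < D + q/2" by linarith+
        qed
        ultimately show "(Lp_pow m (a k) + Lp_pow m (a l)) / 2 - Lp_pow m (\<lambda>x. (a k x + a l x) / 2) \<le> 2 * q"
          using mid[OF k(2)] q by argo
      qed (use aB \<eta> C in auto)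
      also have "\<dots> \<le> e"
      proof -
        have "\<eta> * (B + B) \<le> e/2" using e B0 by (simp add: \<eta>_def field_simps)
        moreover have "C * (2 * q) = e/2" using C(1) by (simp add: q_def)
        ultimately show ?thesis by simp
      qed
      finally show ?thesis .
    qed
    have "Lp_pow m (\<lambda>x. a k x - a l x) \<le> e" if k: "max K1 K2 \<le> k" "max K1 K2 \<le> l" for k l
    proof (cases "k \<le> l")
      case False
      then have "Lp_pow m (\<lambda>x. a l x - a k x) \<le> e" using ord[of l k] k by simp
      then show ?thesis by (simp add: Lp_pow_def abs_minus_commute)
    qed (use ord k in auto)
    then show ?thesis by blast
  qed
  then obtain g where "g \<in> Lp m" "(\<lambda>k. Lp_pow m (\<lambda>x. a k x - g x)) \<longlonglongrightarrow> 0"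
    using Lp_complete[where a = a, OF m a] by blast
  then show ?thesis using that[OF c] unfolding a_def by blast
qed

section \<open>Weak convergence tested on intervals\<close>

lemma Lp_tendsto_Icc:
  assumes m: "1 < m" and a: "\<And>k. a k \<in> Lp m" and g: "g \<in> Lp m"
    and lim: "((\<lambda>k. Lp_pow m (\<lambda>x. a k x - g x)) \<longlongrightarrow> 0) F"
  shows "((\<lambda>k. LINT x:{u..v}|lborel. a k x) \<longlongrightarrow> (LINT x:{u..v}|lborel. g x)) F"
proof (cases "u \<le> v")
  case True
  have d: "(\<lambda>x. a k x - g x) \<in> Lp m" for k using m a g by (intro Lp_diff) auto
  have "((\<lambda>k. 2 * ((v - u) powr (1 - 1/m) * Lp_pow m (\<lambda>x. a k x - g x) powr (1/m))) \<longlongrightarrow> 2 * ((v - u) powr (1 - 1/m) * 0 powr (1/m))) F"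
    using m by (intro tendsto_mult tendsto_const tendsto_powr2 lim) auto
  then have z: "((\<lambda>k. 2 * ((v - u) powr (1 - 1/m) * Lp_pow m (\<lambda>x. a k x - g x) powr (1/m))) \<longlongrightarrow> 0) F" by simp
  have "((\<lambda>k. (LINT x:{u..v}|lborel. a k x) - (LINT x:{u..v}|lborel. g x)) \<longlongrightarrow> 0) F"
  proof (rule Lim_null_comparison[OF _ z], rule always_eventually, rule allI)
    fix k
    have "(LINT x:{u..v}|lborel. a k x) - (LINT x:{u..v}|lborel. g x) = (LINT x:{u..v}|lborel. a k x - g x)"
      by (rule set_integral_diff(2)[symmetric]; rule Lp_Icc_integrable[OF m]) (rule a g)+
    then show "norm ((LINT x:{u..v}|lborel. a k x) - (LINT x:{u..v}|lborel. g x))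
      \<le> 2 * ((v - u) powr (1 - 1/m) * Lp_pow m (\<lambda>x. a k x - g x) powr (1/m))"
      using Lp_Icc_le[OF m d True, of k] by simp
  qed
  then show ?thesis by (rule LIM_zero_cancel)
qed (simp add: set_lebesgue_integral_def)

lemma Lp_convex_Icc:
  fixes N :: nat
  assumes m: "1 < m" and f: "\<And>n. f n \<in> Lp m"
  shows "(LINT x:{u..v}|lborel. (\<Sum>n<N. c n * f n x)) = (\<Sum>n<N. c n * (LINT x:{u..v}|lborel. f n x))"
proof (induction N)
  case (Suc N)
  have "set_integrable lborel {u..v} (\<lambda>x. \<Sum>n<N. c n * f n x)" "set_integrable lborel {u..v} (\<lambda>x. c N * f N x)"
    using m f by (intro Lp_Icc_integrable Lp_sum Lp_cmult; auto)+
  then show ?case using Suc by (simp add: set_integral_add)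
qed (simp add: set_lebesgue_integral_def)

text \<open>This plays the part of weak compactness. Convex averages over moving tails keep the
  limit of each convergent sequence of interval integrals, so the Mazur limit \<open>g\<close> has
  \<open>\<Phi>\<close> as its interval integrals. The set \<open>D\<close> is a parameter because
  for \<open>ultra_weak_limit\<close> sequential convergence is known only at rational end
  points.\<close>

lemma convergent_from_Icc_convergent:
  assumes m: "1 < m" and f: "\<And>n. f n \<in> Lp m" and B: "\<And>n. Lp_pow m (f n) \<le> B"
    and conv: "\<And>u v. (u, v) \<in> D \<Longrightarrow> (\<lambda>n. LINT x:{u..v}|lborel. f n x) \<longlonglongrightarrow> \<Phi> u v"
  obtains N c g where "\<And>k. convex_weights k (N k) (c k)" "g \<in> Lp m"
    "(\<lambda>k. Lp_pow m (\<lambda>x. (\<Sum>n<N k. c k n * f n x) - g x)) \<longlonglongrightarrow> 0"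
    "Lp_pow m g \<le> B" "\<And>u v. (u, v) \<in> D \<Longrightarrow> \<Phi> u v = (LINT x:{u..v}|lborel. g x)"
proof -
  obtain N c g where c: "\<And>k. convex_weights k (N k) (c k)" and g: "g \<in> Lp m"
    and lim: "(\<lambda>k. Lp_pow m (\<lambda>x. (\<Sum>n<N k. c k n * f n x) - g x)) \<longlonglongrightarrow> 0"
    by (rule convex_combinations_converge[where f = f, OF m f B]) blast
  have a: "(\<lambda>x. \<Sum>n<N k. c k n * f n x) \<in> Lp m" for k by (rule Lp_convex[OF m f c])
  have gB: "Lp_pow m g \<le> B"
    by (rule Lp_pow_limit_le[OF m a g lim]) (rule Lp_pow_convex_le[OF m f c B])
  have \<Phi>: "\<Phi> u v = (LINT x:{u..v}|lborel. g x)" if "(u, v) \<in> D" for u v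
  proof (rule LIMSEQ_unique)
    show "(\<lambda>k. LINT x:{u..v}|lborel. (\<Sum>n<N k. c k n * f n x)) \<longlonglongrightarrow> (LINT x:{u..v}|lborel. g x)"
      by (rule Lp_tendsto_Icc[OF m a g lim])
    show "(\<lambda>k. LINT x:{u..v}|lborel. (\<Sum>n<N k. c k n * f n x)) \<longlonglongrightarrow> \<Phi> u v"
      unfolding Lp_convex_Icc[OF m f] by (rule convex_weights_tendsto[OF c conv[OF that]])
  qed
  show ?thesis by (rule that[OF c g lim gB \<Phi>])
qed

definition primitive :: "(real \<Rightarrow> real) \<Rightarrow> real \<Rightarrow> real" where
  "primitive f x = (if 0 \<le> x then LINT s:{0..x}|lborel. f s else - (LINT s:{x..0}|lborel. f s))"

lemma primitive_diff:
  assumes f: "\<And>a b. set_integrable lborel {a..b} f" and ab: "a \<le> b"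
  shows "primitive f b - primitive f a = (LINT s:{a..b}|lborel. f s)"
proof -
  note comb = set_integral_Icc_combine[of f, OF f]
  consider "0 \<le> a" | "a < 0" "0 \<le> b" | "b < 0" using ab by linarith
  then show ?thesis
  proof cases
    case 1
    then show ?thesis using ab comb[of 0 a b] by (simp add: primitive_def)
  next
    case 2
    then show ?thesis using comb[of a 0 b] by (simp add: primitive_def)
  next
    case 3
    then show ?thesis using ab comb[of a b 0] by (simp add: primitive_def)
  qed
qed

text \<open>The same primitive has derivative \<open>f\<close> and derivative \<open>g\<close>
  almost everywhere.\<close>

lemma AE_eq_from_Icc:
  fixes f g :: "real \<Rightarrow> real"
  assumes f: "\<And>a b. set_integrable lborel {a..b} f" and g: "\<And>a b. set_integrable lborel {a..b} g"
    and eq: "\<And>a b. a \<le> b \<Longrightarrow> (LINT s:{a..b}|lborel. f s) = (LINT s:{a..b}|lborel. g s)"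
  shows "AE x in lborel. f x = g x"
proof -
  have "AE x in lborel. (primitive f has_real_derivative f x) (at x)"
    by (rule AE_has_derivative_primitive[OF f primitive_diff[OF f]])
  moreover have "AE x in lborel. (primitive f has_real_derivative g x) (at x)"
    by (rule AE_has_derivative_primitive[OF g]) (simp add: primitive_diff[OF f] eq)
  ultimately show ?thesis by eventually_elim (rule DERIV_unique)
qed

text \<open>A Mazur limit of the sequence has the same interval integrals as \<open>h\<close>, hence
  agrees with it almost everywhere, and convex combinations do not exceed the bound
  \<open>B\<close>.\<close>

lemma weak_lower_semicontinuity:
  assumes m: "1 < m" and f: "\<And>n. f n \<in> Lp m" and B: "\<And>n. Lp_pow m (f n) \<le> B" and h: "h \<in> Lp m"
    and conv: "\<And>u v. (\<lambda>n. LINT x:{u..v}|lborel. f n x) \<longlonglongrightarrow> (LINT x:{u..v}|lborel. h x)"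
  shows "Lp_pow m h \<le> B"
proof -
  obtain N c g where g: "g \<in> Lp m" "Lp_pow m g \<le> B"
    "\<And>u v. (u, v) \<in> UNIV \<Longrightarrow> (LINT x:{u..v}|lborel. h x) = (LINT x:{u..v}|lborel. g x)"
    by (rule convergent_from_Icc_convergent[where f = f and D = UNIV and \<Phi> = "\<lambda>u v. LINT x:{u..v}|lborel. h x", OF m f B conv]) auto
  have "Lp_pow m h = Lp_pow m g"
    by (intro Lp_pow_AE AE_eq_from_Icc Lp_Icc_integrable[OF m] g h Lp_measurable[OF h] Lp_measurable[OF g(1)]) (use g in auto)
  then show ?thesis using g by simp
qed

definition Lp_functional :: "real \<Rightarrow> ((real \<Rightarrow> real) \<Rightarrow> real) \<Rightarrow> bool" where
  "Lp_functional m l \<longleftrightarrow> (\<forall>f\<in>Lp m. \<forall>g\<in>Lp m. l (\<lambda>x. f x + g x) = l f + l g) \<and>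
     (\<forall>f\<in>Lp m. \<forall>c. l (\<lambda>x. c * f x) = c * l f) \<and> (\<exists>C. \<forall>f\<in>Lp m. \<bar>l f\<bar> \<le> C * Lp_pow m f powr (1/m))"

text \<open>If convergence failed, the values along a subsequence would converge to some
  \<open>p\<close> away from \<open>l h\<close>. Its Mazur combinations converge in norm to a
  function equal to \<open>h\<close> almost everywhere, so \<open>l\<close> of them tends to
  \<open>l h\<close>; but by linearity these are averages of values tending to \<open>p\<close>. No
  description of the dual space enters.\<close>

theorem Lp_functional_tendsto:
  assumes m: "1 < m" and f: "\<And>n. f n \<in> Lp m" and B: "\<And>n. Lp_pow m (f n) \<le> B" and h: "h \<in> Lp m"
    and conv: "\<And>u v. (\<lambda>n. LINT x:{u..v}|lborel. f n x) \<longlonglongrightarrow> (LINT x:{u..v}|lborel. h x)"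
    and l: "Lp_functional m l"
  shows "(\<lambda>n. l (f n)) \<longlonglongrightarrow> l h"
proof (rule ccontr)
  have add: "\<And>f g. f \<in> Lp m \<Longrightarrow> g \<in> Lp m \<Longrightarrow> l (\<lambda>x. f x + g x) = l f + l g"
    and cm: "\<And>f c. f \<in> Lp m \<Longrightarrow> l (\<lambda>x. c * f x) = c * l f" using l unfolding Lp_functional_def by blast+
  obtain C where C: "\<And>f. f \<in> Lp m \<Longrightarrow> \<bar>l f\<bar> \<le> C * Lp_pow m f powr (1/m)"
    using l unfolding Lp_functional_def by blast
  have C0: "\<bar>l f\<bar> \<le> \<bar>C\<bar> * Lp_pow m f powr (1/m)" if "f \<in> Lp m" for f
    using C[OF that] by (rule order_trans) (intro mult_right_mono, auto)
  have sub: "l (\<lambda>x. f x - g x) = l f - l g" if "f \<in> Lp m" "g \<in> Lp m" for f g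
    using add[OF that(1) Lp_cmult[OF that(2), of "-1"]] cm[OF that(2), of "-1"] by simp
  have sum: "l (\<lambda>x. \<Sum>n<N. c n * q n x) = (\<Sum>n<N. c n * l (q n))" if "\<And>n. q n \<in> Lp m" for N :: nat and c q
  proof (induction N)
    case 0
    then show ?case using cm[OF Lp_zero, of 0] by simp
  next
    case (Suc N)
    have "l (\<lambda>x. (\<Sum>n<N. c n * q n x) + c N * q N x) = l (\<lambda>x. \<Sum>n<N. c n * q n x) + l (\<lambda>x. c N * q N x)"
      using m that by (intro add Lp_sum Lp_cmult) auto
    then show ?case using Suc cm[OF that[of N], of "c N"] by simp
  qed
  assume "\<not> (\<lambda>n. l (f n)) \<longlonglongrightarrow> l h"
  then obtain e where e: "0 < e" "\<And>K. \<exists>n\<ge>K. e \<le> \<bar>l (f n) - l h\<bar>"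
    by (auto simp: LIMSEQ_def dist_real_def not_less)
  then have "\<exists>\<^sub>\<infinity>n. e \<le> \<bar>l (f n) - l h\<bar>" unfolding INFM_nat_le by auto
  then obtain r :: "nat \<Rightarrow> nat" where r: "strict_mono r" "\<And>n. e \<le> \<bar>l (f (r n)) - l h\<bar>"
    using infinite_enumerate[of "{n. e \<le> \<bar>l (f n) - l h\<bar>}"] by (auto simp: frequently_cofinite)
  have "bounded (range (\<lambda>n. l (f (r n))))"
  proof (rule boundedI)
    fix y assume "y \<in> range (\<lambda>n. l (f (r n)))"
    then obtain n where y: "y = l (f (r n))" by auto
    have "\<bar>y\<bar> \<le> \<bar>C\<bar> * Lp_pow m (f (r n)) powr (1/m)" using C0[OF f] y by simp
    also have "\<dots> \<le> \<bar>C\<bar> * B powr (1/m)" using m B by (intro mult_left_mono powr_mono2) auto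
    finally show "norm y \<le> \<bar>C\<bar> * B powr (1/m)" by simp
  qed
  then obtain p and s :: "nat \<Rightarrow> nat" where s: "strict_mono s" "(\<lambda>n. l (f (r (s n)))) \<longlonglongrightarrow> p"
    using bounded_imp_convergent_subsequence[of "\<lambda>n. l (f (r n))"] by (auto simp: o_def)
  define q where "q n = f (r (s n))" for n
  have q: "q n \<in> Lp m" "Lp_pow m (q n) \<le> B" for n using f B by (auto simp: q_def)
  have qconv: "(\<lambda>n. LINT x:{u..v}|lborel. q n x) \<longlonglongrightarrow> (LINT x:{u..v}|lborel. h x)" for u v
    unfolding q_def using LIMSEQ_subseq_LIMSEQ[OF conv strict_mono_o[OF r(1) s(1)]] by (simp add: o_def)
  obtain N c g where c: "\<And>k. convex_weights k (N k) (c k)" and g: "g \<in> Lp m"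
    and lim: "(\<lambda>k. Lp_pow m (\<lambda>x. (\<Sum>n<N k. c k n * q n x) - g x)) \<longlonglongrightarrow> 0"
    and hg: "\<And>u v. (u, v) \<in> UNIV \<Longrightarrow> (LINT x:{u..v}|lborel. h x) = (LINT x:{u..v}|lborel. g x)"
    by (rule convergent_from_Icc_convergent[where f = q and D = UNIV and \<Phi> = "\<lambda>u v. LINT x:{u..v}|lborel. h x", OF m q(1) q(2) qconv]) auto
  have a: "(\<lambda>x. \<Sum>n<N k. c k n * q n x) \<in> Lp m" for k by (rule Lp_convex[OF m q(1) c])
  have d: "(\<lambda>x. (\<Sum>n<N k. c k n * q n x) - g x) \<in> Lp m" for k using m a g by (intro Lp_diff) auto
  have dhg: "(\<lambda>x. h x - g x) \<in> Lp m" using m h g by (intro Lp_diff) auto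
  have "AE x in lborel. h x = g x"
    by (intro AE_eq_from_Icc Lp_Icc_integrable[OF m] g h) (use hg in auto)
  then have "Lp_pow m (\<lambda>x. h x - g x) = Lp_pow m (\<lambda>x. 0)"
    using Lp_measurable[OF dhg] by (intro Lp_pow_AE) auto
  then have lhg: "l h = l g" using C0[OF dhg] unfolding sub[OF h g] by simp
  have "(\<lambda>k. l (\<lambda>x. \<Sum>n<N k. c k n * q n x) - l g) \<longlonglongrightarrow> 0"
  proof (rule Lim_null_comparison)
    show "\<forall>\<^sub>F k in sequentially. norm (l (\<lambda>x. \<Sum>n<N k. c k n * q n x) - l g)
      \<le> \<bar>C\<bar> * Lp_pow m (\<lambda>x. (\<Sum>n<N k. c k n * q n x) - g x) powr (1/m)"
    proof (rule always_eventually, rule allI)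
      fix k show "norm (l (\<lambda>x. \<Sum>n<N k. c k n * q n x) - l g)
        \<le> \<bar>C\<bar> * Lp_pow m (\<lambda>x. (\<Sum>n<N k. c k n * q n x) - g x) powr (1/m)"
        using C0[OF d[of k]] unfolding sub[OF a[of k] g] by simp
    qed
    have "(\<lambda>k. \<bar>C\<bar> * Lp_pow m (\<lambda>x. (\<Sum>n<N k. c k n * q n x) - g x) powr (1/m)) \<longlonglongrightarrow> \<bar>C\<bar> * 0 powr (1/m)"
      using m by (intro tendsto_mult tendsto_const tendsto_powr2 lim) auto
    then show "(\<lambda>k. \<bar>C\<bar> * Lp_pow m (\<lambda>x. (\<Sum>n<N k. c k n * q n x) - g x) powr (1/m)) \<longlonglongrightarrow> 0" by simp
  qed
  then have "(\<lambda>k. l (\<lambda>x. \<Sum>n<N k. c k n * q n x)) \<longlonglongrightarrow> l g" by (rule LIM_zero_cancel)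
  then have "(\<lambda>k. \<Sum>n<N k. c k n * l (q n)) \<longlonglongrightarrow> l g" by (simp only: sum[of q, OF q(1)])
  moreover have "(\<lambda>k. \<Sum>n<N k. c k n * l (q n)) \<longlonglongrightarrow> p"
    unfolding q_def by (rule convex_weights_tendsto[OF c s(2)])
  ultimately have "l g = p" by (rule LIMSEQ_unique)
  then have "p = l h" using lhg by simp
  moreover have "e \<le> \<bar>p - l h\<bar>"
  proof (rule LIMSEQ_le_const)
    show "(\<lambda>n. \<bar>l (f (r (s n))) - l h\<bar>) \<longlonglongrightarrow> \<bar>p - l h\<bar>" by (intro tendsto_intros s(2))
  qed (use r(2) in auto)
  ultimately show False using e by simp
qed

section \<open>Limits along an ultrafilter\<close>

text \<open>A free ultrafilter: being finer than \<open>sequentially\<close> it keeps every limit of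
  a sequence, and deciding every predicate it gives each bounded real sequence a limit without
  extraction.\<close>

definition ultra :: "nat filter \<Rightarrow> bool" where
  "ultra U \<longleftrightarrow> U \<le> sequentially \<and> U \<noteq> bot \<and> (\<forall>P. eventually P U \<or> eventually (\<lambda>n. \<not> P n) U)"

text \<open>Zorn's lemma among the set filters containing every tail \<open>{n..}\<close>. A maximal
  one decides every \<open>A\<close>, since otherwise its members cut with \<open>A\<close> would
  generate a larger one.\<close>

lemma ex_ultra: "\<exists>U. ultra U"
proof -
  define \<A> where "\<A> = {S :: nat set set. (\<forall>n. {n..} \<in> S) \<and> (\<forall>A\<in>S. \<forall>B\<in>S. A \<inter> B \<in> S) \<and> (\<forall>A\<in>S. \<forall>B. A \<subseteq> B \<longrightarrow> B \<in> S) \<and> {} \<notin> S}"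
  have "\<exists>S\<in>\<A>. \<forall>X\<in>\<A>. S \<subseteq> X \<longrightarrow> X = S"
  proof (rule subset_Zorn_nonempty)
    have "{A. \<exists>n. {n..} \<subseteq> A} \<in> \<A>"
    proof -
      have "\<exists>k. {k..} \<subseteq> A \<inter> B" if "{n..} \<subseteq> A" "{p..} \<subseteq> B" for A B :: "nat set" and n p
        using that by (intro exI[of _ "max n p"]) auto
      moreover have "\<not> {n..} \<subseteq> {}" for n :: nat by auto
      ultimately show ?thesis unfolding \<A>_def by blast
    qed
    then show "\<A> \<noteq> {}" by auto
  next
    fix \<C> assume C: "\<C> \<noteq> {}" "subset.chain \<A> \<C>"
    then obtain X0 where X0: "X0 \<in> \<C>" by blast
    from C have sub: "\<C> \<subseteq> \<A>" and lin: "\<And>X Y. X \<in> \<C> \<Longrightarrow> Y \<in> \<C> \<Longrightarrow> X \<subseteq> Y \<or> Y \<subseteq> X"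
      by (auto simp: subset_chain_def)
    have "A \<inter> B \<in> \<Union>\<C>" if AB: "A \<in> X" "X \<in> \<C>" "B \<in> Y" "Y \<in> \<C>" for A B X Y
    proof -
      obtain Z where "Z \<in> \<C>" "A \<in> Z" "B \<in> Z" using lin[OF AB(2,4)] AB by blast
      moreover have "Z \<in> \<A>" using sub \<open>Z \<in> \<C>\<close> by blast
      ultimately show ?thesis unfolding \<A>_def by blast
    qed
    then have inter: "\<forall>A\<in>\<Union>\<C>. \<forall>B\<in>\<Union>\<C>. A \<inter> B \<in> \<Union>\<C>" by blast
    have "X0 \<in> \<A>" using X0 sub by blast
    then have "\<forall>n. {n..} \<in> X0" unfolding \<A>_def mem_Collect_eq by (elim conjE)
    then have 1: "\<forall>n. {n..} \<in> \<Union>\<C>" using X0 by blast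
    have up: "B \<in> X" if "X \<in> \<C>" "A \<in> X" "A \<subseteq> B" for X A B
    proof -
      have "\<forall>A\<in>X. \<forall>B. A \<subseteq> B \<longrightarrow> B \<in> X" using sub that(1) unfolding \<A>_def by auto
      then show ?thesis using that by blast
    qed
    then have 3: "\<forall>A\<in>\<Union>\<C>. \<forall>B. A \<subseteq> B \<longrightarrow> B \<in> \<Union>\<C>" by (meson UnionE UnionI)
    have "{} \<notin> X" if "X \<in> \<C>" for X using sub that unfolding \<A>_def by auto
    then have 4: "{} \<notin> \<Union>\<C>" by blast
    show "\<Union>\<C> \<in> \<A>" unfolding \<A>_def mem_Collect_eq by (intro conjI 1 inter 3 4)
  qed
  then obtain S where S: "S \<in> \<A>" and max: "\<And>X. X \<in> \<A> \<Longrightarrow> S \<subseteq> X \<Longrightarrow> X = S" by blast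
  have S1: "{n..} \<in> S" and S2: "A \<in> S \<Longrightarrow> B \<in> S \<Longrightarrow> A \<inter> B \<in> S" and S3: "A \<in> S \<Longrightarrow> A \<subseteq> B \<Longrightarrow> B \<in> S"
    and S4: "{} \<notin> S" for n A B
    using S unfolding \<A>_def by blast+
  have U: "UNIV \<in> S" using S3[OF S1[of 0]] by simp
  have ult: "A \<in> S \<or> - A \<in> S" for A
  proof (rule ccontr)
    assume n: "\<not> (A \<in> S \<or> - A \<in> S)"
    define X where "X = {Y. \<exists>s\<in>S. s \<inter> A \<subseteq> Y}"
    have SX: "S \<subseteq> X" unfolding X_def by blast
    have 4: "{} \<notin> X"
    proof
      assume "{} \<in> X"
      then obtain s where "s \<in> S" "s \<subseteq> - A" by (auto simp: X_def)
      then show False using S3[of s "- A"] n by simp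
    qed
    have "Y \<inter> Z \<in> X" if YZ: "Y \<in> X" "Z \<in> X" for Y Z
    proof -
      obtain s s' where "s \<in> S" "s \<inter> A \<subseteq> Y" "s' \<in> S" "s' \<inter> A \<subseteq> Z" using YZ by (auto simp: X_def)
      then show ?thesis unfolding X_def by (intro CollectI bexI[of _ "s \<inter> s'"] S2) auto
    qed
    then have 2: "\<forall>Y\<in>X. \<forall>Z\<in>X. Y \<inter> Z \<in> X" by simp
    have 3: "\<forall>Y\<in>X. \<forall>Z. Y \<subseteq> Z \<longrightarrow> Z \<in> X" unfolding X_def by (auto intro: order_trans)
    have 1: "\<forall>n. {n..} \<in> X" using SX S1 by (simp add: subsetD)
    have "X \<in> \<A>" unfolding \<A>_def mem_Collect_eq by (intro conjI 1 2 3 4)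
    then have "X = S" using max SX by blast
    moreover have "A \<in> X" using U unfolding X_def by blast
    ultimately show False using n by blast
  qed
  define F where "F = Abs_filter (\<lambda>P. {n. P n} \<in> S)"
  have ev: "eventually P F \<longleftrightarrow> {n. P n} \<in> S" for P
    unfolding F_def
  proof (rule eventually_Abs_filter, rule is_filter.intro)
    show "{n. True} \<in> S" using U by simp
    show "{n. P n \<and> Q n} \<in> S" if "{n. P n} \<in> S" "{n. Q n} \<in> S" for P Q :: "nat \<Rightarrow> bool"
      using S2[OF that] by (simp add: Collect_conj_eq)
    show "{n. Q n} \<in> S" if "\<forall>n. P n \<longrightarrow> Q n" "{n. P n} \<in> S" for P Q :: "nat \<Rightarrow> bool"
      using S3[OF that(2)] that(1) by blast
  qed
  have "F \<le> sequentially"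
  proof (rule filter_leI)
    fix P :: "nat \<Rightarrow> bool" assume "eventually P sequentially"
    then obtain N where "{N..} \<subseteq> {n. P n}" by (auto simp: eventually_sequentially)
    then show "eventually P F" using S3[OF S1] ev by blast
  qed
  moreover have "F \<noteq> bot" using ev[of "\<lambda>n. False"] S4 by auto
  moreover have "eventually P F \<or> eventually (\<lambda>n. \<not> P n) F" for P
    using ult[of "{n. P n}"] unfolding ev by (simp add: Collect_neg_eq)
  ultimately show ?thesis unfolding ultra_def by blast
qed

lemma ultra_not_eventually: "ultra U \<Longrightarrow> \<not> eventually P U \<Longrightarrow> eventually (\<lambda>n. \<not> P n) U"
  by (auto simp: ultra_def)

text \<open>Compactness gives a cluster point. Along an ultrafilter it is a limit, since the
  sequence is eventually in a given neighbourhood or eventually outside it.\<close>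

lemma ultra_compact_tendsto:
  fixes x :: "nat \<Rightarrow> 'a::topological_space"
  assumes U: "ultra U" and K: "compact K" and x: "eventually (\<lambda>n. x n \<in> K) U"
  shows "\<exists>L\<in>K. (x \<longlongrightarrow> L) U"
proof -
  have nb: "filtermap x U \<noteq> bot" using U by (simp add: ultra_def filtermap_bot_iff)
  obtain L where L: "L \<in> K" "inf (nhds L) (filtermap x U) \<noteq> bot"
    using K[unfolded compact_filter, rule_format, OF nb] x by (auto simp: eventually_filtermap)
  have "(x \<longlongrightarrow> L) U"
  proof (rule topological_tendstoI)
    fix S assume S: "open S" "L \<in> S"
    show "eventually (\<lambda>n. x n \<in> S) U"
    proof (rule ccontr)
      assume "\<not> eventually (\<lambda>n. x n \<in> S) U"
      then have "eventually (\<lambda>y. y \<notin> S) (filtermap x U)"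
        using U by (simp add: ultra_not_eventually eventually_filtermap)
      moreover have "eventually (\<lambda>y. y \<in> S) (nhds L)" using S by (rule eventually_nhds_in_open)
      ultimately have "eventually (\<lambda>y. False) (inf (nhds L) (filtermap x U))"
        unfolding eventually_inf by blast
      then show False using L(2) by (simp add: trivial_limit_def)
    qed
  qed
  then show ?thesis using L(1) by blast
qed

lemma ultra_bounded_tendsto:
  fixes x :: "nat \<Rightarrow> real"
  assumes "ultra U" "eventually (\<lambda>n. a \<le> x n \<and> x n \<le> b) U"
  shows "\<exists>L\<in>{a..b}. (x \<longlongrightarrow> L) U"
  by (rule ultra_compact_tendsto[OF assms(1)]) (use assms(2) in auto)

text \<open>Applied to frame distances: two sequences of frames are either orthogonal or stay at
  bounded distance, with nothing in between.\<close>

lemma ultra_at_top_or_bounded: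
  fixes x :: "nat \<Rightarrow> real"
  assumes U: "ultra U"
  shows "filterlim x at_top U \<or> (\<exists>B. eventually (\<lambda>n. x n \<le> B) U)"
proof (rule disjCI)
  assume n: "\<not> (\<exists>B. eventually (\<lambda>n. x n \<le> B) U)"
  show "filterlim x at_top U" unfolding filterlim_at_top
  proof
    fix Z :: real
    have "\<not> eventually (\<lambda>n. x n \<le> Z) U" using n by blast
    then have "eventually (\<lambda>n. \<not> x n \<le> Z) U" by (rule ultra_not_eventually[OF U])
    then show "eventually (\<lambda>n. Z \<le> x n) U" by (rule eventually_mono) auto
  qed
qed

text \<open>Diagonal choice along an enumeration: \<open>\<phi> n\<close> satisfies the predicates
  with index at most \<open>n\<close> and exceeds the previous value. This is possible since
  finitely many predicates that hold along \<open>U\<close> hold together at arbitrarily late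
  indices.\<close>

lemma ultra_extract:
  assumes U: "ultra U" and P: "countable \<P>" "\<And>P. P \<in> \<P> \<Longrightarrow> eventually P U"
  shows "\<exists>\<phi> :: nat \<Rightarrow> nat. strict_mono \<phi> \<and> (\<forall>P\<in>\<P>. eventually (\<lambda>n. P (\<phi> n)) sequentially)"
proof (cases "\<P> = {}")
  case True
  then show ?thesis by (intro exI[of _ id]) (auto simp: strict_mono_def)
next
  case False
  define p where "p i = from_nat_into \<P> i" for i
  have ev: "eventually (p i) U" for i unfolding p_def by (rule P(2), rule from_nat_into[OF False])
  have Ub: "U \<noteq> bot" and Us: "U \<le> sequentially" using U by (simp_all add: ultra_def)
  have ex: "\<exists>n. k < n \<and> (\<forall>i\<in>{..N}. p i n)" for k N
  proof -
    have "eventually (\<lambda>n. k < n) U" by (rule filter_leD[OF Us eventually_gt_at_top])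
    moreover have "eventually (\<lambda>n. \<forall>i\<in>{..N}. p i n) U"
      using ev by (intro eventually_ball_finite) auto
    ultimately have "eventually (\<lambda>n. k < n \<and> (\<forall>i\<in>{..N}. p i n)) U" by (rule eventually_conj)
    then show ?thesis by (rule eventually_happens'[OF Ub])
  qed
  have "\<exists>\<phi>. \<forall>n. (\<forall>i\<in>{..n}. p i (\<phi> n)) \<and> \<phi> n < \<phi> (Suc n)"
  proof (rule dependent_nat_choice)
    show "\<exists>x. \<forall>i\<in>{..0}. p i x" using ex[of 0 0] by blast
    show "\<exists>y. (\<forall>i\<in>{..Suc n}. p i y) \<and> x < y" for x n using ex[of x "Suc n"] by blast
  qed
  then obtain \<phi> :: "nat \<Rightarrow> nat" where \<phi>: "\<forall>n. (\<forall>i\<in>{..n}. p i (\<phi> n)) \<and> \<phi> n < \<phi> (Suc n)" ..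
  have "eventually (\<lambda>n. P (\<phi> n)) sequentially" if P': "P \<in> \<P>" for P
  proof -
    obtain i where i: "p i = P" unfolding p_def using from_nat_into_surj[OF P(1) P'] ..
    have "p i (\<phi> n)" if "i \<le> n" for n using \<phi> that by simp
    then show ?thesis unfolding eventually_sequentially i by blast
  qed
  moreover have "strict_mono \<phi>" unfolding strict_mono_Suc_iff using \<phi> by simp
  ultimately show ?thesis by blast
qed

section \<open>Weak limits along the ultrafilter\<close>

lemma primitive_Hoelder:
  assumes m: "1 < m" and f: "f \<in> Lp m" and B: "Lp_pow m f \<le> B"
  shows "\<bar>primitive f x - primitive f y\<bar> \<le> 2 * B powr (1/m) * \<bar>x - y\<bar> powr (1 - 1/m)"
proof -
  have main: "\<bar>primitive f v - primitive f u\<bar> \<le> 2 * B powr (1/m) * (v - u) powr (1 - 1/m)" if "u \<le> v" for u v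
  proof -
    have "\<bar>primitive f v - primitive f u\<bar> \<le> 2 * ((v - u) powr (1 - 1/m) * Lp_pow m f powr (1/m))"
      unfolding primitive_diff[OF Lp_Icc_integrable[OF m f] that] by (rule Lp_Icc_le[OF m f that])
    also have "\<dots> \<le> 2 * ((v - u) powr (1 - 1/m) * B powr (1/m))"
      using B m by (intro mult_left_mono powr_mono2) auto
    finally show ?thesis by (simp add: mult_ac)
  qed
  show ?thesis using main[of x y] main[of y x] by (cases "x \<le> y") (auto simp: abs_minus_commute)
qed

text \<open>Interval integrals are Hoelder continuous in the end points, uniformly over a ball of
  \<open>Lp m\<close>. This equicontinuity is behind \<open>Icc_tendsto_from_rational\<close> and
  \<open>sv_moving_tendsto_0\<close>.\<close>

lemma LINT_Icc_diff_le:
  assumes m: "1 < m" and f: "f \<in> Lp m" and B: "Lp_pow m f \<le> B" and ab: "a \<le> b" "c \<le> d"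
  shows "\<bar>(LINT x:{a..b}|lborel. f x) - (LINT x:{c..d}|lborel. f x)\<bar>
    \<le> 2 * B powr (1/m) * (\<bar>a - c\<bar> powr (1 - 1/m) + \<bar>b - d\<bar> powr (1 - 1/m))"
proof -
  note P = primitive_diff[OF Lp_Icc_integrable[OF m f]]
  have "\<bar>(LINT x:{a..b}|lborel. f x) - (LINT x:{c..d}|lborel. f x)\<bar>
    \<le> \<bar>primitive f a - primitive f c\<bar> + \<bar>primitive f b - primitive f d\<bar>"
    unfolding P[OF ab(1), symmetric] P[OF ab(2), symmetric] by linarith
  also have "\<dots> \<le> 2 * B powr (1/m) * (\<bar>a - c\<bar> powr (1 - 1/m) + \<bar>b - d\<bar> powr (1 - 1/m))"
    unfolding distrib_left by (intro add_mono primitive_Hoelder[OF m f B])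
  finally show ?thesis .
qed

lemma Icc_tendsto_from_rational:
  assumes m: "1 < m" and f: "\<And>n. f n \<in> Lp m" and B: "\<And>n. Lp_pow m (f n) \<le> B" and g: "g \<in> Lp m"
    and conv: "\<And>u v. u \<in> \<rat> \<Longrightarrow> v \<in> \<rat> \<Longrightarrow> ((\<lambda>n. LINT x:{u..v}|lborel. f n x) \<longlongrightarrow> (LINT x:{u..v}|lborel. g x)) F"
  shows "((\<lambda>n. LINT x:{u..v}|lborel. f n x) \<longlongrightarrow> (LINT x:{u..v}|lborel. g x)) F"
proof (cases "u \<le> v")
  case True
  define B' where "B' = max B (Lp_pow m g)"
  define C where "C = 2 * B' powr (1/m)"
  have fB: "Lp_pow m (f n) \<le> B'" for n using B by (simp add: B'_def max.coboundedI1)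
  have gB: "Lp_pow m g \<le> B'" by (simp add: B'_def)
  have C: "0 \<le> C" by (simp add: C_def)
  show ?thesis
  proof (rule tendstoI)
    fix e :: real assume e: "0 < e"
    \<comment> \<open>Moving both end points by less than \<open>d\<close> changes the integrals by
      at most \<open>e / 4\<close>, uniformly in \<open>n\<close>.\<close>
    define d where "d = (e / (8 * (C + 1))) powr (m / (m - 1))"
    have d: "0 < d" using e C by (simp add: d_def)
    have m1: "m / (m - 1) * (1 - 1/m) = 1" using m by (simp add: field_simps)
    have dp: "d powr (1 - 1/m) = e / (8 * (C + 1))"
      unfolding d_def powr_powr m1 using e C by simp
    obtain u' where u': "u' \<in> \<rat>" "u - d < u'" "u' < u" using Rats_dense_in_real[of "u - d" u] d by auto
    obtain v' where v': "v' \<in> \<rat>" "v < v'" "v' < v + d" using Rats_dense_in_real[of v "v + d"] d by auto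
    have close: "\<bar>(LINT x:{u..v}|lborel. q x) - (LINT x:{u'..v'}|lborel. q x)\<bar> \<le> e/4"
      if "q \<in> Lp m" "Lp_pow m q \<le> B'" for q
    proof -
      have "\<bar>(LINT x:{u..v}|lborel. q x) - (LINT x:{u'..v'}|lborel. q x)\<bar>
        \<le> C * (\<bar>u - u'\<bar> powr (1 - 1/m) + \<bar>v - v'\<bar> powr (1 - 1/m))"
        unfolding C_def using True u' v' by (intro LINT_Icc_diff_le[OF m that]) auto
      also have "\<dots> \<le> C * (d powr (1 - 1/m) + d powr (1 - 1/m))"
        using m u' v' C by (intro mult_left_mono add_mono powr_mono2) auto
      also have "\<dots> = (C / (C + 1)) * (e/4)" unfolding dp using C by (simp add: frac_eq_eq algebra_simps)
      also have "\<dots> \<le> 1 * (e/4)" using C e by (intro mult_right_mono) auto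
      finally show ?thesis by simp
    qed
    have "eventually (\<lambda>n. dist (LINT x:{u'..v'}|lborel. f n x) (LINT x:{u'..v'}|lborel. g x) < e/4) F"
      using e by (intro tendstoD[OF conv] u' v') auto
    then show "eventually (\<lambda>n. dist (LINT x:{u..v}|lborel. f n x) (LINT x:{u..v}|lborel. g x) < e) F"
    proof eventually_elim
      case (elim n)
      then show ?case using close[OF f fB, of n] close[OF g gB] e unfolding dist_real_def by linarith
    qed
  qed
qed (simp add: set_lebesgue_integral_def)

lemma real_tendsto_from_eventually_inverse_Suc:
  fixes x :: "nat \<Rightarrow> real"
  assumes "\<And>k. eventually (\<lambda>n. \<bar>x n - L\<bar> < 1 / real (Suc k)) F"
  shows "(x \<longlongrightarrow> L) F"
proof (rule tendstoI)
  fix e :: real assume "0 < e"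
  then obtain k where "1 / real (Suc k) < e" using nat_approx_posE by blast
  then show "eventually (\<lambda>n. dist (x n) L < e) F"
    using assms[of k] by (auto simp: dist_real_def elim: eventually_mono)
qed

text \<open>Every interval integral converges along \<open>U\<close> because it is bounded. Only
  those with rational end points, countably many, are passed to a sequence by
  \<open>ultra_extract\<close>; this sequence produces \<open>g\<close>, and equicontinuity recovers
  all other end points.\<close>

theorem ultra_weak_limit:
  assumes U: "ultra U" and m: "1 < m" and f: "\<And>n. f n \<in> Lp m" and B: "\<And>n. Lp_pow m (f n) \<le> B"
  shows "\<exists>g\<in>Lp m. \<forall>u v. ((\<lambda>n. LINT x:{u..v}|lborel. f n x) \<longlongrightarrow> (LINT x:{u..v}|lborel. g x)) U"
proof -
  have "\<exists>L. ((\<lambda>n. LINT x:{u..v}|lborel. f n x) \<longlongrightarrow> L) U" for u v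
  proof (cases "u \<le> v")
    case True
    define C where "C = 2 * ((v - u) powr (1 - 1/m) * B powr (1/m))"
    have "\<bar>LINT x:{u..v}|lborel. f n x\<bar> \<le> C" for n
    proof -
      have "\<bar>LINT x:{u..v}|lborel. f n x\<bar> \<le> 2 * ((v - u) powr (1 - 1/m) * Lp_pow m (f n) powr (1/m))"
        by (rule Lp_Icc_le[OF m f True])
      also have "\<dots> \<le> C" unfolding C_def using m B by (intro mult_left_mono powr_mono2) auto
      finally show ?thesis .
    qed
    then have "eventually (\<lambda>n. - C \<le> (LINT x:{u..v}|lborel. f n x) \<and> (LINT x:{u..v}|lborel. f n x) \<le> C) U"
      by (intro always_eventually) (auto simp: abs_le_iff minus_le_iff)
    from ultra_bounded_tendsto[OF U this] show ?thesis by blast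
  qed (auto simp: set_lebesgue_integral_def)
  then have \<Phi>: "((\<lambda>n. LINT x:{u..v}|lborel. f n x) \<longlongrightarrow> Lim U (\<lambda>n. LINT x:{u..v}|lborel. f n x)) U" for u v
    using U tendsto_Lim unfolding ultra_def by metis
  define \<Phi> where "\<Phi> u v = Lim U (\<lambda>n. LINT x:{u..v}|lborel. f n x)" for u v
  note \<Phi> = \<Phi>[folded \<Phi>_def]
  define \<P> where "\<P> = (\<lambda>(u, v, k) n. \<bar>(LINT x:{u..v}|lborel. f n x) - \<Phi> u v\<bar> < 1 / real (Suc k)) ` (\<rat> \<times> \<rat> \<times> UNIV)"
  have "countable \<P>" unfolding \<P>_def by (intro countable_image countable_SIGMA countable_rat) auto
  moreover have "eventually P U" if P: "P \<in> \<P>" for P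
  proof -
    obtain u v k where P: "P = (\<lambda>n. \<bar>(LINT x:{u..v}|lborel. f n x) - \<Phi> u v\<bar> < 1 / real (Suc k))"
      using P by (auto simp: \<P>_def)
    show ?thesis using tendstoD[OF \<Phi>[of u v], of "1 / real (Suc k)"] by (simp add: P dist_real_def)
  qed
  ultimately have "\<exists>\<phi> :: nat \<Rightarrow> nat. strict_mono \<phi> \<and> (\<forall>P\<in>\<P>. eventually (\<lambda>n. P (\<phi> n)) sequentially)"
    by (rule ultra_extract[OF U])
  then obtain \<phi> :: "nat \<Rightarrow> nat" where \<phi>: "strict_mono \<phi>" "\<forall>P\<in>\<P>. eventually (\<lambda>n. P (\<phi> n)) sequentially"
    by (elim exE conjE)
  have conv: "(\<lambda>n. LINT x:{u..v}|lborel. f (\<phi> n) x) \<longlonglongrightarrow> \<Phi> u v" if "(u, v) \<in> \<rat> \<times> \<rat>" for u v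
  proof (rule real_tendsto_from_eventually_inverse_Suc)
    fix k
    have "(\<lambda>n. \<bar>(LINT x:{u..v}|lborel. f n x) - \<Phi> u v\<bar> < 1 / real (Suc k)) \<in> \<P>"
      unfolding \<P>_def by (rule image_eqI[of _ _ "(u, v, k)"]) (use that in auto)
    then show "\<forall>\<^sub>F n in sequentially. \<bar>(LINT x:{u..v}|lborel. f (\<phi> n) x) - \<Phi> u v\<bar> < 1 / real (Suc k)"
      by (rule \<phi>(2)[rule_format])
  qed
  obtain N c g where g: "g \<in> Lp m" "\<And>u v. (u, v) \<in> \<rat> \<times> \<rat> \<Longrightarrow> \<Phi> u v = (LINT x:{u..v}|lborel. g x)"
    by (rule convergent_from_Icc_convergent[where f = "\<lambda>n. f (\<phi> n)" and D = "\<rat> \<times> \<rat>" and \<Phi> = \<Phi>, OF m f B conv]) blast+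
  have "((\<lambda>n. LINT x:{u..v}|lborel. f n x) \<longlongrightarrow> (LINT x:{u..v}|lborel. g x)) U" for u v
    by (rule Icc_tendsto_from_rational[OF m f B g(1)]) (metis \<Phi> g(2) mem_Sigma_iff)
  then show ?thesis using g(1) by blast
qed

lemma weak_lsc_eventually:
  assumes m: "1 < m" and f: "\<And>n. f n \<in> Lp m" and B: "\<And>n. Lp_pow m (f n) \<le> B" and h: "h \<in> Lp m"
    and conv: "\<And>u v. (\<lambda>n. LINT x:{u..v}|lborel. f n x) \<longlonglongrightarrow> (LINT x:{u..v}|lborel. h x)" and e: "0 < e"
  shows "eventually (\<lambda>n. Lp_pow m h - e \<le> Lp_pow m (f n)) sequentially"
proof (rule ccontr)
  assume "\<not> eventually (\<lambda>n. Lp_pow m h - e \<le> Lp_pow m (f n)) sequentially"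
  then have "\<exists>\<^sub>\<infinity>n. Lp_pow m (f n) \<le> Lp_pow m h - e"
    unfolding INFM_nat_le eventually_sequentially not_ex not_all not_imp not_le by (meson less_imp_le)
  then have "infinite {n. Lp_pow m (f n) \<le> Lp_pow m h - e}" by (simp add: frequently_cofinite)
  then obtain r :: "nat \<Rightarrow> nat" where r: "strict_mono r" "\<And>n. r n \<in> {n. Lp_pow m (f n) \<le> Lp_pow m h - e}"
    using infinite_enumerate by blast
  have "Lp_pow m h \<le> Lp_pow m h - e"
  proof (rule weak_lower_semicontinuity[where f = "\<lambda>n. f (r n)", OF m f _ h])
    show "Lp_pow m (f (r n)) \<le> Lp_pow m h - e" for n using r(2)[of n] by simp
    show "(\<lambda>n. LINT x:{u..v}|lborel. f (r n) x) \<longlonglongrightarrow> (LINT x:{u..v}|lborel. h x)" for u v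
      using LIMSEQ_subseq_LIMSEQ[OF conv r(1)] by (simp add: o_def)
  qed
  then show False using e by simp
qed

section \<open>Orthogonal frames\<close>

text \<open>For the wave \<open>u\<close> with profile \<open>f\<close> this is
  \<open>l powr (1/m) * u t l\<close>, the rescaled value at time \<open>t\<close> and radius
  \<open>l\<close>. It is invariant when \<open>f\<close> and the frame are rescaled together, see
  \<open>sv_rescale\<close>.\<close>

definition sv :: "real \<Rightarrow> (real \<Rightarrow> real) \<Rightarrow> real \<Rightarrow> real \<Rightarrow> real" where
  "sv m f l t = l powr (1/m - 1) * (LINT x:{t-l..t+l}|lborel. f x)"

text \<open>The inverse of \<open>rescale m l t\<close>: it puts the profile \<open>g\<close> into
  the frame of scale \<open>l\<close> and centre \<open>t\<close>.\<close>

definition bubble :: "real \<Rightarrow> (real \<Rightarrow> real) \<Rightarrow> real \<Rightarrow> real \<Rightarrow> real \<Rightarrow> real" where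
  "bubble m g l t = rescale m (1/l) (- t/l) g"

text \<open>The quantity of the pseudo-orthogonality condition. Dividing the shift by
  \<open>l\<close> alone makes it asymmetric; \<open>frame_dist_sym_le\<close> carries bounds over
  to the exchanged frames.\<close>

definition frame_dist :: "real \<Rightarrow> real \<Rightarrow> real \<Rightarrow> real \<Rightarrow> real" where
  "frame_dist l t l' t' = l / l' + l' / l + \<bar>t - t'\<bar> / l"

lemma bubble_eq: "0 < l \<Longrightarrow> bubble m g l t x = (1/l) powr (1/m) * g ((x - t) / l)"
  by (simp add: bubble_def rescale_def diff_divide_distrib)

lemma
  assumes "1 < m" "g \<in> Lp m" "0 < l"
  shows bubble_Lp: "bubble m g l t \<in> Lp m"
    and Lp_pow_bubble: "Lp_pow m (bubble m g l t) = Lp_pow m g"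
  unfolding bubble_def using rescale_Lp[of m g "1/l" "-t/l"] Lp_pow_rescale[of m g "1/l" "-t/l"] assms by auto

lemma abs_sv_le:
  assumes m: "1 < m" and f: "f \<in> Lp m" and B: "Lp_pow m f \<le> B" and l: "0 < l"
  shows "\<bar>sv m f l t\<bar> \<le> 4 * B powr (1/m)"
proof -
  have "\<bar>LINT x:{t-l..t+l}|lborel. f x\<bar> \<le> 2 * ((t + l - (t - l)) powr (1 - 1/m) * Lp_pow m f powr (1/m))"
    using l by (intro Lp_Icc_le[OF m f]) auto
  also have "\<dots> \<le> 2 * ((2 * l) powr (1 - 1/m) * B powr (1/m))"
    using m B l by (intro mult_left_mono mult_mono powr_mono2) auto
  finally have "\<bar>sv m f l t\<bar> \<le> l powr (1/m - 1) * (2 * ((2 * l) powr (1 - 1/m) * B powr (1/m)))"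
    unfolding sv_def abs_mult by (intro mult_mono) auto
  also have "\<dots> = (l powr (1/m - 1) * l powr (1 - 1/m)) * 2 powr (1 - 1/m) * 2 * B powr (1/m)"
    using l by (simp add: powr_mult)
  also have "l powr (1/m - 1) * l powr (1 - 1/m) = 1" using l by (simp flip: powr_add)
  also have "1 * 2 powr (1 - 1/m) * 2 * B powr (1/m) \<le> 1 * 2 powr 1 * 2 * B powr (1/m)"
    using m by (intro mult_right_mono mult_left_mono powr_mono) auto
  finally show ?thesis by simp
qed

lemma sv_diff:
  assumes m: "1 < m" and f: "f \<in> Lp m" and g: "g \<in> Lp m"
  shows "sv m (\<lambda>x. f x - g x) l t = sv m f l t - sv m g l t"
  unfolding sv_def set_integral_diff(2)[OF Lp_Icc_integrable[OF m f] Lp_Icc_integrable[OF m g]]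
  by (rule right_diff_distrib)

lemma sv_sum:
  assumes m: "1 < m" and f: "\<And>k. f k \<in> Lp m"
  shows "sv m (\<lambda>x. \<Sum>k<(N::nat). f k x) l t = (\<Sum>k<N. sv m (f k) l t)"
  using Lp_convex_Icc[where c = "\<lambda>_. 1" and f = f and N = N and u = "t - l" and v = "t + l", OF m f]
  unfolding sv_def by (simp add: sum_distrib_left)

lemma sv_bubble:
  assumes a: "0 < a" and l: "0 < l"
  shows "sv m (bubble m g a s) l t = sv m g (l/a) ((t - s)/a)"
proof -
  have e: "- s/a + 1/a * (t - l) = (t - s)/a - l/a" "- s/a + 1/a * (t + l) = (t - s)/a + l/a"
    by (simp_all add: diff_divide_distrib add_divide_distrib)
  have "l powr (1/m - 1) * (1/a) powr (1/m - 1) = (l/a) powr (1/m - 1)"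
    using a l by (simp flip: powr_mult)
  then show ?thesis
    unfolding sv_def bubble_def using a by (subst rescale_Icc) (simp_all only: e mult.assoc[symmetric], simp)
qed

lemma sv_rescale:
  assumes a: "0 < a" and l: "0 < l"
  shows "sv m (rescale m a s f) (l/a) ((t - s)/a) = sv m f l t"
proof -
  have e: "s + a * ((t - s)/a - l/a) = t - l" "s + a * ((t - s)/a + l/a) = t + l"
    using a by (simp_all add: field_simps)
  have "(l/a) powr (1/m - 1) * a powr (1/m - 1) = l powr (1/m - 1)"
    using a l by (simp flip: powr_mult)
  then show ?thesis
    unfolding sv_def rescale_Icc[OF a] e by (simp only: mult.assoc[symmetric])
qed

section \<open>Decay of the averages of a fixed profile\<close>

definition trunc :: "real \<Rightarrow> (real \<Rightarrow> real) \<Rightarrow> real \<Rightarrow> real" where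
  "trunc R g x = (if \<bar>x\<bar> \<le> R \<and> \<bar>g x\<bar> \<le> R then g x else 0)"

lemma trunc_measurable [measurable]:
  assumes [measurable]: "g \<in> borel_measurable borel"
  shows "trunc R g \<in> borel_measurable borel"
  unfolding trunc_def[abs_def] by measurable

lemma abs_trunc_le: "\<bar>trunc R g x\<bar> \<le> \<bar>g x\<bar>"
  by (simp add: trunc_def)

lemma
  assumes m: "1 < m" and g: "g \<in> Lp m"
  shows trunc_Lp: "trunc R g \<in> Lp m"
    and Lp_pow_trunc_le: "Lp_pow m (trunc R g) \<le> Lp_pow m g"
  using Lp_bound[OF _ g trunc_measurable[OF Lp_measurable[OF g]] abs_trunc_le] m by auto

lemma trunc_tendsto:
  assumes m: "1 < m" and g: "g \<in> Lp m"
  shows "(\<lambda>n. Lp_pow m (\<lambda>x. g x - trunc (real n) g x)) \<longlonglongrightarrow> 0"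
proof -
  note [measurable] = Lp_measurable[OF g]
  have "(\<lambda>n. \<integral>x. \<bar>g x - trunc (real n) g x\<bar> powr m \<partial>lborel) \<longlonglongrightarrow> integral\<^sup>L lborel (\<lambda>x::real. 0)"
  proof (rule integral_dominated_convergence[where w = "\<lambda>x. \<bar>g x\<bar> powr m"])
    show "AE x in lborel. (\<lambda>n. \<bar>g x - trunc (real n) g x\<bar> powr m) \<longlonglongrightarrow> 0"
    proof (rule AE_I2)
      fix x
      obtain N where N: "max \<bar>x\<bar> \<bar>g x\<bar> < real N" using reals_Archimedean2 by blast
      have "\<forall>\<^sub>F n in sequentially. \<bar>g x - trunc (real n) g x\<bar> powr m = 0"
        using eventually_ge_at_top[of N] by eventually_elim (use N in \<open>auto simp: trunc_def\<close>)
      then show "(\<lambda>n. \<bar>g x - trunc (real n) g x\<bar> powr m) \<longlonglongrightarrow> 0" by (rule tendsto_eventually)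
    qed
    show "AE x in lborel. norm (\<bar>g x - trunc (real n) g x\<bar> powr m) \<le> \<bar>g x\<bar> powr m" for n
      by (rule AE_I2) (auto simp: trunc_def)
  qed (use Lp_integrable[OF g] in auto)
  then show ?thesis by (simp add: Lp_pow_def)
qed

lemma LINT_trunc_le:
  assumes g: "g \<in> borel_measurable borel" and R: "0 \<le> R" and l: "0 \<le> l"
  shows "\<bar>LINT x:{t-l..t+l}|lborel. trunc R g x\<bar> \<le> R * measure lborel ({t-l..t+l} \<inter> {-R..R})"
proof -
  note [measurable] = g
  let ?A = "{t-l..t+l} \<inter> {-R..R}"
  have A: "emeasure lborel ?A < \<infinity>"
    by (rule le_less_trans[OF emeasure_mono[of _ "{-R..R}"]]) (auto simp: emeasure_lborel_Icc_eq)
  have iA: "integrable lborel (\<lambda>x. R * indicat_real ?A x)" using A by simp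
  have le: "norm (indicat_real {t-l..t+l} x *\<^sub>R trunc R g x) \<le> R * indicat_real ?A x" for x
    by (auto simp: indicator_def trunc_def abs_le_iff)
  have int: "integrable lborel (\<lambda>x. indicat_real {t-l..t+l} x *\<^sub>R trunc R g x)"
  proof (rule Bochner_Integration.integrable_bound[OF iA])
    show "AE x in lborel. norm (indicat_real {t-l..t+l} x *\<^sub>R trunc R g x) \<le> norm (R * indicat_real ?A x)"
      using le by (intro AE_I2) (metis abs_ge_self order_trans real_norm_def)
  qed measurable
  have "\<bar>LINT x:{t-l..t+l}|lborel. trunc R g x\<bar> \<le> (\<integral>x. norm (indicat_real {t-l..t+l} x *\<^sub>R trunc R g x) \<partial>lborel)"
    unfolding set_lebesgue_integral_def real_norm_def[symmetric] by (rule integral_norm_bound)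
  also have "\<dots> \<le> (\<integral>x. R * indicat_real ?A x \<partial>lborel)"
    by (rule integral_mono[OF integrable_norm[OF int] iA le])
  also have "\<dots> = R * measure lborel ?A" using A by simp
  finally show ?thesis .
qed

lemma Icc_fmeasurable: "{a..b::real} \<in> fmeasurable lborel"
  by (rule fmeasurableI) (simp_all add: emeasure_lborel_Icc_eq)

text \<open>Up to \<open>e / 2\<close> the profile may be replaced by a function bounded by
  \<open>R\<close> and supported in \<open>{-R..R}\<close>. Its average is at most a multiple of
  \<open>l powr (1/m)\<close>, also of \<open>l powr (1/m - 1)\<close>, and vanishes if the interval
  misses the support; so a large average bounds \<open>1 / l\<close>, \<open>l\<close> and
  \<open>\<bar>t\<bar>\<close>.\<close>

lemma sv_decay:
  assumes m: "1 < m" and g: "g \<in> Lp m" and e: "0 < e"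
  shows "\<exists>B. \<forall>l>0. \<forall>t. e \<le> \<bar>sv m g l t\<bar> \<longrightarrow> l + 1 / l + \<bar>t\<bar> \<le> B"
proof -
  \<comment> \<open>Chosen so that the bound \<open>4 * \<delta> powr (1/m)\<close> of
    \<open>abs_sv_le\<close> is \<open>e / 2\<close>.\<close>
  define \<delta> where "\<delta> = (e / 8) powr m"
  have \<delta>: "0 < \<delta>" using e by (simp add: \<delta>_def)
  have \<delta>m: "\<delta> powr (1/m) = e / 8" using e m by (simp add: \<delta>_def powr_powr)
  obtain R0 where R0: "\<And>n. R0 \<le> n \<Longrightarrow> \<bar>Lp_pow m (\<lambda>x. g x - trunc (real n) g x)\<bar> < \<delta>"
    using LIMSEQ_D[OF trunc_tendsto[OF m g] \<delta>] by auto
  define R where "R = real (Suc R0)"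
  have R: "0 < R" by (simp add: R_def)
  define h where "h = trunc R g"
  have h: "h \<in> Lp m" unfolding h_def by (rule trunc_Lp[OF m g])
  have gh: "(\<lambda>x. g x - h x) \<in> Lp m" using m by (intro Lp_diff g h) auto
  have pgh: "Lp_pow m (\<lambda>x. g x - h x) \<le> \<delta>" using R0[of "Suc R0"] by (simp add: h_def R_def abs_less_iff)
  define L where "L = max 1 ((4 * R * R / e) powr (m / (m - 1)))"
  define c where "c = (e / (4 * R)) powr m"
  have c: "0 < c" using e R by (simp add: c_def)
  have "l + 1 / l + \<bar>t\<bar> \<le> L + 1 / c + (R + L)" if l: "0 < l" and le: "e \<le> \<bar>sv m g l t\<bar>" for l t
  proof -
    have "sv m g l t = sv m (\<lambda>x. g x - h x) l t + sv m h l t" unfolding sv_diff[OF m g h] by simp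
    moreover have "\<bar>sv m (\<lambda>x. g x - h x) l t\<bar> \<le> 4 * \<delta> powr (1/m)" by (rule abs_sv_le[OF m gh pgh l])
    ultimately have svh: "e / 2 \<le> \<bar>sv m h l t\<bar>" using le unfolding \<delta>m by linarith
    define M where "M = measure lborel ({t-l..t+l} \<inter> {-R..R})"
    have M: "\<bar>LINT x:{t-l..t+l}|lborel. h x\<bar> \<le> R * M"
      unfolding h_def M_def using R l by (intro LINT_trunc_le Lp_measurable[OF g]) auto
    have "M \<le> measure lborel {t-l..t+l}" unfolding M_def
      by (rule measure_mono_fmeasurable[OF Int_lower1 _ Icc_fmeasurable]) simp
    then have M1: "M \<le> 2 * l" using l by simp
    have "M \<le> measure lborel {-R..R}" unfolding M_def
      by (rule measure_mono_fmeasurable[OF Int_lower2 _ Icc_fmeasurable]) simp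
    then have M2: "M \<le> 2 * R" using R by simp
    have svM: "e / 2 \<le> l powr (1/m - 1) * (R * M)"
    proof -
      have "\<bar>sv m h l t\<bar> = l powr (1/m - 1) * \<bar>LINT x:{t-l..t+l}|lborel. h x\<bar>"
        unfolding sv_def abs_mult by simp
      also have "\<dots> \<le> l powr (1/m - 1) * (R * M)" by (rule mult_left_mono[OF M]) simp
      finally show ?thesis using svh by simp
    qed
    have "0 < M"
    proof (rule ccontr)
      assume "\<not> 0 < M"
      then have "M = 0" unfolding M_def using measure_nonneg[of lborel] by (simp add: order_less_le)
      then show False using svM e by simp
    qed
    then have "{t-l..t+l} \<inter> {-R..R} \<noteq> {}" unfolding M_def by (intro notI) (simp only: measure_empty less_irrefl)
    then obtain x where "x \<in> {t-l..t+l}" "x \<in> {-R..R}" by blast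
    then have t: "\<bar>t\<bar> \<le> R + l" unfolding atLeastAtMost_iff by linarith
    have lc: "c \<le> l"
    proof -
      have "e / 2 \<le> l powr (1/m - 1) * (R * (2 * l))"
        using svM M1 R by (intro order_trans[OF svM] mult_left_mono) auto
      also have "\<dots> = 2 * R * (l powr (1/m - 1) * l powr 1)" using l by simp
      also have "l powr (1/m - 1) * l powr 1 = l powr (1/m)" by (simp only: powr_add[symmetric]) simp
      finally have "e / (4 * R) \<le> l powr (1/m)" using R by (simp add: field_simps)
      then have "c \<le> (l powr (1/m)) powr m" unfolding c_def using e R m by (intro powr_mono2) auto
      then show ?thesis using l m by (simp add: powr_powr)
    qed
    have lL: "l \<le> L"
    proof -
      have "e / 2 \<le> l powr (1/m - 1) * (R * (2 * R))"
        using svM M2 R by (intro order_trans[OF svM] mult_left_mono) auto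
      also have "l powr (1/m - 1) = 1 / l powr (1 - 1/m)" using powr_minus_divide[of l "1 - 1/m"] by simp
      finally have "e / 2 * l powr (1 - 1/m) \<le> R * (2 * R)" using l by (simp add: pos_le_divide_eq)
      then have "l powr (1 - 1/m) \<le> 4 * R * R / e" using e by (simp add: pos_le_divide_eq mult_ac)
      then have "(l powr (1 - 1/m)) powr (m / (m - 1)) \<le> (4 * R * R / e) powr (m / (m - 1))"
        using m by (intro powr_mono2) auto
      moreover have eq1: "(1 - 1/m) * (m / (m - 1)) = 1" using m by (simp add: field_simps)
      ultimately have "l \<le> (4 * R * R / e) powr (m / (m - 1))" unfolding powr_powr eq1 using l by simp
      then show ?thesis unfolding L_def by simp
    qed
    have "1 / l \<le> 1 / c" using lc c l by (intro divide_left_mono) auto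
    then show ?thesis using t lL by linarith
  qed
  then show ?thesis by blast
qed

text \<open>In terms of scale ratios and rescaled shifts relative to the common frame, every term is
  a product of quantities bounded by \<open>B\<close> or \<open>C\<close>. Bounded distance is thus
  an equivalence relation between sequences of frames, at the price of worse constants.\<close>

lemma frame_dist_quasi_trans:
  assumes l: "0 < la" "0 < lb" "0 < lc"
    and B: "frame_dist la ta lb tb \<le> B" and C: "frame_dist la ta lc tc \<le> C"
  shows "frame_dist lb tb lc tc \<le> 2 * B * C + (B + C) * B"
proof -
  define p where "p = la / lb" define p' where "p' = lb / la"
  define q where "q = la / lc" define q' where "q' = lc / la"
  define x where "x = \<bar>ta - tb\<bar> / la" define y where "y = \<bar>ta - tc\<bar> / la"
  have pos: "0 < p" "0 < p'" "0 < q" "0 < q'" "0 \<le> x" "0 \<le> y" using l by (auto simp: p_def p'_def q_def q'_def x_def y_def)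
  have le: "p \<le> B" "p' \<le> B" "x \<le> B" "q \<le> C" "q' \<le> C" "y \<le> C"
    using B C pos unfolding frame_dist_def p_def[symmetric] p'_def[symmetric] q_def[symmetric] q'_def[symmetric] x_def[symmetric] y_def[symmetric]
    by linarith+
  have "lb / lc = p' * q" using l by (simp add: p'_def q_def)
  moreover have "p' * q \<le> B * C" using le pos by (intro mult_mono) auto
  moreover have "lc / lb = p * q'" using l by (simp add: p_def q'_def)
  moreover have "p * q' \<le> B * C" using le pos by (intro mult_mono) auto
  moreover have "\<bar>tb - tc\<bar> / lb \<le> (x + y) * p"
  proof -
    have "\<bar>tb - tc\<bar> \<le> \<bar>ta - tb\<bar> + \<bar>ta - tc\<bar>" by linarith
    then have "\<bar>tb - tc\<bar> / lb \<le> (\<bar>ta - tb\<bar> + \<bar>ta - tc\<bar>) / lb" using l by (intro divide_right_mono) auto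
    also have "\<dots> = (x + y) * p" using l by (simp add: x_def y_def p_def add_divide_distrib[symmetric])
    finally show ?thesis .
  qed
  moreover have "(x + y) * p \<le> (B + C) * B" using le pos by (intro mult_mono) auto
  ultimately show ?thesis unfolding frame_dist_def by linarith
qed

lemma frame_dist_sym_le:
  assumes "0 < la" "0 < lb" "frame_dist la ta lb tb \<le> B"
  shows "frame_dist lb tb la ta \<le> 4 * B + (B + 2) * B"
  using frame_dist_quasi_trans[OF assms(1,2,1,3), of ta 2] assms(1) by (simp add: frame_dist_def)

section \<open>Disjoint cores of orthogonal frames\<close>

definition bset :: "real \<Rightarrow> real \<Rightarrow> real \<Rightarrow> real set" where
  "bset R l t = {t - R * l..t + R * l}"

text \<open>The intervals of the smaller frames are removed, which makes the cores disjoint.\<close>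

definition core :: "real \<Rightarrow> nat \<Rightarrow> (nat \<Rightarrow> real) \<Rightarrow> (nat \<Rightarrow> real) \<Rightarrow> nat \<Rightarrow> real set" where
  "core R J l t j = bset R (l j) (t j) -
     (\<Union>k\<in>{k. k < J \<and> k \<noteq> j \<and> (l k < l j \<or> l k = l j \<and> k < j)}. bset R (l k) (t k))"

lemma bset_borel [measurable]: "bset R l t \<in> sets borel"
  by (simp add: bset_def)

lemma core_borel [measurable]: "core R J l t j \<in> sets borel"
  unfolding core_def by (intro sets.Diff bset_borel sets.finite_UN) auto

lemma core_subset: "core R J l t j \<subseteq> bset R (l j) (t j)"
  unfolding core_def by (rule Diff_subset)

lemma core_disjoint:
  assumes "i < J" "j < J" "i \<noteq> j"
  shows "core R J l t i \<inter> core R J l t j = {}"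
proof (cases "l i < l j \<or> l i = l j \<and> i < j")
  case True
  then have "core R J l t j \<inter> bset R (l i) (t i) = {}" using assms unfolding core_def by blast
  then show ?thesis using core_subset[of R J l t i] by blast
next
  case False
  then have "l j < l i \<or> l j = l i \<and> j < i" using assms by linarith
  then have "core R J l t i \<inter> bset R (l j) (t j) = {}" using assms unfolding core_def by blast
  then show ?thesis using core_subset[of R J l t j] by blast
qed

lemma bset_emeasure: "0 \<le> R \<Longrightarrow> 0 < l \<Longrightarrow> emeasure lborel (bset R l t) = ennreal (2 * R * l)"
  by (simp add: bset_def emeasure_lborel_Icc_eq)

lemma bset_fmeasurable [simp]: "bset R l t \<in> fmeasurable lborel"
  unfolding bset_def by (rule Icc_fmeasurable)

text \<open>If the intervals meet, the ratio \<open>l' / l\<close> and the shift account for at most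
  \<open>1 + 2 * R\<close> of the frame distance, so \<open>l / l'\<close> is at least
  \<open>1 / e\<close>: the smaller interval is negligible at scale \<open>l\<close>.\<close>

lemma bset_overlap:
  assumes R: "0 < R" and e: "0 < e" and l: "0 < l" "0 < l'" "l' \<le> l"
    and d: "1 / e + 2 + 2 * R \<le> frame_dist l t l' t'"
  shows "measure lborel (bset R l t \<inter> bset R l' t') \<le> 2 * R * e * l"
proof (cases "bset R l t \<inter> bset R l' t' = {}")
  case False
  then obtain x where "x \<in> bset R l t" "x \<in> bset R l' t'" by blast
  then have "\<bar>t - t'\<bar> \<le> R * l + R * l'" by (auto simp: bset_def)
  also have "\<dots> \<le> R * l + R * l" using R l by (intro add_left_mono mult_left_mono) auto
  finally have 1: "\<bar>t - t'\<bar> / l \<le> 2 * R" using l by (simp add: field_simps)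
  have 2: "l' / l \<le> 1" using l by simp
  have "1 / e \<le> l / l'" using 1 2 d unfolding frame_dist_def by linarith
  then have "l' \<le> e * l" using e l by (simp add: field_simps)
  then have "2 * R * l' \<le> 2 * R * (e * l)" using R by (intro mult_left_mono) auto
  moreover have "measure lborel (bset R l t \<inter> bset R l' t') \<le> measure lborel (bset R l' t')"
    by (intro measure_mono_fmeasurable) auto
  moreover have "measure lborel (bset R l' t') = 2 * R * l'"
    using R l by (simp add: measure_def bset_emeasure)
  ultimately show ?thesis by (simp add: mult.assoc)
qed (use assms in auto)

text \<open>Only intervals of smaller or equal scale are removed from a core, the case covered by
  \<open>bset_overlap\<close>. There are at most \<open>J\<close> of them, and each overlap is at
  most \<open>2 * R * e\<close> times \<open>l j n\<close>.\<close>

lemma core_measure_tendsto: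
  fixes l t :: "nat \<Rightarrow> nat \<Rightarrow> real"
  assumes R: "0 < R" and l: "\<And>k n. 0 < l k n" and j: "j < J"
    and orth: "\<And>k. k < J \<Longrightarrow> k \<noteq> j \<Longrightarrow> filterlim (\<lambda>n. frame_dist (l j n) (t j n) (l k n) (t k n)) at_top sequentially"
  shows "(\<lambda>n. measure lborel (bset R (l j n) (t j n) - core R J (\<lambda>k. l k n) (\<lambda>k. t k n) j) / l j n) \<longlonglongrightarrow> 0"
proof (rule LIMSEQ_I)
  fix \<epsilon> :: real assume \<epsilon>: "0 < \<epsilon>"
  define e where "e = \<epsilon> / (4 * R * real (Suc J))"
  have e: "0 < e" using \<epsilon> R by (simp add: e_def)
  have "eventually (\<lambda>n. \<forall>k\<in>{..<J} - {j}. 1 / e + 2 + 2 * R \<le> frame_dist (l j n) (t j n) (l k n) (t k n)) sequentially"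
    using orth by (intro eventually_ball_finite) (auto simp: filterlim_at_top)
  then obtain N where N: "\<And>n k. N \<le> n \<Longrightarrow> k < J \<Longrightarrow> k \<noteq> j \<Longrightarrow> 1 / e + 2 + 2 * R \<le> frame_dist (l j n) (t j n) (l k n) (t k n)"
    unfolding eventually_sequentially by auto
  have "norm (measure lborel (bset R (l j n) (t j n) - core R J (\<lambda>k. l k n) (\<lambda>k. t k n) j) / l j n - 0) < \<epsilon>"
    if n: "N \<le> n" for n
  proof -
    define K where "K = {k. k < J \<and> k \<noteq> j \<and> (l k n < l j n \<or> l k n = l j n \<and> k < j)}"
    have K: "K \<subseteq> {..<J}" "finite K" unfolding K_def by auto
    have "bset R (l j n) (t j n) - core R J (\<lambda>k. l k n) (\<lambda>k. t k n) j
      = (\<Union>k\<in>K. bset R (l j n) (t j n) \<inter> bset R (l k n) (t k n))"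
      unfolding core_def K_def by blast
    then have "measure lborel (bset R (l j n) (t j n) - core R J (\<lambda>k. l k n) (\<lambda>k. t k n) j)
      = measure lborel (\<Union>k\<in>K. bset R (l j n) (t j n) \<inter> bset R (l k n) (t k n))" by (rule arg_cong)
    also have "\<dots> \<le> (\<Sum>k\<in>K. measure lborel (bset R (l j n) (t j n) \<inter> bset R (l k n) (t k n)))"
      using K by (intro measure_UNION_le) auto
    also have "\<dots> \<le> (\<Sum>k\<in>K. 2 * R * e * l j n)"
    proof (rule sum_mono)
      fix k assume "k \<in> K"
      then have k: "k < J" "k \<noteq> j" "l k n \<le> l j n" unfolding K_def by auto
      show "measure lborel (bset R (l j n) (t j n) \<inter> bset R (l k n) (t k n)) \<le> 2 * R * e * l j n"
        by (rule bset_overlap[OF R e l l k(3) N[OF n k(1,2)]])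
    qed
    also have "\<dots> = real (card K) * (2 * R * e * l j n)" by simp
    also have "\<dots> \<le> real J * (2 * R * e * l j n)"
    proof -
      have "card K \<le> J" using card_mono[OF _ K(1)] by simp
      then show ?thesis using R e l[of j n] by (intro mult_right_mono) auto
    qed
    finally have "measure lborel (bset R (l j n) (t j n) - core R J (\<lambda>k. l k n) (\<lambda>k. t k n) j) / l j n
      \<le> real J * (2 * R * e)" using l[of j n] by (simp add: field_simps)
    also have "\<dots> = \<epsilon> / 2 * (real J / real (Suc J))"
    proof -
      have "2 * R * e = \<epsilon> / 2 / real (Suc J)" using R unfolding e_def by (simp del: of_nat_Suc)
      then show ?thesis by (simp del: of_nat_Suc)
    qed
    also have "\<dots> \<le> \<epsilon> / 2 * 1" using \<epsilon> by (intro mult_left_mono) auto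
    also have "\<dots> < \<epsilon>" using \<epsilon> by simp
    finally show ?thesis using l[of j n] by simp
  qed
  then show "\<exists>N. \<forall>n\<ge>N. norm (measure lborel (bset R (l j n) (t j n) - core R J (\<lambda>k. l k n) (\<lambda>k. t k n) j) / l j n - 0) < \<epsilon>"
    by blast
qed

section \<open>Almost orthogonality\<close>

lemma Lp_pow_restrict_tendsto:
  assumes m: "1 < m" and g: "g \<in> Lp m"
  shows "(\<lambda>n. Lp_pow m (\<lambda>x. indicator {- real n..real n} x * g x)) \<longlonglongrightarrow> Lp_pow m g"
  unfolding Lp_pow_def
proof (rule integral_dominated_convergence[where w = "\<lambda>x. \<bar>g x\<bar> powr m"])
  note [measurable] = Lp_measurable[OF g]
  show "AE x in lborel. (\<lambda>n. \<bar>indicator {- real n..real n} x * g x\<bar> powr m) \<longlonglongrightarrow> \<bar>g x\<bar> powr m"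
  proof (rule AE_I2)
    fix x
    obtain N where N: "\<bar>x\<bar> < real N" using reals_Archimedean2 by blast
    have "\<forall>\<^sub>F n in sequentially. \<bar>indicator {- real n..real n} x * g x\<bar> powr m = \<bar>g x\<bar> powr m"
      using eventually_ge_at_top[of N]
    proof eventually_elim
      case (elim n)
      then have "x \<in> {- real n..real n}" using N unfolding atLeastAtMost_iff by linarith
      then show ?case by simp
    qed
    then show "(\<lambda>n. \<bar>indicator {- real n..real n} x * g x\<bar> powr m) \<longlonglongrightarrow> \<bar>g x\<bar> powr m" by (rule tendsto_eventually)
  qed
  show "AE x in lborel. norm (\<bar>indicator {- real n..real n} x * g x\<bar> powr m) \<le> \<bar>g x\<bar> powr m" for n
    by (rule AE_I2) (simp add: indicator_def)
  show "(\<lambda>x. \<bar>g x\<bar> powr m) \<in> borel_measurable lborel" by measurable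
  show "(\<lambda>x. \<bar>indicator {- real n..real n} x * g x\<bar> powr m) \<in> borel_measurable lborel" for n by measurable
  show "integrable lborel (\<lambda>x. \<bar>g x\<bar> powr m)" by (rule Lp_integrable[OF g])
qed

lemma LINT_indicator_mult:
  fixes q :: "real \<Rightarrow> real"
  shows "(LINT x:A|lborel. indicator D x * q x) = (LINT x:A \<inter> D|lborel. q x)"
  unfolding set_lebesgue_integral_def by (simp add: indicator_inter_arith mult.assoc)

lemma rescale_indicator:
  "rescale m l t (\<lambda>x. indicator D x * f x) = (\<lambda>x. indicator D (t + l * x) * rescale m l t f x)"
  by (simp add: rescale_def mult_ac)

lemma indicator_bset:
  assumes "0 < l"
  shows "indicator (bset R l t) (t + l * x) = (indicator {- R..R} x :: real)"
proof -
  have "t + l * x \<in> bset R l t \<longleftrightarrow> l * (- R) \<le> l * x \<and> l * x \<le> l * R"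
    by (auto simp: bset_def mult.commute)
  also have "\<dots> \<longleftrightarrow> x \<in> {- R..R}" unfolding mult_le_cancel_left_pos[OF assms] by simp
  finally show ?thesis by (simp add: indicator_def)
qed

text \<open>On the whole interval of the frame, the restriction becomes after rescaling a
  restriction to the fixed \<open>{- R..R}\<close>. By Hoelder's inequality the missing part
  \<open>d n\<close> costs a multiple of
  \<open>(measure lborel (d n) / l j n) powr (1 - 1/m)\<close>, which tends to 0.\<close>

lemma core_weak_limit:
  fixes l t :: "nat \<Rightarrow> nat \<Rightarrow> real"
  assumes m: "1 < m" and f: "\<And>n. f n \<in> Lp m" and B: "\<And>n. Lp_pow m (f n) \<le> B"
    and R: "0 < R" and l: "\<And>k n. 0 < l k n" and j: "j < J"
    and orth: "\<And>k. k < J \<Longrightarrow> k \<noteq> j \<Longrightarrow> filterlim (\<lambda>n. frame_dist (l j n) (t j n) (l k n) (t k n)) at_top sequentially"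
    and weak: "\<And>u v. (\<lambda>n. LINT x:{u..v}|lborel. rescale m (l j n) (t j n) (f n) x) \<longlonglongrightarrow> (LINT x:{u..v}|lborel. g x)"
  shows "(\<lambda>n. LINT x:{u..v}|lborel. rescale m (l j n) (t j n)
      (\<lambda>x. indicator (core R J (\<lambda>k. l k n) (\<lambda>k. t k n) j) x * f n x) x)
    \<longlonglongrightarrow> (LINT x:{u..v}|lborel. indicator {- R..R} x * g x)"
proof -
  define b where "b n = bset R (l j n) (t j n)" for n
  define c where "c n = core R J (\<lambda>k. l k n) (\<lambda>k. t k n) j" for n
  define d where "d n = b n - c n" for n
  have [measurable]: "b n \<in> sets borel" "c n \<in> sets borel" "d n \<in> sets borel" for n
    unfolding b_def c_def d_def by measurable
  have cb: "c n \<subseteq> b n" for n unfolding b_def c_def by (rule core_subset)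
  have ind: "indicator (c n) x = (indicator (b n) x - indicator (d n) x :: real)" for n x
    using cb[of n] by (auto simp: d_def indicator_def)
  have fb: "(\<lambda>x. indicator (b n) x * f n x) \<in> Lp m" and fd: "(\<lambda>x. indicator (d n) x * f n x) \<in> Lp m" for n
    using m f by (intro Lp_indicator; simp)+
  note rb = rescale_Lp[OF m fb l] and rd = rescale_Lp[OF m fd l]
  have split: "(LINT x:{u..v}|lborel. rescale m (l j n) (t j n) (\<lambda>x. indicator (c n) x * f n x) x)
    = (LINT x:{u..v}|lborel. rescale m (l j n) (t j n) (\<lambda>x. indicator (b n) x * f n x) x)
     - (LINT x:{u..v}|lborel. rescale m (l j n) (t j n) (\<lambda>x. indicator (d n) x * f n x) x)" for n
  proof -
    have "rescale m (l j n) (t j n) (\<lambda>x. indicator (c n) x * f n x)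
      = (\<lambda>x. rescale m (l j n) (t j n) (\<lambda>x. indicator (b n) x * f n x) x
          - rescale m (l j n) (t j n) (\<lambda>x. indicator (d n) x * f n x) x)"
      unfolding rescale_def ind by (simp add: left_diff_distrib right_diff_distrib)
    then show ?thesis
      by (simp only:) (rule set_integral_diff(2)[OF Lp_Icc_integrable[OF m rb] Lp_Icc_integrable[OF m rd]])
  qed
  have lim1: "(\<lambda>n. LINT x:{u..v}|lborel. rescale m (l j n) (t j n) (\<lambda>x. indicator (b n) x * f n x) x)
    \<longlonglongrightarrow> (LINT x:{u..v}|lborel. indicator {- R..R} x * g x)"
    unfolding rescale_indicator b_def indicator_bset[OF l] LINT_indicator_mult Int_atLeastAtMost by (rule weak)
  have lim2: "(\<lambda>n. LINT x:{u..v}|lborel. rescale m (l j n) (t j n) (\<lambda>x. indicator (d n) x * f n x) x) \<longlonglongrightarrow> 0"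
  proof (rule Lim_null_comparison)
    show "\<forall>\<^sub>F n in sequentially. norm (LINT x:{u..v}|lborel. rescale m (l j n) (t j n) (\<lambda>x. indicator (d n) x * f n x) x)
      \<le> 2 * ((measure lborel (d n) / l j n) powr (1 - 1/m) * B powr (1/m))"
    proof (rule always_eventually, rule allI)
      fix n
      define I where "I = {t j n + l j n * u..t j n + l j n * v} \<inter> d n"
      have dfm: "d n \<in> fmeasurable lborel" unfolding d_def b_def by (rule fmeasurable_Diff) (simp_all add: c_def)
      have Ib: "I \<in> sets borel" unfolding I_def by measurable
      have "emeasure lborel I \<le> emeasure lborel (d n)" unfolding I_def by (rule emeasure_mono) auto
      also have "\<dots> < \<infinity>" using dfm by (simp add: fmeasurable_def)
      finally have If: "emeasure lborel I < \<infinity>" .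
      have Id: "measure lborel I \<le> measure lborel (d n)"
        unfolding I_def by (rule measure_mono_fmeasurable[OF Int_lower2 _ dfm]) simp
      have ml: "l j n powr (1/m - 1) * measure lborel (d n) powr (1 - 1/m) = (measure lborel (d n) / l j n) powr (1 - 1/m)"
        using l[of j n] powr_minus_divide[of "l j n" "1 - 1/m"] by (simp add: powr_divide)
      have "\<bar>LINT x:I|lborel. f n x\<bar> \<le> 2 * (measure lborel I powr (1 - 1/m) * Lp_pow m (f n) powr (1/m))"
        by (rule Lp_set_integral_le[OF m f Ib If])
      also have "\<dots> \<le> 2 * (measure lborel (d n) powr (1 - 1/m) * B powr (1/m))"
        using m Id B by (intro mult_left_mono mult_mono powr_mono2) auto
      finally have "l j n powr (1/m - 1) * \<bar>LINT x:I|lborel. f n x\<bar>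
        \<le> l j n powr (1/m - 1) * (2 * (measure lborel (d n) powr (1 - 1/m) * B powr (1/m)))"
        by (rule mult_left_mono) simp
      also have "\<dots> = 2 * ((measure lborel (d n) / l j n) powr (1 - 1/m) * B powr (1/m))"
        unfolding ml[symmetric] by (simp only: mult_ac)
      finally show "norm (LINT x:{u..v}|lborel. rescale m (l j n) (t j n) (\<lambda>x. indicator (d n) x * f n x) x)
        \<le> 2 * ((measure lborel (d n) / l j n) powr (1 - 1/m) * B powr (1/m))"
        unfolding rescale_Icc[OF l] LINT_indicator_mult I_def[symmetric] by (simp add: abs_mult)
    qed
    have "(\<lambda>n. measure lborel (d n) / l j n) \<longlonglongrightarrow> 0"
      unfolding d_def b_def c_def by (rule core_measure_tendsto[where l = l and t = t and j = j and J = J and R = R]) (rule R l j orth | assumption)+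
    then have "(\<lambda>n. 2 * ((measure lborel (d n) / l j n) powr (1 - 1/m) * B powr (1/m)))
      \<longlonglongrightarrow> 2 * (0 powr (1 - 1/m) * B powr (1/m))"
      using m l[of j] by (intro tendsto_mult tendsto_const tendsto_powr2) (auto intro!: always_eventually divide_nonneg_pos)
    then show "(\<lambda>n. 2 * ((measure lborel (d n) / l j n) powr (1 - 1/m) * B powr (1/m))) \<longlonglongrightarrow> 0" by simp
  qed
  show ?thesis using tendsto_diff[OF lim1 lim2] unfolding split[symmetric] c_def by simp
qed

theorem Bessel_Lp:
  fixes l t :: "nat \<Rightarrow> nat \<Rightarrow> real"
  assumes m: "1 < m" and f: "\<And>n. f n \<in> Lp m" and B: "\<And>n. Lp_pow m (f n) \<le> B"
    and l: "\<And>k n. 0 < l k n"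
    and orth: "\<And>j k. j \<noteq> k \<Longrightarrow> filterlim (\<lambda>n. frame_dist (l j n) (t j n) (l k n) (t k n)) at_top sequentially"
    and g: "\<And>j. g j \<in> Lp m"
    and weak: "\<And>j u v. (\<lambda>n. LINT x:{u..v}|lborel. rescale m (l j n) (t j n) (f n) x) \<longlonglongrightarrow> (LINT x:{u..v}|lborel. g j x)"
    and E: "(\<lambda>n. Lp_pow m (f n)) \<longlonglongrightarrow> E"
  shows "(\<Sum>j<J. Lp_pow m (g j)) \<le> E"
proof -
  \<comment> \<open>The profiles are first cut to \<open>{- R..R}\<close>, because the cores are
    built from intervals of half-length \<open>R\<close> times the scale; \<open>R\<close> tends to
    infinity only after the limit in \<open>n\<close>.\<close>
  have main: "(\<Sum>j<J. Lp_pow m (\<lambda>x. indicator {- R..R} x * g j x)) \<le> E" if R: "0 < R" for R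
  proof -
    define a where "a j n = Lp_pow m (\<lambda>x. indicator (core R J (\<lambda>k. l k n) (\<lambda>k. t k n) j) x * f n x)" for j n
    have cf: "(\<lambda>x. indicator (core R J (\<lambda>k. l k n) (\<lambda>k. t k n) j) x * f n x) \<in> Lp m" for j n
      using m f by (intro Lp_indicator(1)) auto
    have le: "(\<Sum>j<J. a j n) \<le> Lp_pow m (f n)" for n
    proof -
      define c where "c j = core R J (\<lambda>k. l k n) (\<lambda>k. t k n) j" for j
      have dis: "disjoint_family_on c {..<J}"
        unfolding disjoint_family_on_def c_def using core_disjoint by (metis lessThan_iff)
      have i: "integrable lborel (\<lambda>x. \<bar>indicator (c j) x * f n x\<bar> powr m)" for j
        using Lp_integrable[OF cf[of n j]] by (simp add: c_def)
      have "(\<Sum>j<J. a j n) = (\<integral>x. (\<Sum>j<J. \<bar>indicator (c j) x * f n x\<bar> powr m) \<partial>lborel)"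
        unfolding a_def Lp_pow_def c_def[symmetric] using i by (subst Bochner_Integration.integral_sum) auto
      also have "\<dots> \<le> (\<integral>x. \<bar>f n x\<bar> powr m \<partial>lborel)"
      proof (rule integral_mono)
        fix x
        have "(\<Sum>j<J. \<bar>indicator (c j) x * f n x\<bar> powr m) = (\<Sum>j<J. indicator (c j) x * \<bar>f n x\<bar> powr m)"
          by (rule sum.cong) (auto simp: indicator_def)
        also have "\<dots> = indicator (\<Union>j<J. c j) x * \<bar>f n x\<bar> powr m"
          unfolding sum_distrib_right[symmetric] by (simp add: indicator_UN_disjoint[OF _ dis])
        also have "\<dots> \<le> \<bar>f n x\<bar> powr m" by (simp add: indicator_def)
        finally show "(\<Sum>j<J. \<bar>indicator (c j) x * f n x\<bar> powr m) \<le> \<bar>f n x\<bar> powr m" .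
      qed (use i Lp_integrable[OF f] in auto)
      finally show ?thesis by (simp add: Lp_pow_def)
    qed
    have ev: "eventually (\<lambda>n. Lp_pow m (\<lambda>x. indicator {- R..R} x * g j x) - e \<le> a j n) sequentially" if j: "j < J" and e: "0 < e" for j e
    proof -
      have "eventually (\<lambda>n. Lp_pow m (\<lambda>x. indicator {- R..R} x * g j x) - e
        \<le> Lp_pow m (rescale m (l j n) (t j n) (\<lambda>x. indicator (core R J (\<lambda>k. l k n) (\<lambda>k. t k n) j) x * f n x))) sequentially"
      proof (rule weak_lsc_eventually[OF m _ _ _ _ e])
        show "rescale m (l j n) (t j n) (\<lambda>x. indicator (core R J (\<lambda>k. l k n) (\<lambda>k. t k n) j) x * f n x) \<in> Lp m" for n
          by (rule rescale_Lp[OF m cf l])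
        show "Lp_pow m (rescale m (l j n) (t j n) (\<lambda>x. indicator (core R J (\<lambda>k. l k n) (\<lambda>k. t k n) j) x * f n x)) \<le> B" for n
          unfolding Lp_pow_rescale[OF m cf l] using m f by (intro order_trans[OF Lp_indicator(2) B]) auto
        show "(\<lambda>x. indicator {- R..R} x * g j x) \<in> Lp m" using m g by (intro Lp_indicator(1)) auto
        show "(\<lambda>n. LINT x:{u..v}|lborel. rescale m (l j n) (t j n) (\<lambda>x. indicator (core R J (\<lambda>k. l k n) (\<lambda>k. t k n) j) x * f n x) x)
          \<longlonglongrightarrow> (LINT x:{u..v}|lborel. indicator {- R..R} x * g j x)" for u v
          by (rule core_weak_limit[where l = l and t = t and j = j and J = J and R = R and f = f and g = "g j" and B = B])
              (simp_all add: m f B R l j orth weak)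
      qed
      then show ?thesis unfolding Lp_pow_rescale[OF m cf l] a_def .
    qed
    show ?thesis
    proof (rule field_le_epsilon)
      fix e :: real assume e: "0 < e"
      \<comment> \<open>Lower semicontinuity holds for each profile up to an error; the
        \<open>J\<close> errors together stay within \<open>e\<close>.\<close>
      define e' where "e' = e / real (Suc J)"
      have e': "0 < e'" using e by (simp add: e'_def)
      have "(\<Sum>j<J. Lp_pow m (\<lambda>x. indicator {- R..R} x * g j x) - e') \<le> E"
      proof (rule tendsto_lowerbound[OF E])
        have "eventually (\<lambda>n. \<forall>j\<in>{..<J}. Lp_pow m (\<lambda>x. indicator {- R..R} x * g j x) - e' \<le> a j n) sequentially"
          using ev e' by (intro eventually_ball_finite) auto
        then show "eventually (\<lambda>n. (\<Sum>j<J. Lp_pow m (\<lambda>x. indicator {- R..R} x * g j x) - e') \<le> Lp_pow m (f n)) sequentially"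
        proof eventually_elim
          case (elim n)
          then have "(\<Sum>j<J. Lp_pow m (\<lambda>x. indicator {- R..R} x * g j x) - e') \<le> (\<Sum>j<J. a j n)" by (intro sum_mono) auto
          then show ?case using le[of n] by (rule order_trans)
        qed
      qed simp
      then have "(\<Sum>j<J. Lp_pow m (\<lambda>x. indicator {- R..R} x * g j x)) \<le> E + real J * e'"
        by (simp add: sum_subtractf)
      also have "real J * e' \<le> e"
      proof -
        have "real J * e' \<le> real (Suc J) * e'" using e' by (intro mult_right_mono) auto
        also have "\<dots> = e" by (simp add: e'_def del: of_nat_Suc)
        finally show ?thesis .
      qed
      finally show "(\<Sum>j<J. Lp_pow m (\<lambda>x. indicator {- R..R} x * g j x)) \<le> E + e" by simp
    qed
  qed
  show ?thesis
  proof (rule LIMSEQ_le_const2)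
    show "(\<lambda>n. \<Sum>j<J. Lp_pow m (\<lambda>x. indicator {- real n..real n} x * g j x)) \<longlonglongrightarrow> (\<Sum>j<J. Lp_pow m (g j))"
      by (intro tendsto_sum Lp_pow_restrict_tendsto m g)
    have "(\<Sum>j<J. Lp_pow m (\<lambda>x. indicator {- real n..real n} x * g j x)) \<le> E" if "1 \<le> n" for n
      by (rule main) (use that in simp)
    then show "\<exists>N. \<forall>n\<ge>N. (\<Sum>j<J. Lp_pow m (\<lambda>x. indicator {- real n..real n} x * g j x)) \<le> E" by blast
  qed
qed

text \<open>At each point at most one summand is nonzero.\<close>

lemma sum_disjoint_powr_le:
  fixes y :: "nat \<Rightarrow> real"
  assumes dis: "disjoint_family_on c {..<J}" and m: "0 < m"
  shows "\<bar>\<Sum>j<J. indicator (c j) x * y j\<bar> powr m \<le> (\<Sum>j<J. \<bar>indicator (c j) x * y j\<bar> powr m)"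
proof (cases "\<exists>i<J. x \<in> c i")
  case True
  then obtain i where i: "i < J" "x \<in> c i" by blast
  have z: "indicator (c j) x * y j = 0" if "j \<in> {..<J} - {i}" for j
  proof -
    have "c i \<inter> c j = {}" using dis that i unfolding disjoint_family_on_def by blast
    then show ?thesis using i by (auto simp: indicator_def)
  qed
  have "(\<Sum>j<J. indicator (c j) x * y j) = indicator (c i) x * y i + (\<Sum>j\<in>{..<J} - {i}. indicator (c j) x * y j)"
    using i by (subst sum.remove[of _ i]) auto
  also have "(\<Sum>j\<in>{..<J} - {i}. indicator (c j) x * y j) = 0" by (rule sum.neutral) (use z in blast)
  finally have "\<bar>\<Sum>j<J. indicator (c j) x * y j\<bar> powr m = \<bar>indicator (c i) x * y i\<bar> powr m" by simp
  also have "\<dots> \<le> (\<Sum>j<J. \<bar>indicator (c j) x * y j\<bar> powr m)"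
    using i member_le_sum[of i "{..<J}" "\<lambda>j. \<bar>indicator (c j) x * y j\<bar> powr m"] by simp
  finally show ?thesis .
next
  case False
  then have "(\<Sum>j<J. indicator (c j) x * y j) = 0" by (intro sum.neutral) (simp add: indicator_def)
  then show ?thesis by (simp add: sum_nonneg)
qed

text \<open>The point is a bound with no factor growing with \<open>J\<close>, in contrast to
  \<open>Lp_pow_sum_le\<close>. Truncated bubbles restricted to their cores have additive
  \<open>m\<close>-th powers; off the cores they are controlled by their size and the vanishing
  relative measure, and the truncation errors are small by the choice of \<open>N\<close>. For large
  \<open>n\<close> each of these two errors is at most 1, whence the \<open>+ 2\<close>.\<close>

theorem Lp_pow_sum_bubbles_le:
  fixes l t :: "nat \<Rightarrow> nat \<Rightarrow> real"
  assumes m: "1 < m" and l: "\<And>k n. 0 < l k n"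
    and orth: "\<And>j k. j \<noteq> k \<Longrightarrow> filterlim (\<lambda>n. frame_dist (l j n) (t j n) (l k n) (t k n)) at_top sequentially"
    and g: "\<And>j. g j \<in> Lp m"
  shows "eventually (\<lambda>n. Lp_pow m (\<lambda>x. \<Sum>j<J. bubble m (g j) (l j n) (t j n) x)
    \<le> 4 powr m * ((\<Sum>j<J. Lp_pow m (g j)) + 2)) sequentially"
proof -
  have Jm: "0 \<le> real J powr m" by simp
  have "(\<lambda>N. real J powr m * (\<Sum>j<J. Lp_pow m (\<lambda>x. g j x - trunc (real N) (g j) x))) \<longlonglongrightarrow> real J powr m * (\<Sum>j<J. 0)"
    by (intro tendsto_mult tendsto_const tendsto_sum trunc_tendsto m g)
  \<comment> \<open>The factor \<open>real J powr m\<close> lost in \<open>Lp_pow_sum_le\<close> is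
    compensated by the truncation level, which depends on \<open>J\<close> but not on
    \<open>n\<close>.\<close>
  then have "eventually (\<lambda>N. real J powr m * (\<Sum>j<J. Lp_pow m (\<lambda>x. g j x - trunc (real N) (g j) x)) < 1 \<and> 1 \<le> N) sequentially"
    by (intro eventually_conj order_tendstoD(2)[of _ 0] eventually_ge_at_top) auto
  then obtain N where N: "real J powr m * (\<Sum>j<J. Lp_pow m (\<lambda>x. g j x - trunc (real N) (g j) x)) < 1" "1 \<le> N"
    using eventually_happens by (metis (mono_tags, lifting) sequentially_bot)
  define R where "R = real N"
  have R: "0 < R" using N by (simp add: R_def)
  define h where "h j = trunc R (g j)" for j
  have h: "h j \<in> Lp m" for j unfolding h_def by (rule trunc_Lp[OF m g])
  have gh: "(\<lambda>x. g j x - h j x) \<in> Lp m" for j using m g h by (intro Lp_diff) auto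
  define D where "D j n = bset R (l j n) (t j n) - core R J (\<lambda>k. l k n) (\<lambda>k. t k n) j" for j n
  have D: "D j n \<in> sets borel" "D j n \<in> fmeasurable lborel" for j n
    unfolding D_def by (auto intro: fmeasurable_Diff)
  have "(\<lambda>n. real J powr m * (\<Sum>j<J. R powr m * (measure lborel (D j n) / l j n))) \<longlonglongrightarrow> real J powr m * (\<Sum>j<J. R powr m * 0)"
      proof (intro tendsto_mult tendsto_const tendsto_sum)
    fix j assume "j \<in> {..<J}"
    then show "(\<lambda>n. measure lborel (D j n) / l j n) \<longlonglongrightarrow> 0"
      unfolding D_def by (intro core_measure_tendsto[where l = l and t = t and j = j and J = J and R = R] R l orth) auto
  qed
  then have "eventually (\<lambda>n. real J powr m * (\<Sum>j<J. R powr m * (measure lborel (D j n) / l j n)) < 1) sequentially"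
    by (intro order_tendstoD(2)[of _ 0]) auto
  then show ?thesis
  proof eventually_elim
    case (elim n)
    define c where "c j = core R J (\<lambda>k. l k n) (\<lambda>k. t k n) j" for j
    define b where "b j = bubble m (h j) (l j n) (t j n)" for j
    define b' where "b' j = bubble m (\<lambda>x. g j x - h j x) (l j n) (t j n)" for j
    have [measurable]: "c j \<in> sets borel" for j by (simp add: c_def)
    have bL: "b j \<in> Lp m" and pb: "Lp_pow m (b j) = Lp_pow m (h j)"
      and bL': "b' j \<in> Lp m" and pb': "Lp_pow m (b' j) = Lp_pow m (\<lambda>x. g j x - h j x)" for j
      unfolding b_def b'_def using m h gh l by (simp_all add: bubble_Lp Lp_pow_bubble)
    have supp: "b j x = indicator (c j) x * b j x + indicator (D j n) x * b j x" for j x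
    proof (cases "x \<in> bset R (l j n) (t j n)")
      case True
      then show ?thesis using core_subset[of R J "\<lambda>k. l k n" "\<lambda>k. t k n" j] by (auto simp: c_def D_def indicator_def)
    next
      case False
      have "\<not> \<bar>(x - t j n) / l j n\<bar> \<le> R"
      proof
        assume "\<bar>(x - t j n) / l j n\<bar> \<le> R"
        then have "\<bar>x - t j n\<bar> \<le> R * l j n" using l[of j n] by (simp add: abs_divide pos_divide_le_eq)
        then have "x \<in> bset R (l j n) (t j n)" unfolding bset_def atLeastAtMost_iff by linarith
        then show False using False by simp
      qed
      then have "b j x = 0" using l[of j n] by (simp add: b_def bubble_eq h_def trunc_def)
      then show ?thesis by simp
    qed
    have gb: "bubble m (g j) (l j n) (t j n) x = b j x + b' j x" for j x
      using l[of j n] by (simp add: b_def b'_def bubble_eq right_diff_distrib)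
    define S1 where "S1 = (\<lambda>x. \<Sum>j<J. indicator (c j) x * b j x)"
    define S2 where "S2 = (\<lambda>x. \<Sum>j<J. indicator (D j n) x * b j x)"
    define S3 where "S3 = (\<lambda>x. \<Sum>j<J. b' j x)"
    have eq: "(\<lambda>x. \<Sum>j<J. bubble m (g j) (l j n) (t j n) x) = (\<lambda>x. S1 x + (S2 x + S3 x))"
    proof (rule ext)
      fix x
      have "(\<Sum>j<J. bubble m (g j) (l j n) (t j n) x)
        = (\<Sum>j<J. indicator (c j) x * b j x + (indicator (D j n) x * b j x + b' j x))"
        unfolding gb by (rule sum.cong[OF refl]) (subst supp, simp only: add.assoc)
      then show "(\<Sum>j<J. bubble m (g j) (l j n) (t j n) x) = S1 x + (S2 x + S3 x)"
        by (simp only: sum.distrib S1_def S2_def S3_def)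
    qed
    have m0: "0 \<le> m" using m by simp
    have cb: "(\<lambda>x. indicator (c j) x * b j x) \<in> Lp m" for j by (rule Lp_indicator(1)[OF m0 bL]) simp
    have Db: "(\<lambda>x. indicator (D j n) x * b j x) \<in> Lp m" for j by (rule Lp_indicator(1)[OF m0 bL D(1)])
    have L1: "S1 \<in> Lp m" unfolding S1_def by (intro Lp_sum m0 cb) auto
    have L2: "S2 \<in> Lp m" unfolding S2_def by (intro Lp_sum m0 Db) auto
    have L3: "S3 \<in> Lp m" unfolding S3_def by (intro Lp_sum m0 bL') auto
    have P1: "Lp_pow m S1 \<le> (\<Sum>j<J. Lp_pow m (g j))"
    proof -
      have dis: "disjoint_family_on c {..<J}"
        unfolding disjoint_family_on_def c_def using core_disjoint by (metis lessThan_iff)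
      have "Lp_pow m S1 \<le> (\<integral>x. (\<Sum>j<J. \<bar>indicator (c j) x * b j x\<bar> powr m) \<partial>lborel)"
        unfolding Lp_pow_def
      proof (rule integral_mono[OF Lp_integrable[OF L1]])
        show "integrable lborel (\<lambda>x. \<Sum>j<J. \<bar>indicator (c j) x * b j x\<bar> powr m)"
          using Lp_integrable[OF cb] by (intro Bochner_Integration.integrable_sum)
        show "\<bar>S1 x\<bar> powr m \<le> (\<Sum>j<J. \<bar>indicator (c j) x * b j x\<bar> powr m)" for x
          unfolding S1_def by (rule sum_disjoint_powr_le[OF dis]) (use m in simp)
      qed
      also have "\<dots> = (\<Sum>j<J. Lp_pow m (\<lambda>x. indicator (c j) x * b j x))"
        unfolding Lp_pow_def using Lp_integrable[OF cb] by (intro Bochner_Integration.integral_sum)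
      also have "\<dots> \<le> (\<Sum>j<J. Lp_pow m (g j))"
      proof (rule sum_mono)
        fix j
        have "Lp_pow m (\<lambda>x. indicator (c j) x * b j x) \<le> Lp_pow m (b j)" by (rule Lp_indicator(2)[OF m0 bL]) simp
        also have "\<dots> \<le> Lp_pow m (g j)" unfolding pb h_def by (rule Lp_pow_trunc_le[OF m g])
        finally show "Lp_pow m (\<lambda>x. indicator (c j) x * b j x) \<le> Lp_pow m (g j)" .
      qed
      finally show ?thesis .
    qed
    have P2: "Lp_pow m S2 \<le> 1"
    proof -
      have "Lp_pow m S2 \<le> real (card {..<J}) powr m * (\<Sum>j<J. Lp_pow m (\<lambda>x. indicator (D j n) x * b j x))"
        unfolding S2_def by (rule Lp_pow_sum_le[OF m0 _ Db]) simp
      also have "\<dots> \<le> real J powr m * (\<Sum>j<J. R powr m * (measure lborel (D j n) / l j n))"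
        unfolding card_lessThan
      proof (intro mult_left_mono sum_mono Jm)
        fix j
        have bb: "\<bar>indicator (D j n) x * b j x\<bar> powr m \<le> (R powr m / l j n) * indicator (D j n) x" for x
        proof (cases "x \<in> D j n")
          case True
          have "\<bar>b j x\<bar> \<le> (1 / l j n) powr (1/m) * R"
            using l[of j n] R by (simp add: b_def bubble_eq abs_mult h_def trunc_def mult_left_mono)
          then have "\<bar>b j x\<bar> powr m \<le> ((1 / l j n) powr (1/m) * R) powr m" using m by (intro powr_mono2) auto
          also have "\<dots> = R powr m / l j n" using l[of j n] m R by (simp add: powr_mult powr_powr)
          finally show ?thesis using True by simp
        qed simp
        have iD: "integrable lborel (indicat_real (D j n))" using D(2)[of j n] by (simp add: fmeasurable_def)
        have "Lp_pow m (\<lambda>x. indicator (D j n) x * b j x) \<le> (\<integral>x. (R powr m / l j n) * indicator (D j n) x \<partial>lborel)"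
          unfolding Lp_pow_def by (rule integral_mono[OF Lp_integrable[OF Db] _ bb]) (use iD in simp)
        also have "\<dots> = R powr m * (measure lborel (D j n) / l j n)" using iD by simp
        finally show "Lp_pow m (\<lambda>x. indicator (D j n) x * b j x) \<le> R powr m * (measure lborel (D j n) / l j n)" .
      qed
      finally show ?thesis using elim by simp
    qed
    have P3: "Lp_pow m S3 \<le> 1"
    proof -
      have "Lp_pow m S3 \<le> real (card {..<J}) powr m * (\<Sum>j<J. Lp_pow m (b' j))"
        unfolding S3_def by (rule Lp_pow_sum_le[OF m0 _ bL']) simp
      also have "\<dots> = real J powr m * (\<Sum>j<J. Lp_pow m (\<lambda>x. g j x - trunc (real N) (g j) x))"
        unfolding pb' h_def R_def by simp
      finally show ?thesis using N(1) by simp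
    qed
    have "Lp_pow m (\<lambda>x. S1 x + (S2 x + S3 x)) \<le> 2 powr m * (Lp_pow m S1 + Lp_pow m (\<lambda>x. S2 x + S3 x))"
      by (rule Lp_pow_add_le[OF m0 L1 Lp_add[OF m0 L2 L3]])
    also have "\<dots> \<le> 2 powr m * (Lp_pow m S1 + 2 powr m * (Lp_pow m S2 + Lp_pow m S3))"
      by (intro mult_left_mono add_left_mono Lp_pow_add_le m0 L2 L3) simp
    also have "\<dots> \<le> 2 powr m * (2 powr m * (\<Sum>j<J. Lp_pow m (g j)) + 2 powr m * (1 + 1))"
    proof (intro mult_left_mono add_mono P2 P3)
      have "1 \<le> 2 powr m" using m by (simp add: ge_one_powr_ge_zero)
      then have "1 * Lp_pow m S1 \<le> 2 powr m * (\<Sum>j<J. Lp_pow m (g j))" using P1 by (intro mult_mono) auto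
      then show "Lp_pow m S1 \<le> 2 powr m * (\<Sum>j<J. Lp_pow m (g j))" by simp
    qed auto
    also have "\<dots> = (2 * 2) powr m * ((\<Sum>j<J. Lp_pow m (g j)) + 2)"
      unfolding powr_mult[of 2 2] by (simp add: algebra_simps)
    finally show ?case unfolding eq by simp
  qed
qed

section \<open>Extraction of the profiles\<close>

text \<open>In the coordinates of the bubble's own frame, the frame distance is the quantity
  \<open>l + 1 / l + \<bar>t\<bar>\<close> that \<open>sv_decay\<close> bounds.\<close>

lemma sv_bubble_tendsto_0:
  fixes l' t' a s :: "'i \<Rightarrow> real"
  assumes m: "1 < m" and g: "g \<in> Lp m" and l': "\<And>n. 0 < l' n" and a: "\<And>n. 0 < a n"
    and orth: "filterlim (\<lambda>n. frame_dist (a n) (s n) (l' n) (t' n)) at_top F"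
  shows "((\<lambda>n. sv m (bubble m g (a n) (s n)) (l' n) (t' n)) \<longlongrightarrow> 0) F"
proof (rule tendstoI)
  fix e :: real assume e: "0 < e"
  obtain B where B: "\<And>l t. 0 < l \<Longrightarrow> e \<le> \<bar>sv m g l t\<bar> \<Longrightarrow> l + 1 / l + \<bar>t\<bar> \<le> B"
    using sv_decay[OF m g e] by blast
  have "eventually (\<lambda>n. B + 1 \<le> frame_dist (a n) (s n) (l' n) (t' n)) F"
    using orth unfolding filterlim_at_top by blast
  then show "eventually (\<lambda>n. dist (sv m (bubble m g (a n) (s n)) (l' n) (t' n)) 0 < e) F"
  proof eventually_elim
    case (elim n)
    have eq: "frame_dist (a n) (s n) (l' n) (t' n) = l' n / a n + 1 / (l' n / a n) + \<bar>(t' n - s n) / a n\<bar>"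
      using a[of n] by (simp add: frame_dist_def abs_divide abs_minus_commute)
    have "\<not> e \<le> \<bar>sv m g (l' n / a n) ((t' n - s n) / a n)\<bar>"
      using B[of "l' n / a n" "(t' n - s n) / a n"] l'[of n] a[of n] elim unfolding eq by auto
    then show ?case unfolding sv_bubble[OF a l'] by (simp add: dist_real_def)
  qed
qed

lemma frames_near_trans:
  fixes l t :: "nat \<Rightarrow> nat \<Rightarrow> real" and l' t' :: "nat \<Rightarrow> real"
  assumes l: "\<And>k n. 0 < l k n" "\<And>n. 0 < l' n"
    and nj: "eventually (\<lambda>n. frame_dist (l j n) (t j n) (l' n) (t' n) \<le> B) F"
    and nk: "eventually (\<lambda>n. frame_dist (l k n) (t k n) (l' n) (t' n) \<le> C) F"
  shows "\<exists>B. eventually (\<lambda>n. frame_dist (l j n) (t j n) (l k n) (t k n) \<le> B) F"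
proof -
  define B' where "B' = 4 * B + (B + 2) * B"
  define C' where "C' = 4 * C + (C + 2) * C"
  have "eventually (\<lambda>n. frame_dist (l j n) (t j n) (l k n) (t k n) \<le> 2 * B' * C' + (B' + C') * B') F"
    using nj nk
  proof eventually_elim
    case (elim n)
    have 1: "frame_dist (l' n) (t' n) (l j n) (t j n) \<le> B'" unfolding B'_def by (rule frame_dist_sym_le[OF l(1) l(2) elim(1)])
    have 2: "frame_dist (l' n) (t' n) (l k n) (t k n) \<le> C'" unfolding C'_def by (rule frame_dist_sym_le[OF l(1) l(2) elim(2)])
    show ?case by (rule frame_dist_quasi_trans[OF l(2) l(1) l(1) 1 2])
  qed
  then show ?thesis by blast
qed

lemma not_at_top_and_bounded:
  assumes "F \<noteq> bot" "filterlim x at_top F" "eventually (\<lambda>n. x n \<le> (B::real)) F"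
  shows False
proof -
  have "eventually (\<lambda>n. B + 1 \<le> x n) F" using assms(2) unfolding filterlim_at_top by blast
  with assms(3) have "eventually (\<lambda>n. False) F" by eventually_elim linarith
  then show False using assms(1) by (simp add: trivial_limit_def)
qed

text \<open>By the dichotomy along \<open>U\<close>, failure of divergence means boundedness, and
  boundedness is symmetric up to constants.\<close>

lemma frames_sym:
  assumes U: "ultra U" and l: "\<And>n. 0 < a n" "\<And>n. 0 < b n"
    and orth: "filterlim (\<lambda>n. frame_dist (a n) (s n) (b n) (t n)) at_top U"
  shows "filterlim (\<lambda>n. frame_dist (b n) (t n) (a n) (s n)) at_top U"
proof (rule ccontr)
  assume "\<not> ?thesis"
  then obtain B where "eventually (\<lambda>n. frame_dist (b n) (t n) (a n) (s n) \<le> B) U"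
    using ultra_at_top_or_bounded[OF U] by blast
  then have "eventually (\<lambda>n. frame_dist (a n) (s n) (b n) (t n) \<le> 4 * B + (B + 2) * B) U"
    by eventually_elim (rule frame_dist_sym_le[OF l(2,1)])
  then show False using not_at_top_and_bounded[OF _ orth] U by (simp add: ultra_def)
qed

text \<open>The averages are bounded, so this limit along \<open>U\<close> exists for every sequence
  of frames; heights of different sequences can be compared without passing to a common
  subsequence.\<close>

definition scale_height :: "nat filter \<Rightarrow> real \<Rightarrow> (nat \<Rightarrow> real \<Rightarrow> real) \<Rightarrow> (nat \<Rightarrow> real) \<Rightarrow> (nat \<Rightarrow> real) \<Rightarrow> real" where
  "scale_height U m f l t = Lim U (\<lambda>n. \<bar>sv m (f n) (l n) (t n)\<bar>)"

lemma scale_height: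
  assumes U: "ultra U" and m: "1 < m" and f: "\<And>n. f n \<in> Lp m" and B: "\<And>n. Lp_pow m (f n) \<le> B" and l: "\<And>n. 0 < l n"
  shows "((\<lambda>n. \<bar>sv m (f n) (l n) (t n)\<bar>) \<longlongrightarrow> scale_height U m f l t) U"
    and "0 \<le> scale_height U m f l t" "scale_height U m f l t \<le> 4 * B powr (1/m)"
proof -
  have "eventually (\<lambda>n. 0 \<le> \<bar>sv m (f n) (l n) (t n)\<bar> \<and> \<bar>sv m (f n) (l n) (t n)\<bar> \<le> 4 * B powr (1/m)) U"
    by (intro always_eventually allI conjI abs_ge_zero abs_sv_le[OF m f B l])
  from ultra_bounded_tendsto[OF U this]
  obtain L where L: "L \<in> {0..4 * B powr (1/m)}" "((\<lambda>n. \<bar>sv m (f n) (l n) (t n)\<bar>) \<longlongrightarrow> L) U" by blast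
  have "scale_height U m f l t = L" unfolding scale_height_def using U L(2) by (intro tendsto_Lim) (simp_all add: ultra_def)
  then show "((\<lambda>n. \<bar>sv m (f n) (l n) (t n)\<bar>) \<longlongrightarrow> scale_height U m f l t) U"
    "0 \<le> scale_height U m f l t" "scale_height U m f l t \<le> 4 * B powr (1/m)" using L by auto
qed

text \<open>Among the frames orthogonal to the previous ones, each new frame is chosen with at least
  half of the largest possible height.\<close>

lemma ex_greedy_frames:
  assumes U: "ultra U" and m: "1 < m" and f: "\<And>n. f n \<in> Lp m" and B: "\<And>n. Lp_pow m (f n) \<le> B"
  shows "\<exists>l t :: nat \<Rightarrow> nat \<Rightarrow> real. (\<forall>k n. 0 < l k n) \<and>
    (\<forall>j k. j \<noteq> k \<longrightarrow> filterlim (\<lambda>n. frame_dist (l j n) (t j n) (l k n) (t k n)) at_top U) \<and>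
    (\<forall>J l' t'. (\<forall>n. 0 < l' n) \<longrightarrow>
       (\<forall>k<J. filterlim (\<lambda>n. frame_dist (l k n) (t k n) (l' n) (t' n)) at_top U) \<longrightarrow>
       scale_height U m f l' t' \<le> 2 * scale_height U m f (l J) (t J))"
proof -
  define ok where "ok Fr J G \<longleftrightarrow> (\<forall>n. 0 < fst G n) \<and>
      (\<forall>k<J. filterlim (\<lambda>n. frame_dist (fst (Fr k) n) (snd (Fr k) n) (fst G n) (snd G n)) at_top U)"
    for Fr :: "nat \<Rightarrow> (nat \<Rightarrow> real) \<times> (nat \<Rightarrow> real)" and J :: nat and G
  define h where "h G = scale_height U m f (fst G) (snd G)" for G
  have "\<exists>Fr. \<forall>J. ok Fr J (Fr J) \<and> (\<forall>G. ok Fr J G \<longrightarrow> h G \<le> 2 * h (Fr J))"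
  proof (rule dependent_wf_choice[OF wf_less_than])
    \<comment> \<open>The recursion is well founded because admissibility at \<open>J\<close>
      depends only on the frames before \<open>J\<close>.\<close>
    show "(ok Fr J G \<and> (\<forall>H. ok Fr J H \<longrightarrow> h H \<le> 2 * h G)) = (ok Fr' J G \<and> (\<forall>H. ok Fr' J H \<longrightarrow> h H \<le> 2 * h G))"
      if eq: "\<And>z. (z, J) \<in> less_than \<Longrightarrow> Fr z = Fr' z" for Fr Fr' J G
    proof -
      have "ok Fr J H = ok Fr' J H" for H unfolding ok_def using eq by simp
      then show ?thesis by simp
    qed
  next
    fix J :: nat and Fr :: "nat \<Rightarrow> (nat \<Rightarrow> real) \<times> (nat \<Rightarrow> real)"
    assume prev: "\<And>k. (k, J) \<in> less_than \<Longrightarrow> ok Fr k (Fr k) \<and> (\<forall>G. ok Fr k G \<longrightarrow> h G \<le> 2 * h (Fr k))"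
    have pos: "0 < fst (Fr k) n" if "k < J" for k n using prev[of k] that by (simp add: ok_def)
    \<comment> \<open>Admissible frames exist: take scale 1 and a centre whose distance from every
      earlier centre is at least \<open>n\<close> times the scale there.\<close>
    define t0 where "t0 n = (\<Sum>k<J. \<bar>snd (Fr k) n\<bar>) + real n * (1 + (\<Sum>k<J. fst (Fr k) n))" for n
    have "ok Fr J (\<lambda>n. 1, t0)"
      unfolding ok_def
    proof (intro conjI allI impI)
      fix k assume k: "k < J"
      show "filterlim (\<lambda>n. frame_dist (fst (Fr k) n) (snd (Fr k) n) (fst (\<lambda>n. 1, t0) n) (snd (\<lambda>n. 1, t0) n)) at_top U"
      proof (rule filterlim_at_top_mono)
        have "filterlim real at_top sequentially" by (rule filterlim_real_sequentially)
        then show "filterlim real at_top U" using U by (auto simp: ultra_def intro: filterlim_mono)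
        show "eventually (\<lambda>n. real n \<le> frame_dist (fst (Fr k) n) (snd (Fr k) n) (fst (\<lambda>n. 1, t0) n) (snd (\<lambda>n. 1, t0) n)) U"
        proof (rule always_eventually, rule allI)
          fix n
          define a where "a = fst (Fr k) n" define s where "s = snd (Fr k) n"
          have a: "0 < a" unfolding a_def by (rule pos[OF k])
          have 1: "\<bar>s\<bar> \<le> (\<Sum>k<J. \<bar>snd (Fr k) n\<bar>)" unfolding s_def using k by (intro member_le_sum[of k "{..<J}" "\<lambda>k. \<bar>snd (Fr k) n\<bar>"]) auto
          have "a \<le> (\<Sum>k<J. fst (Fr k) n)" unfolding a_def using k pos by (intro member_le_sum[of k "{..<J}" "\<lambda>k. fst (Fr k) n"]) (auto intro: less_imp_le)
          then have "real n * a \<le> real n * (1 + (\<Sum>k<J. fst (Fr k) n))" by (intro mult_left_mono) auto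
          then have "real n * a \<le> t0 n - s" using 1 unfolding t0_def by linarith
          then have "real n * a \<le> \<bar>s - t0 n\<bar>" by linarith
          then have "real n \<le> \<bar>s - t0 n\<bar> / a" using a by (simp add: pos_le_divide_eq)
          then show "real n \<le> frame_dist (fst (Fr k) n) (snd (Fr k) n) (fst (\<lambda>n. 1, t0) n) (snd (\<lambda>n. 1, t0) n)"
            unfolding frame_dist_def a_def[symmetric] s_def[symmetric] using a by (simp add: add_increasing)
        qed
      qed
    qed simp
    then have ne: "{G. ok Fr J G} \<noteq> {}" by blast
    have hb: "0 \<le> h G" "h G \<le> 4 * B powr (1/m)" if "ok Fr J G" for G
      using scale_height(2,3)[where l = "fst G" and t = "snd G" and f = f, OF U m f B] that unfolding h_def ok_def by blast+
    define S where "S = Sup (h ` {G. ok Fr J G})"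
    have bdd: "bdd_above (h ` {G. ok Fr J G})" using hb(2) by (intro bdd_aboveI2[of _ _ "4 * B powr (1/m)"]) simp
    have hS: "h G \<le> S" if "ok Fr J G" for G unfolding S_def using that by (intro cSUP_upper bdd) simp
    \<comment> \<open>If the supremum is not positive, half of it is not strictly below it; any
      admissible frame then works, as heights are nonnegative.\<close>
    have "\<exists>G. ok Fr J G \<and> S \<le> 2 * h G"
    proof (cases "S \<le> 0")
      case True
      then obtain G where "ok Fr J G" using ne by blast
      then show ?thesis using True hb(1)[of G] by (intro exI[of _ G]) simp
    next
      case False
      then have "S / 2 < S" by simp
      then have "\<exists>G\<in>{G. ok Fr J G}. S / 2 < h G"
        using less_cSUP_iff[OF ne bdd, of "S / 2"] unfolding S_def[symmetric] by (rule iffD1[rotated])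
      then obtain G where "ok Fr J G" "S / 2 < h G" by blast
      then show ?thesis by (intro exI[of _ G]) simp
    qed
    then obtain G where G: "ok Fr J G" "S \<le> 2 * h G" by blast
    show "\<exists>G. ok Fr J G \<and> (\<forall>H. ok Fr J H \<longrightarrow> h H \<le> 2 * h G)"
      using G hS order_trans by (intro exI[of _ G]) blast
  qed
  then obtain Fr where Fr: "\<And>J. ok Fr J (Fr J)" "\<And>J G. ok Fr J G \<Longrightarrow> h G \<le> 2 * h (Fr J)" by blast
  define l where "l k = fst (Fr k)" for k
  define t where "t k = snd (Fr k)" for k
  have l: "0 < l k n" for k n using Fr(1)[of k] unfolding ok_def l_def by blast
  have lt: "filterlim (\<lambda>n. frame_dist (l j n) (t j n) (l k n) (t k n)) at_top U" if "j < k" for j k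
    using Fr(1)[of k] that unfolding ok_def l_def t_def by blast
  show ?thesis
  proof (rule exI[of _ l], rule exI[of _ t], intro conjI allI impI)
    show "0 < l k n" for k n by (rule l)
    show "filterlim (\<lambda>n. frame_dist (l j n) (t j n) (l k n) (t k n)) at_top U" if "j \<noteq> k" for j k
    proof (cases "j < k")
      case False
      then have "k < j" using that by simp
      from frames_sym[OF U l l lt[OF this]] show ?thesis .
    qed (rule lt)
    fix J l' t'
    assume "\<forall>n. 0 < l' n" "\<forall>k<J. filterlim (\<lambda>n. frame_dist (l k n) (t k n) (l' n) (t' n)) at_top U"
    then have "ok Fr J (l', t')" unfolding ok_def l_def t_def by simp
    from Fr(2)[OF this] show "scale_height U m f l' t' \<le> 2 * scale_height U m f (l J) (t J)"
      unfolding h_def l_def t_def by simp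
  qed
qed

text \<open>Scales and centres stay in a compact set, so they converge along \<open>U\<close> to
  some \<open>r > 0\<close> and \<open>q\<close>. The moving integrals are compared with those over
  the fixed \<open>{q - r..q + r}\<close> by Hoelder continuity in the end points.\<close>

lemma sv_moving_tendsto_0:
  fixes \<rho> c :: "nat \<Rightarrow> real"
  assumes U: "ultra U" and m: "1 < m" and d: "\<And>n. d n \<in> Lp m" and D: "\<And>n. Lp_pow m (d n) \<le> D"
    and weak: "\<And>u v. ((\<lambda>n. LINT x:{u..v}|lborel. d n x) \<longlongrightarrow> 0) U"
    and \<rho>: "\<And>n. 0 < \<rho> n" and near: "eventually (\<lambda>n. \<rho> n + 1 / \<rho> n + \<bar>c n\<bar> \<le> K) U"
  shows "((\<lambda>n. sv m (d n) (\<rho> n) (c n)) \<longlongrightarrow> 0) U"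
proof -
  have Ub: "U \<noteq> bot" using U by (simp add: ultra_def)
  have K: "0 < K"
  proof -
    obtain n where "\<rho> n + 1 / \<rho> n + \<bar>c n\<bar> \<le> K" using eventually_happens'[OF Ub near] by blast
    moreover have "0 < \<rho> n" "0 < 1 / \<rho> n" "0 \<le> \<bar>c n\<bar>" using \<rho>[of n] by auto
    ultimately show ?thesis by linarith
  qed
  have *: "(1 / K \<le> \<rho> n \<and> \<rho> n \<le> K) \<and> (- K \<le> c n \<and> c n \<le> K)" if e: "\<rho> n + 1 / \<rho> n + \<bar>c n\<bar> \<le> K" for n
  proof -
    have p: "0 < \<rho> n" "0 < 1 / \<rho> n" using \<rho>[of n] by auto
    have "1 / \<rho> n \<le> K" using e p by linarith
    then have "1 \<le> K * \<rho> n" using \<rho>[of n] by (simp add: pos_divide_le_eq)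
    then have "1 / K \<le> \<rho> n" using K by (simp add: pos_divide_le_eq mult.commute)
    moreover have "\<rho> n \<le> K" using e p by linarith
    moreover have "- K \<le> c n" "c n \<le> K" using e p by linarith+
    ultimately show ?thesis by blast
  qed
  have b\<rho>: "eventually (\<lambda>n. 1 / K \<le> \<rho> n \<and> \<rho> n \<le> K) U" and bc: "eventually (\<lambda>n. - K \<le> c n \<and> c n \<le> K) U"
    by (rule eventually_mono[OF near], use * in blast)+
  obtain r where r: "r \<in> {1 / K..K}" "(\<rho> \<longlongrightarrow> r) U" using ultra_bounded_tendsto[OF U b\<rho>] by blast
  obtain q where q: "q \<in> {- K..K}" "(c \<longlongrightarrow> q) U" using ultra_bounded_tendsto[OF U bc] by blast
  have r0: "0 < r" using r(1) K by (meson atLeastAtMost_iff less_le_trans zero_less_divide_1_iff)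
  define H where "H n = 2 * D powr (1/m) * (\<bar>(c n - \<rho> n) - (q - r)\<bar> powr (1 - 1/m) + \<bar>(c n + \<rho> n) - (q + r)\<bar> powr (1 - 1/m))" for n
  have z1: "((\<lambda>n. \<bar>(c n - \<rho> n) - (q - r)\<bar>) \<longlongrightarrow> 0) U"
    using tendsto_diff[OF tendsto_diff[OF q(2) r(2)] tendsto_const[of "q - r"]] by (intro tendsto_rabs_zero) simp
  have z2: "((\<lambda>n. \<bar>(c n + \<rho> n) - (q + r)\<bar>) \<longlongrightarrow> 0) U"
    using tendsto_diff[OF tendsto_add[OF q(2) r(2)] tendsto_const[of "q + r"]] by (intro tendsto_rabs_zero) simp
  have "(H \<longlongrightarrow> 2 * D powr (1/m) * (0 powr (1 - 1/m) + 0 powr (1 - 1/m))) U"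
    unfolding H_def using m by (intro tendsto_mult tendsto_add tendsto_const tendsto_powr2 z1 z2) auto
  then have H0: "(H \<longlongrightarrow> 0) U" by simp
  have lim0: "((\<lambda>n. LINT x:{c n - \<rho> n..c n + \<rho> n}|lborel. d n x) \<longlongrightarrow> 0) U"
  proof (rule Lim_null_comparison)
    show "eventually (\<lambda>n. norm (LINT x:{c n - \<rho> n..c n + \<rho> n}|lborel. d n x)
       \<le> H n + \<bar>LINT x:{q - r..q + r}|lborel. d n x\<bar>) U"
    proof (rule always_eventually, rule allI)
      fix n
      have "\<bar>(LINT x:{c n - \<rho> n..c n + \<rho> n}|lborel. d n x) - (LINT x:{q - r..q + r}|lborel. d n x)\<bar> \<le> H n"
        unfolding H_def using r0 \<rho>[of n] by (intro LINT_Icc_diff_le[OF m d D]) auto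
      then show "norm (LINT x:{c n - \<rho> n..c n + \<rho> n}|lborel. d n x) \<le> H n + \<bar>LINT x:{q - r..q + r}|lborel. d n x\<bar>"
        unfolding real_norm_def by linarith
    qed
    show "((\<lambda>n. H n + \<bar>LINT x:{q - r..q + r}|lborel. d n x\<bar>) \<longlongrightarrow> 0) U"
      using tendsto_add[OF H0 tendsto_rabs_zero[OF weak]] by simp
  qed
  have "((\<lambda>n. \<rho> n powr (1/m - 1)) \<longlongrightarrow> r powr (1/m - 1)) U"
    using r0 by (intro tendsto_powr r(2) tendsto_const) simp
  from tendsto_mult[OF this lim0] show ?thesis unfolding sv_def by simp
qed

text \<open>Otherwise there are frames in which the remainder has a large average. If they are far
  from all \<open>J\<close> chosen frames, the bubbles contribute nothing in the limit and the
  greedy bound \<open>\<kappa>\<close> is violated. If they are close to one chosen frame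
  \<open>j\<close>, they are far from all others, and in the coordinates of \<open>j\<close> the
  function \<open>f\<close> minus bubble \<open>j\<close> converges weakly to 0.\<close>

theorem remainder_height_small:
  fixes l t :: "nat \<Rightarrow> nat \<Rightarrow> real"
  assumes U: "ultra U" and m: "1 < m" and f: "\<And>n. f n \<in> Lp m" and B: "\<And>n. Lp_pow m (f n) \<le> B"
    and l: "\<And>k n. 0 < l k n"
    and orth: "\<And>j k. j \<noteq> k \<Longrightarrow> filterlim (\<lambda>n. frame_dist (l j n) (t j n) (l k n) (t k n)) at_top U"
    and g: "\<And>j. g j \<in> Lp m"
    and weak: "\<And>j u v. ((\<lambda>n. LINT x:{u..v}|lborel. rescale m (l j n) (t j n) (f n) x) \<longlongrightarrow> (LINT x:{u..v}|lborel. g j x)) U"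
    and greedy: "\<And>l' t'. (\<And>n. 0 < l' n) \<Longrightarrow>
       (\<And>k. k < J \<Longrightarrow> filterlim (\<lambda>n. frame_dist (l k n) (t k n) (l' n) (t' n)) at_top U) \<Longrightarrow> scale_height U m f l' t' \<le> \<kappa>"
    and \<delta>: "\<kappa> < \<delta>" "0 < \<delta>"
  shows "eventually (\<lambda>n. \<forall>l'>0. \<forall>t'. \<bar>sv m (\<lambda>x. f n x - (\<Sum>j<J. bubble m (g j) (l j n) (t j n) x)) l' t'\<bar> \<le> \<delta>) U"
proof (rule ccontr)
  define r where "r n x = f n x - (\<Sum>j<J. bubble m (g j) (l j n) (t j n) x)" for n x
  define b where "b j n = bubble m (g j) (l j n) (t j n)" for j n
  have Ub: "U \<noteq> bot" using U by (simp add: ultra_def)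
  have bL: "b j n \<in> Lp m" for j n unfolding b_def using m g l by (simp add: bubble_Lp)
  have sb: "(\<lambda>x. \<Sum>j<J. b j n x) \<in> Lp m" for n using m bL by (intro Lp_sum) auto
  have svr: "sv m (r n) l' t' = sv m (f n) l' t' - (\<Sum>j<J. sv m (b j n) l' t')" for n l' t'
    unfolding r_def b_def[symmetric] sv_diff[OF m f sb] sv_sum[of m "\<lambda>j. b j n", OF m bL] ..
  assume "\<not> ?thesis"
  then have ev: "eventually (\<lambda>n. \<not> (\<forall>l'>0. \<forall>t'. \<bar>sv m (r n) l' t'\<bar> \<le> \<delta>)) U"
    unfolding r_def[abs_def] by (rule ultra_not_eventually[OF U])
  define bad where "bad n p \<longleftrightarrow> 0 < fst p \<and> \<delta> < \<bar>sv m (r n) (fst p) (snd p)\<bar>" for n and p :: "real \<times> real"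
  \<comment> \<open>A frame is needed at every \<open>n\<close>; the default \<open>(1, 0)\<close>
    has positive scale and is taken only where no bad frame exists.\<close>
  define p where "p n = (if \<exists>p. bad n p then SOME p. bad n p else (1, 0))" for n
  define l' where "l' n = fst (p n)" for n
  define t' where "t' n = snd (p n)" for n
  have pb: "bad n (p n)" if "bad n q" for n q
  proof -
    have "\<exists>p. bad n p" using that by blast
    then have "p n = (SOME p. bad n p)" unfolding p_def by (rule if_P)
    then show ?thesis using someI[of "bad n", OF that] by simp
  qed
  have l': "0 < l' n" for n
  proof (cases "\<exists>q. bad n q")
    case True
    then show ?thesis using pb unfolding l'_def bad_def by blast
  qed (simp add: l'_def p_def)
  have evb: "eventually (\<lambda>n. \<delta> \<le> \<bar>sv m (r n) (l' n) (t' n)\<bar>) U"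
    using ev
  proof eventually_elim
    case (elim n)
    then obtain x y where "0 < x" "\<delta> < \<bar>sv m (r n) x y\<bar>" by (auto simp: not_le)
    then have "bad n (x, y)" by (simp add: bad_def)
    from pb[OF this] show ?case unfolding bad_def l'_def t'_def by simp
  qed
  have far: "((\<lambda>n. sv m (b k n) (l' n) (t' n)) \<longlongrightarrow> 0) U"
    if "filterlim (\<lambda>n. frame_dist (l k n) (t k n) (l' n) (t' n)) at_top U" for k
    unfolding b_def by (rule sv_bubble_tendsto_0[OF m g l' l that])
  show False
  proof (cases "\<forall>k<J. filterlim (\<lambda>n. frame_dist (l k n) (t k n) (l' n) (t' n)) at_top U")
    case True
    have "((\<lambda>n. \<Sum>j<J. sv m (b j n) (l' n) (t' n)) \<longlongrightarrow> (\<Sum>j<J. 0)) U"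
      using True by (intro tendsto_sum far) simp
    then have s0: "((\<lambda>n. \<bar>\<Sum>j<J. sv m (b j n) (l' n) (t' n)\<bar>) \<longlongrightarrow> 0) U" by (intro tendsto_rabs_zero) simp
    have "\<delta> \<le> scale_height U m f l' t' + 0"
    proof (rule tendsto_lowerbound)
      show "((\<lambda>n. \<bar>sv m (f n) (l' n) (t' n)\<bar> + \<bar>\<Sum>j<J. sv m (b j n) (l' n) (t' n)\<bar>) \<longlongrightarrow> scale_height U m f l' t' + 0) U"
        by (rule tendsto_add[OF scale_height(1)[OF U m f B l'] s0])
      show "eventually (\<lambda>n. \<delta> \<le> \<bar>sv m (f n) (l' n) (t' n)\<bar> + \<bar>\<Sum>j<J. sv m (b j n) (l' n) (t' n)\<bar>) U"
        using evb by eventually_elim (unfold svr, linarith)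
    qed (rule Ub)
    moreover have "scale_height U m f l' t' \<le> \<kappa>" using True by (intro greedy l') auto
    ultimately show False using \<delta> by simp
  next
    case False
    then obtain j where j: "j < J" "\<not> filterlim (\<lambda>n. frame_dist (l j n) (t j n) (l' n) (t' n)) at_top U" by blast
    obtain K where K: "eventually (\<lambda>n. frame_dist (l j n) (t j n) (l' n) (t' n) \<le> K) U"
      using ultra_at_top_or_bounded[OF U] j(2) by blast
    \<comment> \<open>Closeness to two chosen frames would bring these within bounded distance of
      each other, against orthogonality.\<close>
    have other: "filterlim (\<lambda>n. frame_dist (l k n) (t k n) (l' n) (t' n)) at_top U" if "k \<noteq> j" for k
    proof (rule ccontr)
      assume "\<not> ?thesis"
      then obtain C where C: "eventually (\<lambda>n. frame_dist (l k n) (t k n) (l' n) (t' n) \<le> C) U"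
        using ultra_at_top_or_bounded[OF U] by blast
      obtain D where "eventually (\<lambda>n. frame_dist (l k n) (t k n) (l j n) (t j n) \<le> D) U"
        using frames_near_trans[OF l l' C K] by blast
      then show False using not_at_top_and_bounded[OF Ub orth[OF that]] by blast
    qed
    define d where "d n x = rescale m (l j n) (t j n) (f n) x - g j x" for n x
    note rf = rescale_Lp[OF m f l]
    have d: "d n \<in> Lp m" for n unfolding d_def using m rf g by (intro Lp_diff) auto
    have dD: "Lp_pow m (d n) \<le> 2 powr m * (B + Lp_pow m (g j))" for n
    proof -
      have "Lp_pow m (d n) \<le> 2 powr m * (Lp_pow m (rescale m (l j n) (t j n) (f n)) + Lp_pow m (g j))"
        unfolding d_def using m by (intro Lp_pow_diff_le rf g) simp
      also have "\<dots> \<le> 2 powr m * (B + Lp_pow m (g j))"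
        unfolding Lp_pow_rescale[OF m f l] by (intro mult_left_mono add_right_mono B) simp
      finally show ?thesis .
    qed
    have dw: "((\<lambda>n. LINT x:{u..v}|lborel. d n x) \<longlongrightarrow> 0) U" for u v
    proof -
      have "((\<lambda>n. (LINT x:{u..v}|lborel. rescale m (l j n) (t j n) (f n) x) - (LINT x:{u..v}|lborel. g j x)) \<longlongrightarrow> 0) U"
        using tendsto_diff[OF weak[where j = j and u = u and v = v] tendsto_const[of "LINT x:{u..v}|lborel. g j x"]] by simp
      then show ?thesis unfolding d_def set_integral_diff(2)[OF Lp_Icc_integrable[OF m rf] Lp_Icc_integrable[OF m g]] .
    qed
    define \<rho> where "\<rho> n = l' n / l j n" for n
    define c where "c n = (t' n - t j n) / l j n" for n
    have \<rho>: "0 < \<rho> n" for n unfolding \<rho>_def using l' l by simp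
    have "eventually (\<lambda>n. \<rho> n + 1 / \<rho> n + \<bar>c n\<bar> \<le> K) U"
      using K
    proof eventually_elim
      case (elim n)
      then show ?case using l[of j n] by (simp add: frame_dist_def \<rho>_def c_def abs_divide abs_minus_commute)
    qed
    then have dz: "((\<lambda>n. sv m (d n) (\<rho> n) (c n)) \<longlongrightarrow> 0) U"
      by (rule sv_moving_tendsto_0[OF U m d dD dw \<rho>])
    have deq: "sv m (d n) (\<rho> n) (c n) = sv m (f n) (l' n) (t' n) - sv m (b j n) (l' n) (t' n)" for n
      unfolding d_def \<rho>_def c_def b_def sv_diff[OF m rf g] sv_rescale[OF l l'] sv_bubble[OF l l'] ..
    have "((\<lambda>n. \<Sum>k\<in>{..<J} - {j}. sv m (b k n) (l' n) (t' n)) \<longlongrightarrow> (\<Sum>k\<in>{..<J} - {j}. 0)) U"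
      by (intro tendsto_sum far other) simp
    from tendsto_diff[OF dz this]
    have "((\<lambda>n. sv m (d n) (\<rho> n) (c n) - (\<Sum>k\<in>{..<J} - {j}. sv m (b k n) (l' n) (t' n))) \<longlongrightarrow> 0) U" by simp
    moreover have "sv m (r n) (l' n) (t' n) = sv m (d n) (\<rho> n) (c n) - (\<Sum>k\<in>{..<J} - {j}. sv m (b k n) (l' n) (t' n))" for n
    proof -
      have "(\<Sum>k<J. sv m (b k n) (l' n) (t' n)) = sv m (b j n) (l' n) (t' n) + (\<Sum>k\<in>{..<J} - {j}. sv m (b k n) (l' n) (t' n))"
        using j(1) by (intro sum.remove) auto
      then show ?thesis unfolding svr deq by linarith
    qed
    ultimately have "((\<lambda>n. sv m (r n) (l' n) (t' n)) \<longlongrightarrow> 0) U" by (simp only:)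
    from tendstoD[OF this \<delta>(2)] have "eventually (\<lambda>n. \<bar>sv m (r n) (l' n) (t' n)\<bar> < \<delta>) U"
      by (simp add: dist_real_def)
    with evb have "eventually (\<lambda>n. False) U" by eventually_elim linarith
    then show False using Ub by (simp add: trivial_limit_def)
  qed
qed

lemma sv_unit: "0 < l \<Longrightarrow> sv m f l t = (LINT x:{-1..1}|lborel. rescale m l t f x)"
  unfolding sv_def by (subst rescale_Icc) (auto simp: algebra_simps)

lemma abs_LINT_le_sv:
  assumes "\<bar>sv m f l t\<bar> \<le> A" "0 < l"
  shows "\<bar>LINT x:{t-l..t+l}|lborel. f x\<bar> \<le> A * l powr (1 - 1/m)"
proof -
  have "\<bar>LINT x:{t-l..t+l}|lborel. f x\<bar> = \<bar>sv m f l t\<bar> * l powr (1 - 1/m)"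
    using assms(2) powr_minus_divide[of l "1 - 1/m"] by (simp add: sv_def abs_mult)
  then show ?thesis using assms(1) by (simp add: mult_right_mono)
qed

definition Strichartz_const :: "real \<Rightarrow> real" where
  "Strichartz_const m = 2 powr (1/m) * (20 * m / (m - 1) * 4 powr (m - 1))"

lemma S_norm_le:
  assumes m: "1 < m" and f: "f \<in> Lp m" and A: "0 < A" and sv: "\<And>l t. 0 < l \<Longrightarrow> \<bar>sv m f l t\<bar> \<le> A"
    and K: "Lp_pow m f \<le> K"
  shows "S_norm m (\<lambda>t r. 1 / r * (LINT x:{t-r..t+r}|lborel. f x))
    \<le> ennreal ((Strichartz_const m * A powr (m + 1) * K) powr (1 / (2 * m + 1)))"
proof -
  have "S_norm m (\<lambda>t r. 1 / r * (LINT x:{t-r..t+r}|lborel. f x))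
    \<le> ennreal ((Strichartz_const m * A powr (m + 1) * Lp_pow m f) powr (1 / (2 * m + 1)))"
    unfolding Strichartz_const_def by (rule refined_Strichartz[OF m f A]) (rule abs_LINT_le_sv[OF sv])
  also have "\<dots> \<le> ennreal ((Strichartz_const m * A powr (m + 1) * K) powr (1 / (2 * m + 1)))"
    using m K by (intro ennreal_leI powr_mono2 mult_left_mono) (auto simp: Strichartz_const_def)
  finally show ?thesis .
qed

text \<open>All limits along the ultrafilter are limits along one common subsequence, since they are
  determined by countably many conditions.\<close>

theorem profile_decomposition_Lp:
  fixes f :: "nat \<Rightarrow> real \<Rightarrow> real"
  assumes m: "1 < m" and f: "\<And>n. f n \<in> Lp m" and B: "\<And>n. Lp_pow m (f n) \<le> B"
  obtains \<phi> :: "nat \<Rightarrow> nat" and l t :: "nat \<Rightarrow> nat \<Rightarrow> real" and g :: "nat \<Rightarrow> real \<Rightarrow> real" and E and L :: "nat \<Rightarrow> real"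
  where "strict_mono \<phi>" "\<And>k n. 0 < l k n" "\<And>k. g k \<in> Lp m"
    "\<And>j k. j \<noteq> k \<Longrightarrow> filterlim (\<lambda>n. frame_dist (l j n) (t j n) (l k n) (t k n)) at_top sequentially"
    "\<And>j u v. (\<lambda>n. LINT x:{u..v}|lborel. rescale m (l j n) (t j n) (f (\<phi> n)) x) \<longlonglongrightarrow> (LINT x:{u..v}|lborel. g j x)"
    "(\<lambda>n. Lp_pow m (f (\<phi> n))) \<longlonglongrightarrow> E" "\<And>J. (\<Sum>j<J. Lp_pow m (g j)) \<le> E"
    "\<And>J. (\<lambda>n. S_norm m (\<lambda>s r. 1 / r * (LINT x:{s-r..s+r}|lborel.
        f (\<phi> n) x - (\<Sum>j<J. bubble m (g j) (l j n) (t j n) x)))) \<longlonglongrightarrow> ennreal (L J)"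
    "L \<longlonglongrightarrow> 0"
proof -
  obtain U where U: "ultra U" using ex_ultra by blast
  have m0: "0 \<le> m" using m by simp
  from ex_greedy_frames[where f = f, OF U m f B] obtain l t :: "nat \<Rightarrow> nat \<Rightarrow> real"
    where l': "\<forall>k n. 0 < l k n"
      and orth': "\<forall>j k. j \<noteq> k \<longrightarrow> filterlim (\<lambda>n. frame_dist (l j n) (t j n) (l k n) (t k n)) at_top U"
      and greedy: "\<forall>J l' t'. (\<forall>n. 0 < l' n) \<longrightarrow>
       (\<forall>k<J. filterlim (\<lambda>n. frame_dist (l k n) (t k n) (l' n) (t' n)) at_top U) \<longrightarrow>
       scale_height U m f l' t' \<le> 2 * scale_height U m f (l J) (t J)"
    by (elim exE conjE)
  have l: "0 < l k n" for k n using l' by simp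
  have orthU: "filterlim (\<lambda>n. frame_dist (l j n) (t j n) (l k n) (t k n)) at_top U" if "j \<noteq> k" for j k
    using orth' that by simp
  note rL = rescale_Lp[OF m f l]
  have "\<exists>g\<in>Lp m. \<forall>u v. ((\<lambda>n. LINT x:{u..v}|lborel. rescale m (l j n) (t j n) (f n) x) \<longlongrightarrow> (LINT x:{u..v}|lborel. g x)) U" for j
    by (rule ultra_weak_limit[OF U m rL, where B = B]) (simp add: Lp_pow_rescale[OF m f l] B)
  then have "\<forall>j. \<exists>g. g \<in> Lp m \<and> (\<forall>u v. ((\<lambda>n. LINT x:{u..v}|lborel. rescale m (l j n) (t j n) (f n) x) \<longlongrightarrow> (LINT x:{u..v}|lborel. g x)) U)"
    by blast
  from choice[OF this] obtain g where gg: "\<forall>j. g j \<in> Lp m \<and> (\<forall>u v. ((\<lambda>n. LINT x:{u..v}|lborel. rescale m (l j n) (t j n) (f n) x) \<longlongrightarrow> (LINT x:{u..v}|lborel. g j x)) U)"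
    by blast
  have g: "g j \<in> Lp m" for j using gg by blast
  have weakU: "((\<lambda>n. LINT x:{u..v}|lborel. rescale m (l j n) (t j n) (f n) x) \<longlongrightarrow> (LINT x:{u..v}|lborel. g j x)) U" for j u v
    using gg by blast
  define h where "h J = scale_height U m f (l J) (t J)" for J
  have h0: "0 \<le> h J" for J unfolding h_def by (rule scale_height(2)[OF U m f B l])
  define r where "r J n x = f n x - (\<Sum>j<J. bubble m (g j) (l j n) (t j n) x)" for J n x
  have bL: "bubble m (g j) (l j n) (t j n) \<in> Lp m" for j n by (rule bubble_Lp[OF m g l])
  have sbL: "(\<lambda>x. \<Sum>j<J. bubble m (g j) (l j n) (t j n) x) \<in> Lp m" for J n by (intro Lp_sum m0 bL) simp
  have rJ: "r J n \<in> Lp m" for J n unfolding r_def[abs_def] by (intro Lp_diff m0 f sbL)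
  \<comment> \<open>The term \<open>1 / real (Suc J)\<close> makes the level positive and strictly
    above the greedy bound \<open>2 * h J\<close>, and still lets it tend to 0.\<close>
  define A where "A J = 2 * h J + 1 / real (Suc J)" for J
  have A0: "0 < A J" for J using h0[of J] unfolding A_def by (intro add_nonneg_pos) auto
  have small: "eventually (\<lambda>n. \<forall>l'>0. \<forall>t'. \<bar>sv m (r J n) l' t'\<bar> \<le> A J) U" for J
    unfolding r_def[abs_def]
  proof (rule remainder_height_small[where \<kappa> = "2 * h J" and f = f and l = l and t = t and g = g and B = B])
    fix l' t' :: "nat \<Rightarrow> real"
    assume "\<And>n. 0 < l' n" "\<And>k. k < J \<Longrightarrow> filterlim (\<lambda>n. frame_dist (l k n) (t k n) (l' n) (t' n)) at_top U"
    then have "\<forall>n. 0 < l' n" "\<forall>k<J. filterlim (\<lambda>n. frame_dist (l k n) (t k n) (l' n) (t' n)) at_top U" by simp_all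
    then show "scale_height U m f l' t' \<le> 2 * h J"
      unfolding h_def by (rule greedy[THEN spec, THEN spec, THEN spec, THEN mp, THEN mp])
  next
    show "2 * h J < A J" unfolding A_def by simp
  qed (rule U m f B l orthU g weakU A0 | assumption)+
  have "eventually (\<lambda>n. 0 \<le> Lp_pow m (f n) \<and> Lp_pow m (f n) \<le> B) U" by (simp add: B)
  from ultra_bounded_tendsto[OF U this] obtain E where EU: "((\<lambda>n. Lp_pow m (f n)) \<longlongrightarrow> E) U" by blast
  define \<sigma> where "\<sigma> J n = S_norm m (\<lambda>s q. 1 / q * (LINT x:{s-q..s+q}|lborel. r J n x))" for J n
  \<comment> \<open>This bound carries a power of \<open>J\<close>; it only ensures that the
    dispersive norms are finite and bounded in \<open>n\<close>, so that their limits along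
    \<open>U\<close> exist. The bound uniform in \<open>J\<close> holds for large \<open>n\<close>
    along the subsequence and is \<open>K'\<close> below.\<close>
  define K where "K J = 2 powr m * (B + real J powr m * (\<Sum>j<J. Lp_pow m (g j)))" for J
  have rK: "Lp_pow m (r J n) \<le> K J" for J n
  proof -
    have "Lp_pow m (\<lambda>x. \<Sum>j<J. bubble m (g j) (l j n) (t j n) x) \<le> real (card {..<J}) powr m * (\<Sum>j<J. Lp_pow m (bubble m (g j) (l j n) (t j n)))"
      by (rule Lp_pow_sum_le[OF m0 _ bL]) simp
    then have s: "Lp_pow m (\<lambda>x. \<Sum>j<J. bubble m (g j) (l j n) (t j n) x) \<le> real J powr m * (\<Sum>j<J. Lp_pow m (g j))"
      unfolding Lp_pow_bubble[OF m g l] by simp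
    have "Lp_pow m (r J n) \<le> 2 powr m * (Lp_pow m (f n) + Lp_pow m (\<lambda>x. \<Sum>j<J. bubble m (g j) (l j n) (t j n) x))"
      unfolding r_def[abs_def] by (rule Lp_pow_diff_le[OF m0 f sbL])
    also have "\<dots> \<le> K J" unfolding K_def by (intro mult_left_mono add_mono B s) simp
    finally show ?thesis .
  qed
  define C where "C J = (Strichartz_const m * (4 * K J powr (1/m) + 1) powr (m + 1) * K J) powr (1 / (2 * m + 1))" for J
  have \<sigma>C: "\<sigma> J n \<le> ennreal (C J)" for J n
    unfolding \<sigma>_def C_def
  proof (rule S_norm_le[OF m rJ _ _ rK])
    show "0 < 4 * K J powr (1/m) + 1" by (intro add_nonneg_pos) auto
    show "\<bar>sv m (r J n) l t\<bar> \<le> 4 * K J powr (1/m) + 1" if "0 < l" for l t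
      using abs_sv_le[OF m rJ rK that, of J n t] by linarith
  qed
  have \<sigma>fin: "ennreal (enn2real (\<sigma> J n)) = \<sigma> J n" for J n
    using \<sigma>C[of J n] by (simp add: ennreal_enn2real_if) (metis ennreal_neq_top neq_top_trans)
  have "\<exists>L. ((\<lambda>n. enn2real (\<sigma> J n)) \<longlongrightarrow> L) U" for J
  proof -
    have "enn2real (\<sigma> J n) \<le> C J" for n
      using enn2real_mono[OF \<sigma>C[of J n]] by (simp add: C_def)
    then have "eventually (\<lambda>n. 0 \<le> enn2real (\<sigma> J n) \<and> enn2real (\<sigma> J n) \<le> C J) U" by simp
    from ultra_bounded_tendsto[OF U this] show ?thesis by blast
  qed
  then have "\<forall>J. \<exists>L. ((\<lambda>n. enn2real (\<sigma> J n)) \<longlongrightarrow> L) U" by blast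
  from choice[OF this] obtain L where LU: "\<forall>J. ((\<lambda>n. enn2real (\<sigma> J n)) \<longlongrightarrow> L J) U" by blast
  \<comment> \<open>Each limit along \<open>U\<close> is encoded by countably many predicates:
    tolerances \<open>1 / real (Suc k)\<close>, thresholds \<open>real N\<close>, and rational end
    points for the weak limits. \<open>P3\<close> is the uniform bound on the averages of the
    remainder.\<close>
  define P1 where "P1 = (\<lambda>(j, u, v, k) n. \<bar>(LINT x:{u..v}|lborel. rescale m (l j n) (t j n) (f n) x) - (LINT x:{u..v}|lborel. g j x)\<bar> < 1 / real (Suc k))"
  define P2 where "P2 = (\<lambda>(j, k, N) n. j \<noteq> k \<longrightarrow> real N \<le> frame_dist (l j n) (t j n) (l k n) (t k n))"
  define P3 where "P3 = (\<lambda>J n. \<forall>l'>0. \<forall>t'. \<bar>sv m (r J n) l' t'\<bar> \<le> A J)"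
  define P4 where "P4 = (\<lambda>k n. \<bar>Lp_pow m (f n) - E\<bar> < 1 / real (Suc k))"
  define P5 where "P5 = (\<lambda>(J, k) n. \<bar>enn2real (\<sigma> J n) - L J\<bar> < 1 / real (Suc k))"
  define \<P> where "\<P> = P1 ` (UNIV \<times> \<rat> \<times> \<rat> \<times> UNIV) \<union> range P2 \<union> range P3 \<union> range P4 \<union> range P5"
  have ev1: "eventually (P1 (j, u, v, k)) U" for j u v k
    using tendstoD[OF weakU[where j = j and u = u and v = v], of "1 / real (Suc k)"] by (simp add: P1_def dist_real_def)
  have ev2: "eventually (P2 (j, k, N)) U" for j k N
    using orthU[of j k] unfolding P2_def filterlim_at_top by (cases "j = k") auto
  have ev3: "eventually (P3 J) U" for J unfolding P3_def by (rule small)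
  have ev4: "eventually (P4 k) U" for k
    using tendstoD[OF EU, of "1 / real (Suc k)"] by (simp add: P4_def dist_real_def)
  have ev5: "eventually (P5 (J, k)) U" for J k
    using tendstoD[OF LU[rule_format, of J], of "1 / real (Suc k)"] by (simp add: P5_def dist_real_def)
  have "countable \<P>"
    unfolding \<P>_def by (intro countable_Un countable_image countable_SIGMA countable_rat) auto
  moreover have "eventually P U" if "P \<in> \<P>" for P
    using that ev1 ev2 ev3 ev4 ev5 unfolding \<P>_def by auto
  ultimately have "\<exists>\<phi> :: nat \<Rightarrow> nat. strict_mono \<phi> \<and> (\<forall>P\<in>\<P>. eventually (\<lambda>n. P (\<phi> n)) sequentially)"
    by (rule ultra_extract[OF U])
  then obtain \<phi> :: "nat \<Rightarrow> nat" where \<phi>: "strict_mono \<phi>" and \<phi>P: "\<forall>P\<in>\<P>. eventually (\<lambda>n. P (\<phi> n)) sequentially"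
    by (elim exE conjE)
  have s1: "eventually (\<lambda>n. P1 (j, u, v, k) (\<phi> n)) sequentially" if "u \<in> \<rat>" "v \<in> \<rat>" for j u v k
    by (rule \<phi>P[rule_format]) (unfold \<P>_def, use that in blast)
  have s2: "eventually (\<lambda>n. P2 (j, k, N) (\<phi> n)) sequentially" for j k N
    by (rule \<phi>P[rule_format]) (unfold \<P>_def, blast)
  have s3: "eventually (\<lambda>n. P3 J (\<phi> n)) sequentially" for J
    by (rule \<phi>P[rule_format]) (unfold \<P>_def, blast)
  have s4: "eventually (\<lambda>n. P4 k (\<phi> n)) sequentially" for k
    by (rule \<phi>P[rule_format]) (unfold \<P>_def, blast)
  have s5: "eventually (\<lambda>n. P5 (J, k) (\<phi> n)) sequentially" for J k
    by (rule \<phi>P[rule_format]) (unfold \<P>_def, blast)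
  have weakR: "(\<lambda>n. LINT x:{u..v}|lborel. rescale m (l j (\<phi> n)) (t j (\<phi> n)) (f (\<phi> n)) x) \<longlonglongrightarrow> (LINT x:{u..v}|lborel. g j x)"
    if "u \<in> \<rat>" "v \<in> \<rat>" for j u v
    using s1[OF that, of j] unfolding P1_def prod.case by (rule real_tendsto_from_eventually_inverse_Suc)
  have weak: "(\<lambda>n. LINT x:{u..v}|lborel. rescale m (l j (\<phi> n)) (t j (\<phi> n)) (f (\<phi> n)) x) \<longlonglongrightarrow> (LINT x:{u..v}|lborel. g j x)"
    for j u v
  proof (rule Icc_tendsto_from_rational[where g = "g j" and B = B, OF m _ _ g weakR])
    show "rescale m (l j (\<phi> n)) (t j (\<phi> n)) (f (\<phi> n)) \<in> Lp m" for n by (rule rL)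
    show "Lp_pow m (rescale m (l j (\<phi> n)) (t j (\<phi> n)) (f (\<phi> n))) \<le> B" for n
      unfolding Lp_pow_rescale[OF m f l] by (rule B)
  qed
  have orth: "filterlim (\<lambda>n. frame_dist (l j (\<phi> n)) (t j (\<phi> n)) (l k (\<phi> n)) (t k (\<phi> n))) at_top sequentially"
    if "j \<noteq> k" for j k
    unfolding filterlim_at_top
  proof
    fix Z :: real
    obtain N where N: "Z \<le> real N" using real_arch_simple by blast
    show "eventually (\<lambda>n. Z \<le> frame_dist (l j (\<phi> n)) (t j (\<phi> n)) (l k (\<phi> n)) (t k (\<phi> n))) sequentially"
      using s2[of j k N]
    proof eventually_elim
      case (elim n)
      then have "real N \<le> frame_dist (l j (\<phi> n)) (t j (\<phi> n)) (l k (\<phi> n)) (t k (\<phi> n))" unfolding P2_def prod.case using that by blast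
      then show ?case using N by linarith
    qed
  qed
  have Elim: "(\<lambda>n. Lp_pow m (f (\<phi> n))) \<longlonglongrightarrow> E"
    using s4 unfolding P4_def by (rule real_tendsto_from_eventually_inverse_Suc)
  have Bes: "(\<Sum>j<J. Lp_pow m (g j)) \<le> E" for J
    by (rule Bessel_Lp[where g = g and B = B and f = "\<lambda>n. f (\<phi> n)" and l = "\<lambda>j n. l j (\<phi> n)" and t = "\<lambda>j n. t j (\<phi> n)", OF m f B l orth g weak Elim])
  have Llim: "(\<lambda>n. enn2real (\<sigma> J (\<phi> n))) \<longlonglongrightarrow> L J" for J
    using s5[of J] unfolding P5_def prod.case by (rule real_tendsto_from_eventually_inverse_Suc)
  have Slim: "(\<lambda>n. \<sigma> J (\<phi> n)) \<longlonglongrightarrow> ennreal (L J)" for J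
    using tendsto_ennrealI[OF Llim[of J]] unfolding \<sigma>fin .
  have L0: "0 \<le> L J" for J by (rule LIMSEQ_le_const[OF Llim]) auto
  define K' where "K' = 2 powr m * (B + 4 powr m * (E + 2))"
  have Lle: "L J \<le> (Strichartz_const m * A J powr (m + 1) * K') powr (1 / (2 * m + 1))" for J
  proof (rule tendsto_upperbound[OF Llim])
    have "eventually (\<lambda>n. Lp_pow m (\<lambda>x. \<Sum>j<J. bubble m (g j) (l j (\<phi> n)) (t j (\<phi> n)) x)
      \<le> 4 powr m * ((\<Sum>j<J. Lp_pow m (g j)) + 2)) sequentially"
      by (rule Lp_pow_sum_bubbles_le[where g = g and l = "\<lambda>j n. l j (\<phi> n)" and t = "\<lambda>j n. t j (\<phi> n)", OF m l orth g])
    then show "eventually (\<lambda>n. enn2real (\<sigma> J (\<phi> n)) \<le> (Strichartz_const m * A J powr (m + 1) * K') powr (1 / (2 * m + 1))) sequentially"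
      using s3[of J]
    proof eventually_elim
      case (elim n)
      have "Lp_pow m (r J (\<phi> n)) \<le> 2 powr m * (Lp_pow m (f (\<phi> n)) + Lp_pow m (\<lambda>x. \<Sum>j<J. bubble m (g j) (l j (\<phi> n)) (t j (\<phi> n)) x))"
        unfolding r_def[abs_def] by (rule Lp_pow_diff_le[OF m0 f sbL])
      also have "\<dots> \<le> 2 powr m * (B + 4 powr m * ((\<Sum>j<J. Lp_pow m (g j)) + 2))"
        by (intro mult_left_mono add_mono B elim(1)) simp
      also have "\<dots> \<le> K'" unfolding K'_def by (intro mult_left_mono add_left_mono add_right_mono Bes) auto
      finally have rK': "Lp_pow m (r J (\<phi> n)) \<le> K'" .
      have "\<sigma> J (\<phi> n) \<le> ennreal ((Strichartz_const m * A J powr (m + 1) * K') powr (1 / (2 * m + 1)))"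
        unfolding \<sigma>_def
        by (rule S_norm_le[OF m rJ A0 _ rK']) (use elim(2) in \<open>simp add: P3_def\<close>)
      from enn2real_mono[OF this] show ?case by simp
    qed
  qed simp
  \<comment> \<open>The average in the chosen frame is the integral of the rescaled function over
    \<open>{-1..1}\<close>, hence passes to the weak limit. This links the heights to the profile
    norms, whose \<open>m\<close>-th powers are summable by Bessel's inequality.\<close>
  have heq: "h J = \<bar>LINT x:{-1..1}|lborel. g J x\<bar>" for J
  proof (rule tendsto_unique)
    show "((\<lambda>n. \<bar>sv m (f n) (l J n) (t J n)\<bar>) \<longlongrightarrow> h J) U"
      unfolding h_def by (rule scale_height(1)[where f = f and l = "l J" and t = "t J", OF U m f B l])
    show "((\<lambda>n. \<bar>sv m (f n) (l J n) (t J n)\<bar>) \<longlongrightarrow> \<bar>LINT x:{-1..1}|lborel. g J x\<bar>) U"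
      unfolding sv_unit[OF l] by (rule tendsto_rabs[OF weakU])
  qed (use U in \<open>simp add: ultra_def\<close>)
  have hle: "h J \<le> 2 * ((1 - - 1) powr (1 - 1/m) * Lp_pow m (g J) powr (1/m))" for J
    unfolding heq by (rule Lp_Icc_le[OF m g]) simp
  have "summable (\<lambda>j. Lp_pow m (g j))" by (rule summableI_nonneg_bounded[OF Lp_pow_nonneg Bes])
  then have "(\<lambda>j. Lp_pow m (g j)) \<longlonglongrightarrow> 0" by (rule summable_LIMSEQ_zero)
  then have "(\<lambda>J. 2 * ((1 - - 1) powr (1 - 1/m) * Lp_pow m (g J) powr (1/m))) \<longlonglongrightarrow> 2 * ((1 - - 1) powr (1 - 1/m) * 0 powr (1/m))"
    using m by (intro tendsto_mult tendsto_const tendsto_powr2) auto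
  then have "(\<lambda>J. 2 * ((1 - - 1) powr (1 - 1/m) * Lp_pow m (g J) powr (1/m))) \<longlonglongrightarrow> 0" by simp
  from tendsto_sandwich[OF _ _ tendsto_const this] have hlim: "h \<longlonglongrightarrow> 0" using h0 hle by simp
  have "A \<longlonglongrightarrow> 2 * 0 + 0"
    unfolding A_def by (intro tendsto_add tendsto_mult tendsto_const hlim LIMSEQ_Suc[OF lim_1_over_n])
  then have Alim: "A \<longlonglongrightarrow> 0" by simp
  have "(\<lambda>J. (Strichartz_const m * A J powr (m + 1) * K') powr (1 / (2 * m + 1))) \<longlonglongrightarrow> (Strichartz_const m * 0 powr (m + 1) * K') powr (1 / (2 * m + 1))"
  proof (rule tendsto_powr2)
    show "(\<lambda>J. Strichartz_const m * A J powr (m + 1) * K') \<longlonglongrightarrow> Strichartz_const m * 0 powr (m + 1) * K'"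
      using m A0 by (intro tendsto_mult tendsto_const tendsto_powr2 Alim) (auto intro!: always_eventually less_imp_le)
    have K'0: "0 \<le> K'" using rK[of 0 0] Bes[of 0] order_trans[OF Lp_pow_nonneg B] by (simp add: K'_def)
    show "\<forall>\<^sub>F J in sequentially. 0 \<le> Strichartz_const m * A J powr (m + 1) * K'"
      using m K'0 by (simp add: Strichartz_const_def)
  qed (use m in auto)
  then have z: "(\<lambda>J. (Strichartz_const m * A J powr (m + 1) * K') powr (1 / (2 * m + 1))) \<longlonglongrightarrow> 0" by simp
  have Lz: "L \<longlonglongrightarrow> 0" by (rule tendsto_sandwich[OF _ _ tendsto_const z]) (use L0 Lle in auto)
  show ?thesis
    by (rule that[of \<phi> "\<lambda>j n. l j (\<phi> n)" g "\<lambda>j n. t j (\<phi> n)" E L, OF \<phi> l g orth weak Elim Bes Slim[unfolded \<sigma>_def r_def] Lz])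
qed

section \<open>Density of smooth radial functions\<close>

text \<open>The polynomial factor in \<open>1/y\<close> makes the family closed under
  differentiation: the derivative of \<open>poly p (1/y) * exp (- (1/y))\<close> has the polynomial
  \<open>p - pderiv p\<close>, times the square of the variable.\<close>

definition exp_bump :: "real poly \<Rightarrow> real \<Rightarrow> real" where
  "exp_bump p y = (if 0 < y then poly p (1/y) * exp (- (1/y)) else 0)"

lemma poly_mult_exp_tendsto_0:
  fixes p :: "real poly"
  shows "((\<lambda>z. z ^ k * poly p z * exp (- z)) \<longlongrightarrow> 0) at_top"
proof (induction p arbitrary: k)
  case (pCons a p)
  have "((\<lambda>z::real. a * (z ^ k / exp z) + z ^ Suc k * poly p z * exp (- z)) \<longlongrightarrow> a * 0 + 0) at_top"
    by (intro tendsto_add tendsto_mult tendsto_const tendsto_power_div_exp_0 pCons.IH)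
  then show ?case by (simp add: algebra_simps exp_minus divide_inverse)
qed simp

lemma exp_bump_has_derivative:
  "(exp_bump p has_real_derivative exp_bump ([:0, 0, 1:] * (p - pderiv p)) y) (at y)"
proof -
  consider "0 < y" | "y < 0" | "y = 0" by linarith
  then show ?thesis
  proof cases
    case 1
    have "((\<lambda>y. poly p (1/y) * exp (- (1/y))) has_real_derivative
      exp_bump ([:0, 0, 1:] * (p - pderiv p)) y) (at y)"
      unfolding exp_bump_def using 1
      by (auto intro!: derivative_eq_intros DERIV_chain2[OF poly_DERIV] simp: power2_eq_square field_simps)
    moreover have "eventually (\<lambda>x. x \<in> {0<..}) (nhds y)" using 1 by (intro eventually_nhds_in_open) auto
    then have "eventually (\<lambda>x. poly p (1/x) * exp (- (1/x)) = exp_bump p x) (nhds y)"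
      by eventually_elim (simp add: exp_bump_def)
    ultimately show ?thesis by (subst (asm) DERIV_cong_ev[OF refl _ refl]) auto
  next
    case 2
    have "eventually (\<lambda>x. x \<in> {..<0}) (nhds y)" using 2 by (intro eventually_nhds_in_open) auto
    then have "eventually (\<lambda>x. exp_bump p x = 0) (nhds y)"
      by eventually_elim (simp add: exp_bump_def)
    then show ?thesis using 2 by (subst DERIV_cong_ev[OF refl _ refl]) (auto simp: exp_bump_def)
  next
    case 3
    \<comment> \<open>With \<open>z = 1 / x\<close> the difference quotient at 0 becomes
      \<open>z * poly p z * exp (- z)\<close>.\<close>
    have "((\<lambda>x. exp_bump p x / x) \<longlongrightarrow> 0) (at_right 0)"
      unfolding filterlim_at_right_to_top
    proof (rule Lim_transform_eventually)
      show "((\<lambda>z. z ^ 1 * poly p z * exp (- z)) \<longlongrightarrow> 0) at_top" by (rule poly_mult_exp_tendsto_0)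
      show "eventually (\<lambda>z. z ^ 1 * poly p z * exp (- z) = exp_bump p (inverse z) / inverse z) at_top"
        using eventually_gt_at_top[of "0::real"] by eventually_elim (simp add: exp_bump_def field_simps)
    qed
    moreover have "((\<lambda>x. exp_bump p x / x) \<longlongrightarrow> 0) (at_left 0)"
    proof (rule tendsto_eventually)
      show "eventually (\<lambda>x. exp_bump p x / x = 0) (at_left (0::real))"
        using eventually_at_left_real[of "-1" "0::real"] by (auto simp: exp_bump_def elim: eventually_mono)
    qed
    ultimately have "((\<lambda>x. exp_bump p x / x) \<longlongrightarrow> 0) (at 0)" by (simp add: filterlim_at_split)
    then show ?thesis using 3 by (simp add: DERIV_def exp_bump_def)
  qed
qed

text \<open>A class of functions closed under differentiation, large enough for the cut-offs below.\<close>

inductive smooth :: "(real \<Rightarrow> real) \<Rightarrow> bool" where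
  smooth_const: "smooth (\<lambda>x. c)"
| smooth_id: "smooth (\<lambda>x. x)"
| smooth_bump: "smooth (\<lambda>x. exp_bump p (a + b * x))"
| smooth_add: "smooth f \<Longrightarrow> smooth g \<Longrightarrow> smooth (\<lambda>x. f x + g x)"
| smooth_mult: "smooth f \<Longrightarrow> smooth g \<Longrightarrow> smooth (\<lambda>x. f x * g x)"
| smooth_primitive: "(\<And>x. (F has_real_derivative f x) (at x)) \<Longrightarrow> smooth f \<Longrightarrow> smooth F"

lemma smooth_deriv: "smooth f \<Longrightarrow> \<exists>f'. smooth f' \<and> (\<forall>x. (f has_real_derivative f' x) (at x))"
proof (induction rule: smooth.induct)
  case (smooth_const c)
  then show ?case by (intro exI[of _ "\<lambda>x. 0"]) (auto intro: smooth.intros)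
next
  case smooth_id
  then show ?case by (intro exI[of _ "\<lambda>x. 1"]) (auto intro: smooth.intros)
next
  case (smooth_bump p a b)
  show ?case
  proof (intro exI conjI allI)
    show "smooth (\<lambda>x. exp_bump ([:0, 0, 1:] * (p - pderiv p)) (a + b * x) * b)"
      by (intro smooth.smooth_mult smooth.smooth_bump smooth.smooth_const)
    show "((\<lambda>x. exp_bump p (a + b * x)) has_real_derivative exp_bump ([:0, 0, 1:] * (p - pderiv p)) (a + b * x) * b) (at x)" for x
      by (rule DERIV_chain2[OF exp_bump_has_derivative]) (auto intro!: derivative_eq_intros)
  qed
next
  case (smooth_add f g)
  then obtain f' g' where "smooth f'" "smooth g'" "\<forall>x. (f has_real_derivative f' x) (at x)" "\<forall>x. (g has_real_derivative g' x) (at x)"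
    by blast
  then show ?case by (intro exI[of _ "\<lambda>x. f' x + g' x"]) (auto intro: smooth.intros DERIV_add)
next
  case (smooth_mult f g)
  then obtain f' g' where fg: "smooth f'" "smooth g'" "\<forall>x. (f has_real_derivative f' x) (at x)" "\<forall>x. (g has_real_derivative g' x) (at x)"
    by blast
  show ?case
  proof (intro exI[of _ "\<lambda>x. f' x * g x + g' x * f x"] conjI allI)
    show "smooth (\<lambda>x. f' x * g x + g' x * f x)"
      by (intro smooth.smooth_add smooth.smooth_mult fg smooth_mult.hyps)
    show "((\<lambda>x. f x * g x) has_real_derivative f' x * g x + g' x * f x) (at x)" for x
      by (rule DERIV_mult) (use fg in auto)
  qed
next
  case (smooth_primitive F f)
  then show ?case by blast
qed

lemma smooth_continuous: "smooth f \<Longrightarrow> continuous_on A f"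
  using smooth_deriv DERIV_isCont continuous_at_imp_continuous_on by metis

text \<open>Differentiating \<open>q (x \<bullet> x)\<close> produces \<open>q'\<close> and a
  coordinate, so the class is closed under partial derivatives. Using the square of the norm keeps
  radial functions smooth at the origin.\<close>

inductive smooth_on_space :: "('a::euclidean_space \<Rightarrow> real) \<Rightarrow> bool" where
  space_radial: "smooth q \<Longrightarrow> smooth_on_space (\<lambda>x. q (x \<bullet> x))"
| space_inner: "smooth_on_space (\<lambda>x. x \<bullet> i)"
| space_const: "smooth_on_space (\<lambda>x. c)"
| space_add: "smooth_on_space f \<Longrightarrow> smooth_on_space g \<Longrightarrow> smooth_on_space (\<lambda>x. f x + g x)"
| space_mult: "smooth_on_space f \<Longrightarrow> smooth_on_space g \<Longrightarrow> smooth_on_space (\<lambda>x. f x * g x)"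

lemma smooth_on_space_derivative:
  "smooth_on_space f \<Longrightarrow> \<exists>D. (\<forall>x. (f has_derivative D x) (at x)) \<and> (\<forall>i. smooth_on_space (\<lambda>x. D x i))"
proof (induction rule: smooth_on_space.induct)
  case (space_radial q)
  then obtain q' where q': "smooth q'" "\<And>x. (q has_real_derivative q' x) (at x)" using smooth_deriv by blast
  show ?case
  proof (intro exI[of _ "\<lambda>x h. q' (x \<bullet> x) * (2 * (x \<bullet> h))"] conjI allI)
    fix x :: 'a
    have "((\<lambda>x. x \<bullet> x) has_derivative (\<lambda>h. 2 * (x \<bullet> h))) (at x)"
      by (auto intro!: derivative_eq_intros simp: inner_commute)
    then have "((\<lambda>x. q (x \<bullet> x)) has_derivative (\<lambda>h. q' (x \<bullet> x) * (2 * (x \<bullet> h)))) (at x)"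
      using has_derivative_compose[OF _ q'(2)[unfolded has_field_derivative_def], of "\<lambda>x. x \<bullet> x"] by blast
    then show "((\<lambda>x. q (x \<bullet> x)) has_derivative (\<lambda>h. q' (x \<bullet> x) * (2 * (x \<bullet> h)))) (at x)" .
  next
    fix i :: 'a
    show "smooth_on_space (\<lambda>x. q' (x \<bullet> x) * (2 * (x \<bullet> i)))"
      by (intro smooth_on_space.intros q'(1))
  qed
next
  case (space_inner i)
  show ?case
    by (intro exI[of _ "\<lambda>x h. h \<bullet> i"]) (auto intro!: derivative_eq_intros smooth_on_space.intros)
next
  case (space_const c)
  show ?case
    by (intro exI[of _ "\<lambda>x h. 0"]) (auto intro!: smooth_on_space.intros)
next
  case (space_add f g)
  then obtain D D' where D: "\<forall>x. (f has_derivative D x) (at x)" "\<forall>i. smooth_on_space (\<lambda>x. D x i)"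
    "\<forall>x. (g has_derivative D' x) (at x)" "\<forall>i. smooth_on_space (\<lambda>x. D' x i)" by blast
  show ?case
    by (intro exI[of _ "\<lambda>x h. D x h + D' x h"] conjI allI has_derivative_add smooth_on_space.space_add) (use D in auto)
next
  case (space_mult f g)
  then obtain D D' where D: "\<forall>x. (f has_derivative D x) (at x)" "\<forall>i. smooth_on_space (\<lambda>x. D x i)"
    "\<forall>x. (g has_derivative D' x) (at x)" "\<forall>i. smooth_on_space (\<lambda>x. D' x i)" by blast
  show ?case
  proof (intro exI[of _ "\<lambda>x h. f x * D' x h + D x h * g x"] conjI allI)
    show "((\<lambda>x. f x * g x) has_derivative (\<lambda>h. f x * D' x h + D x h * g x)) (at x)" for x
      by (rule has_derivative_mult) (use D in auto)
    show "smooth_on_space (\<lambda>x. f x * D' x i + D x i * g x)" for i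
      by (intro smooth_on_space.space_add smooth_on_space.space_mult space_mult.hyps) (use D in auto)
  qed
qed

lemma smooth_on_space_Ck: "smooth_on_space f \<Longrightarrow> Ck k f"
proof (induction k arbitrary: f)
  case 0
  then obtain D where "\<forall>x. (f has_derivative D x) (at x)" using smooth_on_space_derivative by blast
  then have "\<forall>x\<in>UNIV. isCont f x" using has_derivative_continuous by blast
  then show ?case by (simp add: continuous_at_imp_continuous_on)
next
  case (Suc k)
  then obtain D where D: "\<forall>x. (f has_derivative D x) (at x)" "\<forall>i. smooth_on_space (\<lambda>x. D x i)"
    using smooth_on_space_derivative by blast
  have fd: "frechet_derivative f (at x) = D x" for x using frechet_derivative_at D(1) by metis
  show ?case using D Suc.IH unfolding Ck.simps fd differentiable_def by blast
qed

lemma radial_test_smooth: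
  assumes q: "smooth q" and S: "\<And>s. S \<le> s \<Longrightarrow> q s = 0"
  shows "radial_test (\<lambda>r. q (r\<^sup>2))"
  unfolding radial_test_def
proof (intro exI[of _ "\<lambda>x. q (x \<bullet> x)"] conjI allI)
  show "Ck k (\<lambda>x::real^3. q (x \<bullet> x))" for k by (intro smooth_on_space_Ck space_radial q)
  have "{x::real^3. q (x \<bullet> x) \<noteq> 0} \<subseteq> cball 0 (sqrt \<bar>S\<bar>)"
  proof
    fix x :: "real^3" assume "x \<in> {x. q (x \<bullet> x) \<noteq> 0}"
    then have "\<not> S \<le> x \<bullet> x" using S[of "x \<bullet> x"] by auto
    then have "(norm x)\<^sup>2 \<le> \<bar>S\<bar>" by (simp add: power2_norm_eq_inner)
    then show "x \<in> cball 0 (sqrt \<bar>S\<bar>)" by (simp add: real_le_rsqrt)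
  qed
  then have "bounded {x::real^3. q (x \<bullet> x) \<noteq> 0}" using bounded_cball bounded_subset by blast
  then show "compact (closure {x::real^3. q (x \<bullet> x) \<noteq> 0})" by (simp add: compact_closure)
  show "q (x \<bullet> x) = q ((norm x)\<^sup>2)" for x :: "real^3" by (simp add: power2_norm_eq_inner)
qed

text \<open>It vanishes off \<open>{a<..<b}\<close> and stays below 1 inside, but tends to 1 there
  as \<open>n\<close> grows, because \<open>exp (- (1 / (n * y)))\<close> tends to 1.\<close>

definition cutoff :: "nat \<Rightarrow> real \<Rightarrow> real \<Rightarrow> real \<Rightarrow> real" where
  "cutoff n a b s = exp_bump 1 (real n * (s - a)) * exp_bump 1 (real n * (b - s))"

lemma smooth_cutoff: "smooth (cutoff n a b)"
proof -
  have "smooth (\<lambda>s. exp_bump 1 (- (real n * a) + real n * s) * exp_bump 1 (real n * b + - real n * s))"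
    by (intro smooth.intros)
  then show ?thesis unfolding cutoff_def[abs_def] by (simp add: algebra_simps)
qed

lemma exp_bump_1_bounds: "0 \<le> exp_bump 1 y" "exp_bump 1 y \<le> 1"
  by (auto simp: exp_bump_def)

lemma cutoff_bounds: "0 \<le> cutoff n a b s" "cutoff n a b s \<le> 1"
  unfolding cutoff_def using exp_bump_1_bounds by (auto intro: mult_le_one)

lemma cutoff_eq_0: "s \<notin> {a<..<b} \<Longrightarrow> cutoff n a b s = 0"
  by (auto simp: cutoff_def exp_bump_def zero_less_mult_iff not_less)

lemma exp_bump_1_tendsto:
  assumes "0 < y"
  shows "(\<lambda>n. exp_bump 1 (real n * y)) \<longlonglongrightarrow> 1"
proof -
  have "(\<lambda>n. exp (- (1 / y * (1 / real n)))) \<longlonglongrightarrow> exp (- (1 / y * 0))"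
    by (intro tendsto_intros lim_1_over_n)
  then have 1: "(\<lambda>n. exp (- (1 / y * (1 / real n)))) \<longlonglongrightarrow> 1" by simp
  show ?thesis
  proof (rule Lim_transform_eventually[OF 1])
    show "eventually (\<lambda>n. exp (- (1 / y * (1 / real n))) = exp_bump 1 (real n * y)) sequentially"
      using eventually_gt_at_top[of 0] by eventually_elim (use assms in \<open>simp add: exp_bump_def mult.commute\<close>)
  qed
qed

lemma cutoff_tendsto: "s \<in> {a<..<b} \<Longrightarrow> (\<lambda>n. cutoff n a b s) \<longlonglongrightarrow> 1"
  unfolding cutoff_def using tendsto_mult[OF exp_bump_1_tendsto[of "s - a"] exp_bump_1_tendsto[of "b - s"]] by auto

lemma smooth_real_polynomial_function: "real_polynomial_function (f :: real \<Rightarrow> real) \<Longrightarrow> smooth f"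
proof (induction rule: real_polynomial_function.induct)
  case (linear f)
  have "f x = f 1 * x" for x
    using linear_scale[OF bounded_linear.linear[OF linear], of x 1] by (simp add: mult.commute)
  then have "f = (\<lambda>x. f 1 * x)" by (rule ext)
  moreover have "smooth (\<lambda>x. f 1 * x)" by (intro smooth.intros)
  ultimately show ?case by simp
qed (auto intro: smooth.intros)

lemma tail_restrict_tendsto:
  assumes m: "1 < m" and k: "k \<in> Lp m" and pos: "\<And>x. x \<le> 0 \<Longrightarrow> k x = 0"
  shows "(\<lambda>n. Lp_pow m (\<lambda>x. k x - indicator {1 / real (Suc n)..real (Suc n)} x * trunc (real n) k x)) \<longlonglongrightarrow> 0"
proof -
  note [measurable] = Lp_measurable[OF k]
  let ?t = "\<lambda>n x. indicator {1 / real (Suc n)..real (Suc n)} x * trunc (real n) k x"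
  have "(\<lambda>n. \<integral>x. \<bar>k x - ?t n x\<bar> powr m \<partial>lborel) \<longlonglongrightarrow> integral\<^sup>L lborel (\<lambda>x::real. 0)"
  proof (rule integral_dominated_convergence[where w = "\<lambda>x. \<bar>k x\<bar> powr m"])
    show "AE x in lborel. (\<lambda>n. \<bar>k x - ?t n x\<bar> powr m) \<longlonglongrightarrow> 0"
    proof (rule AE_I2)
      fix x
      show "(\<lambda>n. \<bar>k x - ?t n x\<bar> powr m) \<longlonglongrightarrow> 0"
      proof (cases "0 < x")
        case True
        obtain N where N: "max (1 / x) (max \<bar>x\<bar> \<bar>k x\<bar>) < real N" using reals_Archimedean2 by blast
        have "\<forall>\<^sub>F n in sequentially. \<bar>k x - ?t n x\<bar> powr m = 0"
          using eventually_ge_at_top[of N]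
        proof eventually_elim
          case (elim n)
          then have n: "1 / x < real n" "\<bar>x\<bar> < real n" "\<bar>k x\<bar> < real n" using N by auto
          then have "1 / x < real (Suc n)" by simp
          then have "1 / real (Suc n) \<le> x" using True by (simp add: pos_divide_less_eq pos_divide_le_eq mult.commute)
          then show ?case using n True by (simp add: trunc_def)
        qed
        then show ?thesis by (rule tendsto_eventually)
      next
        case False
        then have "k x = 0" by (intro pos) simp
        then have "trunc (real n) k x = 0" for n by (simp add: trunc_def)
        then show ?thesis using \<open>k x = 0\<close> by simp
      qed
    qed
    show "AE x in lborel. norm (\<bar>k x - ?t n x\<bar> powr m) \<le> \<bar>k x\<bar> powr m" for n
      by (rule AE_I2) (auto simp: trunc_def indicator_def)
  qed (use Lp_integrable[OF k] in auto)
  then show ?thesis by (simp add: Lp_pow_def)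
qed

text \<open>Truncation, approximation by a continuous function in \<open>L\<^sup>1\<close>, Weierstrass approximation by a
  polynomial in \<open>s = x\<^sup>2\<close>, and multiplication by a cut-off.\<close>

theorem weighted_smooth_dense:
  fixes \<omega> :: "real \<Rightarrow> real"
  assumes m: "1 < m" and k: "k \<in> Lp m" and pos: "\<And>x. x \<le> 0 \<Longrightarrow> k x = 0"
    and \<omega>: "continuous_on UNIV \<omega>" "\<And>x. 0 < x \<Longrightarrow> 0 < \<omega> x" and \<epsilon>: "0 < \<epsilon>"
  shows "\<exists>Q a b. smooth Q \<and> 0 < a \<and> a < b \<and> (\<forall>s. s \<notin> {a<..<b} \<longrightarrow> Q s = 0) \<and>
     (\<lambda>x. k x - indicator {0<..} x * (\<omega> x * Q (x\<^sup>2))) \<in> Lp m \<and>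
     Lp_pow m (\<lambda>x. k x - indicator {0<..} x * (\<omega> x * Q (x\<^sup>2))) < \<epsilon>"
proof -
  have m0: "0 \<le> m" using m by simp
  note [measurable] = Lp_measurable[OF k]
  \<comment> \<open>Four error terms, each multiplied by at most three factors
    \<open>2 powr m\<close>, that is by \<open>8 powr m\<close>.\<close>
  define \<epsilon>1 where "\<epsilon>1 = \<epsilon> / (4 * 8 powr m)"
  have \<epsilon>1: "0 < \<epsilon>1" using \<epsilon> by (simp add: \<epsilon>1_def)
  from order_tendstoD(2)[OF tail_restrict_tendsto[OF m k pos] \<epsilon>1]
  obtain N where N: "Lp_pow m (\<lambda>x. k x - indicator {1 / real (Suc N)..real (Suc N)} x * trunc (real N) k x) < \<epsilon>1"
    unfolding eventually_sequentially by blast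
  define a where "a = 1 / real (Suc N)"
  define b where "b = real (Suc N)"
  have "a \<le> 1" "1 \<le> b" by (simp_all add: a_def b_def)
  then have "a \<le> b" by (rule order_trans)
  moreover have "0 < a" by (simp add: a_def)
  ultimately have ab: "0 < a" "a \<le> b" by blast+
  define \<kappa> where "\<kappa> x = indicator {a..b} x * trunc (real N) k x" for x
  have \<kappa>m[measurable]: "\<kappa> \<in> borel_measurable borel" unfolding \<kappa>_def[abs_def] by measurable
  have \<kappa>L: "\<kappa> \<in> Lp m" unfolding \<kappa>_def[abs_def] by (rule Lp_indicator(1)[OF m0 trunc_Lp[OF m k]]) simp
  have k\<kappa>: "Lp_pow m (\<lambda>x. k x - \<kappa> x) < \<epsilon>1" using N by (simp add: \<kappa>_def a_def b_def)
  \<comment> \<open>A margin around \<open>{a..b}\<close>: the cut-off lives on the larger interval,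
    so it tends to 1 wherever \<open>\<kappa>\<close> is nonzero.\<close>
  define a' where "a' = a / 2"
  define b' where "b' = b + 1"
  have ab': "0 < a'" "a' < a" "b < b'" "a' < b'" using ab by (auto simp: a'_def b'_def)
  have "compact (\<omega> ` {a'..b'})" by (intro compact_continuous_image continuous_on_subset[OF \<omega>(1)]) auto
  then obtain W where W: "\<And>x. x \<in> {a'..b'} \<Longrightarrow> \<bar>\<omega> x\<bar> \<le> W" "1 \<le> W"
  proof -
    assume that: "\<And>W. \<lbrakk>\<And>x. x \<in> {a'..b'} \<Longrightarrow> \<bar>\<omega> x\<bar> \<le> W; 1 \<le> W\<rbrakk> \<Longrightarrow> thesis"
    have "bounded (\<omega> ` {a'..b'})" by (intro compact_imp_bounded compact_continuous_image continuous_on_subset[OF \<omega>(1)]) auto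
    then obtain W0 where W0: "\<forall>x\<in>{a'..b'}. norm (\<omega> x) \<le> W0" unfolding bounded_iff by auto
    show thesis by (rule that[of "max W0 1"]) (use W0 in \<open>auto simp: le_max_iff_disj\<close>)
  qed
  obtain x0 where x0: "x0 \<in> {a..b}" "\<And>x. x \<in> {a..b} \<Longrightarrow> \<omega> x0 \<le> \<omega> x"
    using continuous_attains_inf[of "{a..b}" \<omega>] ab continuous_on_subset[OF \<omega>(1)] by auto
  define w where "w = \<omega> x0"
  have w: "0 < w" unfolding w_def using x0(1) ab by (intro \<omega>(2)) auto
  define M where "M = real N / w + 1"
  have M: "0 < M" using w by (simp add: M_def add_nonneg_pos)
  have [measurable]: "\<omega> \<in> borel_measurable borel" using \<omega>(1) by (rule borel_measurable_continuous_onI)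
  define c where "c x = \<kappa> x / \<omega> x" for x
  have [measurable]: "c \<in> borel_measurable borel" unfolding c_def[abs_def] by measurable
  have cM: "\<bar>c x\<bar> \<le> M" for x
  proof (cases "x \<in> {a..b}")
    case True
    have "\<bar>\<kappa> x\<bar> \<le> real N" by (auto simp: \<kappa>_def indicator_def trunc_def)
    moreover have "w \<le> \<omega> x" unfolding w_def by (rule x0(2)[OF True])
    ultimately have "\<bar>c x\<bar> \<le> real N / w" unfolding c_def abs_divide using w by (intro frac_le) auto
    then show ?thesis by (simp add: M_def)
  qed (use M in \<open>simp add: c_def \<kappa>_def\<close>)
  have c0: "c x = 0" if "x \<notin> {a..b}" for x using that by (simp add: c_def \<kappa>_def)
  have c\<kappa>: "\<kappa> x = \<omega> x * c x" if "0 < x" for x using \<omega>(2)[OF that] by (simp add: c_def)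
  have cint: "integrable lborel c"
  proof (rule Bochner_Integration.integrable_bound)
    show "integrable lborel (\<lambda>x. M * indicat_real {a..b} x)" by (simp add: emeasure_lborel_Icc_eq)
    show "AE x in lborel. norm (c x) \<le> norm (M * indicat_real {a..b} x)"
    proof (rule AE_I2)
      fix x show "norm (c x) \<le> norm (M * indicat_real {a..b} x)"
        using cM[of x] c0[of x] M by (cases "x \<in> {a..b}") auto
    qed
  qed measurable
  \<comment> \<open>As \<open>c\<close> and \<open>g\<close> are bounded by \<open>M\<close>,
    \<open>\<bar>c x - g x\<bar> powr m\<close> is at most
    \<open>(2 * M) powr (m - 1) * \<bar>c x - g0 x\<bar>\<close>: closeness in mean gives closeness
    in \<open>Lp m\<close>. Clamping \<open>g0\<close> to \<open>{- M..M}\<close> does not increase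
    the distance to \<open>c\<close>.\<close>
  define \<delta> where "\<delta> = \<epsilon>1 / (W powr m * (2 * M) powr (m - 1))"
  have \<delta>: "0 < \<delta>" using \<epsilon>1 W(2) M by (simp add: \<delta>_def)
  obtain g0 where g0: "continuous_on UNIV g0" "integrable lborel g0" "(\<integral>x. \<bar>c x - g0 x\<bar> \<partial>lborel) < \<delta>"
    using L1_approx_continuous[OF cint \<delta>] by blast
  define g where "g x = max (- M) (min M (g0 x))" for x
  have gc: "continuous_on A g" for A unfolding g_def[abs_def]
    by (intro continuous_intros continuous_on_subset[OF g0(1)]) auto
  have [measurable]: "g \<in> borel_measurable borel" by (rule borel_measurable_continuous_onI[OF gc])
  have gM: "\<bar>g x\<bar> \<le> M" for x using M by (auto simp: g_def)
  have cg: "\<bar>c x - g x\<bar> \<le> \<bar>c x - g0 x\<bar>" for x using cM[of x] M unfolding g_def by (auto simp: abs_le_iff max_def min_def)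
  have cgi: "integrable lborel (\<lambda>x. \<bar>c x - g0 x\<bar>)" using cint g0(2) by simp
  define \<eta> where "\<eta> = (\<epsilon>1 / (W powr m * (b' - a'))) powr (1/m)"
  have \<eta>: "0 < \<eta>" using \<epsilon>1 W(2) ab' by (simp add: \<eta>_def)
  have \<eta>m: "\<eta> powr m = \<epsilon>1 / (W powr m * (b' - a'))" unfolding \<eta>_def using m \<epsilon>1 W(2) ab' by (simp add: powr_powr)
  have "continuous_on {a'\<^sup>2..b'\<^sup>2} (\<lambda>s. g (sqrt s))"
    by (rule continuous_on_compose2[OF gc[of UNIV]]) (auto intro: continuous_intros)
  from Stone_Weierstrass_real_polynomial_function[OF _ this \<eta>]
  obtain p where p: "real_polynomial_function p" "\<And>s. s \<in> {a'\<^sup>2..b'\<^sup>2} \<Longrightarrow> \<bar>g (sqrt s) - p s\<bar> < \<eta>" by auto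
  have psm: "smooth p" by (rule smooth_real_polynomial_function[OF p(1)])
  have [measurable]: "p \<in> borel_measurable borel" by (rule borel_measurable_continuous_onI[OF smooth_continuous[OF psm]])
  define A where "A = a'\<^sup>2"
  define B where "B = b'\<^sup>2"
  have AB: "0 < A" "A < B" unfolding A_def B_def using ab' by (auto intro!: power_strict_mono)
  have in_iff: "x\<^sup>2 \<in> {A<..<B} \<longleftrightarrow> x \<in> {a'<..<b'}" if "0 < x" for x
  proof -
    have "u\<^sup>2 < v\<^sup>2 \<longleftrightarrow> u < v" if "0 < u" "0 < v" for u v :: real
      using that by (auto intro: power_strict_mono power2_less_imp_less)
    then show ?thesis unfolding A_def B_def using that ab' by simp
  qed
  define Q where "Q n s = p s * cutoff n A B s" for n s
  have Qs: "smooth (Q n)" for n unfolding Q_def[abs_def] by (intro smooth.smooth_mult psm smooth_cutoff)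
  have Q0: "Q n s = 0" if "s \<notin> {A<..<B}" for n s unfolding Q_def using cutoff_eq_0[OF that] by simp
  have [measurable]: "Q n \<in> borel_measurable borel" for n by (rule borel_measurable_continuous_onI[OF smooth_continuous[OF Qs]])
  define h where "h n x = indicator {0<..} x * (\<omega> x * Q n (x\<^sup>2))" for n x
  have [measurable]: "h n \<in> borel_measurable borel" for n unfolding h_def[abs_def] by measurable
  have cutm[measurable]: "cutoff n A B \<in> borel_measurable borel" for n
    by (rule borel_measurable_continuous_onI[OF smooth_continuous[OF smooth_cutoff]])
  \<comment> \<open>\<open>z n\<close> is the loss from the cut-off and \<open>y n\<close> the
    approximation error times the cut-off. The latter is small uniformly in \<open>n\<close>, so
    \<open>n\<close> is chosen last to make \<open>z n\<close> small.\<close>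
  define z where "z n x = \<kappa> x * (1 - cutoff n A B (x\<^sup>2))" for n x
  define y where "y n x = \<kappa> x - h n x - z n x" for n x
  have [measurable]: "z n \<in> borel_measurable borel" "y n \<in> borel_measurable borel" for n
    unfolding z_def[abs_def] y_def[abs_def] by measurable
  have zL: "z n \<in> Lp m" for n
  proof (rule Lp_bound(1)[OF m0 \<kappa>L])
    show "\<bar>z n x\<bar> \<le> \<bar>\<kappa> x\<bar>" for x unfolding z_def abs_mult
      using cutoff_bounds[of n A B "x\<^sup>2"] by (intro mult_left_le) auto
  qed measurable
  have zlim: "(\<lambda>n. Lp_pow m (z n)) \<longlonglongrightarrow> 0"
  proof -
    have "(\<lambda>n. \<integral>x. \<bar>z n x\<bar> powr m \<partial>lborel) \<longlonglongrightarrow> integral\<^sup>L lborel (\<lambda>x::real. 0)"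
    proof (rule integral_dominated_convergence[where w = "\<lambda>x. \<bar>\<kappa> x\<bar> powr m"])
      show "AE x in lborel. (\<lambda>n. \<bar>z n x\<bar> powr m) \<longlonglongrightarrow> 0"
      proof (rule AE_I2)
        fix x
        show "(\<lambda>n. \<bar>z n x\<bar> powr m) \<longlonglongrightarrow> 0"
        proof (cases "x \<in> {a..b}")
          case True
          then have "x\<^sup>2 \<in> {A<..<B}" using in_iff[of x] ab ab' by auto
          then have "(\<lambda>n. \<bar>\<kappa> x * (1 - cutoff n A B (x\<^sup>2))\<bar> powr m) \<longlonglongrightarrow> \<bar>\<kappa> x * (1 - 1)\<bar> powr m"
            using m by (intro tendsto_powr2 tendsto_intros cutoff_tendsto) auto
          then show ?thesis by (simp add: z_def)
        qed (simp add: z_def \<kappa>_def)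
      qed
      show "AE x in lborel. norm (\<bar>z n x\<bar> powr m) \<le> \<bar>\<kappa> x\<bar> powr m" for n
      proof (rule AE_I2)
        fix x
        have "\<bar>z n x\<bar> \<le> \<bar>\<kappa> x\<bar>" unfolding z_def abs_mult
          using cutoff_bounds[of n A B "x\<^sup>2"] by (intro mult_left_le) auto
        then show "norm (\<bar>z n x\<bar> powr m) \<le> \<bar>\<kappa> x\<bar> powr m" using m by (simp add: powr_mono2)
      qed
    qed (use Lp_integrable[OF \<kappa>L] in auto)
    then show ?thesis by (simp add: Lp_pow_def)
  qed
  have yb: "\<bar>y n x\<bar> powr m \<le> 2 powr m * (W powr m * (2 * M) powr (m - 1) * \<bar>c x - g0 x\<bar>
      + W powr m * \<eta> powr m * indicator {a'..b'} x)" for n x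
  proof (cases "x \<in> {a'<..<b'}")
    case True
    then have x: "0 < x" "x \<in> {a'..b'}" using ab' by auto
    define \<beta> where "\<beta> = cutoff n A B (x\<^sup>2)"
    have \<beta>: "0 \<le> \<beta>" "\<beta> \<le> 1" unfolding \<beta>_def by (rule cutoff_bounds)+
    have gp: "\<bar>g x - p (x\<^sup>2)\<bar> \<le> \<eta>"
    proof -
      have "x\<^sup>2 \<in> {a'\<^sup>2..b'\<^sup>2}" using x ab' by (auto intro!: power_mono)
      from p(2)[OF this] show ?thesis using x by simp
    qed
    have "y n x = \<omega> x * \<beta> * ((c x - g x) + (g x - p (x\<^sup>2)))"
      unfolding y_def z_def h_def Q_def \<beta>_def[symmetric] c\<kappa>[OF x(1)] using x(1) by (simp add: algebra_simps)
    then have "\<bar>y n x\<bar> = \<bar>\<omega> x\<bar> * \<beta> * \<bar>(c x - g x) + (g x - p (x\<^sup>2))\<bar>" using \<beta> by (simp add: abs_mult)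
    also have "\<dots> \<le> W * 1 * \<bar>(c x - g x) + (g x - p (x\<^sup>2))\<bar>"
      using W x \<beta> by (intro mult_right_mono mult_mono) auto
    finally have "\<bar>y n x\<bar> powr m \<le> (W * \<bar>(c x - g x) + (g x - p (x\<^sup>2))\<bar>) powr m"
      using m by (intro powr_mono2) auto
    also have "\<dots> = W powr m * \<bar>(c x - g x) + (g x - p (x\<^sup>2))\<bar> powr m" using W by (simp add: powr_mult)
    also have "\<dots> \<le> W powr m * (2 powr m * (\<bar>c x - g x\<bar> powr m + \<bar>g x - p (x\<^sup>2)\<bar> powr m))"
      by (intro mult_left_mono powr_abs_add_le m0) simp
    also have "\<dots> \<le> W powr m * (2 powr m * ((2 * M) powr (m - 1) * \<bar>c x - g0 x\<bar> + \<eta> powr m))"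
    proof (intro mult_left_mono add_mono)
      have "\<bar>c x - g x\<bar> \<le> 2 * M" using cM[of x] gM[of x] by linarith
      have "\<bar>c x - g x\<bar> powr m = \<bar>c x - g x\<bar> powr (m - 1) * \<bar>c x - g x\<bar>"
        by (cases "c x - g x = 0") (simp_all add: powr_diff)
      also have "\<dots> \<le> (2 * M) powr (m - 1) * \<bar>c x - g0 x\<bar>"
        using m cg[of x] \<open>\<bar>c x - g x\<bar> \<le> 2 * M\<close> by (intro mult_mono powr_mono2) auto
      finally show "\<bar>c x - g x\<bar> powr m \<le> (2 * M) powr (m - 1) * \<bar>c x - g0 x\<bar>" .
      show "\<bar>g x - p (x\<^sup>2)\<bar> powr m \<le> \<eta> powr m" using gp m by (intro powr_mono2) auto
    qed auto
    also have "\<dots> = 2 powr m * (W powr m * (2 * M) powr (m - 1) * \<bar>c x - g0 x\<bar> + W powr m * \<eta> powr m * indicator {a'..b'} x)"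
      using x(2) by (simp add: algebra_simps)
    finally show ?thesis .
  next
    case False
    have "\<kappa> x = 0" using False ab' by (auto simp: \<kappa>_def indicator_def)
    moreover have "h n x = 0"
    proof (cases "0 < x")
      case True
      then have "x\<^sup>2 \<notin> {A<..<B}" using in_iff[of x] False by blast
      then show ?thesis by (simp add: h_def Q0)
    qed (simp add: h_def)
    ultimately have "y n x = 0" by (simp add: y_def z_def)
    then show ?thesis using m by (simp add: indicator_def)
  qed
  let ?Y = "\<lambda>x. 2 powr m * (W powr m * (2 * M) powr (m - 1) * \<bar>c x - g0 x\<bar> + W powr m * \<eta> powr m * indicator {a'..b'} x)"
  have Yi: "integrable lborel ?Y" using cgi by (simp add: emeasure_lborel_Icc_eq)
  have yL: "y n \<in> Lp m" for n
    unfolding Lp_def mem_Collect_eq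
  proof (intro conjI Bochner_Integration.integrable_bound[OF Yi])
    show "AE x in lborel. norm (\<bar>y n x\<bar> powr m) \<le> norm (?Y x)"
    proof (rule AE_I2)
      fix x show "norm (\<bar>y n x\<bar> powr m) \<le> norm (?Y x)" using yb[of n x] by simp
    qed
  qed measurable
  have yp: "Lp_pow m (y n) \<le> 2 powr m * (\<epsilon>1 + \<epsilon>1)" for n
  proof -
    have "Lp_pow m (y n) \<le> (\<integral>x. ?Y x \<partial>lborel)"
      unfolding Lp_pow_def by (rule integral_mono[OF Lp_integrable[OF yL] Yi yb])
    also have "\<dots> = 2 powr m * (W powr m * (2 * M) powr (m - 1) * (\<integral>x. \<bar>c x - g0 x\<bar> \<partial>lborel) + W powr m * \<eta> powr m * (b' - a'))"
      using cgi ab' by (simp add: emeasure_lborel_Icc_eq)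
    also have "\<dots> \<le> 2 powr m * (\<epsilon>1 + \<epsilon>1)"
    proof (intro mult_left_mono add_mono)
      have "W powr m * (2 * M) powr (m - 1) * (\<integral>x. \<bar>c x - g0 x\<bar> \<partial>lborel) \<le> W powr m * (2 * M) powr (m - 1) * \<delta>"
        using g0(3) by (intro mult_left_mono) auto
      also have "\<dots> = \<epsilon>1" using W(2) M by (simp add: \<delta>_def)
      finally show "W powr m * (2 * M) powr (m - 1) * (\<integral>x. \<bar>c x - g0 x\<bar> \<partial>lborel) \<le> \<epsilon>1" .
      show "W powr m * \<eta> powr m * (b' - a') \<le> \<epsilon>1" unfolding \<eta>m using W(2) ab' by simp
    qed simp
    finally show ?thesis .
  qed
  from order_tendstoD(2)[OF zlim \<epsilon>1] obtain n where n: "Lp_pow m (z n) < \<epsilon>1" unfolding eventually_sequentially by blast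
  have d1: "(\<lambda>x. k x - \<kappa> x) \<in> Lp m" by (rule Lp_diff[OF m0 k \<kappa>L])
  have d2: "(\<lambda>x. y n x + z n x) \<in> Lp m" by (rule Lp_add[OF m0 yL zL])
  have eq: "(\<lambda>x. k x - h n x) = (\<lambda>x. (k x - \<kappa> x) + (y n x + z n x))" by (simp add: y_def)
  have L: "(\<lambda>x. k x - h n x) \<in> Lp m" unfolding eq by (rule Lp_add[OF m0 d1 d2])
  have "Lp_pow m (\<lambda>x. k x - h n x) \<le> 2 powr m * (Lp_pow m (\<lambda>x. k x - \<kappa> x) + Lp_pow m (\<lambda>x. y n x + z n x))"
    unfolding eq by (rule Lp_pow_add_le[OF m0 d1 d2])
  also have "\<dots> \<le> 2 powr m * (Lp_pow m (\<lambda>x. k x - \<kappa> x) + 2 powr m * (Lp_pow m (y n) + Lp_pow m (z n)))"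
    by (intro mult_left_mono add_left_mono Lp_pow_add_le m0 yL zL) simp
  also have "\<dots> < \<epsilon>"
  proof -
    have t1: "1 \<le> 2 powr m" using m by (simp add: ge_one_powr_ge_zero)
    define T where "T = 2 powr m"
    have T: "1 \<le> T" "8 powr m = T * T * T" using t1 unfolding T_def by (simp_all flip: powr_mult)
    have TT: "T \<le> T * T * T" "T * T \<le> T * T * T" using T(1)
      by (simp_all add: mult_left_le_one_le mult_le_cancel_left1 one_le_mult_iff) (smt (verit) mult_le_cancel_left1 mult_left_mono)+
    have "T * (Lp_pow m (\<lambda>x. k x - \<kappa> x) + T * (Lp_pow m (y n) + Lp_pow m (z n)))
      < T * (\<epsilon>1 + T * (T * (\<epsilon>1 + \<epsilon>1) + \<epsilon>1))"
      using T(1) k\<kappa> n yp[of n] by (intro mult_strict_left_mono add_less_le_mono mult_left_mono add_mono) (auto simp: T_def)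
    also have "\<dots> = \<epsilon>1 * T + 2 * (\<epsilon>1 * (T * T * T)) + \<epsilon>1 * (T * T)" by (simp add: algebra_simps)
    also have "\<dots> \<le> \<epsilon>1 * (T * T * T) + 2 * (\<epsilon>1 * (T * T * T)) + \<epsilon>1 * (T * T * T)"
      using TT \<epsilon>1 by (intro add_mono mult_left_mono) auto
    also have "\<dots> = \<epsilon>" unfolding \<epsilon>1_def T(2) using T(1) by simp
    finally show ?thesis unfolding T_def .
  qed
  finally have "Lp_pow m (\<lambda>x. k x - h n x) < \<epsilon>" .
  then show ?thesis using Qs[of n] AB Q0 L unfolding h_def by blast
qed

section \<open>Borel representatives for the completed measure\<close>

lemma lebesgue_measurable_AE_eq:
  fixes f g :: "real \<Rightarrow> real"
  assumes g: "g \<in> borel_measurable borel" and eq: "AE x in lborel. f x = g x"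
  shows "f \<in> borel_measurable lebesgue"
proof (rule measurableI)
  fix A :: "real set" assume A: "A \<in> sets borel"
  have 1: "{x \<in> space lebesgue. f x \<in> A \<and> f x \<noteq> g x} \<in> sets lebesgue"
    using eq by (intro sets_completion_AE[unfolded pred_def]) (auto elim: eventually_mono)
  have 2: "{x \<in> space lebesgue. f x \<noteq> g x} \<in> sets lebesgue"
    using eq by (intro sets_completion_AE[unfolded pred_def]) (auto elim: eventually_mono)
  have 3: "g -` A \<in> sets lebesgue" using measurable_sets_borel[OF g A] by auto
  have "f -` A \<inter> space lebesgue = {x \<in> space lebesgue. f x \<in> A \<and> f x \<noteq> g x} \<union> (g -` A - {x \<in> space lebesgue. f x \<noteq> g x})"
    by auto
  then show "f -` A \<inter> space lebesgue \<in> sets lebesgue" using 1 2 3 by auto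
qed auto

lemma LINT_lebesgue_AE_eq:
  fixes f g :: "real \<Rightarrow> real"
  assumes g: "g \<in> borel_measurable borel" and S: "S \<in> sets borel" and eq: "AE x in lborel. x \<in> S \<longrightarrow> f x = g x"
  shows "(LINT x:S|lebesgue. f x) = (LINT x:S|lborel. g x)"
    and "set_integrable lebesgue S f \<longleftrightarrow> set_integrable lborel S g"
proof -
  note [measurable] = g S
  have ae: "AE x in lborel. indicator S x *\<^sub>R f x = indicator S x *\<^sub>R g x"
    using eq by eventually_elim (auto simp: indicator_def)
  have m: "(\<lambda>x. indicator S x *\<^sub>R f x) \<in> borel_measurable lebesgue"
    by (rule lebesgue_measurable_AE_eq[OF _ ae]) measurable
  have mg: "(\<lambda>x. indicator S x *\<^sub>R g x) \<in> borel_measurable lborel" by measurable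
  have mg': "(\<lambda>x. indicator S x *\<^sub>R g x) \<in> borel_measurable lebesgue" using mg by (rule measurable_completion)
  have ae': "AE x in lebesgue. indicator S x *\<^sub>R f x = indicator S x *\<^sub>R g x" using ae by (rule AE_completion)
  show "(LINT x:S|lebesgue. f x) = (LINT x:S|lborel. g x)"
    unfolding set_lebesgue_integral_def
    using integral_cong_AE[OF m mg' ae'] integral_completion[OF mg] by simp
  show "set_integrable lebesgue S f \<longleftrightarrow> set_integrable lborel S g"
    unfolding set_integrable_def
    using integrable_cong_AE[OF m mg' ae'] integrable_completion[OF mg] by simp
qed

text \<open>The density is given only on compact subintervals and for the completed measure.
  Exhausting the half-line shows that it is measurable there, and a Borel representative has the
  same integrals.\<close>

lemma loc_abs_cont_borel:
  assumes "loc_abs_cont u"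
  shows "\<exists>g\<in>borel_measurable borel. (\<forall>a b. 0 < a \<longrightarrow> set_integrable lborel {a..b} g) \<and>
    (\<forall>a b. 0 < a \<and> a \<le> b \<longrightarrow> u b - u a = (LINT x:{a..b}|lborel. g x))"
proof -
  obtain g0 where g0: "\<And>a b. 0 < a \<Longrightarrow> a \<le> b \<Longrightarrow> set_integrable lebesgue {a..b} g0"
    "\<And>a b. 0 < a \<Longrightarrow> a \<le> b \<Longrightarrow> u b - u a = (LINT r:{a..b}|lebesgue. g0 r)"
    using assms unfolding loc_abs_cont_def by blast
  have m: "(\<lambda>x. indicator {0<..} x * g0 x) \<in> borel_measurable lebesgue"
  proof (rule borel_measurable_LIMSEQ_real)
    \<comment> \<open>The right end is written as the left end plus \<open>real n\<close> so that
      the interval is never reversed, as \<open>g0(1)\<close> requires.\<close>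
    show "(\<lambda>x. indicator {1 / real (Suc n)..1 / real (Suc n) + real n} x * g0 x) \<in> borel_measurable lebesgue" for n
      using g0(1)[of "1 / real (Suc n)" "1 / real (Suc n) + real n"] by (simp add: set_integrable_def)
    fix x :: real
    show "(\<lambda>n. indicator {1 / real (Suc n)..1 / real (Suc n) + real n} x * g0 x) \<longlonglongrightarrow> indicator {0<..} x * g0 x"
    proof (cases "0 < x")
      case True
      obtain N where N: "max x (1/x) < real N" using reals_Archimedean2 by blast
      have "eventually (\<lambda>n. indicator {1 / real (Suc n)..1 / real (Suc n) + real n} x * g0 x = indicator {0<..} x * g0 x) sequentially"
        using eventually_ge_at_top[of N]
      proof eventually_elim
        case (elim n)
        then have n: "x < real n" "1 / x < real n" using N by auto
        then have "1 / x < real (Suc n)" by simp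
        then have "1 / real (Suc n) \<le> x" using True by (simp add: pos_divide_less_eq pos_divide_le_eq mult.commute)
        moreover have "x \<le> 1 / real (Suc n) + real n" using n(1) by (intro add_increasing) auto
        ultimately show ?case using True by simp
      qed
      then show ?thesis by (rule tendsto_eventually)
    next
      case False
      have "x \<notin> {1 / real (Suc n)..1 / real (Suc n) + real n}" for n
      proof -
        have "0 < 1 / real (Suc n)" by simp
        then show ?thesis using False unfolding atLeastAtMost_iff by linarith
      qed
      then show ?thesis using False by simp
    qed
  qed
  obtain g where g: "g \<in> borel_measurable lborel" "AE x in lborel. indicator {0<..} x * g0 x = g x"
    using completion_ex_borel_measurable_real[OF m] by blast
  have gb: "g \<in> borel_measurable borel" using g(1) by simp
  have ae: "AE x in lborel. x \<in> {a..b} \<longrightarrow> g0 x = g x" if "0 < a" for a b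
    using g(2) by eventually_elim (use that in \<open>auto simp: indicator_def\<close>)
  show ?thesis
  proof (intro bexI[OF _ gb] conjI allI impI)
    fix a b :: real assume a: "0 < a"
    show "set_integrable lborel {a..b} g"
    proof (cases "a \<le> b")
      case True
      then show ?thesis using g0(1)[OF a True] LINT_lebesgue_AE_eq(2)[OF gb _ ae[OF a], of b] by simp
    qed (simp add: set_integrable_def)
  next
    fix a b :: real assume ab: "0 < a \<and> a \<le> b"
    then show "u b - u a = (LINT x:{a..b}|lborel. g x)"
      using g0(2)[of a b] LINT_lebesgue_AE_eq(1)[OF gb _ ae[of a b]] by simp
  qed
qed

text \<open>\<open>k0\<close> and \<open>k1\<close> represent \<open>r \<partial>\<^sub>r u\<^sub>0\<close> and \<open>r u\<^sub>1\<close>, extended by zero to the negative half-line.\<close>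

definition Lm_repr :: "real \<Rightarrow> (real \<Rightarrow> real) \<Rightarrow> (real \<Rightarrow> real) \<Rightarrow> (real \<Rightarrow> real) \<Rightarrow> (real \<Rightarrow> real) \<Rightarrow> bool" where
  "Lm_repr m u0 u1 k0 k1 \<longleftrightarrow> k0 \<in> Lp m \<and> k1 \<in> Lp m \<and> (\<forall>x\<le>0. k0 x = 0 \<and> k1 x = 0) \<and>
     (\<forall>a b. 0 < a \<and> a \<le> b \<longrightarrow> u0 b - u0 a = (LINT x:{a..b}|lborel. k0 x / x)) \<and>
     (AE x in lborel. 0 < x \<longrightarrow> x * u1 x = k1 x)"

lemma set_integrable_divide_id:
  assumes m: "1 < m" and k: "k \<in> Lp m" and a: "0 < a"
  shows "set_integrable lborel {a..b} (\<lambda>x. k x / x)"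
  unfolding set_integrable_def
proof (rule Bochner_Integration.integrable_bound)
  note [measurable] = Lp_measurable[OF k]
  show "integrable lborel (\<lambda>x. (1 / a) * (indicat_real {a..b} x *\<^sub>R k x))"
    using Lp_Icc_integrable[OF m k, of a b] by (intro integrable_mult_right) (simp add: set_integrable_def)
  show "AE x in lborel. norm (indicat_real {a..b} x *\<^sub>R (k x / x)) \<le> norm ((1 / a) * (indicat_real {a..b} x *\<^sub>R k x))"
  proof (rule AE_I2)
    fix x show "norm (indicat_real {a..b} x *\<^sub>R (k x / x)) \<le> norm ((1 / a) * (indicat_real {a..b} x *\<^sub>R k x))"
    proof (cases "x \<in> {a..b}")
      case True
      then have "\<bar>k x\<bar> / x \<le> \<bar>k x\<bar> / a" using a by (intro divide_left_mono) auto
      then show ?thesis using True a by simp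
    qed simp
  qed
  show "(\<lambda>x. indicat_real {a..b} x *\<^sub>R (k x / x)) \<in> borel_measurable lborel" by simp
qed

lemma Lm_repr_deriv:
  assumes m: "1 < m" and r: "Lm_repr m u0 u1 k0 k1"
  shows "AE x in lborel. 0 < x \<longrightarrow> (u0 has_real_derivative k0 x / x) (at x)"
  by (rule AE_has_derivative_primitive_pos) (use r set_integrable_divide_id[OF m] in \<open>auto simp: Lm_repr_def\<close>)

lemma
  assumes m: "1 < m" and r: "Lm_repr m u0 u1 k0 k1"
  shows Lm_repr_norm: "Lm_norm m (u0, u1) = (Lp_pow m k0 + Lp_pow m k1) powr (1/m)"
    and Lm_repr_set_integrable: "set_integrable lebesgue {0<..} (\<lambda>r. \<bar>r * deriv u0 r\<bar> powr m + \<bar>r * u1 r\<bar> powr m)"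
proof -
  have k: "k0 \<in> Lp m" "k1 \<in> Lp m" and z: "\<And>x. x \<le> 0 \<Longrightarrow> k0 x = 0 \<and> k1 x = 0"
    and ae1: "AE x in lborel. 0 < x \<longrightarrow> x * u1 x = k1 x"
    using r unfolding Lm_repr_def by blast+
  note [measurable] = Lp_measurable[OF k(1)] Lp_measurable[OF k(2)]
  have b: "(\<lambda>x. \<bar>k0 x\<bar> powr m + \<bar>k1 x\<bar> powr m) \<in> borel_measurable borel" by measurable
  have S: "{0<..} \<in> sets (borel :: real measure)" by simp
  have ae: "AE x in lborel. x \<in> {0<..} \<longrightarrow> \<bar>x * deriv u0 x\<bar> powr m + \<bar>x * u1 x\<bar> powr m = \<bar>k0 x\<bar> powr m + \<bar>k1 x\<bar> powr m"
    using Lm_repr_deriv[OF m r] ae1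
  proof eventually_elim
    case (elim x)
    show ?case
    proof
      assume x: "x \<in> {0<..}"
      then have "deriv u0 x = k0 x / x" using elim by (intro DERIV_imp_deriv) simp
      then show "\<bar>x * deriv u0 x\<bar> powr m + \<bar>x * u1 x\<bar> powr m = \<bar>k0 x\<bar> powr m + \<bar>k1 x\<bar> powr m" using elim x by simp
    qed
  qed
  have ind: "(\<lambda>x. indicator {0<..} x *\<^sub>R (\<bar>k0 x\<bar> powr m + \<bar>k1 x\<bar> powr m)) = (\<lambda>x. \<bar>k0 x\<bar> powr m + \<bar>k1 x\<bar> powr m)"
  proof
    fix x show "indicator {0<..} x *\<^sub>R (\<bar>k0 x\<bar> powr m + \<bar>k1 x\<bar> powr m) = \<bar>k0 x\<bar> powr m + \<bar>k1 x\<bar> powr m"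
      using z[of x] by (cases "0 < x") auto
  qed
  have int: "integrable lborel (\<lambda>x. \<bar>k0 x\<bar> powr m)" "integrable lborel (\<lambda>x. \<bar>k1 x\<bar> powr m)"
    using k by (auto intro: Lp_integrable)
  show "set_integrable lebesgue {0<..} (\<lambda>r. \<bar>r * deriv u0 r\<bar> powr m + \<bar>r * u1 r\<bar> powr m)"
    unfolding LINT_lebesgue_AE_eq(2)[OF b S ae] unfolding set_integrable_def ind using int by simp
  have "(LINT r:{0<..}|lebesgue. \<bar>r * deriv u0 r\<bar> powr m + \<bar>r * u1 r\<bar> powr m) = Lp_pow m k0 + Lp_pow m k1"
    unfolding LINT_lebesgue_AE_eq(1)[OF b S ae] unfolding set_lebesgue_integral_def ind Lp_pow_def using int by simp
  then show "Lm_norm m (u0, u1) = (Lp_pow m k0 + Lp_pow m k1) powr (1/m)" by (simp add: Lm_norm_def)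
qed

lemma Lm_repr_finite:
  assumes m: "1 < m" and r: "Lm_repr m u0 u1 k0 k1" and lim: "(u0 \<longlongrightarrow> 0) at_top"
  shows "(u0, u1) \<in> Lm_finite m"
proof -
  have k: "k0 \<in> Lp m" "k1 \<in> Lp m" and inc: "\<And>a b. 0 < a \<Longrightarrow> a \<le> b \<Longrightarrow> u0 b - u0 a = (LINT x:{a..b}|lborel. k0 x / x)"
    and ae1: "AE x in lborel. 0 < x \<longrightarrow> x * u1 x = k1 x"
    using r unfolding Lm_repr_def by blast+
  note [measurable] = Lp_measurable[OF k(1)] Lp_measurable[OF k(2)]
  have b: "(\<lambda>x. k0 x / x) \<in> borel_measurable borel" by measurable
  have "loc_abs_cont u0"
    unfolding loc_abs_cont_def
  proof (intro exI[of _ "\<lambda>x. k0 x / x"] allI impI)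
    fix a c :: real assume ac: "0 < a \<and> a \<le> c"
    have S: "{a..c} \<in> sets borel" by simp
    have ae: "AE x in lborel. x \<in> {a..c} \<longrightarrow> k0 x / x = k0 x / x" by simp
    show "set_integrable lebesgue {a..c} (\<lambda>x. k0 x / x) \<and> u0 c - u0 a = (LINT x:{a..c}|lebesgue. k0 x / x)"
      unfolding LINT_lebesgue_AE_eq[OF b S ae] using ac set_integrable_divide_id[OF m k(1)] inc by simp
  qed
  moreover have "u1 \<in> borel_measurable (lebesgue_on {0<..})"
  proof -
    have "(\<lambda>x. if x \<in> {0<..} then u1 x else 0) \<in> borel_measurable lebesgue"
    proof (rule lebesgue_measurable_AE_eq)
      show "(\<lambda>x. if x \<in> {0<..} then k1 x / x else 0) \<in> borel_measurable borel" by measurable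
      show "AE x in lborel. (if x \<in> {0<..} then u1 x else 0) = (if x \<in> {0<..} then k1 x / x else 0)"
        using ae1 by eventually_elim (auto simp: field_simps)
    qed
    then show ?thesis by (rule borel_measurable_if_D)
  qed
  ultimately show ?thesis using lim Lm_repr_set_integrable[OF m r] by (simp add: Lm_finite_def)
qed

text \<open>The density of \<open>u0\<close> agrees almost everywhere with \<open>deriv u0\<close>,
  so finiteness of the norm puts its product with \<open>x\<close> into \<open>Lp m\<close> after
  extension by zero.\<close>

lemma Lm_finite_repr:
  assumes m: "1 < m" and u: "(u0, u1) \<in> Lm_finite m"
  shows "\<exists>k0 k1. Lm_repr m u0 u1 k0 k1"
proof -
  have lac: "loc_abs_cont u0" and u1: "u1 \<in> borel_measurable (lebesgue_on {0<..})"
    and int: "set_integrable lebesgue {0<..} (\<lambda>r. \<bar>r * deriv u0 r\<bar> powr m + \<bar>r * u1 r\<bar> powr m)"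
    using u unfolding Lm_finite_def by auto
  obtain g where g: "g \<in> borel_measurable borel" "\<And>a b. 0 < a \<Longrightarrow> set_integrable lborel {a..b} g"
    "\<And>a b. 0 < a \<Longrightarrow> a \<le> b \<Longrightarrow> u0 b - u0 a = (LINT x:{a..b}|lborel. g x)"
    using loc_abs_cont_borel[OF lac] by blast
  have "(\<lambda>x. if x \<in> {0<..} then u1 x else 0) \<in> borel_measurable lebesgue"
    using u1 by (rule borel_measurable_if_I) simp
  then obtain h where h: "h \<in> borel_measurable lborel" "AE x in lborel. (if x \<in> {0<..} then u1 x else 0) = h x"
    using completion_ex_borel_measurable_real by blast
  note [measurable] = g(1) h(1)
  define k0 where "k0 x = (if 0 < x then x * g x else 0)" for x
  define k1 where "k1 x = (if 0 < x then x * h x else 0)" for x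
  have [measurable]: "k0 \<in> borel_measurable borel" "k1 \<in> borel_measurable borel"
    using h(1) unfolding k0_def[abs_def] k1_def[abs_def] by measurable
  have aed: "AE x in lborel. 0 < x \<longrightarrow> (u0 has_real_derivative g x) (at x)"
    by (rule AE_has_derivative_primitive_pos[OF g(2,3)])
  have ae: "AE x in lborel. x \<in> {0<..} \<longrightarrow> \<bar>x * deriv u0 x\<bar> powr m + \<bar>x * u1 x\<bar> powr m = \<bar>k0 x\<bar> powr m + \<bar>k1 x\<bar> powr m"
    using aed h(2)
  proof eventually_elim
    case (elim x)
    show ?case
    proof
      assume x: "x \<in> {0<..}"
      then have "deriv u0 x = g x" using elim by (intro DERIV_imp_deriv) simp
      then show "\<bar>x * deriv u0 x\<bar> powr m + \<bar>x * u1 x\<bar> powr m = \<bar>k0 x\<bar> powr m + \<bar>k1 x\<bar> powr m"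
        using elim x by (simp add: k0_def k1_def)
    qed
  qed
  have b: "(\<lambda>x. \<bar>k0 x\<bar> powr m + \<bar>k1 x\<bar> powr m) \<in> borel_measurable borel" by measurable
  have "set_integrable lborel {0<..} (\<lambda>x. \<bar>k0 x\<bar> powr m + \<bar>k1 x\<bar> powr m)"
    using int LINT_lebesgue_AE_eq(2)[OF b _ ae] by simp
  then have I: "integrable lborel (\<lambda>x. indicator {0<..} x *\<^sub>R (\<bar>k0 x\<bar> powr m + \<bar>k1 x\<bar> powr m))"
    by (simp add: set_integrable_def)
  have L0: "k0 \<in> Lp m" unfolding Lp_def mem_Collect_eq
  proof (intro conjI Bochner_Integration.integrable_bound[OF I])
    show "AE x in lborel. norm (\<bar>k0 x\<bar> powr m) \<le> norm (indicator {0<..} x *\<^sub>R (\<bar>k0 x\<bar> powr m + \<bar>k1 x\<bar> powr m))"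
      by (rule AE_I2) (simp add: k0_def indicator_def)
  qed measurable
  have L1: "k1 \<in> Lp m" unfolding Lp_def mem_Collect_eq
  proof (intro conjI Bochner_Integration.integrable_bound[OF I])
    show "AE x in lborel. norm (\<bar>k1 x\<bar> powr m) \<le> norm (indicator {0<..} x *\<^sub>R (\<bar>k0 x\<bar> powr m + \<bar>k1 x\<bar> powr m))"
      by (rule AE_I2) (simp add: k1_def indicator_def)
  qed measurable
  have "u0 b - u0 a = (LINT x:{a..b}|lborel. k0 x / x)" if "0 < a" "a \<le> b" for a b
    unfolding g(3)[OF that] using that by (intro set_lebesgue_integral_cong) (auto simp: k0_def)
  moreover have "AE x in lborel. 0 < x \<longrightarrow> x * u1 x = k1 x"
    using h(2) by eventually_elim (auto simp: k1_def)
  ultimately have "Lm_repr m u0 u1 k0 k1" unfolding Lm_repr_def using L0 L1 by (auto simp: k0_def k1_def)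
  then show ?thesis by blast
qed

section \<open>Density of test pairs among all pairs of finite norm\<close>

lemma Lm_repr_diff:
  assumes m: "1 < m" and u: "Lm_repr m u0 u1 k0 k1" and v: "Lm_repr m v0 v1 h0 h1"
  shows "Lm_repr m (\<lambda>r. u0 r - v0 r) (\<lambda>r. u1 r - v1 r) (\<lambda>x. k0 x - h0 x) (\<lambda>x. k1 x - h1 x)"
  unfolding Lm_repr_def
proof (intro conjI)
  have k: "k0 \<in> Lp m" "k1 \<in> Lp m" "h0 \<in> Lp m" "h1 \<in> Lp m" using u v unfolding Lm_repr_def by blast+
  show "(\<lambda>x. k0 x - h0 x) \<in> Lp m" "(\<lambda>x. k1 x - h1 x) \<in> Lp m" using m k by (auto intro: Lp_diff)
  show "\<forall>x\<le>0. k0 x - h0 x = 0 \<and> k1 x - h1 x = 0" using u v unfolding Lm_repr_def by auto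
  show "\<forall>a b. 0 < a \<and> a \<le> b \<longrightarrow> u0 b - v0 b - (u0 a - v0 a) = (LINT x:{a..b}|lborel. (k0 x - h0 x) / x)"
  proof (intro allI impI)
    fix a b :: real assume ab: "0 < a \<and> a \<le> b"
    have "(LINT x:{a..b}|lborel. (k0 x - h0 x) / x) = (LINT x:{a..b}|lborel. k0 x / x) - (LINT x:{a..b}|lborel. h0 x / x)"
      unfolding diff_divide_distrib using ab k m by (intro set_integral_diff set_integrable_divide_id) auto
    moreover have "u0 b - u0 a = (LINT x:{a..b}|lborel. k0 x / x)" "v0 b - v0 a = (LINT x:{a..b}|lborel. h0 x / x)"
      using u v ab unfolding Lm_repr_def by blast+
    ultimately show "u0 b - v0 b - (u0 a - v0 a) = (LINT x:{a..b}|lborel. (k0 x - h0 x) / x)" by linarith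
  qed
  have "AE x in lborel. 0 < x \<longrightarrow> x * u1 x = k1 x" "AE x in lborel. 0 < x \<longrightarrow> x * v1 x = h1 x"
    using u v unfolding Lm_repr_def by blast+
  then show "AE x in lborel. 0 < x \<longrightarrow> x * (u1 x - v1 x) = k1 x - h1 x"
    by eventually_elim (simp add: right_diff_distrib)
qed

lemma continuous_has_antiderivative:
  fixes f :: "real \<Rightarrow> real"
  assumes "continuous_on UNIV f"
  shows "\<exists>F. \<forall>x. (F has_real_derivative f x) (at x)"
proof -
  have "\<exists>F. \<forall>x::real. (-\<infinity>::ereal) < x \<longrightarrow> x < (\<infinity>::ereal) \<longrightarrow> (F has_vector_derivative f x) (at x)"
    using assms by (intro einterval_antiderivative) (auto simp: continuous_on_eq_continuous_at)
  then show ?thesis by (auto simp: has_real_derivative_iff_has_vector_derivative)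
qed

text \<open>For \<open>p r = G (r\<^sup>2)\<close> and \<open>q r = S (r\<^sup>2)\<close> with
  \<open>G' = Q\<close>, the products of \<open>r\<close> with \<open>p'\<close> and with
  \<open>q\<close> are \<open>2 * r\<^sup>2 * Q (r\<^sup>2)\<close> and
  \<open>r * S (r\<^sup>2)\<close>. This is the origin of the weights \<open>2 * x\<^sup>2\<close>
  and \<open>x\<close> in the two approximations.\<close>

theorem Lm_finite_imp_space:
  assumes m: "1 < m" and u: "(u0, u1) \<in> Lm_finite m"
  shows "(u0, u1) \<in> Lm_space m"
proof -
  obtain k0 k1 where r: "Lm_repr m u0 u1 k0 k1" using Lm_finite_repr[OF m u] by blast
  have k: "k0 \<in> Lp m" "k1 \<in> Lp m" and z: "\<And>x. x \<le> 0 \<Longrightarrow> k0 x = 0" "\<And>x. x \<le> 0 \<Longrightarrow> k1 x = 0"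
    using r unfolding Lm_repr_def by blast+
  have "\<exists>p q. radial_test p \<and> radial_test q \<and> Lm_norm m (\<lambda>r. u0 r - p r, \<lambda>r. u1 r - q r) < e" if e: "0 < e" for e
  proof -
    define \<epsilon> where "\<epsilon> = e powr m / 2"
    have \<epsilon>: "0 < \<epsilon>" using e by (simp add: \<epsilon>_def)
    have c0: "continuous_on UNIV (\<lambda>x::real. 2 * x\<^sup>2)" and c1: "continuous_on UNIV (\<lambda>x::real. x)"
      by (intro continuous_intros)+
    obtain Q a b where Q: "smooth Q" "0 < a" "a < b" "\<forall>s. s \<notin> {a<..<b} \<longrightarrow> Q s = 0"
      "(\<lambda>x. k0 x - indicator {0<..} x * (2 * x\<^sup>2 * Q (x\<^sup>2))) \<in> Lp m"
      "Lp_pow m (\<lambda>x. k0 x - indicator {0<..} x * (2 * x\<^sup>2 * Q (x\<^sup>2))) < \<epsilon>"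
      using weighted_smooth_dense[OF m k(1) z(1) c0 _ \<epsilon>] by auto
    obtain S a' b' where S: "smooth S" "0 < a'" "a' < b'" "\<forall>s. s \<notin> {a'<..<b'} \<longrightarrow> S s = 0"
      "(\<lambda>x. k1 x - indicator {0<..} x * (x * S (x\<^sup>2))) \<in> Lp m"
      "Lp_pow m (\<lambda>x. k1 x - indicator {0<..} x * (x * S (x\<^sup>2))) < \<epsilon>"
      using weighted_smooth_dense[OF m k(2) z(2) c1 _ \<epsilon>] by auto
    obtain F where F: "\<And>x. (F has_real_derivative Q x) (at x)"
      using continuous_has_antiderivative[OF smooth_continuous[OF Q(1)]] by blast
    \<comment> \<open>Normalised to vanish at \<open>b\<close>, hence beyond it. Below
      \<open>a\<close> it is a possibly nonzero constant, so \<open>p\<close> is flat near the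
      origin without having to vanish there.\<close>
    define G where "G s = F s + - F b" for s
    have Gs: "smooth G" unfolding G_def[abs_def]
      by (intro smooth_add smooth_const smooth_primitive[OF F Q(1)])
    have G0: "G s = 0" if "b \<le> s" for s
    proof (cases "b = s")
      case False
      then have "b < s" using that by simp
      from MVT2[OF this, of F Q] F obtain y where "b < y" "y < s" "F s - F b = (s - b) * Q y" by blast
      then show ?thesis using Q(4) by (simp add: G_def)
    qed (simp add: G_def)
    define p where "p r = G (r\<^sup>2)" for r
    define q where "q r = S (r\<^sup>2)" for r
    have tp: "radial_test p" unfolding p_def[abs_def] by (rule radial_test_smooth[OF Gs G0])
    have tq: "radial_test q" unfolding q_def[abs_def] by (rule radial_test_smooth[OF S(1), of b']) (use S(4) in auto)
    define h0 where "h0 x = indicator {0<..} x * (2 * x\<^sup>2 * Q (x\<^sup>2))" for x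
    define h1 where "h1 x = indicator {0<..} x * (x * S (x\<^sup>2))" for x
    have m0: "0 \<le> m" using m by simp
    have "(\<lambda>x. k0 x - (k0 x - h0 x)) \<in> Lp m" unfolding h0_def by (rule Lp_diff[OF m0 k(1) Q(5)])
    then have h0L: "h0 \<in> Lp m" by simp
    have "(\<lambda>x. k1 x - (k1 x - h1 x)) \<in> Lp m" unfolding h1_def by (rule Lp_diff[OF m0 k(2) S(5)])
    then have h1L: "h1 \<in> Lp m" by simp
    have pq: "Lm_repr m p q h0 h1"
      unfolding Lm_repr_def
    proof (intro conjI h0L h1L)
      show "\<forall>x\<le>0. h0 x = 0 \<and> h1 x = 0" by (simp add: h0_def h1_def)
      show "\<forall>a b. 0 < a \<and> a \<le> b \<longrightarrow> p b - p a = (LINT x:{a..b}|lborel. h0 x / x)"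
      proof (intro allI impI)
        fix a b :: real assume ab: "0 < a \<and> a \<le> b"
        have "(\<integral>x. 2 * x * Q (x\<^sup>2) * indicator {a..b} x \<partial>lborel) = p b - p a"
        proof (rule integral_FTC_Icc_real)
          show "(p has_real_derivative 2 * x * Q (x\<^sup>2)) (at x)" for x
            unfolding p_def G_def by (auto intro!: derivative_eq_intros DERIV_chain2[OF F])
          show "isCont (\<lambda>x. 2 * x * Q (x\<^sup>2)) x" for x
            using continuous_on_compose2[OF smooth_continuous[OF Q(1), of UNIV], of UNIV "\<lambda>x. x\<^sup>2"]
            by (intro continuous_intros) (auto simp: continuous_on_eq_continuous_at intro: continuous_intros)
        qed (use ab in auto)
        moreover have "(\<integral>x. 2 * x * Q (x\<^sup>2) * indicator {a..b} x \<partial>lborel) = (LINT x:{a..b}|lborel. h0 x / x)"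
          unfolding set_lebesgue_integral_def
          by (rule Bochner_Integration.integral_cong) (use ab in \<open>auto simp: h0_def indicator_def power2_eq_square\<close>)
        ultimately show "p b - p a = (LINT x:{a..b}|lborel. h0 x / x)" by simp
      qed
      show "AE x in lborel. 0 < x \<longrightarrow> x * q x = h1 x" by (rule AE_I2) (simp add: h1_def q_def)
    qed
    have "Lm_norm m (\<lambda>r. u0 r - p r, \<lambda>r. u1 r - q r) = (Lp_pow m (\<lambda>x. k0 x - h0 x) + Lp_pow m (\<lambda>x. k1 x - h1 x)) powr (1/m)"
      by (rule Lm_repr_norm[OF m Lm_repr_diff[OF m r pq]])
    also have "\<dots> < (\<epsilon> + \<epsilon>) powr (1/m)"
      using Q(6) S(6) m by (intro powr_less_mono2 add_strict_mono) (auto simp: h0_def h1_def add_nonneg_nonneg)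
    also have "\<dots> = e" using e m by (simp add: \<epsilon>_def powr_powr)
    finally show ?thesis using tp tq by blast
  qed
  then show ?thesis using u unfolding Lm_space_def by auto
qed

section \<open>Hardy's inequality\<close>

text \<open>The defect in the integration by parts formula has derivative zero, because its increments are
  bounded by \<open>2 C (y - x) \<integral>\<^bsub>x\<^esub>\<^bsup>y\<^esup> \<bar>g\<bar>\<close>.\<close>

lemma integration_by_parts_primitive:
  fixes V g \<omega> \<omega>' :: "real \<Rightarrow> real"
  assumes ab: "a < b" and g: "set_integrable lborel {a..b} g"
    and V: "\<And>x y. a \<le> x \<Longrightarrow> x \<le> y \<Longrightarrow> y \<le> b \<Longrightarrow> V y - V x = (LINT s:{x..y}|lborel. g s)"
    and \<omega>: "\<And>x. x \<in> {a..b} \<Longrightarrow> (\<omega> has_real_derivative \<omega>' x) (at x)"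
    and c\<omega>': "continuous_on {a..b} \<omega>'"
  shows "\<omega> b * V b - \<omega> a * V a = (LINT s:{a..b}|lborel. \<omega>' s * V s + \<omega> s * g s)"
proof -
  have gs: "set_integrable lborel {x..y} g" if "a \<le> x" "y \<le> b" for x y
    by (rule set_integrable_subset[OF g]) (use that in auto)
  note gas = set_integrable_abs[OF gs]
  \<comment> \<open>The primitive of \<open>\<bar>g\<bar>\<close> dominates the increments of
    \<open>V\<close> and, unlike \<open>V\<close>, is monotone.\<close>
  define N where "N x = integral {a..x} (\<lambda>s. \<bar>g s\<bar>)" for x
  have gi: "g integrable_on {a..b}" "(\<lambda>s. \<bar>g s\<bar>) integrable_on {a..b}"
    using set_borel_integral_eq_integral(1)[OF gs] set_borel_integral_eq_integral(1)[OF gas] by auto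
  have cN: "continuous_on {a..b} N" unfolding N_def[abs_def] by (rule indefinite_integral_continuous_1[OF gi(2)])
  have NL: "N y - N x = (LINT s:{x..y}|lborel. \<bar>g s\<bar>)" if "a \<le> x" "x \<le> y" "y \<le> b" for x y
  proof -
    have "integral {a..x} (\<lambda>s. \<bar>g s\<bar>) + integral {x..y} (\<lambda>s. \<bar>g s\<bar>) = integral {a..y} (\<lambda>s. \<bar>g s\<bar>)"
      using that by (intro Henstock_Kurzweil_Integration.integral_combine integrable_on_subinterval[OF gi(2)]) auto
    then show ?thesis unfolding N_def using set_borel_integral_eq_integral(2)[OF gas[OF that(1,3)]] by simp
  qed
  have Veq: "V x = V a + integral {a..x} g" if "x \<in> {a..b}" for x
    using V[of a x] that set_borel_integral_eq_integral(2)[OF gs[of a x]] by auto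
  have "continuous_on {a..b} (\<lambda>x. V a + integral {a..x} g)"
    by (intro continuous_intros indefinite_integral_continuous_1 gi(1))
  then have cV: "continuous_on {a..b} V" by (rule continuous_on_eq) (rule Veq[symmetric])
  have c\<omega>: "continuous_on {a..b} \<omega>"
    using \<omega> DERIV_isCont by (intro continuous_at_imp_continuous_on) blast
  have "bounded (\<omega>' ` {a..b})" by (intro compact_imp_bounded compact_continuous_image c\<omega>') auto
  then obtain C0 where C0: "\<forall>x\<in>{a..b}. norm (\<omega>' x) \<le> C0" unfolding bounded_iff by auto
  define C where "C = max C0 0"
  have C: "0 \<le> C" "\<And>x. x \<in> {a..b} \<Longrightarrow> \<bar>\<omega>' x\<bar> \<le> C" using C0 by (auto simp: C_def intro!: max.coboundedI1)
  have lip: "\<bar>\<omega> y - \<omega> x\<bar> \<le> C * (y - x)" if "a \<le> x" "x \<le> y" "y \<le> b" for x y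
  proof (cases "x = y")
    case False
    then have "x < y" using that by simp
    from MVT2[OF this, of \<omega> \<omega>'] \<omega> that obtain z where z: "x < z" "z < y" "\<omega> y - \<omega> x = (y - x) * \<omega>' z" by auto
    have "\<bar>\<omega>' z\<bar> \<le> C" using z that by (intro C) auto
    then show ?thesis unfolding z(3) abs_mult using that by (simp add: mult.commute mult_right_mono)
  qed simp
  have i1: "set_integrable lborel {x..y} (\<lambda>s. \<omega>' s * V s)" if "a \<le> x" "y \<le> b" for x y
    by (rule borel_integrable_atLeastAtMost', rule continuous_on_subset[of "{a..b}"])
      (use that in \<open>auto intro: continuous_on_mult c\<omega>' cV\<close>)
  have i0: "set_integrable lborel {x..y} \<omega>'" if "a \<le> x" "y \<le> b" for x y
    by (rule borel_integrable_atLeastAtMost', rule continuous_on_subset[OF c\<omega>']) (use that in auto)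
  have i2: "set_integrable lborel {x..y} (\<lambda>s. \<omega> s * g s)" if xy: "a \<le> x" "y \<le> b" for x y
  proof -
    have "bounded (\<omega> ` {a..b})" by (intro compact_imp_bounded compact_continuous_image c\<omega>) auto
    then obtain K where K: "\<forall>x\<in>{a..b}. norm (\<omega> x) \<le> K" unfolding bounded_iff by auto
    have m1: "(\<lambda>s. indicator {x..y} s *\<^sub>R \<omega> s) \<in> borel_measurable borel"
      by (rule borel_measurable_continuous_on_indicator) (use continuous_on_subset[OF c\<omega>] xy in auto)
    have m2: "(\<lambda>s. indicator {x..y} s *\<^sub>R g s) \<in> borel_measurable borel"
      using gs[OF xy] by (auto simp: set_integrable_def)
    have eq: "(\<lambda>s. indicator {x..y} s *\<^sub>R (\<omega> s * g s)) = (\<lambda>s. (indicator {x..y} s *\<^sub>R \<omega> s) * (indicator {x..y} s *\<^sub>R g s))"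
      by (auto simp: indicator_def)
    show ?thesis unfolding set_integrable_def
    proof (rule Bochner_Integration.integrable_bound)
      show "integrable lborel (\<lambda>s. K * (indicator {x..y} s *\<^sub>R g s))"
        using gs[OF xy] unfolding set_integrable_def by (rule integrable_mult_right)
      show "(\<lambda>s. indicator {x..y} s *\<^sub>R (\<omega> s * g s)) \<in> borel_measurable lborel"
        unfolding eq using borel_measurable_times[OF m1 m2] by simp
      show "AE s in lborel. norm (indicator {x..y} s *\<^sub>R (\<omega> s * g s)) \<le> norm (K * (indicator {x..y} s *\<^sub>R g s))"
      proof (rule AE_I2)
        fix s show "norm (indicator {x..y} s *\<^sub>R (\<omega> s * g s)) \<le> norm (K * (indicator {x..y} s *\<^sub>R g s))"
        proof (cases "s \<in> {x..y}")
          case True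
          then have "\<bar>\<omega> s\<bar> \<le> \<bar>K\<bar>" using K xy by (auto intro: order_trans[OF _ abs_ge_self])
          then show ?thesis using True by (simp add: abs_mult mult_right_mono)
        qed simp
      qed
    qed
  qed
  define H where "H s = \<omega>' s * V s + \<omega> s * g s" for s
  have iH: "set_integrable lborel {x..y} H" if "a \<le> x" "y \<le> b" for x y
    unfolding H_def by (rule set_integral_add(1)[OF i1[OF that] i2[OF that]])
  define D where "D x = \<omega> x * V x - integral {a..x} H" for x
  have Hi: "H integrable_on {a..b}" using set_borel_integral_eq_integral(1)[OF iH] by auto
  have HL: "integral {a..y} H - integral {a..x} H = (LINT s:{x..y}|lborel. H s)" if "a \<le> x" "x \<le> y" "y \<le> b" for x y
  proof -
    have "integral {a..x} H + integral {x..y} H = integral {a..y} H"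
      using that by (intro Henstock_Kurzweil_Integration.integral_combine integrable_on_subinterval[OF Hi]) auto
    then show ?thesis using set_borel_integral_eq_integral(2)[OF iH[OF that(1,3)]] by simp
  qed
  have Dinc: "\<bar>D y - D x\<bar> \<le> 2 * C * (y - x) * (N y - N x)" if xy: "a \<le> x" "x \<le> y" "y \<le> b" for x y
  proof -
    have w: "\<omega> y - \<omega> x = (LINT s:{x..y}|lborel. \<omega>' s)"
    proof -
      have "(\<omega>' has_integral (\<omega> y - \<omega> x)) {x..y}"
        using xy \<omega> by (intro fundamental_theorem_of_calculus)
          (auto simp: has_real_derivative_iff_has_vector_derivative[symmetric] intro: has_field_derivative_at_within)
      then show ?thesis using set_borel_integral_eq_integral(2)[OF i0[OF xy(1,3)]] by (simp add: integral_unique)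
    qed
    \<comment> \<open>With \<open>V\<close> frozen at \<open>y\<close> and \<open>\<omega>\<close>
      at \<open>x\<close>, the integral of \<open>H\<close> would be the exact increment of the
      product; the increment of \<open>D\<close> is the integral of the freezing error.\<close>
    have e: "D y - D x = (LINT s:{x..y}|lborel. \<omega>' s * V y + \<omega> x * g s - H s)"
    proof -
      have "D y - D x = (\<omega> y - \<omega> x) * V y + \<omega> x * (V y - V x) - (LINT s:{x..y}|lborel. H s)"
        unfolding HL[OF xy, symmetric] D_def by (simp add: algebra_simps)
      also have "\<dots> = (LINT s:{x..y}|lborel. \<omega>' s * V y) + (LINT s:{x..y}|lborel. \<omega> x * g s) - (LINT s:{x..y}|lborel. H s)"
        unfolding w V[OF xy] by simp
      also have "\<dots> = (LINT s:{x..y}|lborel. \<omega>' s * V y + \<omega> x * g s - H s)"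
        using i0[OF xy(1,3)] gs[OF xy(1,3)] iH[OF xy(1,3)] by (simp add: set_integral_add set_integral_diff)
      finally show ?thesis .
    qed
    have int: "set_integrable lborel {x..y} (\<lambda>s. \<omega>' s * V y + \<omega> x * g s - H s)"
      using i0[OF xy(1,3)] gs[OF xy(1,3)] iH[OF xy(1,3)] by (intro set_integral_diff(1) set_integral_add(1)) auto
    have const: "set_integrable lborel {x..y} (\<lambda>s. C * (N y - N x))"
      by (simp add: set_integrable_def emeasure_lborel_Icc_eq)
    have gm: "set_integrable lborel {x..y} (\<lambda>s. C * (y - x) * \<bar>g s\<bar>)"
      using gas[OF xy(1,3)] by simp
    have "\<bar>D y - D x\<bar> \<le> (LINT s:{x..y}|lborel. \<bar>\<omega>' s * V y + \<omega> x * g s - H s\<bar>)"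
      unfolding e using set_integral_norm_bound[OF int] by simp
    also have "\<dots> \<le> (LINT s:{x..y}|lborel. C * (N y - N x) + C * (y - x) * \<bar>g s\<bar>)"
    proof (rule set_integral_mono[OF set_integrable_abs[OF int] set_integral_add(1)[OF const gm]])
      fix s assume s: "s \<in> {x..y}"
      have "\<bar>V y - V s\<bar> \<le> N y - N x"
      proof -
        have sy: "a \<le> s" "s \<le> y" "y \<le> b" using s xy by auto
        have "\<bar>V y - V s\<bar> \<le> (LINT s:{s..y}|lborel. \<bar>g s\<bar>)"
          unfolding V[OF sy] using set_integral_norm_bound[OF gs[OF sy(1,3)]] by simp
        also have "\<dots> = N y - N s" using NL[OF sy] by simp
        also have "\<dots> \<le> N y - N x"
        proof -
          have "0 \<le> (LINT r:{x..s}|lborel. \<bar>g r\<bar>)" unfolding set_lebesgue_integral_def by simp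
          then show ?thesis using NL[of x s] s xy by auto
        qed
        finally show ?thesis .
      qed
      then have 1: "\<bar>\<omega>' s * (V y - V s)\<bar> \<le> C * (N y - N x)"
        unfolding abs_mult using C s xy by (intro mult_mono) auto
      have "\<bar>\<omega> x - \<omega> s\<bar> \<le> C * (y - x)"
      proof -
        have "\<bar>\<omega> x - \<omega> s\<bar> \<le> C * (s - x)" using lip[of x s] s xy by (auto simp: abs_minus_commute)
        also have "\<dots> \<le> C * (y - x)" using s C by (intro mult_left_mono) auto
        finally show ?thesis .
      qed
      then have 2: "\<bar>(\<omega> x - \<omega> s) * g s\<bar> \<le> C * (y - x) * \<bar>g s\<bar>" unfolding abs_mult by (rule mult_right_mono) simp
      have "\<omega>' s * V y + \<omega> x * g s - H s = \<omega>' s * (V y - V s) + (\<omega> x - \<omega> s) * g s"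
        unfolding H_def by (simp add: algebra_simps)
      then show "\<bar>\<omega>' s * V y + \<omega> x * g s - H s\<bar> \<le> C * (N y - N x) + C * (y - x) * \<bar>g s\<bar>"
        using 1 2 by linarith
    qed
    also have "\<dots> = C * (N y - N x) * (y - x) + C * (y - x) * (LINT s:{x..y}|lborel. \<bar>g s\<bar>)"
      unfolding set_integral_add(2)[OF const gm] using xy by (simp add: set_lebesgue_integral_def)
    also have "\<dots> = 2 * C * (y - x) * (N y - N x)" unfolding NL[OF xy, symmetric] by (simp add: algebra_simps)
    finally show ?thesis .
  qed
  have Dinc': "\<bar>D y - D x\<bar> \<le> 2 * C * \<bar>y - x\<bar> * \<bar>N y - N x\<bar>" if "x \<in> {a..b}" "y \<in> {a..b}" for x y
  proof (cases "x \<le> y")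
    case True
    have "\<bar>D y - D x\<bar> \<le> 2 * C * (y - x) * (N y - N x)" using Dinc[of x y] that True by auto
    also have "\<dots> \<le> 2 * C * (y - x) * \<bar>N y - N x\<bar>" using True C by (intro mult_left_mono) auto
    finally show ?thesis using True by simp
  next
    case False
    have "\<bar>D x - D y\<bar> \<le> 2 * C * (x - y) * (N x - N y)" using Dinc[of y x] that False by auto
    also have "\<dots> \<le> 2 * C * (x - y) * \<bar>N x - N y\<bar>" using False C by (intro mult_left_mono) auto
    finally show ?thesis using False by (simp add: abs_minus_commute)
  qed
  have cD: "continuous_on {a..b} D" unfolding D_def[abs_def]
    by (intro continuous_intros c\<omega> cV indefinite_integral_continuous_1 Hi)
  have "D b = D a"
  proof (rule DERIV_isconst_end[OF ab cD])
    fix x assume x: "a < x" "x < b"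
    show "(D has_real_derivative 0) (at x)"
      unfolding DERIV_def
    proof (rule Lim_null_comparison)
      have "isCont N x" using cN x by (intro continuous_on_interior[of "{a..b}"]) auto
      then have "((\<lambda>h. N (x + h)) \<longlongrightarrow> N x) (at 0)" by (simp add: isCont_iff)
      then have "((\<lambda>h. 2 * C * \<bar>N (x + h) - N x\<bar>) \<longlongrightarrow> 2 * C * \<bar>N x - N x\<bar>) (at 0)" by (intro tendsto_intros)
      then show "((\<lambda>h. 2 * C * \<bar>N (x + h) - N x\<bar>) \<longlongrightarrow> 0) (at 0)" by simp
      have "eventually (\<lambda>h. h \<in> {a - x<..<b - x}) (nhds 0)" using x by (intro eventually_nhds_in_open) auto
      then have "eventually (\<lambda>h. h \<in> {a - x<..<b - x} \<and> h \<noteq> 0) (at 0)"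
        by (auto simp: eventually_at_filter elim: eventually_mono)
      then show "eventually (\<lambda>h. norm ((D (x + h) - D x) / h) \<le> 2 * C * \<bar>N (x + h) - N x\<bar>) (at 0)"
      proof eventually_elim
        case (elim h)
        then have "\<bar>D (x + h) - D x\<bar> \<le> 2 * C * \<bar>h\<bar> * \<bar>N (x + h) - N x\<bar>" using Dinc'[of x "x + h"] x by auto
        then show ?case using elim by (simp add: abs_divide pos_divide_le_eq mult_ac)
      qed
    qed
  qed
  then show ?thesis using HL[of a b] ab by (simp add: D_def H_def)
qed

text \<open>This weighted integral comes from Hoelder's inequality for \<open>\<integral>\<^bsub>x\<^esub>\<^bsup>\<infinity>\<^esup> k s / s\<close> with the weight \<open>s powr - \<beta>\<close>, \<open>\<beta> = 1 / (2 (m - 1))\<close>.\<close>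

definition hardy_weight :: "real \<Rightarrow> (real \<Rightarrow> real) \<Rightarrow> real \<Rightarrow> real" where
  "hardy_weight m k x = (LINT s:{x..}|lborel. s powr (- 1/2) * \<bar>k s\<bar> powr m)"

lemma
  assumes m: "1 < m" and k: "k \<in> Lp m" and x: "0 < x"
  shows hardy_weight_integrable: "set_integrable lborel {x..} (\<lambda>s. s powr (- 1/2) * \<bar>k s\<bar> powr m)"
    and hardy_weight_le: "hardy_weight m k x \<le> x powr (- 1/2) * Lp_pow m k"
    and hardy_weight_nonneg: "0 \<le> hardy_weight m k x"
proof -
  note [measurable] = Lp_measurable[OF k]
  have le: "indicator {x..} s * (s powr (- 1/2) * \<bar>k s\<bar> powr m) \<le> x powr (- 1/2) * \<bar>k s\<bar> powr m" for s
    using x by (cases "s \<in> {x..}") (auto intro!: mult_right_mono powr_mono2')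
  have i: "integrable lborel (\<lambda>s. x powr (- 1/2) * \<bar>k s\<bar> powr m)" using Lp_integrable[OF k] by simp
  show si: "set_integrable lborel {x..} (\<lambda>s. s powr (- 1/2) * \<bar>k s\<bar> powr m)"
    unfolding set_integrable_def
  proof (rule Bochner_Integration.integrable_bound[OF i])
    show "AE s in lborel. norm (indicat_real {x..} s *\<^sub>R (s powr (- 1/2) * \<bar>k s\<bar> powr m)) \<le> norm (x powr (- 1/2) * \<bar>k s\<bar> powr m)"
    proof (rule AE_I2)
      fix s show "norm (indicat_real {x..} s *\<^sub>R (s powr (- 1/2) * \<bar>k s\<bar> powr m)) \<le> norm (x powr (- 1/2) * \<bar>k s\<bar> powr m)"
        using le[of s] by (simp add: abs_mult)
    qed
    show "(\<lambda>s. indicat_real {x..} s *\<^sub>R (s powr (- 1/2) * \<bar>k s\<bar> powr m)) \<in> borel_measurable lborel" by simp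
  qed
  have "hardy_weight m k x \<le> (\<integral>s. x powr (- 1/2) * \<bar>k s\<bar> powr m \<partial>lborel)"
    unfolding hardy_weight_def set_lebesgue_integral_def
    by (rule integral_mono[OF si[unfolded set_integrable_def] i]) (use le in simp)
  then show "hardy_weight m k x \<le> x powr (- 1/2) * Lp_pow m k" by (simp add: Lp_pow_def)
  show "0 \<le> hardy_weight m k x" unfolding hardy_weight_def set_lebesgue_integral_def
    by (rule Bochner_Integration.integral_nonneg) simp
qed

text \<open>As \<open>v\<close> vanishes at infinity, \<open>\<bar>v x\<bar>\<close> is the limit of
  \<open>\<bar>v b - v x\<bar>\<close>. \<open>le_add_powr\<close> is used with
  \<open>c * s powr (- \<beta>)\<close> in place of \<open>c\<close>; since
  \<open>\<beta> * (m - 1) = 1/2\<close>, the second weight becomes \<open>s powr (- 1/2)\<close>,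
  and \<open>optimize_powr\<close> removes \<open>c\<close>.\<close>

lemma dual_hardy_pointwise:
  assumes m: "1 < m" and k: "k \<in> Lp m" and x: "0 < x"
    and lim: "(v \<longlongrightarrow> 0) at_top" and inc: "\<And>a b. 0 < a \<Longrightarrow> a \<le> b \<Longrightarrow> v b - v a = (LINT s:{a..b}|lborel. k s / s)"
  shows "\<bar>v x\<bar> \<le> 2 * ((2 * (m - 1) * x powr (- (1 / (2 * (m - 1))))) powr (1 - 1/m) * hardy_weight m k x powr (1/m))"
proof (rule optimize_powr[OF m])
  define \<beta> where "\<beta> = 1 / (2 * (m - 1))"
  have \<beta>: "0 < \<beta>" "1 / \<beta> = 2 * (m - 1)" "\<beta> * (m - 1) = 1/2" using m by (simp_all add: \<beta>_def)
  show "0 \<le> 2 * (m - 1) * x powr (- (1 / (2 * (m - 1))))" using m by simp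
  show "0 \<le> hardy_weight m k x" by (rule hardy_weight_nonneg[OF m k x])
  fix c :: real assume c: "0 < c"
  note [measurable] = Lp_measurable[OF k]
  have ti: "((\<lambda>s. s powr (- \<beta> - 1)) has_integral (x powr (- \<beta>) / \<beta>)) {x..}"
    using has_integral_powr_to_inf[of "- \<beta> - 1" x] \<beta> x by simp
  have tn: "(\<integral>\<^sup>+s. ennreal (s powr (- \<beta> - 1)) * indicator {x..} s \<partial>lborel) = ennreal (x powr (- \<beta>) / \<beta>)"
    by (rule nn_integral_has_integral_on[OF _ _ _ ti]) auto
  have bnd: "\<bar>v b - v x\<bar> \<le> c * (x powr (- \<beta>) / \<beta>) + c powr (1 - m) * hardy_weight m k x" if b: "x \<le> b" for b
  proof -
    have "ennreal \<bar>v b - v x\<bar> \<le> ennreal (LINT s:{x..b}|lborel. \<bar>k s / s\<bar>)"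
      unfolding inc[OF x b] using set_integral_norm_bound[OF set_integrable_divide_id[OF m k x]] by (intro ennreal_leI) simp
    also have "\<dots> = (\<integral>\<^sup>+s. ennreal \<bar>k s / s\<bar> * indicator {x..b} s \<partial>lborel)"
      by (rule ennreal_set_integral[symmetric, OF set_integrable_abs[OF set_integrable_divide_id[OF m k x]]]) simp
    also have "\<dots> \<le> (\<integral>\<^sup>+s. ennreal c * (ennreal (s powr (- \<beta> - 1)) * indicator {x..} s)
        + ennreal (c powr (1 - m)) * (ennreal (s powr (- 1/2) * \<bar>k s\<bar> powr m) * indicator {x..} s) \<partial>lborel)"
    proof (rule nn_integral_mono)
      fix s
      show "ennreal \<bar>k s / s\<bar> * indicator {x..b} s \<le> ennreal c * (ennreal (s powr (- \<beta> - 1)) * indicator {x..} s)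
        + ennreal (c powr (1 - m)) * (ennreal (s powr (- 1/2) * \<bar>k s\<bar> powr m) * indicator {x..} s)"
      proof (cases "s \<in> {x..b}")
        case True
        then have s: "0 < s" "x \<le> s" using x by auto
        have cs: "0 < c * s powr (- \<beta>)" using c s by simp
        have "\<bar>k s\<bar> \<le> c * s powr (- \<beta>) + (c * s powr (- \<beta>)) powr (1 - m) * \<bar>k s\<bar> powr m"
          using m cs by (intro le_add_powr) auto
        also have "(c * s powr (- \<beta>)) powr (1 - m) = c powr (1 - m) * s powr (1/2)"
        proof -
          have "- \<beta> * (1 - m) = 1/2" using \<beta>(3) by (simp add: algebra_simps)
          then show ?thesis by (simp only: powr_mult powr_powr)
        qed
        finally have "\<bar>k s\<bar> / s \<le> (c * s powr (- \<beta>) + c powr (1 - m) * s powr (1/2) * \<bar>k s\<bar> powr m) / s"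
          using s by (intro divide_right_mono) auto
        also have "\<dots> = c * (s powr (- \<beta>) / s) + c powr (1 - m) * ((s powr (1/2) / s) * \<bar>k s\<bar> powr m)"
          by (simp add: add_divide_distrib)
        also have "s powr (- \<beta>) / s = s powr (- \<beta> - 1)" using s by (simp add: powr_diff)
        also have "s powr (1/2) / s = s powr (- 1/2)" using s powr_diff[of s "1/2" 1] by simp
        finally have "\<bar>k s / s\<bar> \<le> c * s powr (- \<beta> - 1) + c powr (1 - m) * (s powr (- 1/2) * \<bar>k s\<bar> powr m)"
          using s by (simp add: abs_divide)
        then have "ennreal \<bar>k s / s\<bar> \<le> ennreal (c * s powr (- \<beta> - 1) + c powr (1 - m) * (s powr (- 1/2) * \<bar>k s\<bar> powr m))"
          by (rule ennreal_leI)
        also have "\<dots> = ennreal c * ennreal (s powr (- \<beta> - 1)) + ennreal (c powr (1 - m)) * ennreal (s powr (- 1/2) * \<bar>k s\<bar> powr m)"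
          using c by (simp add: ennreal_plus ennreal_mult del: ennreal_plus[symmetric])
        finally show ?thesis using True s by simp
      qed simp
    qed
    also have "\<dots> = ennreal c * ennreal (x powr (- \<beta>) / \<beta>) + ennreal (c powr (1 - m)) * ennreal (hardy_weight m k x)"
    proof -
      have "(\<integral>\<^sup>+s. ennreal (s powr (- 1/2) * \<bar>k s\<bar> powr m) * indicator {x..} s \<partial>lborel) = ennreal (hardy_weight m k x)"
        unfolding hardy_weight_def by (rule ennreal_set_integral[OF hardy_weight_integrable[OF m k x]]) simp
      then show ?thesis using tn by (subst nn_integral_add) (auto simp: nn_integral_cmult)
    qed
    also have "\<dots> = ennreal (c * (x powr (- \<beta>) / \<beta>) + c powr (1 - m) * hardy_weight m k x)"
      using c \<beta> hardy_weight_nonneg[OF m k x] by (simp add: ennreal_plus ennreal_mult[symmetric])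
    finally show ?thesis using c \<beta> hardy_weight_nonneg[OF m k x] by (subst (asm) ennreal_le_iff) auto
  qed
  have "\<bar>0 - v x\<bar> \<le> c * (x powr (- \<beta>) / \<beta>) + c powr (1 - m) * hardy_weight m k x"
  proof (rule tendsto_upperbound)
    show "((\<lambda>b. \<bar>v b - v x\<bar>) \<longlongrightarrow> \<bar>0 - v x\<bar>) at_top" by (intro tendsto_intros lim)
    show "eventually (\<lambda>b. \<bar>v b - v x\<bar> \<le> c * (x powr (- \<beta>) / \<beta>) + c powr (1 - m) * hardy_weight m k x) at_top"
      using eventually_ge_at_top[of x] by eventually_elim (rule bnd)
  qed simp
  moreover have "x powr (- \<beta>) / \<beta> = 2 * (m - 1) * x powr (- (1 / (2 * (m - 1))))"
    unfolding \<beta>(2)[symmetric] by (simp add: \<beta>_def)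
  ultimately show "\<bar>v x\<bar> \<le> c * (2 * (m - 1) * x powr (- (1 / (2 * (m - 1))))) + c powr (1 - m) * hardy_weight m k x" by simp
qed

text \<open>Inserting \<open>hardy_weight_le\<close> makes both powers of \<open>x\<close> equal to
  \<open>- 1 / (2 * m)\<close>. The resulting bound shows that \<open>x * v x\<close> tends to 0 at
  the origin, which \<open>Lm_finite_wave_repr\<close> needs.\<close>

lemma dual_hardy_decay:
  assumes m: "1 < m" and k: "k \<in> Lp m" and x: "0 < x"
    and lim: "(v \<longlongrightarrow> 0) at_top" and inc: "\<And>a b. 0 < a \<Longrightarrow> a \<le> b \<Longrightarrow> v b - v a = (LINT s:{a..b}|lborel. k s / s)"
  shows "\<bar>v x\<bar> \<le> 2 * (2 * (m - 1)) powr (1 - 1/m) * Lp_pow m k powr (1/m) * x powr (- 1/m)"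
proof -
  have e1: "- (1 / (2 * (m - 1))) * (1 - 1/m) = - 1 / (2 * m)" using m by (simp add: divide_simps)
  have e2: "- 1/2 * (1/m) = - 1 / (2 * m)" by simp
  have e3: "- 1 / (2 * m) + - 1 / (2 * m) = - 1/m" by simp
  have "\<bar>v x\<bar> \<le> 2 * ((2 * (m - 1) * x powr (- (1 / (2 * (m - 1))))) powr (1 - 1/m) * hardy_weight m k x powr (1/m))"
    by (rule dual_hardy_pointwise[OF assms])
  also have "\<dots> \<le> 2 * ((2 * (m - 1) * x powr (- (1 / (2 * (m - 1))))) powr (1 - 1/m) * (x powr (- 1/2) * Lp_pow m k) powr (1/m))"
    using m hardy_weight_nonneg[OF m k x] hardy_weight_le[OF m k x] by (intro mult_left_mono powr_mono2) auto
  also have "\<dots> = 2 * (2 * (m - 1)) powr (1 - 1/m) * Lp_pow m k powr (1/m) * (x powr (- 1 / (2 * m)) * x powr (- 1 / (2 * m)))"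
    using m x by (simp only: powr_mult powr_powr e1 e2) (simp add: mult_ac)
  also have "x powr (- 1 / (2 * m)) * x powr (- 1 / (2 * m)) = x powr (- 1/m)" by (simp only: powr_add[symmetric] e3)
  finally show ?thesis .
qed

definition hardy_const :: "real \<Rightarrow> real" where
  "hardy_const m = 2 powr m * (2 * (m - 1)) powr (m - 1) * 2"

text \<open>After the pointwise bound the integrals in \<open>x\<close> and \<open>s\<close> are
  exchanged: the integral of \<open>x powr (- 1/2)\<close> from 0 to \<open>s\<close> is
  \<open>2 * s powr (1/2)\<close>, which cancels the weight \<open>s powr (- 1/2)\<close> and leaves
  the last factor of \<open>hardy_const\<close>.\<close>

theorem dual_hardy:
  assumes m: "1 < m" and k: "k \<in> Lp m" and V: "V \<in> borel_measurable borel"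
    and lim: "(v \<longlongrightarrow> 0) at_top" and inc: "\<And>a b. 0 < a \<Longrightarrow> a \<le> b \<Longrightarrow> v b - v a = (LINT s:{a..b}|lborel. k s / s)"
    and Vv: "\<And>x. 0 < x \<Longrightarrow> V x = v x" "\<And>x. x \<le> 0 \<Longrightarrow> V x = 0"
  shows "V \<in> Lp m" "Lp_pow m V \<le> hardy_const m * Lp_pow m k"
proof -
  note [measurable] = Lp_measurable[OF k] V
  define K where "K = 2 powr m * (2 * (m - 1)) powr (m - 1)"
  have K: "0 \<le> K" by (simp add: K_def)
  have pt: "\<bar>V x\<bar> powr m \<le> K * (x powr (- 1/2) * hardy_weight m k x)" if x: "0 < x" for x
  proof -
    have e0: "(1 - 1/m) * m = m - 1" using m by (simp add: field_simps)
    have e1: "- (1 / (2 * (m - 1))) * (m - 1) = - 1/2" using m by simp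
    have "\<bar>V x\<bar> powr m \<le> (2 * ((2 * (m - 1) * x powr (- (1 / (2 * (m - 1))))) powr (1 - 1/m) * hardy_weight m k x powr (1/m))) powr m"
      unfolding Vv(1)[OF x] using m by (intro powr_mono2 dual_hardy_pointwise[OF m k x lim inc]) auto
    also have "\<dots> = 2 powr m * ((2 * (m - 1) * x powr (- (1 / (2 * (m - 1))))) powr ((1 - 1/m) * m) * hardy_weight m k x powr (1/m * m))"
      by (simp only: powr_mult powr_powr mult.assoc)
    also have "\<dots> = 2 powr m * ((2 * (m - 1)) powr (m - 1) * x powr (- (1 / (2 * (m - 1))) * (m - 1)) * hardy_weight m k x)"
      unfolding e0 using m hardy_weight_nonneg[OF m k x] by (simp add: powr_mult powr_powr)
    also have "\<dots> = K * (x powr (- 1/2) * hardy_weight m k x)" unfolding e1 K_def by (simp add: mult_ac)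
    finally show ?thesis .
  qed
  have "(\<integral>\<^sup>+x. ennreal (\<bar>V x\<bar> powr m) \<partial>lborel)
    \<le> (\<integral>\<^sup>+x. \<integral>\<^sup>+s. ennreal K * (ennreal (indicator {0<..s} x * x powr (- 1/2)) * ennreal (indicator {0<..} s * s powr (- 1/2) * \<bar>k s\<bar> powr m)) \<partial>lborel \<partial>lborel)"
  proof (rule nn_integral_mono)
    fix x
    show "ennreal (\<bar>V x\<bar> powr m) \<le> (\<integral>\<^sup>+s. ennreal K * (ennreal (indicator {0<..s} x * x powr (- 1/2)) * ennreal (indicator {0<..} s * s powr (- 1/2) * \<bar>k s\<bar> powr m)) \<partial>lborel)"
    proof (cases "0 < x")
      case x: True
      have "ennreal (\<bar>V x\<bar> powr m) \<le> ennreal (K * (x powr (- 1/2) * hardy_weight m k x))" by (rule ennreal_leI[OF pt[OF x]])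
      also have "\<dots> = ennreal (K * x powr (- 1/2)) * ennreal (hardy_weight m k x)"
        using K hardy_weight_nonneg[OF m k x] by (simp add: ennreal_mult[symmetric] mult.assoc)
      also have "ennreal (hardy_weight m k x) = (\<integral>\<^sup>+s. ennreal (s powr (- 1/2) * \<bar>k s\<bar> powr m) * indicator {x..} s \<partial>lborel)"
        unfolding hardy_weight_def by (rule ennreal_set_integral[symmetric, OF hardy_weight_integrable[OF m k x]]) simp
      also have "ennreal (K * x powr (- 1/2)) * \<dots> = (\<integral>\<^sup>+s. ennreal (K * x powr (- 1/2)) * (ennreal (s powr (- 1/2) * \<bar>k s\<bar> powr m) * indicator {x..} s) \<partial>lborel)"
        by (intro nn_integral_cmult[symmetric]) measurable
      also have "\<dots> = (\<integral>\<^sup>+s. ennreal K * (ennreal (indicator {0<..s} x * x powr (- 1/2)) * ennreal (indicator {0<..} s * s powr (- 1/2) * \<bar>k s\<bar> powr m)) \<partial>lborel)"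
      proof (rule nn_integral_cong)
        fix s
        show "ennreal (K * x powr (- 1/2)) * (ennreal (s powr (- 1/2) * \<bar>k s\<bar> powr m) * indicator {x..} s)
          = ennreal K * (ennreal (indicator {0<..s} x * x powr (- 1/2)) * ennreal (indicator {0<..} s * s powr (- 1/2) * \<bar>k s\<bar> powr m))"
          using x K by (cases "x \<le> s") (auto simp: ennreal_mult mult.assoc)
      qed
      finally show ?thesis .
    qed (simp add: Vv(2))
  qed
  also have "\<dots> = (\<integral>\<^sup>+s. \<integral>\<^sup>+x. ennreal K * (ennreal (indicator {0<..s} x * x powr (- 1/2)) * ennreal (indicator {0<..} s * s powr (- 1/2) * \<bar>k s\<bar> powr m)) \<partial>lborel \<partial>lborel)"
    by (rule lborel_pair.Fubini'[symmetric]) (simp add: indicator_def, measurable)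
  also have "\<dots> \<le> (\<integral>\<^sup>+s. ennreal (2 * K) * ennreal (\<bar>k s\<bar> powr m) \<partial>lborel)"
  proof (rule nn_integral_mono)
    fix s :: real
    show "(\<integral>\<^sup>+x. ennreal K * (ennreal (indicator {0<..s} x * x powr (- 1/2)) * ennreal (indicator {0<..} s * s powr (- 1/2) * \<bar>k s\<bar> powr m)) \<partial>lborel)
      \<le> ennreal (2 * K) * ennreal (\<bar>k s\<bar> powr m)"
    proof (cases "0 < s")
      case s: True
      have hi: "((\<lambda>x. x powr (- 1/2)) has_integral (s powr (- 1/2 + 1) / (- 1/2 + 1))) {0..s}"
        using s by (intro has_integral_powr_from_0) auto
      have "(\<integral>\<^sup>+x. ennreal (indicator {0<..s} x * x powr (- 1/2)) \<partial>lborel) \<le> (\<integral>\<^sup>+x. ennreal (x powr (- 1/2)) * indicator {0..s} x \<partial>lborel)"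
        by (intro nn_integral_mono) (auto simp: indicator_def)
      also have "\<dots> = ennreal (s powr (- 1/2 + 1) / (- 1/2 + 1))"
        by (rule nn_integral_has_integral_on[OF _ _ _ hi]) auto
      also have "s powr (- 1/2 + 1) / (- 1/2 + 1) = 2 * s powr (1/2)" by simp
      finally have I: "(\<integral>\<^sup>+x. ennreal (indicator {0<..s} x * x powr (- 1/2)) \<partial>lborel) \<le> ennreal (2 * s powr (1/2))" .
      have "(\<integral>\<^sup>+x. ennreal K * (ennreal (indicator {0<..s} x * x powr (- 1/2)) * ennreal (indicator {0<..} s * s powr (- 1/2) * \<bar>k s\<bar> powr m)) \<partial>lborel)
        = ennreal K * ((\<integral>\<^sup>+x. ennreal (indicator {0<..s} x * x powr (- 1/2)) \<partial>lborel) * ennreal (s powr (- 1/2) * \<bar>k s\<bar> powr m))"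
        using s by (subst nn_integral_cmult, simp, subst nn_integral_multc) auto
      also have "\<dots> \<le> ennreal K * (ennreal (2 * s powr (1/2)) * ennreal (s powr (- 1/2) * \<bar>k s\<bar> powr m))"
        by (intro mult_left_mono mult_right_mono I) auto
      also have "\<dots> = ennreal (K * (2 * s powr (1/2) * (s powr (- 1/2) * \<bar>k s\<bar> powr m)))"
        using K by (simp add: ennreal_mult)
      also have "K * (2 * s powr (1/2) * (s powr (- 1/2) * \<bar>k s\<bar> powr m)) = 2 * K * \<bar>k s\<bar> powr m * (s powr (1/2) * s powr (- 1/2))"
        by (simp only: mult_ac)
      also have "s powr (1/2) * s powr (- 1/2) = 1" using s by (simp flip: powr_add)
      finally show ?thesis using K by (simp add: ennreal_mult)
    qed simp
  qed
  also have "\<dots> = ennreal (2 * K) * (\<integral>\<^sup>+s. ennreal (\<bar>k s\<bar> powr m) \<partial>lborel)"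
    by (intro nn_integral_cmult) measurable
  also have "(\<integral>\<^sup>+s. ennreal (\<bar>k s\<bar> powr m) \<partial>lborel) = ennreal (Lp_pow m k)"
    unfolding Lp_pow_def using Lp_integrable[OF k] by (intro nn_integral_eq_integral) auto
  also have "ennreal (2 * K) * ennreal (Lp_pow m k) = ennreal (hardy_const m * Lp_pow m k)"
    using K by (simp add: ennreal_mult[symmetric] hardy_const_def K_def mult_ac)
  finally have fin: "(\<integral>\<^sup>+x. ennreal (\<bar>V x\<bar> powr m) \<partial>lborel) \<le> ennreal (hardy_const m * Lp_pow m k)" .
  have "integrable lborel (\<lambda>x. \<bar>V x\<bar> powr m)"
    by (rule integrableI_bounded) (use fin in \<open>auto intro: le_less_trans\<close>)
  then show L: "V \<in> Lp m" unfolding Lp_def using V by simp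
  have "ennreal (Lp_pow m V) \<le> ennreal (hardy_const m * Lp_pow m k)"
    using fin Lp_integrable[OF L] unfolding Lp_pow_def by (subst (asm) nn_integral_eq_integral) auto
  then show "Lp_pow m V \<le> hardy_const m * Lp_pow m k" by (subst (asm) ennreal_le_iff) (simp_all add: hardy_const_def)
qed

section \<open>Radial waves\<close>

lemma continuous_primitive:
  assumes f: "\<And>a b. set_integrable lborel {a..b} f"
  shows "continuous_on UNIV (primitive f)"
proof -
  have "isCont (primitive f) x" for x
  proof -
    have i: "f integrable_on {x - 1..x + 1}" using set_borel_integral_eq_integral(1)[OF f] .
    have eq: "primitive f y = primitive f (x - 1) + integral {x - 1..y} f" if "y \<in> {x - 1..x + 1}" for y
      using primitive_diff[OF f, of "x - 1" y] set_borel_integral_eq_integral(2)[OF f, of "x - 1" y] that by auto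
    have "continuous_on {x - 1..x + 1} (\<lambda>y. primitive f (x - 1) + integral {x - 1..y} f)"
      by (intro continuous_intros indefinite_integral_continuous_1 i)
    then have "continuous_on {x - 1..x + 1} (primitive f)" by (rule continuous_on_eq) (rule eq[symmetric])
    then show ?thesis by (rule continuous_on_interior) simp
  qed
  then show ?thesis by (simp add: continuous_at_imp_continuous_on)
qed

lemma
  assumes f: "f \<in> Lp m"
  shows Lp_reflect: "(\<lambda>x. f (- x)) \<in> Lp m" and Lp_pow_reflect: "Lp_pow m (\<lambda>x. f (- x)) = Lp_pow m f"
proof -
  note [measurable] = Lp_measurable[OF f]
  show "(\<lambda>x. f (- x)) \<in> Lp m"
    using lborel_integrable_real_affine[OF Lp_integrable[OF f], of "-1" 0] by (simp add: Lp_def)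
  show "Lp_pow m (\<lambda>x. f (- x)) = Lp_pow m f"
    unfolding Lp_pow_def using lborel_integral_real_affine[of "-1" "\<lambda>x. \<bar>f x\<bar> powr m" 0] by simp
qed

lemma LINT_Icc_reflect:
  fixes f :: "real \<Rightarrow> real"
  shows "(LINT x:{a..b}|lborel. f (- x)) = (LINT x:{- b..- a}|lborel. f x)"
proof -
  have ind: "indicat_real {- b..- a} (- x) = indicat_real {a..b} x" for x by (auto simp: indicator_def)
  show ?thesis unfolding set_lebesgue_integral_def
    using lborel_integral_real_affine[of "-1" "\<lambda>x. indicat_real {- b..- a} x *\<^sub>R f x" 0] by (simp add: ind)
qed

lemma LINT_singleton [simp]: "(LINT x:{a}|lborel. f x) = (0::real)" for a :: real
  unfolding set_lebesgue_integral_def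
  by (rule integral_eq_zero_AE, rule eventually_mono[OF AE_lborel_singleton[of a]]) simp

lemma LINT_symmetric_Icc:
  fixes f :: "real \<Rightarrow> real"
  assumes f: "\<And>a b. set_integrable lborel {a..b} f" and f': "\<And>a b. set_integrable lborel {a..b} (\<lambda>x. f (- x))" and ab: "0 \<le> a" "a \<le> b"
  shows "(LINT x:{- b..b}|lborel. f x) - (LINT x:{- a..a}|lborel. f x) = (LINT x:{a..b}|lborel. f x + f (- x))"
proof -
  have "(LINT x:{- b..b}|lborel. f x) = (LINT x:{- b..- a}|lborel. f x) + (LINT x:{- a..a}|lborel. f x) + (LINT x:{a..b}|lborel. f x)"
    using set_integral_Icc_combine[of f, OF f, of "- b" a b] set_integral_Icc_combine[of f, OF f, of "- b" "- a" a] ab by simp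
  then show ?thesis using set_integral_add(2)[OF f f', of a b] LINT_Icc_reflect[of a b f] by simp
qed

lemma Lp_nn_integral_bound:
  assumes G: "G \<in> borel_measurable borel" and le: "(\<integral>\<^sup>+x. ennreal (\<bar>G x\<bar> powr m) \<partial>lborel) \<le> ennreal K" and K: "0 \<le> K"
  shows "G \<in> Lp m" "Lp_pow m G \<le> K"
proof -
  note [measurable] = G
  have i: "integrable lborel (\<lambda>x. \<bar>G x\<bar> powr m)"
    using le by (intro integrableI_nonneg) (auto intro: le_less_trans simp: ennreal_less_top)
  then show "G \<in> Lp m" by (simp add: Lp_def G)
  have "ennreal (Lp_pow m G) \<le> ennreal K"
    using le nn_integral_eq_integral[OF i] by (simp add: Lp_pow_def)
  then show "Lp_pow m G \<le> K" using K by simp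
qed

text \<open>A pair represented by \<open>f\<close> consists of the data at time zero of the wave whose primitive profile
  \<^const>\<open>wave_F\<close> has derivative \<open>f\<close>.\<close>

definition wave_repr :: "(real \<Rightarrow> real) \<Rightarrow> (real \<Rightarrow> real) \<Rightarrow> (real \<Rightarrow> real) \<Rightarrow> bool" where
  "wave_repr f v0 v1 \<longleftrightarrow> (\<forall>r>0. v0 r = 1 / r * (LINT x:{- r..r}|lborel. f x)) \<and>
     (AE r in lborel. 0 < r \<longrightarrow> r * v1 r = f r - f (- r))"

section \<open>From the profile of a wave to its data\<close>

definition sym_mean :: "(real \<Rightarrow> real) \<Rightarrow> real \<Rightarrow> real" where
  "sym_mean f x = (if 0 < x then 1 / x * (LINT s:{- x..x}|lborel. f s) else 0)"

definition mean_const :: "real \<Rightarrow> real" where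
  "mean_const m = 2 powr m * (20 * m / (m - 1) * 4 powr (m - 1))"

text \<open>For \<open>x > 0\<close> the interval \<open>{- x..x}\<close> lies in the one of radius
  \<open>2 * x\<close> around \<open>x\<close>, so half of the mean is below the maximal function at
  \<open>x\<close>. Hardy's inequality for means thus follows from the maximal inequality, with an
  extra factor \<open>2 powr m\<close>.\<close>

lemma
  assumes m: "1 < m" and f: "f \<in> Lp m"
  shows sym_mean_Lp: "sym_mean f \<in> Lp m" and Lp_pow_sym_mean: "Lp_pow m (sym_mean f) \<le> mean_const m * Lp_pow m f"
proof -
  note fI = Lp_Icc_integrable[OF m f]
  note [measurable] = borel_measurable_continuous_onI[OF continuous_primitive[of f, OF fI]]
  have eq: "sym_mean f = (\<lambda>x. if 0 < x then 1 / x * (primitive f x - primitive f (- x)) else 0)"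
    by (rule ext) (simp add: sym_mean_def primitive_diff[of f, OF fI])
  have meas: "(\<lambda>x. 1/2 * sym_mean f x) \<in> borel_measurable borel" unfolding eq by measurable
  have pt: "ennreal (\<bar>1/2 * sym_mean f x\<bar> powr m) \<le> ennreal_rpow (hl_max f x) m" for x
  proof (cases "0 < x")
    case True
    have "\<bar>LINT s:{- x..x}|lborel. f s\<bar> \<le> (LINT s:{- x..x}|lborel. \<bar>f s\<bar>)"
      using set_integral_norm_bound[OF fI] by simp
    also have "\<dots> \<le> (LINT s:{x - 2 * x..x + 2 * x}|lborel. \<bar>f s\<bar>)"
      using True by (intro set_integral_mono_nonneg_set set_integrable_abs fI) auto
    finally have "\<bar>1/2 * sym_mean f x\<bar> \<le> (LINT s:{x - 2 * x..x + 2 * x}|lborel. \<bar>f s\<bar>) / (2 * x)"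
      using True by (simp add: sym_mean_def abs_mult field_simps)
    then have "ennreal \<bar>1/2 * sym_mean f x\<bar> \<le> ennreal ((LINT s:{x - 2 * x..x + 2 * x}|lborel. \<bar>f s\<bar>) / (2 * x))" by (rule ennreal_leI)
    also have "\<dots> \<le> hl_max f x"
      unfolding hl_max_def by (rule SUP_upper[of "2 * x" "{0<..}" "\<lambda>r. ennreal ((LINT s:{x - r..x + r}|lborel. \<bar>f s\<bar>) / r)"]) (use True in simp)
    finally have "ennreal_rpow (ennreal \<bar>1/2 * sym_mean f x\<bar>) m \<le> ennreal_rpow (hl_max f x) m"
      using m by (intro ennreal_rpow_mono) auto
    then show ?thesis by (simp add: ennreal_rpow_ennreal)
  qed (simp add: sym_mean_def)
  have le: "(\<integral>\<^sup>+x. ennreal (\<bar>1/2 * sym_mean f x\<bar> powr m) \<partial>lborel) \<le> ennreal (20 * m / (m - 1) * 4 powr (m - 1) * Lp_pow m f)"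
    by (rule order_trans[OF nn_integral_mono[OF pt] hl_max_strong_type[OF m f]])
  have K: "0 \<le> 20 * m / (m - 1) * 4 powr (m - 1) * Lp_pow m f" using m by simp
  note h = Lp_nn_integral_bound[OF meas le K]
  show "sym_mean f \<in> Lp m" using Lp_cmult[OF h(1), of 2] by simp
  have "Lp_pow m (sym_mean f) = 2 powr m * Lp_pow m (\<lambda>x. 1/2 * sym_mean f x)" using Lp_pow_cmult[OF h(1), of 2] by simp
  also have "\<dots> \<le> mean_const m * Lp_pow m f" unfolding mean_const_def mult.assoc[of "2 powr m"] by (rule mult_left_mono[OF h(2)]) simp
  finally show "Lp_pow m (sym_mean f) \<le> mean_const m * Lp_pow m f" .
qed

text \<open>The product rule for \<open>r * v0 r\<close>, the integral of \<open>f\<close> over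
  \<open>{- r..r}\<close>, gives \<open>f r + f (- r) - v0 r\<close> for \<open>r\<close> times the
  derivative of \<open>v0\<close>; and \<open>sym_mean f\<close> is \<open>v0\<close>.\<close>

definition wave_k0 :: "(real \<Rightarrow> real) \<Rightarrow> real \<Rightarrow> real" where
  "wave_k0 f x = indicator {0<..} x * (f x + f (- x) - sym_mean f x)"

definition wave_k1 :: "(real \<Rightarrow> real) \<Rightarrow> real \<Rightarrow> real" where
  "wave_k1 f x = indicator {0<..} x * (f x - f (- x))"

definition wave_const :: "real \<Rightarrow> real" where
  "wave_const m = 2 powr m * (2 powr m * 2 + mean_const m) + 2 powr m * 2"

lemma
  assumes m: "1 < m" and f: "f \<in> Lp m"
  shows wave_k_Lp: "wave_k0 f \<in> Lp m" "wave_k1 f \<in> Lp m"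
    and wave_k_bound: "Lp_pow m (wave_k0 f) + Lp_pow m (wave_k1 f) \<le> wave_const m * Lp_pow m f"
proof -
  have m0: "0 \<le> m" using m by simp
  note f' = Lp_reflect[OF f]
  note s = Lp_add[OF m0 f f'] and d = Lp_diff[OF m0 f f'] and M = sym_mean_Lp[OF m f]
  note k0 = Lp_diff[OF m0 s M]
  show "wave_k0 f \<in> Lp m" unfolding wave_k0_def[abs_def] by (rule Lp_indicator(1)[OF m0 k0]) simp
  show "wave_k1 f \<in> Lp m" unfolding wave_k1_def[abs_def] by (rule Lp_indicator(1)[OF m0 d]) simp
  have "Lp_pow m (wave_k0 f) \<le> Lp_pow m (\<lambda>x. f x + f (- x) - sym_mean f x)"
    unfolding wave_k0_def[abs_def] by (rule Lp_indicator(2)[OF m0 k0]) simp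
  also have "\<dots> \<le> 2 powr m * (Lp_pow m (\<lambda>x. f x + f (- x)) + Lp_pow m (sym_mean f))"
    by (rule Lp_pow_diff_le[OF m0 s M])
  also have "\<dots> \<le> 2 powr m * (2 powr m * (Lp_pow m f + Lp_pow m f) + mean_const m * Lp_pow m f)"
    using Lp_pow_add_le[OF m0 f f'] Lp_pow_sym_mean[OF m f] Lp_pow_reflect[OF f]
    by (intro mult_left_mono add_mono) auto
  finally have 0: "Lp_pow m (wave_k0 f) \<le> 2 powr m * (2 powr m * (Lp_pow m f + Lp_pow m f) + mean_const m * Lp_pow m f)" .
  have "Lp_pow m (wave_k1 f) \<le> Lp_pow m (\<lambda>x. f x - f (- x))"
    unfolding wave_k1_def[abs_def] by (rule Lp_indicator(2)[OF m0 d]) simp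
  also have "\<dots> \<le> 2 powr m * (Lp_pow m f + Lp_pow m f)" using Lp_pow_diff_le[OF m0 f f'] Lp_pow_reflect[OF f] by simp
  finally show "Lp_pow m (wave_k0 f) + Lp_pow m (wave_k1 f) \<le> wave_const m * Lp_pow m f"
    using 0 unfolding wave_const_def by (simp add: algebra_simps)
qed

text \<open>Integration by parts of \<open>1 / s\<close> against the integral of \<open>f\<close>
  over \<open>{- s..s}\<close>, whose density in \<open>s\<close> is
  \<open>f s + f (- s)\<close>.\<close>

lemma wave_repr_Lm_repr:
  assumes m: "1 < m" and f: "f \<in> Lp m" and w: "wave_repr f v0 v1"
  shows "Lm_repr m v0 v1 (wave_k0 f) (wave_k1 f)"
  unfolding Lm_repr_def
proof (intro conjI allI impI)
  note fI = Lp_Icc_integrable[OF m f] and f'I = Lp_Icc_integrable[OF m Lp_reflect[OF f]]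
  have v0: "v0 r = 1 / r * (LINT x:{- r..r}|lborel. f x)" if "0 < r" for r using w that by (simp add: wave_repr_def)
  show "wave_k0 f \<in> Lp m" "wave_k1 f \<in> Lp m" by (rule wave_k_Lp[OF m f])+
  show "wave_k0 f x = 0" "wave_k1 f x = 0" if "x \<le> 0" for x using that by (auto simp: wave_k0_def wave_k1_def)
  show "AE x in lborel. 0 < x \<longrightarrow> x * v1 x = wave_k1 f x"
    using conjunct2[OF w[unfolded wave_repr_def]] by eventually_elim (simp add: wave_k1_def)
  fix a b :: real assume ab: "0 < a \<and> a \<le> b"
  show "v0 b - v0 a = (LINT x:{a..b}|lborel. wave_k0 f x / x)"
  proof (cases "a = b")
    case True
    then show ?thesis by simp
  next
    case False
    then have lt: "a < b" using ab by simp
    have "(1 / b) * (LINT x:{- b..b}|lborel. f x) - (1 / a) * (LINT x:{- a..a}|lborel. f x)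
      = (LINT s:{a..b}|lborel. (- 1 / s\<^sup>2) * (LINT x:{- s..s}|lborel. f x) + (1 / s) * (f s + f (- s)))"
    proof (rule integration_by_parts_primitive[OF lt, where \<omega> = "\<lambda>s. 1 / s" and V = "\<lambda>s. LINT x:{- s..s}|lborel. f x" and \<omega>' = "\<lambda>s. - 1 / s\<^sup>2"])
      show "set_integrable lborel {a..b} (\<lambda>s. f s + f (- s))" by (rule set_integral_add(1)[OF fI f'I])
      show "(LINT x:{- y..y}|lborel. f x) - (LINT x:{- x..x}|lborel. f x) = (LINT s:{x..y}|lborel. f s + f (- s))"
        if "a \<le> x" "x \<le> y" for x y using ab that by (intro LINT_symmetric_Icc fI f'I) auto
      show "((\<lambda>s. 1 / s) has_real_derivative - 1 / x\<^sup>2) (at x)" if "x \<in> {a..b}" for x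
        using ab that by (auto intro!: derivative_eq_intros simp: power2_eq_square)
      show "continuous_on {a..b} (\<lambda>s. - 1 / s\<^sup>2)" using ab by (intro continuous_intros) auto
    qed
    also have "\<dots> = (LINT s:{a..b}|lborel. wave_k0 f s / s)"
    proof (rule set_lebesgue_integral_cong)
      show "\<forall>s. s \<in> {a..b} \<longrightarrow> (- 1 / s\<^sup>2) * (LINT x:{- s..s}|lborel. f x) + (1 / s) * (f s + f (- s)) = wave_k0 f s / s"
      proof (intro allI impI)
        fix s assume "s \<in> {a..b}"
        then have s: "0 < s" using ab by auto
        show "(- 1 / s\<^sup>2) * (LINT x:{- s..s}|lborel. f x) + (1 / s) * (f s + f (- s)) = wave_k0 f s / s"
          using s by (simp add: wave_k0_def sym_mean_def power2_eq_square diff_divide_distrib)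
      qed
    qed simp
    finally show ?thesis using ab by (simp add: v0)
  qed
qed

lemma
  assumes m: "1 < m" and f: "f \<in> Lp m" and w: "wave_repr f v0 v1"
  shows wave_repr_space: "(v0, v1) \<in> Lm_space m"
    and wave_repr_norm: "Lm_norm m (v0, v1) \<le> wave_const m powr (1/m) * Lp_pow m f powr (1/m)"
proof -
  note r = wave_repr_Lm_repr[OF m f w]
  have v0: "v0 r = 1 / r * (LINT x:{- r..r}|lborel. f x)" if "0 < r" for r using w that by (simp add: wave_repr_def)
  \<comment> \<open>Hoelder's inequality on \<open>{- r..r}\<close> gives decay like
    \<open>r powr (- (1/m))\<close>, which yields the condition at infinity in
    \<open>Lm_finite\<close>.\<close>
  have "(v0 \<longlongrightarrow> 0) at_top"
  proof (rule Lim_null_comparison)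
    show "eventually (\<lambda>r. norm (v0 r) \<le> 2 * (2 powr (1 - 1/m) * Lp_pow m f powr (1/m)) * r powr (- (1/m))) at_top"
      using eventually_gt_at_top[of 0]
    proof eventually_elim
      case (elim r)
      have "norm (v0 r) = 1 / r * \<bar>LINT x:{- r..r}|lborel. f x\<bar>" using elim by (simp add: v0 abs_mult)
      also have "\<dots> \<le> 1 / r * (2 * ((r - - r) powr (1 - 1/m) * Lp_pow m f powr (1/m)))"
        using elim by (intro mult_left_mono Lp_Icc_le[OF m f]) auto
      also have "(r - - r) powr (1 - 1/m) = 2 powr (1 - 1/m) * r powr (1 - 1/m)" using elim by (simp flip: powr_mult)
      also have "1 / r * (2 * (2 powr (1 - 1/m) * r powr (1 - 1/m) * Lp_pow m f powr (1/m)))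
        = 2 * (2 powr (1 - 1/m) * Lp_pow m f powr (1/m)) * (r powr (1 - 1/m) / r)" by simp
      also have "r powr (1 - 1/m) / r = r powr (- (1/m))"
        using powr_diff[of r "1 - 1/m" 1] elim by simp
      finally show ?case .
    qed
    have "((\<lambda>r. r powr (- (1/m))) \<longlongrightarrow> 0) at_top" using m by (intro tendsto_neg_powr filterlim_ident) auto
    then show "((\<lambda>r. 2 * (2 powr (1 - 1/m) * Lp_pow m f powr (1/m)) * r powr (- (1/m))) \<longlongrightarrow> 0) at_top"
      by (rule tendsto_mult_right_zero)
  qed
  then show "(v0, v1) \<in> Lm_space m" by (intro Lm_finite_imp_space[OF m] Lm_repr_finite[OF m r])
  have "0 \<le> wave_const m" using m by (simp add: wave_const_def mean_const_def)
  then have "(wave_const m * Lp_pow m f) powr (1/m) = wave_const m powr (1/m) * Lp_pow m f powr (1/m)" by (simp add: powr_mult)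
  moreover have "(Lp_pow m (wave_k0 f) + Lp_pow m (wave_k1 f)) powr (1/m) \<le> (wave_const m * Lp_pow m f) powr (1/m)"
    using m wave_k_bound[OF m f] by (intro powr_mono2) auto
  ultimately show "Lm_norm m (v0, v1) \<le> wave_const m powr (1/m) * Lp_pow m f powr (1/m)"
    unfolding Lm_repr_norm[OF m r] by simp
qed

text \<open>The two terms of \<open>wave_F\<close> are the odd and the even part of
  \<open>primitive f\<close>.\<close>

lemma wave_repr_wave_F:
  assumes m: "1 < m" and f: "f \<in> Lp m" and w: "wave_repr f v0 v1"
  shows "wave_F (v0, v1) = primitive f"
proof
  fix \<sigma>
  note [measurable] = Lp_measurable[OF f]
  note fI = Lp_Icc_integrable[OF m f] and f'I = Lp_Icc_integrable[OF m Lp_reflect[OF f]]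
  have v0: "v0 r = 1 / r * (LINT x:{- r..r}|lborel. f x)" if "0 < r" for r using w that by (simp add: wave_repr_def)
  have b: "(\<lambda>x. f x - f (- x)) \<in> borel_measurable borel" by measurable
  have "AE x in lborel. x \<in> {0..\<bar>\<sigma>\<bar>} \<longrightarrow> x * v1 x = f x - f (- x)"
    using conjunct2[OF w[unfolded wave_repr_def]] AE_lborel_singleton[of 0] by eventually_elim auto
  from LINT_lebesgue_AE_eq(1)[OF b _ this]
  have I: "(LINT \<rho>:{0..\<bar>\<sigma>\<bar>}|lebesgue. \<rho> * v1 \<rho>) = (LINT x:{0..\<bar>\<sigma>\<bar>}|lborel. f x) - (LINT x:{- \<bar>\<sigma>\<bar>..0}|lborel. f x)"
    using set_integral_diff(2)[OF fI f'I, of 0 "\<bar>\<sigma>\<bar>"] LINT_Icc_reflect[of 0 "\<bar>\<sigma>\<bar>" f] by simp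
  have c: "(LINT x:{- r..r}|lborel. f x) = (LINT x:{- r..0}|lborel. f x) + (LINT x:{0..r}|lborel. f x)" if "0 < r" for r
    using that by (intro set_integral_Icc_combine fI) auto
  have F: "wave_F (v0, v1) \<sigma> = 1/2 * \<sigma> * v0 \<bar>\<sigma>\<bar> + 1/2 * ((LINT x:{0..\<bar>\<sigma>\<bar>}|lborel. f x) - (LINT x:{- \<bar>\<sigma>\<bar>..0}|lborel. f x))"
    by (simp add: wave_F_def I)
  consider "\<sigma> = 0" | "0 < \<sigma>" | "\<sigma> < 0" by linarith
  then show "wave_F (v0, v1) \<sigma> = primitive f \<sigma>"
  proof cases
    case 1
    then show ?thesis unfolding F by (simp add: primitive_def)
  next
    case 2
    then show ?thesis unfolding F using v0[of \<sigma>] c[of \<sigma>] by (simp add: primitive_def field_simps)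
  next
    case 3
    have "1/2 * \<sigma> * v0 (- \<sigma>) = - (1/2) * (LINT x:{\<sigma>..- \<sigma>}|lborel. f x)" using v0[of "- \<sigma>"] 3 by simp
    then show ?thesis unfolding F using c[of "- \<sigma>"] 3 by (simp add: primitive_def field_simps)
  qed
qed

text \<open>The two combinations in the energy are \<open>2 * f r\<close> and
  \<open>2 * f (- r)\<close>, so the half-line sees each half of the profile exactly once.\<close>

lemma wave_repr_energy:
  assumes m: "1 < m" and f: "f \<in> Lp m" and w: "wave_repr f v0 v1"
  shows "energy m (v0, v1) = 2 powr m * Lp_pow m f"
proof -
  note [measurable] = Lp_measurable[OF f]
  note fI = Lp_Icc_integrable[OF m f] and f'I = Lp_Icc_integrable[OF m Lp_reflect[OF f]]
  have v0: "v0 r = 1 / r * (LINT x:{- r..r}|lborel. f x)" if "0 < r" for r using w that by (simp add: wave_repr_def)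
  have "AE r in lborel. 0 < r \<longrightarrow> ((\<lambda>r. r * v0 r) has_real_derivative f r + f (- r)) (at r)"
  proof (rule AE_has_derivative_primitive_pos)
    show "set_integrable lborel {a..b} (\<lambda>r. f r + f (- r))" for a b by (rule set_integral_add(1)[OF fI f'I])
    show "y * v0 y - x * v0 x = (LINT s:{x..y}|lborel. f s + f (- s))" if "0 < x" "x \<le> y" for x y
      using that LINT_symmetric_Icc[of f x y, OF fI f'I] by (simp add: v0)
  qed
  then have ae: "AE r in lborel. r \<in> {0<..} \<longrightarrow>
      \<bar>deriv (\<lambda>s. s * v0 s) r + r * v1 r\<bar> powr m + \<bar>deriv (\<lambda>s. s * v0 s) r - r * v1 r\<bar> powr m
      = 2 powr m * \<bar>f r\<bar> powr m + 2 powr m * \<bar>f (- r)\<bar> powr m"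
    using conjunct2[OF w[unfolded wave_repr_def]]
  proof eventually_elim
    case (elim r)
    show ?case
    proof
      assume r: "r \<in> {0<..}"
      have "deriv (\<lambda>s. s * v0 s) r = f r + f (- r)" using elim(1) r by (intro DERIV_imp_deriv) auto
      moreover have "r * v1 r = f r - f (- r)" using elim(2) r by auto
      ultimately have "deriv (\<lambda>s. s * v0 s) r + r * v1 r = 2 * f r" "deriv (\<lambda>s. s * v0 s) r - r * v1 r = 2 * f (- r)" by auto
      then show "\<bar>deriv (\<lambda>s. s * v0 s) r + r * v1 r\<bar> powr m + \<bar>deriv (\<lambda>s. s * v0 s) r - r * v1 r\<bar> powr m
        = 2 powr m * \<bar>f r\<bar> powr m + 2 powr m * \<bar>f (- r)\<bar> powr m" by (simp add: abs_mult powr_mult)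
    qed
  qed
  have b: "(\<lambda>r. 2 powr m * \<bar>f r\<bar> powr m + 2 powr m * \<bar>f (- r)\<bar> powr m) \<in> borel_measurable borel" by measurable
  have S: "{0<..} \<in> sets (borel :: real measure)" by simp
  have iI: "integrable lborel (\<lambda>r. \<bar>f r\<bar> powr m)" "integrable lborel (\<lambda>r. \<bar>f (- r)\<bar> powr m)"
    using Lp_integrable[OF f] Lp_integrable[OF Lp_reflect[OF f]] by auto
  have i: "set_integrable lborel A (\<lambda>r. \<bar>f r\<bar> powr m)" "set_integrable lborel A (\<lambda>r. \<bar>f (- r)\<bar> powr m)"
    if "A \<in> sets borel" for A using iI that by (auto intro: integrable_imp_set_integrable)
  have "energy m (v0, v1) = (LINT r:{0<..}|lborel. 2 powr m * \<bar>f r\<bar> powr m + 2 powr m * \<bar>f (- r)\<bar> powr m)"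
    unfolding energy_def by (simp add: LINT_lebesgue_AE_eq(1)[OF b S ae])
  also have "\<dots> = 2 powr m * (LINT r:{0<..}|lborel. \<bar>f r\<bar> powr m) + 2 powr m * (LINT r:{0<..}|lborel. \<bar>f (- r)\<bar> powr m)"
    using i[OF S] by (subst set_integral_add(2)) simp_all
  also have "(LINT r:{0<..}|lborel. \<bar>f (- r)\<bar> powr m) = (LINT r:{..<0}|lborel. \<bar>f r\<bar> powr m)"
  proof -
    have ind: "indicat_real {..<0} (- x) = indicat_real {0<..} x" for x :: real by (auto simp: indicator_def)
    show ?thesis unfolding set_lebesgue_integral_def
      using lborel_integral_real_affine[of "-1" "\<lambda>x. indicat_real {..<0} x *\<^sub>R (\<bar>f x\<bar> powr m)" 0] by (simp add: ind)
  qed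
  also have "2 powr m * (LINT r:{0<..}|lborel. \<bar>f r\<bar> powr m) + 2 powr m * (LINT r:{..<0}|lborel. \<bar>f r\<bar> powr m)
    = 2 powr m * ((LINT r:{0<..}|lborel. \<bar>f r\<bar> powr m) + (LINT r:{..<0}|lborel. \<bar>f r\<bar> powr m))" by (simp add: distrib_left)
  also have "(LINT r:{0<..}|lborel. \<bar>f r\<bar> powr m) + (LINT r:{..<0}|lborel. \<bar>f r\<bar> powr m)
    = (LINT r:{0<..} \<union> {..<0}|lborel. \<bar>f r\<bar> powr m)"
    by (rule set_integral_Un[symmetric]) (auto intro: i)
  also have "\<dots> = Lp_pow m f"
    unfolding set_lebesgue_integral_def Lp_pow_def
    by (rule integral_cong_AE) (use AE_lborel_singleton[of 0] in \<open>auto simp: indicator_def elim!: eventually_mono\<close>)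
  finally show ?thesis .
qed

section \<open>From the data to the profile\<close>

lemma continuous_divide_primitive:
  assumes m: "1 < m" and k: "k \<in> Lp m"
    and inc: "\<And>a b. 0 < a \<Longrightarrow> a \<le> b \<Longrightarrow> v b - v a = (LINT s:{a..b}|lborel. k s / s)"
  shows "continuous_on {0<..} v"
proof -
  have "isCont v x" if x: "0 < x" for x
  proof -
    have fI: "set_integrable lborel {x / 2..y} (\<lambda>s. k s / s)" for y using x by (intro set_integrable_divide_id[OF m k]) auto
    have i: "(\<lambda>s. k s / s) integrable_on {x / 2..2 * x}" using set_borel_integral_eq_integral(1)[OF fI] .
    have eq: "v y = v (x / 2) + integral {x / 2..y} (\<lambda>s. k s / s)" if "y \<in> {x / 2..2 * x}" for y
      using inc[of "x / 2" y] set_borel_integral_eq_integral(2)[OF fI, of y] that x by auto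
    have "continuous_on {x / 2..2 * x} (\<lambda>y. v (x / 2) + integral {x / 2..y} (\<lambda>s. k s / s))"
      by (intro continuous_intros indefinite_integral_continuous_1 i)
    then have "continuous_on {x / 2..2 * x} v" by (rule continuous_on_eq) (rule eq[symmetric])
    then show ?thesis by (rule continuous_on_interior) (use x in simp)
  qed
  then show ?thesis by (simp add: continuous_at_imp_continuous_on)
qed

definition profile_const :: "real \<Rightarrow> real" where
  "profile_const m = 2 powr m * 2 powr m * (2 powr m * (2 * hardy_const m + 2) + 2)"

text \<open>As \<open>k\<close> vanishes on the negative half-line and at 0,
  \<open>k \<bar>x\<bar>\<close> is \<open>k x + k (- x)\<close>. The factor \<open>s\<close> is 1
  for the even part of the profile and \<open>sgn\<close> for the odd part.\<close>

lemma Lp_abs: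
  assumes m: "0 \<le> m" and k: "k \<in> Lp m" and z: "\<And>x. x \<le> 0 \<Longrightarrow> k x = 0" and s: "s \<in> borel_measurable borel" "\<And>x. \<bar>s x\<bar> \<le> 1"
  shows "(\<lambda>x. s x * k \<bar>x\<bar>) \<in> Lp m" "Lp_pow m (\<lambda>x. s x * k \<bar>x\<bar>) \<le> 2 powr m * (2 * Lp_pow m k)"
proof -
  note [measurable] = Lp_measurable[OF k] s(1)
  note k' = Lp_reflect[OF k]
  have eq: "k x + k (- x) = k \<bar>x\<bar>" for x using z[of x] z[of "- x"] by (cases "0 \<le> x") auto
  note a = Lp_add[OF m k k']
  have le: "\<bar>s x * k \<bar>x\<bar>\<bar> \<le> \<bar>k x + k (- x)\<bar>" for x unfolding eq abs_mult using s(2)[of x] by (intro mult_left_le_one_le) auto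
  have b: "(\<lambda>x. s x * k \<bar>x\<bar>) \<in> borel_measurable borel" by measurable
  show "(\<lambda>x. s x * k \<bar>x\<bar>) \<in> Lp m" by (rule Lp_bound(1)[OF m a b le])
  have "Lp_pow m (\<lambda>x. s x * k \<bar>x\<bar>) \<le> Lp_pow m (\<lambda>x. k x + k (- x))" by (rule Lp_bound(2)[OF m a b le])
  also have "\<dots> \<le> 2 powr m * (Lp_pow m k + Lp_pow m k)" using Lp_pow_add_le[OF m k k'] Lp_pow_reflect[OF k] by simp
  finally show "Lp_pow m (\<lambda>x. s x * k \<bar>x\<bar>) \<le> 2 powr m * (2 * Lp_pow m k)" by simp
qed

text \<open>The profile is \<open>F' = (v\<^sub>0 + k\<^sub>0 \<plusminus> k\<^sub>1) / 2\<close>, evaluated at \<open>\<bar>\<sigma>\<bar>\<close>; that it reproduces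
  \<open>v\<^sub>0\<close> is the product rule for \<open>r v\<^sub>0\<close> together with \<open>r v\<^sub>0(r) \<rightarrow> 0\<close> as \<open>r \<rightarrow> 0\<close>.\<close>

theorem Lm_finite_wave_repr:
  assumes m: "1 < m" and v: "(v0, v1) \<in> Lm_finite m"
  shows "\<exists>f\<in>Lp m. wave_repr f v0 v1 \<and> Lp_pow m f \<le> profile_const m * Lm_norm m (v0, v1) powr m"
proof -
  have m0: "0 \<le> m" using m by simp
  obtain k0 k1 where r: "Lm_repr m v0 v1 k0 k1" using Lm_finite_repr[OF m v] by blast
  have lim: "(v0 \<longlongrightarrow> 0) at_top" using v by (simp add: Lm_finite_def)
  have k0: "k0 \<in> Lp m" and k1: "k1 \<in> Lp m" and z0: "\<And>x. x \<le> 0 \<Longrightarrow> k0 x = 0" and z1: "\<And>x. x \<le> 0 \<Longrightarrow> k1 x = 0"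
    and inc: "\<And>a b. 0 < a \<Longrightarrow> a \<le> b \<Longrightarrow> v0 b - v0 a = (LINT s:{a..b}|lborel. k0 s / s)"
    and ae: "AE x in lborel. 0 < x \<longrightarrow> x * v1 x = k1 x"
    using r unfolding Lm_repr_def by blast+
  define V where "V = (\<lambda>x. if x \<in> {0<..} then v0 x else 0)"
  have VB: "V \<in> borel_measurable borel" unfolding V_def
    by (rule borel_measurable_continuous_on_if) (use continuous_divide_primitive[OF m k0 inc] in auto)
  have Vv: "\<And>x. 0 < x \<Longrightarrow> V x = v0 x" "\<And>x. x \<le> 0 \<Longrightarrow> V x = 0" by (auto simp: V_def)
  note V = dual_hardy[OF m k0 VB lim inc Vv]
  have VI: "\<And>a b. set_integrable lborel {a..b} V" and k0I: "\<And>a b. set_integrable lborel {a..b} k0"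
    and k1I: "\<And>a b. set_integrable lborel {a..b} k1"
    using Lp_Icc_integrable[OF m] V(1) k0 k1 by auto
  have VkI: "set_integrable lborel {a..b} (\<lambda>s. V s + k0 s)" for a b by (rule set_integral_add(1)[OF VI k0I])
  define h where "h = (\<lambda>x. 1 * (V \<bar>x\<bar>) + 1 * k0 \<bar>x\<bar>)"
  define f where "f = (\<lambda>x. 1/2 * (h x + sgn x * k1 \<bar>x\<bar>))"
  have one: "(\<lambda>x. 1::real) \<in> borel_measurable borel" "\<And>x::real. \<bar>1::real\<bar> \<le> 1" by auto
  have sg: "sgn \<in> borel_measurable (borel :: real measure)" "\<And>x::real. \<bar>sgn x\<bar> \<le> 1" by (auto simp: sgn_if)
  note aV = Lp_abs[OF m0 V(1) Vv(2) one] and a0 = Lp_abs[OF m0 k0 z0 one] and a1 = Lp_abs[OF m0 k1 z1 sg]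
  have h: "h \<in> Lp m" unfolding h_def by (rule Lp_add[OF m0 aV(1) a0(1)])
  note s = Lp_add[OF m0 h a1(1)]
  have f: "f \<in> Lp m" unfolding f_def by (rule Lp_cmult[OF s])
  have hardy0: "0 \<le> hardy_const m" using m by (simp add: hardy_const_def)
  have "Lp_pow m h \<le> 2 powr m * (Lp_pow m (\<lambda>x. 1 * V \<bar>x\<bar>) + Lp_pow m (\<lambda>x. 1 * k0 \<bar>x\<bar>))"
    unfolding h_def by (rule Lp_pow_add_le[OF m0 aV(1) a0(1)])
  also have "\<dots> \<le> 2 powr m * (2 powr m * (2 * Lp_pow m V) + 2 powr m * (2 * Lp_pow m k0))"
    using aV(2) a0(2) by (intro mult_left_mono add_mono) auto
  also have "\<dots> \<le> 2 powr m * (2 powr m * (2 * (hardy_const m * Lp_pow m k0)) + 2 powr m * (2 * Lp_pow m k0))"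
    using V(2) by (intro mult_left_mono add_mono) auto
  finally have hb: "Lp_pow m h \<le> 2 powr m * (2 powr m * (2 * (hardy_const m * Lp_pow m k0)) + 2 powr m * (2 * Lp_pow m k0))" .
  have "Lp_pow m f = \<bar>1/2\<bar> powr m * Lp_pow m (\<lambda>x. h x + sgn x * k1 \<bar>x\<bar>)" unfolding f_def by (rule Lp_pow_cmult[OF s])
  also have "\<dots> \<le> 1 * Lp_pow m (\<lambda>x. h x + sgn x * k1 \<bar>x\<bar>)"
    using m by (intro mult_right_mono) (auto intro: powr_le1)
  also have "\<dots> \<le> 1 * (2 powr m * (Lp_pow m h + Lp_pow m (\<lambda>x. sgn x * k1 \<bar>x\<bar>)))"
    using Lp_pow_add_le[OF m0 h a1(1)] by simp
  also have "\<dots> \<le> 1 * (2 powr m * (2 powr m * (2 powr m * (2 * (hardy_const m * Lp_pow m k0)) + 2 powr m * (2 * Lp_pow m k0)) + 2 powr m * (2 * Lp_pow m k1)))"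
    by (intro mult_left_mono add_mono hb a1(2)) auto
  also have "\<dots> \<le> profile_const m * (Lp_pow m k0 + Lp_pow m k1)"
  proof -
    define P where "P = (2::real) powr m"
    have P: "0 \<le> P" by (simp add: P_def)
    have "0 \<le> P * P * 2 * Lp_pow m k0 + P * P * P * (2 * hardy_const m + 2) * Lp_pow m k1" using P hardy0 by simp
    then show ?thesis unfolding profile_const_def P_def[symmetric] by (simp add: algebra_simps)
  qed
  finally have fb: "Lp_pow m f \<le> profile_const m * (Lp_pow m k0 + Lp_pow m k1)" .
  have nrm: "Lm_norm m (v0, v1) powr m = Lp_pow m k0 + Lp_pow m k1"
    unfolding Lm_repr_norm[OF m r] using m by (simp add: powr_powr add_nonneg_nonneg)
  have fd: "f x - f (- x) = k1 x" and fs: "f x + f (- x) = V x + k0 x" if "0 < x" for x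
    using that by (simp_all add: f_def h_def field_simps)
  note fI = Lp_Icc_integrable[OF m f] and f'I = Lp_Icc_integrable[OF m Lp_reflect[OF f]]
  \<comment> \<open>Integration by parts stops at a positive \<open>e\<close>, since
    \<open>k0 s / s\<close> need not be integrable at the origin; the boundary term
    \<open>e * v0 e\<close> is at most a multiple of \<open>e powr (1 - 1/m)\<close> and vanishes
    with \<open>e\<close>.\<close>
  have main: "x * v0 x = (LINT s:{0..x}|lborel. V s + k0 s)" if x: "0 < x" for x
  proof -
    define G where "G = primitive (\<lambda>s. V s + k0 s)"
    have ibp: "x * v0 x - e * v0 e = G x - G e" if e: "0 < e" "e < x" for e
    proof -
      have "x * v0 x - e * v0 e = (LINT s:{e..x}|lborel. 1 * v0 s + s * (k0 s / s))"
      proof (rule integration_by_parts_primitive[OF e(2), where \<omega> = "\<lambda>s. s" and \<omega>' = "\<lambda>s. 1" and V = v0])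
        show "set_integrable lborel {e..x} (\<lambda>s. k0 s / s)" by (rule set_integrable_divide_id[OF m k0 e(1)])
        show "v0 b - v0 a = (LINT s:{a..b}|lborel. k0 s / s)" if "e \<le> a" "a \<le> b" for a b using that e by (intro inc) auto
      qed auto
      also have "\<dots> = (LINT s:{e..x}|lborel. V s + k0 s)"
        using e by (intro set_lebesgue_integral_cong) (auto simp: V_def)
      also have "\<dots> = G x - G e" unfolding G_def using primitive_diff[of "\<lambda>s. V s + k0 s" e x, OF VkI] e by simp
      finally show ?thesis .
    qed
    have "isCont G 0" using continuous_primitive[of "\<lambda>s. V s + k0 s", OF VkI] by (simp add: G_def continuous_on_eq_continuous_at)
    then have G0: "(G \<longlongrightarrow> G 0) (at_right 0)" unfolding isCont_def by (rule filterlim_mono[OF _ order_refl at_le]) simp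
    have e0: "((\<lambda>e. e * v0 e) \<longlongrightarrow> 0) (at_right 0)"
    proof (rule Lim_null_comparison)
      show "eventually (\<lambda>e. norm (e * v0 e) \<le> 2 * (2 * (m - 1)) powr (1 - 1/m) * Lp_pow m k0 powr (1/m) * e powr (1 - 1/m)) (at_right 0)"
        using eventually_at_right_less[of 0]
      proof eventually_elim
        case (elim e)
        have "norm (e * v0 e) \<le> e * (2 * (2 * (m - 1)) powr (1 - 1/m) * Lp_pow m k0 powr (1/m) * e powr (- 1/m))"
          using dual_hardy_decay[OF m k0 elim lim inc] elim by (simp add: abs_mult mult_left_mono)
        also have "\<dots> = 2 * (2 * (m - 1)) powr (1 - 1/m) * Lp_pow m k0 powr (1/m) * (e powr 1 * e powr (- 1/m))"
          using elim by simp
        also have "e powr 1 * e powr (- 1/m) = e powr (1 - 1/m)" unfolding powr_add[symmetric] by simp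
        finally show ?case .
      qed
      have "((\<lambda>e. e powr (1 - 1/m)) \<longlongrightarrow> 0 powr (1 - 1/m)) (at_right (0::real))"
      proof (rule tendsto_powr')
        show "((\<lambda>e. e) \<longlongrightarrow> 0) (at_right (0::real))" by (rule tendsto_ident_at)
        show "(0::real) \<noteq> 0 \<or> 0 < 1 - 1/m \<and> (\<forall>\<^sub>F e in at_right 0. 0 \<le> (e::real))"
          using m eventually_at_right_less[of "0::real"] by (auto elim: eventually_mono)
      qed simp
      then have "((\<lambda>e. e powr (1 - 1/m)) \<longlongrightarrow> 0) (at_right (0::real))" by simp
      then show "((\<lambda>e. 2 * (2 * (m - 1)) powr (1 - 1/m) * Lp_pow m k0 powr (1/m) * e powr (1 - 1/m)) \<longlongrightarrow> 0) (at_right 0)"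
        by (rule tendsto_mult_right_zero)
    qed
    have "((\<lambda>e. G x - G e + e * v0 e) \<longlongrightarrow> G x - G 0 + 0) (at_right 0)" by (intro tendsto_intros G0 e0)
    moreover have "((\<lambda>e. G x - G e + e * v0 e) \<longlongrightarrow> x * v0 x) (at_right 0)"
    proof (rule tendsto_eventually)
      have "eventually (\<lambda>e. e \<in> {0<..<x}) (at_right 0)" using x by (rule eventually_at_right_real)
      then show "eventually (\<lambda>e. G x - G e + e * v0 e = x * v0 x) (at_right 0)"
      proof eventually_elim
        case (elim e)
        then show ?case using ibp[of e] by simp
      qed
    qed
    ultimately have "G x - G 0 + 0 = x * v0 x" using tendsto_unique trivial_limit_at_right_real by blast
    then show ?thesis using primitive_diff[of "\<lambda>s. V s + k0 s" 0 x, OF VkI] x by (simp add: G_def)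
  qed
  have "wave_repr f v0 v1" unfolding wave_repr_def
  proof (intro conjI allI impI)
    fix x :: real assume x: "0 < x"
    have "(LINT s:{- x..x}|lborel. f s) = (LINT s:{0..x}|lborel. f s + f (- s))"
      using LINT_symmetric_Icc[of f 0 x, OF fI f'I] x by simp
    also have "\<dots> = (LINT s:{0..x}|lborel. V s + k0 s)"
      unfolding set_lebesgue_integral_def
    proof (rule integral_cong_AE)
      show "AE s in lborel. indicat_real {0..x} s *\<^sub>R (f s + f (- s)) = indicat_real {0..x} s *\<^sub>R (V s + k0 s)"
        using AE_lborel_singleton[of 0] by eventually_elim (auto simp: fs indicator_def)
      show "(\<lambda>s. indicat_real {0..x} s *\<^sub>R (f s + f (- s))) \<in> borel_measurable lborel"
        using set_integral_add(1)[OF fI f'I, of 0 x] by (auto simp: set_integrable_def)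
      show "(\<lambda>s. indicat_real {0..x} s *\<^sub>R (V s + k0 s)) \<in> borel_measurable lborel"
        using VkI[of 0 x] by (auto simp: set_integrable_def)
    qed
    also have "\<dots> = x * v0 x" using main[OF x] by simp
    finally show "v0 x = 1 / x * (LINT s:{- x..x}|lborel. f s)" using x by simp
  next
    show "AE r in lborel. 0 < r \<longrightarrow> r * v1 r = f r - f (- r)" using ae by eventually_elim (simp add: fd)
  qed
  then show ?thesis using f fb nrm by (intro bexI[OF _ f]) simp
qed

section \<open>Bounded functionals on the profile side\<close>

lemma wave_repr_cmult: "wave_repr f v0 v1 \<Longrightarrow> wave_repr (\<lambda>x. c * f x) (\<lambda>r. c * v0 r) (\<lambda>r. c * v1 r)"
  unfolding wave_repr_def
proof (elim conjE, intro conjI)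
  assume "AE r in lborel. 0 < r \<longrightarrow> r * v1 r = f r - f (- r)"
  then show "AE r in lborel. 0 < r \<longrightarrow> r * (c * v1 r) = c * f r - c * f (- r)"
    by eventually_elim (auto simp: right_diff_distrib[symmetric] mult.left_commute)
qed (simp add: mult.left_commute)

lemma wave_repr_add:
  assumes m: "1 < m" and f: "f \<in> Lp m" "g \<in> Lp m" and v: "wave_repr f v0 v1" and w: "wave_repr g w0 w1"
  shows "wave_repr (\<lambda>x. f x + g x) (\<lambda>r. v0 r + w0 r) (\<lambda>r. v1 r + w1 r)"
  unfolding wave_repr_def
proof (intro conjI)
  show "AE r in lborel. 0 < r \<longrightarrow> r * (v1 r + w1 r) = f r + g r - (f (- r) + g (- r))"
    using conjunct2[OF v[unfolded wave_repr_def]] conjunct2[OF w[unfolded wave_repr_def]]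
    by eventually_elim (auto simp: distrib_left)
  show "\<forall>r>0. v0 r + w0 r = 1 / r * (LINT x:{- r..r}|lborel. f x + g x)"
    using v w set_integral_add(2)[OF Lp_Icc_integrable[OF m f(1)] Lp_Icc_integrable[OF m f(2)]]
    unfolding wave_repr_def by (simp add: distrib_left add_divide_distrib)
qed

text \<open>The profile fixes the pair only for positive \<open>r\<close>, and the second component
  only almost everywhere. The difference of two such pairs is represented by 0, so it has norm 0 and
  a bounded functional vanishes on it.\<close>

lemma Lm_dual_wave_repr_eq:
  assumes m: "1 < m" and l: "l \<in> Lm_dual m" and f: "f \<in> Lp m" and v: "wave_repr f v0 v1" and w: "wave_repr f w0 w1"
  shows "l (v0, v1) = l (w0, w1)"
proof -
  obtain C where C: "\<And>v. v \<in> Lm_space m \<Longrightarrow> \<bar>l v\<bar> \<le> C * Lm_norm m v"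
    using l unfolding Lm_dual_def by blast
  define f' where "f' = (\<lambda>x. - 1 * f x)"
  have f': "f' \<in> Lp m" unfolding f'_def by (rule Lp_cmult[OF f])
  note w' = wave_repr_cmult[OF w, of "- 1", folded f'_def]
  define z0 z1 where "z0 = (\<lambda>r. v0 r + - 1 * w0 r)" "z1 = (\<lambda>r. v1 r + - 1 * w1 r)"
  have z: "wave_repr (\<lambda>x. 0) z0 z1"
    using wave_repr_add[OF m f f' v w'] unfolding z0_z1_def by (simp add: f'_def)
  note s = wave_repr_space[OF m]
  have "Lm_norm m (z0, z1) \<le> 0" using wave_repr_norm[OF m Lp_zero z] m by simp
  moreover have "0 \<le> Lm_norm m (z0, z1)" by (simp add: Lm_norm_def)
  ultimately have "\<bar>l (z0, z1)\<bar> \<le> 0" using C[OF s[OF Lp_zero z]] by simp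
  moreover have "l (z0, z1) = l (v0, v1) + l (\<lambda>r. - 1 * w0 r, \<lambda>r. - 1 * w1 r)"
    unfolding z0_z1_def using l s[OF f v] s[OF f' w'] unfolding Lm_dual_def by blast
  moreover have "l (\<lambda>r. - 1 * w0 r, \<lambda>r. - 1 * w1 r) = - 1 * l (w0, w1)"
    using l s[OF f w] unfolding Lm_dual_def by blast
  ultimately show ?thesis by simp
qed

text \<open>A canonical pair for each profile, through which functionals on data are pulled back to
  \<open>Lp m\<close>, where \<open>Lp_functional_tendsto\<close> applies.\<close>

definition wave_data :: "(real \<Rightarrow> real) \<Rightarrow> radial_pair" where
  "wave_data f = (\<lambda>r. 1 / r * (LINT x:{- r..r}|lborel. f x), \<lambda>r. (f r - f (- r)) / r)"

lemma wave_repr_wave_data: "wave_repr f (fst (wave_data f)) (snd (wave_data f))"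
  by (simp add: wave_repr_def wave_data_def)

lemma Lm_dual_Lp_functional:
  assumes m: "1 < m" and l: "l \<in> Lm_dual m"
  shows "Lp_functional m (\<lambda>f. l (wave_data f))"
  unfolding Lp_functional_def
proof (intro conjI ballI allI)
  have sp: "wave_data f \<in> Lm_space m" if "f \<in> Lp m" for f
    using wave_repr_space[OF m that wave_repr_wave_data] by simp
  obtain C where C: "\<And>v. v \<in> Lm_space m \<Longrightarrow> \<bar>l v\<bar> \<le> C * Lm_norm m v"
    using l unfolding Lm_dual_def by blast
  have nonneg: "0 \<le> Lm_norm m v" for v by (cases v) (simp add: Lm_norm_def)
  have "\<bar>l (wave_data f)\<bar> \<le> (\<bar>C\<bar> * wave_const m powr (1/m)) * Lp_pow m f powr (1/m)" if f: "f \<in> Lp m" for f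
  proof -
    have "\<bar>l (wave_data f)\<bar> \<le> C * Lm_norm m (wave_data f)" by (rule C[OF sp[OF f]])
    also have "\<dots> \<le> \<bar>C\<bar> * Lm_norm m (wave_data f)" using nonneg by (intro mult_right_mono) auto
    also have "\<dots> \<le> \<bar>C\<bar> * (wave_const m powr (1/m) * Lp_pow m f powr (1/m))"
      using wave_repr_norm[OF m f wave_repr_wave_data] by (intro mult_left_mono) auto
    finally show ?thesis by simp
  qed
  then show "\<exists>C. \<forall>f\<in>Lp m. \<bar>l (wave_data f)\<bar> \<le> C * Lp_pow m f powr (1/m)" by blast
  have add: "l (\<lambda>r. u0 r + v0 r, \<lambda>r. u1 r + v1 r) = l (u0, u1) + l (v0, v1)"
    if "(u0, u1) \<in> Lm_space m" "(v0, v1) \<in> Lm_space m" for u0 u1 v0 v1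
    using l that unfolding Lm_dual_def by blast
  have cm: "l (\<lambda>r. c * u0 r, \<lambda>r. c * u1 r) = c * l (u0, u1)" if "(u0, u1) \<in> Lm_space m" for c u0 u1
    using l that unfolding Lm_dual_def by blast
  fix f assume f: "f \<in> Lp m"
  note rf = wave_repr_wave_data[of f]
  show "l (wave_data (\<lambda>x. c * f x)) = c * l (wave_data f)" for c
  proof -
    have "l (wave_data (\<lambda>x. c * f x)) = l (\<lambda>r. c * fst (wave_data f) r, \<lambda>r. c * snd (wave_data f) r)"
      using Lm_dual_wave_repr_eq[OF m l Lp_cmult[OF f] wave_repr_wave_data wave_repr_cmult[OF rf]] by simp
    then show ?thesis using cm[of "fst (wave_data f)" "snd (wave_data f)" c] sp[OF f] by simp
  qed
  fix g assume g: "g \<in> Lp m"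
  have "(\<lambda>x. f x + g x) \<in> Lp m" using m f g by (intro Lp_add) auto
  from Lm_dual_wave_repr_eq[OF m l this wave_repr_wave_data wave_repr_add[OF m f g rf wave_repr_wave_data]]
  have "l (wave_data (\<lambda>x. f x + g x)) = l (\<lambda>r. fst (wave_data f) r + fst (wave_data g) r, \<lambda>r. snd (wave_data f) r + snd (wave_data g) r)"
    by simp
  then show "l (wave_data (\<lambda>x. f x + g x)) = l (wave_data f) + l (wave_data g)"
    using add[of "fst (wave_data f)" "snd (wave_data f)" "fst (wave_data g)" "snd (wave_data g)"] sp[OF f] sp[OF g] by simp
qed

section \<open>Rescaled waves\<close>

lemma AE_lborel_affine:
  assumes c: "c \<noteq> 0" and P: "AE x in lborel. P x"
  shows "AE x in lborel. P (t + c * x :: real)"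
proof -
  have "AE x in density (distr lborel borel (\<lambda>x. t + c * x)) (\<lambda>_. ennreal \<bar>c\<bar>). P x"
    using P unfolding lborel_real_affine[OF c, of t, symmetric] .
  then have "AE x in distr lborel borel (\<lambda>x. t + c * x). P x"
    using c by (subst (asm) AE_density) auto
  then show ?thesis by (rule AE_distrD[rotated]) simp
qed

definition wave_sol :: "(real \<Rightarrow> real) \<Rightarrow> real \<Rightarrow> real \<Rightarrow> real" where
  "wave_sol f t r = 1 / r * (LINT x:{t - r..t + r}|lborel. f x)"

lemma linear_wave_eq_wave_sol:
  assumes m: "1 < m" and f: "f \<in> Lp m" and w: "wave_repr f v0 v1"
  shows "linear_wave m (v0, v1) u \<longleftrightarrow> (\<forall>t. \<forall>r>0. u t r = wave_sol f t r)"
  unfolding linear_wave_def wave_repr_wave_F[OF m f w] wave_sol_def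
  using wave_repr_space[OF m f w] primitive_diff[of f, OF Lp_Icc_integrable[OF m f]] by simp

text \<open>The time derivative exists at radius \<open>l * r\<close> wherever
  \<open>primitive f\<close> is differentiable at both \<open>\<tau> + l * r\<close> and
  \<open>\<tau> - l * r\<close>; this holds for almost every \<open>r\<close>, because affine maps
  preserve null sets.\<close>

lemma wave_repr_rescale:
  assumes m: "1 < m" and f: "f \<in> Lp m" and l: "0 < l" and u: "\<And>t r. 0 < r \<Longrightarrow> u t r = wave_sol f t r"
  shows "wave_repr (rescale m l \<tau> f) (\<lambda>r. l powr (1 / m) * u \<tau> (l * r)) (\<lambda>r. l powr (1 / m + 1) * time_deriv u \<tau> (l * r))"
  unfolding wave_repr_def
proof (intro conjI allI impI)
  note fI = Lp_Icc_integrable[OF m f]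
  show "l powr (1 / m) * u \<tau> (l * r) = 1 / r * (LINT x:{- r..r}|lborel. rescale m l \<tau> f x)" if r: "0 < r" for r
  proof -
    have "l powr (1/m - 1) = l powr (1/m) / l" using l by (simp add: powr_diff)
    then show ?thesis using l r by (simp add: rescale_Icc[OF l] u wave_sol_def)
  qed
  have ae: "AE x in lborel. (primitive f has_real_derivative f x) (at x)"
    by (rule AE_has_derivative_primitive[of f, OF fI primitive_diff[of f, OF fI]])
  have "AE r in lborel. (primitive f has_real_derivative f (\<tau> + c * r)) (at (\<tau> + c * r))" if "c \<noteq> 0" for c
    by (rule AE_lborel_affine[where P = "\<lambda>x. (primitive f has_real_derivative f x) (at x)", OF that ae])
  from this[of l] this[of "- l"] l
  have "AE r in lborel. (primitive f has_real_derivative f (\<tau> + l * r)) (at (\<tau> + l * r))"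
    "AE r in lborel. (primitive f has_real_derivative f (\<tau> + - l * r)) (at (\<tau> + - l * r))" by simp_all
  then show "AE r in lborel. 0 < r \<longrightarrow> r * (l powr (1 / m + 1) * time_deriv u \<tau> (l * r)) = rescale m l \<tau> f r - rescale m l \<tau> f (- r)"
  proof eventually_elim
    case (elim r)
    show ?case
    proof
      assume r: "0 < r"
      have eq: "u s (l * r) = (primitive f (s + l * r) - primitive f (s - l * r)) / (l * r)" for s
        using l r by (simp add: u wave_sol_def primitive_diff[of f, OF fI])
      have d1: "((\<lambda>s. primitive f (s + l * r)) has_real_derivative f (\<tau> + l * r)) (at \<tau>)"
        using elim(1) by (subst (asm) DERIV_shift) simp
      have d2: "((\<lambda>s. primitive f (s - l * r)) has_real_derivative f (\<tau> - l * r)) (at \<tau>)"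
        using elim(2) DERIV_shift[of "primitive f" "f (\<tau> - l * r)" \<tau> "- (l * r)"] by simp
      have "((\<lambda>s. u s (l * r)) has_real_derivative (f (\<tau> + l * r) - f (\<tau> - l * r)) / (l * r)) (at \<tau>)"
        unfolding eq by (rule DERIV_cdivide[OF DERIV_diff[OF d1 d2]])
      then have td: "time_deriv u \<tau> (l * r) = (f (\<tau> + l * r) - f (\<tau> - l * r)) / (l * r)"
        unfolding time_deriv_def by (rule DERIV_imp_deriv)
      have "l powr (1 / m + 1) = l powr (1 / m) * l" using l by (simp add: powr_add)
      then show "r * (l powr (1 / m + 1) * time_deriv u \<tau> (l * r)) = rescale m l \<tau> f r - rescale m l \<tau> f (- r)"
        using l r by (simp add: td rescale_def field_simps)
    qed
  qed
qed

text \<open>The translated and dilated wave of profile \<open>g\<close> is the wave of profile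
  \<open>bubble m g l \<tau>\<close>; this identifies the terms subtracted in the remainder.\<close>

lemma LINT_Icc_bubble:
  assumes l: "0 < l" and r: "0 < r"
  shows "1 / l powr (1/m) * wave_sol g ((t - \<tau>) / l) (r / l) = 1 / r * (LINT x:{t - r..t + r}|lborel. bubble m g l \<tau> x)"
proof -
  have "(1/l) powr (1/m - 1) = l / l powr (1/m)"
    using l by (simp add: powr_diff powr_divide)
  moreover have "- \<tau> / l + 1 / l * (t - r) = (t - \<tau>) / l - r / l" "- \<tau> / l + 1 / l * (t + r) = (t - \<tau>) / l + r / l"
    by (simp_all add: diff_divide_distrib add_divide_distrib)
  moreover have "0 < 1 / l" using l by simp
  ultimately show ?thesis using l r by (simp only: bubble_def rescale_Icc wave_sol_def) simp
qed

theorem theorem3p1: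
  fixes m :: real
    and u :: "nat \<Rightarrow> real \<Rightarrow> real \<Rightarrow> real"
    and u0 u1 :: "nat \<Rightarrow> real \<Rightarrow> real"
  assumes "1 < m"
    and "\<And>n. linear_wave m (u0 n, u1 n) (u n)"
    and "bounded (range (\<lambda>n. Lm_norm m (u0 n, u1 n)))"
  shows "\<exists>(\<phi> :: nat \<Rightarrow> nat)
            (U :: nat \<Rightarrow> real \<Rightarrow> real \<Rightarrow> real) (U0 :: nat \<Rightarrow> real \<Rightarrow> real) (U1 :: nat \<Rightarrow> real \<Rightarrow> real)
            (lam :: nat \<Rightarrow> nat \<Rightarrow> real) (\<tau> :: nat \<Rightarrow> nat \<Rightarrow> real).
     strict_mono \<phi> \<and>
     (\<forall>j\<ge>1. linear_wave m (U0 j, U1 j) (U j)) \<and>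
     (\<forall>j\<ge>1. \<forall>n. lam j n > 0) \<and>
     (\<forall>j\<ge>1. \<forall>k\<ge>1. j \<noteq> k \<longrightarrow>
        filterlim (\<lambda>n. lam j n / lam k n + lam k n / lam j n + \<bar>\<tau> j n - \<tau> k n\<bar> / lam j n)
          at_top sequentially) \<and>
     (\<forall>j\<ge>1. Lm_weakly_tendsto m
        (\<lambda>n. (\<lambda>r. lam j n powr (1 / m) * u (\<phi> n) (\<tau> j n) (lam j n * r),
              \<lambda>r. lam j n powr (1 / m + 1) * time_deriv (u (\<phi> n)) (\<tau> j n) (lam j n * r)))
        (U0 j, U1 j)) \<and>
     (\<forall>J\<ge>1. \<exists>L\<ge>0.
        (\<lambda>n. energy m (u0 (\<phi> n), u1 (\<phi> n)) - (\<Sum>j=1..J. energy m (U0 j, U1 j))) \<longlonglongrightarrow> L) \<and>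
     (\<exists>L :: nat \<Rightarrow> ennreal.
        (\<forall>J\<ge>1. (\<lambda>n. S_norm m (\<lambda>t r. u (\<phi> n) t r -
            (\<Sum>j=1..J. 1 / lam j n powr (1 / m) * U j ((t - \<tau> j n) / lam j n) (r / lam j n))))
          \<longlonglongrightarrow> L J) \<and>
        L \<longlonglongrightarrow> 0)"
proof -
  note m = assms(1)
  have "\<exists>f\<in>Lp m. wave_repr f (u0 n) (u1 n) \<and> Lp_pow m f \<le> profile_const m * Lm_norm m (u0 n, u1 n) powr m" for n
    using assms(2)[of n] by (intro Lm_finite_wave_repr[OF m]) (auto simp: linear_wave_def Lm_space_def)
  then obtain f where f: "\<And>n. f n \<in> Lp m" and fu: "\<And>n. wave_repr (f n) (u0 n) (u1 n)"
    and fb: "\<And>n. Lp_pow m (f n) \<le> profile_const m * Lm_norm m (u0 n, u1 n) powr m" by metis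
  obtain K where K: "\<And>n. Lm_norm m (u0 n, u1 n) \<le> K"
    using assms(3) unfolding bounded_iff by (auto intro: order_trans[OF abs_ge_self])
  have B: "Lp_pow m (f n) \<le> profile_const m * K powr m" for n
  proof -
    have "0 \<le> profile_const m" using m by (simp add: profile_const_def hardy_const_def)
    moreover have "Lm_norm m (u0 n, u1 n) powr m \<le> K powr m"
      using m K by (intro powr_mono2) (auto simp: Lm_norm_def)
    ultimately show ?thesis using fb[of n] by (meson mult_left_mono order_trans)
  qed
  have us: "u n t r = wave_sol (f n) t r" if "0 < r" for n t r
    using assms(2)[of n] that unfolding linear_wave_eq_wave_sol[OF m f fu] by simp
  show ?thesis
  proof (rule profile_decomposition_Lp[where f = f and m = m, OF m f B])
    fix \<phi> :: "nat \<Rightarrow> nat" and l t :: "nat \<Rightarrow> nat \<Rightarrow> real" and g :: "nat \<Rightarrow> real \<Rightarrow> real" and E and L :: "nat \<Rightarrow> real"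
  assume \<phi>: "strict_mono \<phi>" and l: "\<And>k n. 0 < l k n" and g: "\<And>k. g k \<in> Lp m"
    and orth: "\<And>j k. j \<noteq> k \<Longrightarrow> filterlim (\<lambda>n. frame_dist (l j n) (t j n) (l k n) (t k n)) at_top sequentially"
    and conv: "\<And>j u v. (\<lambda>n. LINT x:{u..v}|lborel. rescale m (l j n) (t j n) (f (\<phi> n)) x) \<longlonglongrightarrow> (LINT x:{u..v}|lborel. g j x)"
    and E: "(\<lambda>n. Lp_pow m (f (\<phi> n))) \<longlonglongrightarrow> E" and bessel: "\<And>J. (\<Sum>j<J. Lp_pow m (g j)) \<le> E"
    and S: "\<And>J. (\<lambda>n. S_norm m (\<lambda>s r. 1 / r * (LINT x:{s-r..s+r}|lborel.
        f (\<phi> n) x - (\<Sum>j<J. bubble m (g j) (l j n) (t j n) x)))) \<longlonglongrightarrow> ennreal (L J)"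
    and L: "L \<longlonglongrightarrow> 0"
  \<comment> \<open>Profiles are numbered from 1 here and from 0 in the decomposition, hence the
    shift \<open>j - 1\<close>.\<close>
  define U0 where "U0 j = fst (wave_data (g (j - 1)))" for j
  define U1 where "U1 j = snd (wave_data (g (j - 1)))" for j
  define lam where "lam j = l (j - 1)" for j
  define \<tau> where "\<tau> j = t (j - 1)" for j
  define U where "U j = wave_sol (g (j - 1))" for j :: nat
  have lam: "0 < lam j n" for j n by (simp add: lam_def l)
  have gU: "wave_repr (g (j - 1)) (U0 j) (U1 j)" for j unfolding U0_def U1_def by (rule wave_repr_wave_data)
  have weak: "Lm_weakly_tendsto m
        (\<lambda>n. (\<lambda>r. lam j n powr (1 / m) * u (\<phi> n) (\<tau> j n) (lam j n * r),
              \<lambda>r. lam j n powr (1 / m + 1) * time_deriv (u (\<phi> n)) (\<tau> j n) (lam j n * r)))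
        (U0 j, U1 j)" for j
    unfolding Lm_weakly_tendsto_def
  proof (intro conjI allI ballI)
    have T: "rescale m (lam j n) (\<tau> j n) (f (\<phi> n)) \<in> Lp m" for n by (rule rescale_Lp[OF m f lam])
    note w = wave_repr_rescale[OF m f lam us]
    show "(\<lambda>r. lam j n powr (1 / m) * u (\<phi> n) (\<tau> j n) (lam j n * r),
              \<lambda>r. lam j n powr (1 / m + 1) * time_deriv (u (\<phi> n)) (\<tau> j n) (lam j n * r)) \<in> Lm_space m" for n
      by (rule wave_repr_space[OF m T w])
    show "(U0 j, U1 j) \<in> Lm_space m" by (rule wave_repr_space[OF m g gU])
    fix lf assume lf: "lf \<in> Lm_dual m"
    \<comment> \<open>The functional is pulled back to \<open>Lp m\<close>. Evolving the wave to
      time \<open>\<tau> j n\<close> and rescaling it amounts to \<open>rescale\<close> of its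
      profile, so the weak limits of the profiles apply.\<close>
    have "(\<lambda>n. lf (wave_data (rescale m (lam j n) (\<tau> j n) (f (\<phi> n))))) \<longlonglongrightarrow> lf (wave_data (g (j - 1)))"
    proof (rule Lp_functional_tendsto[where f = "\<lambda>n. rescale m (lam j n) (\<tau> j n) (f (\<phi> n))" and h = "g (j - 1)" and l = "\<lambda>f. lf (wave_data f)", OF m T _ g _ Lm_dual_Lp_functional[OF m lf]])
      show "Lp_pow m (rescale m (lam j n) (\<tau> j n) (f (\<phi> n))) \<le> profile_const m * K powr m" for n
        unfolding Lp_pow_rescale[OF m f lam] by (rule B)
      show "(\<lambda>n. LINT x:{u..v}|lborel. rescale m (lam j n) (\<tau> j n) (f (\<phi> n)) x) \<longlonglongrightarrow> (LINT x:{u..v}|lborel. g (j - 1) x)" for u v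
        unfolding lam_def \<tau>_def by (rule conv)
    qed
    moreover have "lf (wave_data (rescale m (lam j n) (\<tau> j n) (f (\<phi> n)))) = lf (\<lambda>r. lam j n powr (1 / m) * u (\<phi> n) (\<tau> j n) (lam j n * r),
              \<lambda>r. lam j n powr (1 / m + 1) * time_deriv (u (\<phi> n)) (\<tau> j n) (lam j n * r))" for n
      using Lm_dual_wave_repr_eq[OF m lf T wave_repr_wave_data w, of n] by simp
    moreover have "lf (wave_data (g (j - 1))) = lf (U0 j, U1 j)" by (simp add: U0_def U1_def)
    ultimately show "(\<lambda>n. lf (\<lambda>r. lam j n powr (1 / m) * u (\<phi> n) (\<tau> j n) (lam j n * r),
              \<lambda>r. lam j n powr (1 / m + 1) * time_deriv (u (\<phi> n)) (\<tau> j n) (lam j n * r))) \<longlonglongrightarrow> lf (U0 j, U1 j)"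
      by simp
  qed
  have energy: "\<exists>L\<ge>0. (\<lambda>n. energy m (u0 (\<phi> n), u1 (\<phi> n)) - (\<Sum>j=1..J. energy m (U0 j, U1 j))) \<longlonglongrightarrow> L" for J
  proof (intro exI conjI)
    \<comment> \<open>The energy is \<open>2 powr m\<close> times \<open>Lp_pow\<close> of the
      profile, so the energies tend to \<open>2 powr m * E\<close>; nonnegativity is Bessel's
      inequality for the profiles.\<close>
    show "0 \<le> 2 powr m * (E - (\<Sum>j<J. Lp_pow m (g j)))" using bessel[of J] by simp
    have "(\<Sum>j=1..J. energy m (U0 j, U1 j)) = 2 powr m * (\<Sum>j<J. Lp_pow m (g j))"
      by (simp add: wave_repr_energy[OF m g gU] sum_distrib_left sum.atLeast1_atMost_eq)
    moreover have "(\<lambda>n. 2 powr m * Lp_pow m (f (\<phi> n)) - 2 powr m * (\<Sum>j<J. Lp_pow m (g j)))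
        \<longlonglongrightarrow> 2 powr m * E - 2 powr m * (\<Sum>j<J. Lp_pow m (g j))" by (intro tendsto_intros E)
    ultimately show "(\<lambda>n. energy m (u0 (\<phi> n), u1 (\<phi> n)) - (\<Sum>j=1..J. energy m (U0 j, U1 j)))
        \<longlonglongrightarrow> 2 powr m * (E - (\<Sum>j<J. Lp_pow m (g j)))"
      by (simp add: wave_repr_energy[OF m f fu] right_diff_distrib)
  qed
  have disp: "(\<lambda>n. S_norm m (\<lambda>t r. u (\<phi> n) t r -
      (\<Sum>j=1..J. 1 / lam j n powr (1 / m) * U j ((t - \<tau> j n) / lam j n) (r / lam j n)))) \<longlonglongrightarrow> ennreal (L J)" for J
  proof -
    have "S_norm m (\<lambda>t r. u (\<phi> n) t r -
        (\<Sum>j=1..J. 1 / lam j n powr (1 / m) * U j ((t - \<tau> j n) / lam j n) (r / lam j n)))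
      = S_norm m (\<lambda>s r. 1 / r * (LINT x:{s-r..s+r}|lborel. f (\<phi> n) x - (\<Sum>j<J. bubble m (g j) (l j n) (t j n) x)))" for n
    proof (rule S_norm_cong)
      fix s r :: real assume r: "0 < r"
      have i1: "set_integrable lborel {s - r..s + r} (bubble m (g j) (l j n) (t j n))" for j
        by (rule Lp_Icc_integrable[OF m bubble_Lp[OF m g l]])
      have i2: "set_integrable lborel {s - r..s + r} (\<lambda>x. \<Sum>j<J. bubble m (g j) (l j n) (t j n) x)"
        and e2: "(LINT x:{s-r..s+r}|lborel. \<Sum>j<J. bubble m (g j) (l j n) (t j n) x)
          = (\<Sum>j<J. LINT x:{s-r..s+r}|lborel. bubble m (g j) (l j n) (t j n) x)"
        unfolding set_integrable_def set_lebesgue_integral_def scaleR_sum_right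
        by (rule Bochner_Integration.integrable_sum Bochner_Integration.integral_sum, rule i1[unfolded set_integrable_def])+
      have "(LINT x:{s-r..s+r}|lborel. f (\<phi> n) x - (\<Sum>j<J. bubble m (g j) (l j n) (t j n) x))
        = (LINT x:{s-r..s+r}|lborel. f (\<phi> n) x) - (\<Sum>j<J. LINT x:{s-r..s+r}|lborel. bubble m (g j) (l j n) (t j n) x)"
        using set_integral_diff(2)[OF Lp_Icc_integrable[OF m f] i2, of "\<phi> n"] e2 by simp
      moreover have "(\<Sum>j=1..J. 1 / lam j n powr (1 / m) * U j ((s - \<tau> j n) / lam j n) (r / lam j n))
        = (\<Sum>j<J. 1 / r * (LINT x:{s-r..s+r}|lborel. bubble m (g j) (l j n) (t j n) x))"
        by (simp only: One_nat_def sum.atLeast1_atMost_eq lam_def \<tau>_def U_def diff_Suc_Suc minus_nat.diff_0 LINT_Icc_bubble[OF l r])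
      ultimately show "u (\<phi> n) s r - (\<Sum>j=1..J. 1 / lam j n powr (1 / m) * U j ((s - \<tau> j n) / lam j n) (r / lam j n))
        = 1 / r * (LINT x:{s-r..s+r}|lborel. f (\<phi> n) x - (\<Sum>j<J. bubble m (g j) (l j n) (t j n) x))"
        using r by (simp only: us wave_sol_def right_diff_distrib sum_distrib_left)
    qed
    then show ?thesis using S[of J] by simp
  qed
  show ?thesis
  proof (rule exI[of _ \<phi>], rule exI[of _ U], rule exI[of _ U0], rule exI[of _ U1], rule exI[of _ lam], rule exI[of _ \<tau>], intro conjI allI impI)
    show "strict_mono \<phi>" by (rule \<phi>)
    show "linear_wave m (U0 j, U1 j) (U j)" for j
      unfolding linear_wave_eq_wave_sol[OF m g gU] by (simp add: U_def)
    show "0 < lam j n" for j n by (rule lam)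
    show "filterlim (\<lambda>n. lam j n / lam k n + lam k n / lam j n + \<bar>\<tau> j n - \<tau> k n\<bar> / lam j n) at_top sequentially"
      if "1 \<le> j" "1 \<le> k" "j \<noteq> k" for j k :: nat
      using orth[of "j - 1" "k - 1"] that unfolding lam_def \<tau>_def frame_dist_def by simp
    show "\<exists>L :: nat \<Rightarrow> ennreal. (\<forall>J\<ge>1. (\<lambda>n. S_norm m (\<lambda>t r. u (\<phi> n) t r -
            (\<Sum>j=1..J. 1 / lam j n powr (1 / m) * U j ((t - \<tau> j n) / lam j n) (r / lam j n))))
          \<longlonglongrightarrow> L J) \<and> L \<longlonglongrightarrow> 0"
      using disp tendsto_ennrealI[OF L] by (intro exI[of _ "\<lambda>J. ennreal (L J)"]) simp
  qed (rule weak energy)+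
  qed
qed

end
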